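(* Fix $x\in\mathbb{R}$. Suppose: (i) $f$ takes values in $\Omega_{\mathcal F}$, where $\Omega_{\mathcal F}$ is the bi-Lipschitz shape space with constants $0<M<L<\infty$ described in the context; (ii) there exist constants $\kappa>0$ and $M_1\in[\kappa,\infty)$ such that $\kappa\le\tau\le M_1$ almost surely; (iii) the marginal density $f_X$ of $X$ and the conditional densities $g_y$ of $X$ given $f=y$ exist and are twice continuously differentiable, the latter for all $y\in\Omega_{\mathcal F}$, with $\sup_{x',y}|g_y''(x')|<\infty$; additionally, for every open $U\subset\Omega_{\mathcal F}$, the map $x'\mapsto P(f\in U\mid X=x')$ is continuous; (iv) $f_X(\cdot)>0$, and the functions $m(x)=E(\tau\mid X=x)$ and $\sigma^2(x)=E(e^2\mid X=x)$, where $e=\tau-m(X)$, are twice continuously differentiable in $x$; (v) there exist $\delta>0$ and $\bar\sigma>0$ such that $E(|e|^{2+\delta}\mid X)\le\bar\sigma$; (vi) $h=h_n=c_0n^{-1/5}$ for some constant $c_0>0$ (so that $nh^5=O(1)$); (vii) $\alpha_n/\log n\to\infty$ as $n\to\infty$, and $\psi(\alpha_n)\asymp n^{2/5}$ for some function $\psi:\mathbb{R}^+\to\mathbb{R}$. Then the estimate $\hat\Lambda_\oplus(x)=\tilde\tau_\oplus(x)\tilde f_\oplus(x)$ of the conditional intensity function $m_\oplus(x)$ satisfies $$d\big(m_\oplus(x),E(\tau)\hat\Lambda_\oplus(x)\big)=O_p\big(n^{-2/5}+\alpha_n^{-1/4}\big)\quad\text{as } n\to\infty.$$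
   Context: Shape space. Fix $T>0$ and constants $0<M<L<\infty$. The quantile function of a probability measure on $[0,T]$ with cdf $F$ is $t\mapsto\inf\{u\in[0,T]:F(u)\ge t\}$. Let $Q(\Omega_{\mathcal F})$ be the set of functions $q:[0,1]\to[0,T]$ with $q(0)=0$, $q(1)=T$ and $M|s-t|\le|q(s)-q(t)|\le L|s-t|$ for all $s,t\in[0,1]$ (assumed nonempty), and let $\Omega_{\mathcal F}$ be the set of probability densities on $[0,T]$ whose quantile functions lie in $Q(\Omega_{\mathcal F})$. For $f_1,f_2\in\Omega_{\mathcal F}$ with quantile functions $Q_1,Q_2$, $d_{\mathcal F}(f_1,f_2)=\|Q_1-Q_2\|_{L^2([0,1])}$. Intensity space. An intensity function $\Lambda=\tau f$ is identified with the pair $(\tau,f)$ of its intensity factor $\tau=\int_0^T\Lambda$ and its shape $f=\Lambda/\tau$; the metric is $d((\tau_1,f_1),(\tau_2,f_2))=\sqrt{|\tau_1-\tau_2|^2+d_{\mathcal F}^2(f_1,f_2)}$. Thus $E(\tau)\hat\Lambda_\oplus(x)$ is identified with the pair $(E(\tau)\tilde\tau_\oplus(x),\tilde f_\oplus(x))$ (the same formula for $d$ is used if the factor is $0$). Sampling model. $(X,\Lambda)$ is a random pair, where $X$ is a real covariate and $\Lambda:[0,T]\to\mathbb{R}^+$ is a random integrable intensity function, with intensity factor $\tau$ and shape $f$. $(X_i,\Lambda_i)$, $i=1,\dots,n$, are i.i.d. copies, with corresponding $\tau_i,f_i$. $(\alpha_n)$ is a sequence of positive numbers. For each $n$, conditionally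 on $(X_i,\Lambda_i)_{i\le n}$, the point processes $N_1^{(n)},\dots,N_n^{(n)}$ on $[0,T]$ are independent and $N_i^{(n)}$ is a Poisson process with intensity function $\alpha_n\Lambda_i$. $N_i^{(n)}(T)$ is the total count and $\bar N(T)=n^{-1}\sum_{i=1}^nN_i^{(n)}(T)$. Target. $m_\oplus(x)=(\tau_\oplus(x),f_\oplus(x))$, with $\tau_\oplus(x)=\max\{E(\tau\mid X=x),0\}$ and $f_\oplus(x)=\arg\min_{f_0\in\Omega_{\mathcal F}}E(d_{\mathcal F}^2(f,f_0)\mid X=x)$. Estimator. $K$ is a continuous symmetric probability density with support $[-1,1]$, $K_h(u)=h^{-1}K(u/h)$, $\hat u_j=n^{-1}\sum_{i=1}^nK_h(X_i-x)(X_i-x)^j$ for $j=0,1,2$, $\hat\sigma_0^2=\hat u_0\hat u_2-\hat u_1^2$, and $s_{in}(x,h)=\hat\sigma_0^{-2}K_h(X_i-x)[\hat u_2-\hat u_1(X_i-x)]$. Put $\tilde\tau_\oplus(x)=\max\big(0,\,n^{-1}\sum_{i=1}^ns_{in}(x,h)N_i^{(n)}(T)/\bar N(T)\big)$. Let $\hat\mu_i$ be the empirical measure of the arrival times of $N_i^{(n)}$ if $N_i^{(n)}(T)\ge1$ and the uniform distribution on $[0,T]$ otherwise, and $\hat Q_i$ its quantile function; $\tilde f_\oplus(x)$ is the density with quantile function $\tilde Q_\oplus(\cdot,x)=\arg\min_{q\in Q(\Omega_{\mathcal F})}\|q-n^{-1}\sum_{i=1}^ns_{in}(x,h)\hat Q_i\|_{L^2([0,1])}^2$.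 (On the events $\hat\sigma_0^2=0$ or $\bar N(T)=0$, of vanishing probability, estimators may be defined arbitrarily.) Notation. $\beta_n\asymp\gamma_n$ means $c_1\beta_n\le\gamma_n\le c_2\beta_n$ for some constants $c_1,c_2>0$. *)

theory Defs
  imports "HOL-Probability.Probability"
begin

text \<open>
  Functions on \<open>[0,T]\<close> and \<open>[0,1]\<close> are represented by functions on the reals whose values outside
  the interval are never inspected.
\<close>

definition quantile :: "real \<Rightarrow> real measure \<Rightarrow> real \<Rightarrow> real" where
  "quantile T \<mu> t = Inf {u \<in> {0..T}. cdf \<mu> u \<ge> t}"

definition shape_quantile :: "real \<Rightarrow> (real \<Rightarrow> real) \<Rightarrow> real \<Rightarrow> real" where
  "shape_quantile T f = quantile T (density lborel (\<lambda>t. ennreal (indicator {0..T} t * f t)))"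

definition quantile_set :: "real \<Rightarrow> real \<Rightarrow> real \<Rightarrow> (real \<Rightarrow> real) set" where
  "quantile_set T M L = {q. q \<in> {0..1} \<rightarrow> {0..T} \<and> q 0 = 0 \<and> q 1 = T \<and>
     (\<forall>s\<in>{0..1}. \<forall>t\<in>{0..1}. M * \<bar>s - t\<bar> \<le> \<bar>q s - q t\<bar> \<and> \<bar>q s - q t\<bar> \<le> L * \<bar>s - t\<bar>)}"

definition shape_space :: "real \<Rightarrow> real \<Rightarrow> real \<Rightarrow> (real \<Rightarrow> real) set" where
  "shape_space T M L = {f. set_integrable lborel {0..T} f \<and> (\<forall>t\<in>{0..T}. 0 \<le> f t) \<and>
     (LBINT t:{0..T}. f t) = 1 \<and> shape_quantile T f \<in> quantile_set T M L}"

definition L2_dist :: "(real \<Rightarrow> real) \<Rightarrow> (real \<Rightarrow> real) \<Rightarrow> real" where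
  "L2_dist p q = sqrt (LBINT t:{0..1}. (p t - q t)\<^sup>2)"

definition shape_dist :: "real \<Rightarrow> (real \<Rightarrow> real) \<Rightarrow> (real \<Rightarrow> real) \<Rightarrow> real" where
  "shape_dist T f g = L2_dist (shape_quantile T f) (shape_quantile T g)"

definition intensity_dist ::
    "real \<Rightarrow> real \<times> (real \<Rightarrow> real) \<Rightarrow> real \<times> (real \<Rightarrow> real) \<Rightarrow> real" where
  "intensity_dist T p q = sqrt (\<bar>fst p - fst q\<bar>\<^sup>2 + (shape_dist T (snd p) (snd q))\<^sup>2)"

text \<open>
  Densities that agree almost everywhere have distance 0, so \<^const>\<open>shape_dist\<close> is a metric only up to
  almost everywhere equality; the open sets below are those of the pseudometric on representatives.
\<close>

definition shape_open :: "real \<Rightarrow> real \<Rightarrow> real \<Rightarrow> (real \<Rightarrow> real) set \<Rightarrow> bool" where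
  "shape_open T M L U \<longleftrightarrow> U \<subseteq> shape_space T M L \<and>
     (\<forall>f\<in>U. \<exists>\<epsilon>>0. \<forall>g\<in>shape_space T M L. shape_dist T f g < \<epsilon> \<longrightarrow> g \<in> U)"

definition shape_borel :: "real \<Rightarrow> real \<Rightarrow> real \<Rightarrow> (real \<Rightarrow> real) measure" where
  "shape_borel T M L = sigma (shape_space T M L) {U. shape_open T M L U}"

definition intensity_set :: "real \<Rightarrow> (real \<Rightarrow> real) set" where
  "intensity_set T = {g. set_integrable lborel {0..T} g \<and> (\<forall>t\<in>{0..T}. 0 \<le> g t)}"

text \<open>
  The \<open>\<sigma>\<close>-algebra making the evaluations \<open>g \<mapsto> \<integral>\<^sub>A g\<close> measurable for all Borel \<open>A\<close>; up to almost everywhere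
  equality this is the Borel \<open>\<sigma>\<close>-algebra of \<open>L\<^sup>1([0,T])\<close> restricted to nonnegative functions.
\<close>

definition intensity_algebra :: "real \<Rightarrow> (real \<Rightarrow> real) measure" where
  "intensity_algebra T = sigma (intensity_set T)
     {{g \<in> intensity_set T. (LBINT t:A. g t) \<le> c} | A c. A \<in> sets borel \<and> A \<subseteq> {0..T}}"

definition intensity_factor :: "real \<Rightarrow> (real \<Rightarrow> real) \<Rightarrow> real" where
  "intensity_factor T g = (LBINT t:{0..T}. g t)"

definition shape :: "real \<Rightarrow> (real \<Rightarrow> real) \<Rightarrow> real \<Rightarrow> real" where
  "shape T g = (\<lambda>t. g t / intensity_factor T g)"

text \<open>\<open>m\<close> is a version of \<open>u \<mapsto> E(Y | X = u)\<close>.\<close>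

definition regression_function ::
    "'a measure \<Rightarrow> ('a \<Rightarrow> real) \<Rightarrow> ('a \<Rightarrow> real) \<Rightarrow> (real \<Rightarrow> real) \<Rightarrow> bool" where
  "regression_function P X Y m \<longleftrightarrow> m \<in> borel_measurable borel \<and>
     (AE \<omega> in P. real_cond_exp P (vimage_algebra (space P) X borel) Y \<omega> = m (X \<omega>))"

text \<open>\<open>\<kappa>\<close> is a regular conditional distribution of \<open>Y\<close> (with values in \<open>R\<close>) given \<open>Z\<close> (with values in \<open>S\<close>).\<close>

definition regular_cond_distr ::
    "'a measure \<Rightarrow> 'b measure \<Rightarrow> ('a \<Rightarrow> 'b) \<Rightarrow> 'c measure \<Rightarrow> ('a \<Rightarrow> 'c) \<Rightarrow> ('c \<Rightarrow> 'b measure) \<Rightarrow> bool" where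
  "regular_cond_distr P R Y S Z \<kappa> \<longleftrightarrow> \<kappa> \<in> S \<rightarrow>\<^sub>M prob_algebra R \<and>
     (\<forall>A\<in>sets R. AE \<omega> in P. real_cond_exp P (vimage_algebra (space P) Z S)
        (indicat_real (Y -` A \<inter> space P)) \<omega> = measure (\<kappa> (Z \<omega>)) A)"

text \<open>The minimiser of \<open>f\<^sub>0 \<mapsto> E(d\<^sup>2(f, f\<^sub>0) | X = x)\<close>, where \<open>\<mu>\<close> is the conditional law of \<open>f\<close> given \<open>X = x\<close>.\<close>

definition frechet_mean :: "real \<Rightarrow> real \<Rightarrow> real \<Rightarrow> (real \<Rightarrow> real) measure \<Rightarrow> real \<Rightarrow> real" where
  "frechet_mean T M L \<mu> = arg_min_on (\<lambda>f0. LINT f|\<mu>. (shape_dist T f f0)\<^sup>2) (shape_space T M L)"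

text \<open>A realisation of a finite point process is the finite multiset of its arrival times.\<close>

definition num_points :: "real multiset \<Rightarrow> real set \<Rightarrow> nat" where
  "num_points N B = size {#t \<in># N. t \<in> B#}"

text \<open>The library's \<^const>\<open>poisson_pmf\<close> is unspecified at rate 0, which occurs here (e.g. for null sets).\<close>

definition poisson_prob :: "real \<Rightarrow> nat \<Rightarrow> real" where
  "poisson_prob r k = r ^ k / fact k * exp (- r)"

text \<open>
  Conditionally on \<open>F\<close>, the processes \<open>N i\<close> (\<open>i \<in> I\<close>) on \<open>[0,T]\<close> are independent and \<open>N i\<close> is a
  Poisson process with intensity function \<open>\<Lambda> i\<close>. The factorisation over \<open>i\<close> is
  independence between the processes, that over \<open>j\<close> independence of the counts of one process in
  disjoint sets, and each factor is the Poisson probability with mean \<open>\<integral>\<^sub>B \<Lambda> i\<close>.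
\<close>

definition cond_poisson_processes ::
    "'a measure \<Rightarrow> 'a measure \<Rightarrow> real \<Rightarrow> nat set \<Rightarrow> (nat \<Rightarrow> 'a \<Rightarrow> real \<Rightarrow> real) \<Rightarrow>
     (nat \<Rightarrow> 'a \<Rightarrow> real multiset) \<Rightarrow> bool" where
  "cond_poisson_processes P F T I \<Lambda> N \<longleftrightarrow>
     (\<forall>i\<in>I. \<forall>\<omega>\<in>space P. set_mset (N i \<omega>) \<subseteq> {0..T}) \<and>
     (\<forall>i\<in>I. \<forall>B\<in>sets borel. (\<lambda>\<omega>. num_points (N i \<omega>) B) \<in> P \<rightarrow>\<^sub>M count_space UNIV) \<and>
     (\<forall>(J::nat) (B :: nat \<Rightarrow> nat \<Rightarrow> real set) (k :: nat \<Rightarrow> nat \<Rightarrow> nat).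
        (\<forall>i\<in>I. disjoint_family_on (B i) {..<J} \<and> (\<forall>j<J. B i j \<in> sets borel \<and> B i j \<subseteq> {0..T})) \<longrightarrow>
        (AE \<omega> in P. real_cond_exp P F
             (indicat_real {\<omega>\<in>space P. \<forall>i\<in>I. \<forall>j<J. num_points (N i \<omega>) (B i j) = k i j}) \<omega>
           = (\<Prod>i\<in>I. \<Prod>j<J. poisson_prob (LBINT t:B i j. \<Lambda> i \<omega> t) (k i j))))"

definition empirical_quantile :: "real \<Rightarrow> real multiset \<Rightarrow> real \<Rightarrow> real" where
  "empirical_quantile T N = quantile T
     (if N = {#} then uniform_measure lborel {0..T} else measure_pmf (pmf_of_multiset N))"

text \<open>
  Here \<open>X i\<close> and \<open>N i\<close> (\<open>i = 1, \<dots>, n\<close>) are realised covariates and point patterns. On the events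
  where a denominator vanishes, the convention \<open>a / 0 = 0\<close> applies.
\<close>

definition smoothing_kernel :: "(real \<Rightarrow> real) \<Rightarrow> bool" where
  "smoothing_kernel K \<longleftrightarrow> continuous_on UNIV K \<and> (\<forall>u. K (- u) = K u) \<and> (\<forall>u. 0 \<le> K u) \<and>
     has_bochner_integral lborel K 1 \<and> closure {u. K u \<noteq> 0} = {-1..1}"

definition scaled_kernel :: "(real \<Rightarrow> real) \<Rightarrow> real \<Rightarrow> real \<Rightarrow> real" where
  "scaled_kernel K h u = K (u / h) / h"

definition u_hat :: "(real \<Rightarrow> real) \<Rightarrow> real \<Rightarrow> real \<Rightarrow> nat \<Rightarrow> (nat \<Rightarrow> real) \<Rightarrow> nat \<Rightarrow> real" where
  "u_hat K h x n X j = (\<Sum>i=1..n. scaled_kernel K h (X i - x) * (X i - x) ^ j) / real n"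

definition sigma0_sq :: "(real \<Rightarrow> real) \<Rightarrow> real \<Rightarrow> real \<Rightarrow> nat \<Rightarrow> (nat \<Rightarrow> real) \<Rightarrow> real" where
  "sigma0_sq K h x n X = u_hat K h x n X 0 * u_hat K h x n X 2 - (u_hat K h x n X 1)\<^sup>2"

definition local_weight :: "(real \<Rightarrow> real) \<Rightarrow> real \<Rightarrow> real \<Rightarrow> nat \<Rightarrow> (nat \<Rightarrow> real) \<Rightarrow> nat \<Rightarrow> real" where
  "local_weight K h x n X i =
     scaled_kernel K h (X i - x) * (u_hat K h x n X 2 - u_hat K h x n X 1 * (X i - x))
       / sigma0_sq K h x n X"

definition mean_count :: "nat \<Rightarrow> (nat \<Rightarrow> real multiset) \<Rightarrow> real" where
  "mean_count n N = (\<Sum>i=1..n. real (size (N i))) / real n"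

definition tau_tilde ::
    "(real \<Rightarrow> real) \<Rightarrow> real \<Rightarrow> real \<Rightarrow> nat \<Rightarrow> (nat \<Rightarrow> real) \<Rightarrow> (nat \<Rightarrow> real multiset) \<Rightarrow> real" where
  "tau_tilde K h x n X N = max 0
     ((\<Sum>i=1..n. local_weight K h x n X i * real (size (N i)) / mean_count n N) / real n)"

definition Q_tilde ::
    "real \<Rightarrow> real \<Rightarrow> real \<Rightarrow> (real \<Rightarrow> real) \<Rightarrow> real \<Rightarrow> real \<Rightarrow> nat \<Rightarrow> (nat \<Rightarrow> real) \<Rightarrow>
     (nat \<Rightarrow> real multiset) \<Rightarrow> real \<Rightarrow> real" where
  "Q_tilde T M L K h x n X N = arg_min_on
     (\<lambda>q. (L2_dist q (\<lambda>t. (\<Sum>i=1..n. local_weight K h x n X i * empirical_quantile T (N i) t) / real n))\<^sup>2)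
     (quantile_set T M L)"

definition f_tilde ::
    "real \<Rightarrow> real \<Rightarrow> real \<Rightarrow> (real \<Rightarrow> real) \<Rightarrow> real \<Rightarrow> real \<Rightarrow> nat \<Rightarrow> (nat \<Rightarrow> real) \<Rightarrow>
     (nat \<Rightarrow> real multiset) \<Rightarrow> real \<Rightarrow> real" where
  "f_tilde T M L K h x n X N =
     (SOME f. f \<in> shape_space T M L \<and> (\<forall>t\<in>{0..1}. shape_quantile T f t = Q_tilde T M L K h x n X N t))"

definition twice_cont_diff :: "(real \<Rightarrow> real) \<Rightarrow> bool" where
  "twice_cont_diff f \<longleftrightarrow> f differentiable_on UNIV \<and> deriv f differentiable_on UNIV \<and>
     continuous_on UNIV (deriv (deriv f))"

definition same_order :: "(nat \<Rightarrow> real) \<Rightarrow> (nat \<Rightarrow> real) \<Rightarrow> bool" (infix "\<asymp>" 50) where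
  "\<beta> \<asymp> \<gamma> \<longleftrightarrow> (\<exists>c1>0. \<exists>c2>0. \<forall>n\<ge>1. c1 * \<beta> n \<le> \<gamma> n \<and> \<gamma> n \<le> c2 * \<beta> n)"

text \<open>
  \<open>R n = O\<^sub>p(r n)\<close>. Covering the exceptional event by a measurable set amounts to the usual
  \<open>P(\<bar>R n\<bar> > C r n) \<le> \<epsilon>\<close> when that event is measurable, and avoids the convention that \<^const>\<open>measure\<close>
  is 0 on non-measurable sets.
\<close>

definition big_O_p :: "'a measure \<Rightarrow> (nat \<Rightarrow> 'a \<Rightarrow> real) \<Rightarrow> (nat \<Rightarrow> real) \<Rightarrow> bool" where
  "big_O_p P R r \<longleftrightarrow> (\<forall>\<epsilon>>0. \<exists>C>0. \<forall>\<^sub>F n in sequentially.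
     \<exists>A\<in>sets P. {\<omega>\<in>space P. \<bar>R n \<omega>\<bar> > C * r n} \<subseteq> A \<and> measure P A \<le> \<epsilon>)"

end

theory Submission
  imports Defs "HOL-Complex_Analysis.Great_Picard"
begin

text \<open>
  On an event whose probability tends to 1 the local design moments are close to their limits, so the local
  linear weights are dominated by the kernel. There the squared distance is at most a constant times a sum of
  nonnegative terms with expectation \<open>O(n\<^sup>-\<^sup>4\<^sup>/\<^sup>5 + \<alpha>\<^sub>n\<^sup>-\<^sup>1\<^sup>/\<^sup>2)\<close>, and Markov's inequality gives the rate.

  The quantile function of the Frechet mean is \<open>q\<^sub>0(t) = E(Q(t) | X = x)\<close>, because this function lies in the set of
  admissible quantile functions. Projecting onto that set at most doubles the distance to \<open>q\<^sub>0\<close>, so it suffices to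
  study the local linear average itself. By Bayes' formula \<open>E(Q(t) | X = u) f\<^sub>X(u) = E(Q(t) g\<^sub>f(u))\<close>, whose
  Taylor remainder at \<open>x\<close> is quadratic uniformly in \<open>t\<close>; this makes the squared bias \<open>O(h\<^sup>4)\<close>, and the variance of
  averages of independent copies is \<open>O(1/(nh))\<close>. Replacing the empirical quantile functions by the true ones costs
  \<open>\<parallel>Q' - Q\<parallel>\<^sup>2 \<le> T \<integral> \<bar>F' - F\<bar>\<close>, where each \<open>\<bar>F'(u) - F(u)\<bar>\<close> is of order \<open>\<alpha>\<^sub>n\<^sup>-\<^sup>1\<^sup>/\<^sup>2\<close> by the variance of Poisson counts.
\<close>

subsection \<open>Quantile functions\<close>

text \<open>The estimators contain the choices \<open>arg_min_on\<close> and \<open>SOME\<close>,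
  and nothing is known about their measurability in \<omega>. So no expectation of the error itself
  is taken: on the good event the error is bounded pointwise by a multiple of
  \<open>error_budget\<close>, a measurable variable built from kernel averages and Poisson counts,
  and only that variable is integrated. The local linear weights are random and do not separate from
  the responses; on the good event the design moments inside them are replaced by constants, which
  leaves averages with the explicit weights \<open>kern\<close>. The conditional law of the shape is
  determined by its defining property only for almost every covariate value, whereas the target
  lives at the single point x; continuity of u \<mapsto> P(f \<in> U | X = u) bridges this gap. The
  exponent -1/4 of \<alpha> arises because squared distances of quantile functions are controlled by
  first powers of differences of distribution functions, so a square root is lost.\<close>

lemma quantile_le_iff:
  assumes \<mu>: "real_distribution \<mu>" "cdf \<mu> T = 1" and "0 \<le> T" "t \<le> 1" "u \<in> {0..T}"
  shows "quantile T \<mu> t \<le> u \<longleftrightarrow> t \<le> cdf \<mu> u"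
proof -
  interpret real_distribution \<mu> by fact
  define A where "A = {u \<in> {0..T}. cdf \<mu> u \<ge> t}"
  have ne: "A \<noteq> {}" and bdd: "bdd_below A"
    using assms by (auto simp: A_def intro!: exI[of _ T] bdd_belowI[of _ 0])
  have q: "quantile T \<mu> t = Inf A"
    by (simp add: quantile_def A_def)
  show ?thesis
  proof
    assume le: "quantile T \<mu> t \<le> u"
    \<comment> \<open>The infimum need not be attained a priori: all points above u reach the level
      t, and right continuity of the distribution function passes this on to u.\<close>
    have "t \<le> cdf \<mu> v" if "u < v" for v
    proof -
      have "Inf A < v" using le that q by simp
      then obtain a where "a \<in> A" "a < v" using cInf_less_iff[OF ne bdd] by blast
      then show ?thesis using cdf_nondecreasing[of a v] by (auto simp: A_def)
    qed
    then have "eventually (\<lambda>v. t \<le> cdf \<mu> v) (at_right u)"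
      by (auto simp: eventually_at_filter)
    moreover have "(cdf \<mu> \<longlongrightarrow> cdf \<mu> u) (at_right u)"
      using cdf_is_right_cont[of u] by (simp add: continuous_within)
    ultimately show "t \<le> cdf \<mu> u"
      by (intro tendsto_lowerbound[where F = "at_right u"]) auto
  next
    assume "t \<le> cdf \<mu> u"
    then show "quantile T \<mu> t \<le> u"
      unfolding q using assms by (intro cInf_lower bdd) (auto simp: A_def)
  qed
qed

lemma quantile_mem:
  assumes "cdf \<mu> T = 1" "0 \<le> T" "t \<le> 1"
  shows "quantile T \<mu> t \<in> {0..T}"
proof -
  have T: "T \<in> {u \<in> {0..T}. cdf \<mu> u \<ge> t}" using assms by auto
  have "0 \<le> quantile T \<mu> t" unfolding quantile_def
    by (rule cInf_greatest) (use T in auto)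
  moreover have "quantile T \<mu> t \<le> T" unfolding quantile_def
    by (rule cInf_lower) (use T in \<open>auto intro!: bdd_belowI[of _ 0]\<close>)
  ultimately show ?thesis by simp
qed

lemma quantile_mono:
  assumes "cdf \<mu> T = 1" "0 \<le> T" "s \<le> t" "t \<le> 1"
  shows "quantile T \<mu> s \<le> quantile T \<mu> t"
  unfolding quantile_def using assms
  by (intro cInf_superset_mono) (auto intro!: exI[of _ T] bdd_belowI[of _ 0])

text \<open>An interval of length b - a contains at least (b - a) J / T - 1 grid points j T / J, and
  each of them separates a from b, which is what a difference of the two indicators records. The
  summand 1 pays for rounding.\<close>

lemma dist_le_grid_count:
  fixes a b T :: real and J :: nat
  assumes T: "0 < T" and J: "0 < J" and a: "a \<in> {0..T}" and b: "b \<in> {0..T}"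
  shows "\<bar>a - b\<bar> \<le> T / real J *
    (1 + (\<Sum>j<J. \<bar>of_bool (a \<le> real j * T / real J) - of_bool (b \<le> real j * T / real J)\<bar>))"
  using a b
proof (induction a b rule: linorder_wlog)
  case (le a b)
  \<comment> \<open>The grid points in [a, b) are those with index from p to q - 1.\<close>
  define p where "p = nat \<lceil>a * J / T\<rceil>"
  define q where "q = nat \<lceil>b * J / T\<rceil>"
  have qJ: "q \<le> J" unfolding q_def using le T J
    by (auto simp: nat_le_iff ceiling_le_iff divide_simps mult_right_mono)
  have "of_bool (a \<le> real j * T / real J) = (1::real) \<and> of_bool (b \<le> real j * T / real J) = (0::real)"
    if "j \<in> {p..<q}" for j
  proof -
    have "a * J / T \<le> j" using that by (simp add: p_def nat_le_iff ceiling_le_iff)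
    then have "a \<le> real j * T / real J" using T J by (simp add: field_simps)
    moreover have "j < b * J / T" using that by (auto simp: q_def nat_less_iff less_ceiling_iff zless_nat_eq_int_zless)
    then have "\<not> b \<le> real j * T / real J" using T J by (simp add: field_simps)
    ultimately show ?thesis by simp
  qed
  then have "(\<Sum>j\<in>{p..<q}. \<bar>of_bool (a \<le> real j * T / real J) - of_bool (b \<le> real j * T / real J)\<bar>) = (\<Sum>j\<in>{p..<q}. 1::real)"
    by (intro sum.cong) auto
  moreover have "(\<Sum>j\<in>{p..<q}. \<bar>of_bool (a \<le> real j * T / real J) - of_bool (b \<le> real j * T / real J)\<bar>)
     \<le> (\<Sum>j<J. \<bar>of_bool (a \<le> real j * T / real J) - of_bool (b \<le> real j * T / real J) :: real\<bar>)"
    using qJ by (intro sum_mono2) auto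
  moreover have "real (q - p) \<ge> (b - a) * J / T - 1"
  proof -
    have "real q \<ge> b * J / T" unfolding q_def using le T by (simp add: real_nat_ceiling_ge)
    moreover have "real p \<le> a * J / T + 1"
    proof -
      have "0 \<le> a * J / T" using le T by simp
      then have "0 \<le> \<lceil>a * J / T\<rceil>" by (metis ceiling_mono ceiling_zero)
      then have "real (nat \<lceil>a * J / T\<rceil>) = of_int \<lceil>a * J / T\<rceil>" by (rule of_nat_nat)
      then show ?thesis unfolding p_def
        using of_int_ceiling_le_add_one[of "a * J / T"] by (simp only:)
    qed
    moreover have "(b - a) * J / T = b * J / T - a * J / T" by (simp add: left_diff_distrib diff_divide_distrib)
    ultimately show ?thesis by linarith
  qed
  ultimately have "(b - a) * J / T \<le> 1 + (\<Sum>j<J. \<bar>of_bool (a \<le> real j * T / real J) - of_bool (b \<le> real j * T / real J) :: real\<bar>)"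
    by simp
  then have "T / J * ((b - a) * J / T) \<le> T / J * (1 + (\<Sum>j<J. \<bar>of_bool (a \<le> real j * T / real J) - of_bool (b \<le> real j * T / real J) :: real\<bar>))"
    using T J by (intro mult_left_mono) auto
  then show ?case using le T J by simp
next
  case (sym a b)
  then show ?case by (simp add: abs_minus_commute)
qed

text \<open>Integrating over the level t turns a difference of thresholds into
  \<open>\<bar>F - G\<bar>\<close>. Combined with a sum over the grid, this is the discrete form of
  the fact that the area between two quantile functions equals the area between the two distribution
  functions.\<close>

lemma has_integral_threshold_difference:
  fixes F G :: real
  assumes "F \<in> {0..1}" "G \<in> {0..1}"
  shows "has_bochner_integral lborel (\<lambda>t. indicator {0..1} t * \<bar>of_bool (t \<le> F) - of_bool (t \<le> G)\<bar>) \<bar>F - G\<bar>"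
proof -
  have eq: "(\<lambda>t. indicator {0..1} t * \<bar>of_bool (t \<le> F) - of_bool (t \<le> G)\<bar>) = (indicator {min F G<..max F G} :: real \<Rightarrow> real)"
    using assms by (auto simp: indicator_def fun_eq_iff min_def max_def)
  have "has_bochner_integral lborel (indicator {min F G<..max F G} :: real \<Rightarrow> real) (measure lborel {min F G<..max F G})"
    by (rule has_bochner_integral_real_indicator) auto
  then show ?thesis unfolding eq by (simp add: max_def min_def split: if_splits)
qed

text \<open>Discretising \<open>\<integral> \<bar>F - G\<bar>\<close> on a grid means that only finitely many counts of a point process enter below,
  and that no joint measurability of the empirical quantile function in \<open>(t, \<omega>)\<close> is needed.\<close>

lemma L2_dist_quantile_le_grid:
  assumes \<mu>: "real_distribution \<mu>" "cdf \<mu> T = 1" and \<nu>: "real_distribution \<nu>" "cdf \<nu> T = 1"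
    and T: "0 < T" and J: "0 < J"
  shows "(LBINT t:{0..1}. (quantile T \<mu> t - quantile T \<nu> t)\<^sup>2) \<le>
    T\<^sup>2 / real J * (1 + (\<Sum>j<J. \<bar>cdf \<mu> (real j * T / real J) - cdf \<nu> (real j * T / real J)\<bar>))"
proof -
  let ?u = "\<lambda>j. real j * T / real J"
  have u: "?u j \<in> {0..T}" if "j < J" for j
    using that T J by (auto simp: divide_simps mult_right_mono)
  have int: "has_bochner_integral lborel (\<lambda>t. T\<^sup>2 / real J * (indicator {0..1} t + (\<Sum>j<J. indicator {0..1} t * \<bar>of_bool (t \<le> cdf \<mu> (?u j)) - of_bool (t \<le> cdf \<nu> (?u j))\<bar>)))
     (T\<^sup>2 / real J * (measure lborel {0..1::real} + (\<Sum>j<J. \<bar>cdf \<mu> (?u j) - cdf \<nu> (?u j)\<bar>)))"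
    using \<mu>(1) \<nu>(1)
    by (intro has_bochner_integral_mult_right has_bochner_integral_add has_bochner_integral_sum
         has_bochner_integral_real_indicator has_integral_threshold_difference)
      (auto simp: real_distribution.cdf_bounded_prob finite_borel_measure.cdf_nonneg real_distribution.finite_borel_measure_M)
  have "indicator {0..1} t * (quantile T \<mu> t - quantile T \<nu> t)\<^sup>2
     \<le> T\<^sup>2 / real J * (indicator {0..1} t + (\<Sum>j<J. indicator {0..1} t * \<bar>of_bool (t \<le> cdf \<mu> (?u j)) - of_bool (t \<le> cdf \<nu> (?u j))\<bar>))" for t
  proof (cases "t \<in> {0..1}")
    case True
    let ?a = "quantile T \<mu> t" let ?b = "quantile T \<nu> t"
    have ab: "?a \<in> {0..T}" "?b \<in> {0..T}" using True T \<mu>(2) \<nu>(2) by (auto intro!: quantile_mem simp del: atLeastAtMost_iff dest: atLeastAtMost_iff[THEN iffD1])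
    have "(?a - ?b)\<^sup>2 = \<bar>?a - ?b\<bar> * \<bar>?a - ?b\<bar>" by (simp add: power2_eq_square)
    \<comment> \<open>Bounding one factor by T turns the square into a first power, which can be
      counted on the grid.\<close>
    also have "\<dots> \<le> T * \<bar>?a - ?b\<bar>" using ab by (intro mult_right_mono) auto
    also have "\<dots> \<le> T * (T / real J * (1 + (\<Sum>j<J. \<bar>of_bool (?a \<le> ?u j) - of_bool (?b \<le> ?u j)\<bar>)))"
      using dist_le_grid_count[OF T J ab] T by (intro mult_left_mono) auto
    \<comment> \<open>The Galois connection between quantile and distribution function turns
      conditions on the quantiles at level t into conditions on the distribution functions at grid
      points.\<close>
    also have "(\<Sum>j<J. \<bar>of_bool (?a \<le> ?u j) - of_bool (?b \<le> ?u j)\<bar>)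
      = (\<Sum>j<J. indicator {0..1} t * \<bar>of_bool (t \<le> cdf \<mu> (?u j)) - of_bool (t \<le> cdf \<nu> (?u j))\<bar> :: real)"
      using quantile_le_iff[OF \<mu> _ _ u] quantile_le_iff[OF \<nu> _ _ u] True T
      by (intro sum.cong) auto
    finally have *: "(?a - ?b)\<^sup>2 \<le> T * (T / real J * (1 + (\<Sum>j<J. indicator {0..1} t * \<bar>of_bool (t \<le> cdf \<mu> (?u j)) - of_bool (t \<le> cdf \<nu> (?u j))\<bar>)))" .
    have ind: "indicator {0..1} t = (1::real)" using True by simp
    have eq: "T * (T / real J * S) = T\<^sup>2 / real J * S" for S by (simp add: power2_eq_square)
    show ?thesis using * unfolding ind eq mult_1 .
  qed simp
  then have "(LBINT t:{0..1}. (quantile T \<mu> t - quantile T \<nu> t)\<^sup>2) \<le>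
     (\<integral>t. T\<^sup>2 / real J * (indicator {0..1} t + (\<Sum>j<J. indicator {0..1} t * \<bar>of_bool (t \<le> cdf \<mu> (?u j)) - of_bool (t \<le> cdf \<nu> (?u j))\<bar>)) \<partial>lborel)"
    unfolding set_lebesgue_integral_def real_scaleR_def
    using int J
    by (intro integral_mono') (auto simp: has_bochner_integral_iff intro!: mult_nonneg_nonneg add_nonneg_nonneg sum_nonneg)
  also have "\<dots> = T\<^sup>2 / real J * (1 + (\<Sum>j<J. \<bar>cdf \<mu> (?u j) - cdf \<nu> (?u j)\<bar>))"
    using int by (simp add: has_bochner_integral_iff)
  finally show ?thesis .
qed
subsection \<open>Bi-Lipschitz quantile functions and shapes\<close>

lemma quantile_setD:
  assumes "q \<in> quantile_set T M L" "s \<in> {0..1}" "t \<in> {0..1}"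
  shows "q s \<in> {0..T}" "M * \<bar>s - t\<bar> \<le> \<bar>q s - q t\<bar>" "\<bar>q s - q t\<bar> \<le> L * \<bar>s - t\<bar>" "q 0 = 0" "q 1 = T"
  using assms by (auto simp: quantile_set_def Pi_iff)

lemma quantile_set_cong:
  assumes "\<And>t. t \<in> {0..1} \<Longrightarrow> p t = q t"
  shows "p \<in> quantile_set T M L \<longleftrightarrow> q \<in> quantile_set T M L"
  using assms by (simp add: quantile_set_def Pi_iff)

lemma quantile_set_continuous:
  assumes "q \<in> quantile_set T M L"
  shows "continuous_on {0..1} q"
proof (rule continuous_on_iff[THEN iffD2], intro ballI allI impI)
  fix s e :: real assume s: "s \<in> {0..1}" and e: "0 < e"
  show "\<exists>d>0. \<forall>s'\<in>{0..1}. dist s' s < d \<longrightarrow> dist (q s') (q s) < e"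
  proof (intro exI[of _ "e / (\<bar>L\<bar> + 1)"] conjI ballI impI)
    fix t assume t: "t \<in> {0..1}" "dist t s < e / (\<bar>L\<bar> + 1)"
    have "\<bar>q t - q s\<bar> \<le> L * \<bar>t - s\<bar>" using quantile_setD(3)[OF assms t(1) s] .
    also have "\<dots> \<le> (\<bar>L\<bar> + 1) * \<bar>t - s\<bar>" by (intro mult_right_mono) auto
    also have "\<dots> < e" using t(2) by (simp add: dist_real_def field_simps)
    finally show "dist (q t) (q s) < e" by (simp add: dist_real_def)
  qed (use e in auto)
qed

text \<open>The definition compares absolute values only and does not say which way q moves. If q
  decreased from s to t, the intermediate value theorem would give some r \<le> s with q r = q t,
  and the lower Lipschitz bound would force r = t.\<close>

lemma quantile_set_mono:
  assumes q: "q \<in> quantile_set T M L" and M: "0 < M" and st: "s \<in> {0..1}" "t \<in> {0..1}" "s \<le> t"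
  shows "q s \<le> q t"
proof (rule ccontr)
  assume "\<not> q s \<le> q t"
  then have lt: "q t < q s" by simp
  have "continuous_on {0..s} q"
    using quantile_set_continuous[OF q] st by (auto intro: continuous_on_subset)
  moreover have "q 0 \<le> q t" using quantile_setD[OF q st(2) st(2)] by auto
  ultimately obtain r where r: "0 \<le> r" "r \<le> s" "q r = q t"
    using IVT'[of q 0 "q t" s] lt st by auto
  have "M * \<bar>r - t\<bar> \<le> \<bar>q r - q t\<bar>" using quantile_setD(2)[OF q _ st(2), of r] r st by auto
  then have "r = t" using r M by (simp add: mult_le_0_iff)
  then show False using r st lt by auto
qed

text \<open>Without absolute values the bi-Lipschitz condition is linear in q, hence inherited by
  averages of quantile functions.\<close>

lemma quantile_set_slope:
  assumes q: "q \<in> quantile_set T M L" and M: "0 < M" and st: "s \<in> {0..1}" "t \<in> {0..1}" "s \<le> t"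
  shows "M * (t - s) \<le> q t - q s" "q t - q s \<le> L * (t - s)"
  using quantile_setD(2,3)[OF q st(1,2)] quantile_set_mono[OF assms] st(3) by auto

lemma quantile_set_surj:
  assumes "q \<in> quantile_set T M L" "u \<in> {0..T}"
  shows "\<exists>s\<in>{0..1}. q s = u"
  using IVT'[of q 0 u 1] quantile_set_continuous[OF assms(1)] quantile_setD(4,5)[OF assms(1), of 0 0] assms(2)
  by fastforce

section \<open>Densities on [0, T] and the distributions they define\<close>

abbreviation shape_measure :: "real \<Rightarrow> (real \<Rightarrow> real) \<Rightarrow> real measure" where
  "shape_measure T f \<equiv> density lborel (\<lambda>t. ennreal (indicator {0..T} t * f t))"

lemma emeasure_shape_measure:
  assumes f: "set_integrable lborel {0..T} f" "\<forall>t\<in>{0..T}. 0 \<le> f t" and A: "A \<in> sets borel"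
  shows "emeasure (shape_measure T f) A = ennreal (LBINT t:A \<inter> {0..T}. f t)"
proof -
  have m: "(\<lambda>t. indicator {0..T} t * f t) \<in> borel_measurable lborel"
    using f(1) by (simp add: set_integrable_def borel_measurable_integrable)
  have "set_integrable lborel (A \<inter> {0..T}) f"
    by (rule set_integrable_subset[OF f(1)]) (use A in auto)
  then have i: "integrable lborel (\<lambda>t. indicator (A \<inter> {0..T}) t * f t)"
    by (simp add: set_integrable_def)
  have "emeasure (shape_measure T f) A = (\<integral>\<^sup>+t. ennreal (indicator {0..T} t * f t) * indicator A t \<partial>lborel)"
    using m A by (intro emeasure_density) auto
  also have "\<dots> = (\<integral>\<^sup>+t. ennreal (indicator (A \<inter> {0..T}) t * f t) \<partial>lborel)"
    by (intro nn_integral_cong) (auto simp: indicator_def)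
  also have "\<dots> = ennreal (\<integral>t. indicator (A \<inter> {0..T}) t * f t \<partial>lborel)"
    using f(2) by (intro nn_integral_eq_integral i AE_I2) (auto simp: indicator_def)
  finally show ?thesis by (simp add: set_lebesgue_integral_def)
qed

lemma shape_measure_distribution:
  assumes f: "set_integrable lborel {0..T} f" "\<forall>t\<in>{0..T}. 0 \<le> f t" "(LBINT t:{0..T}. f t) = 1"
  shows "real_distribution (shape_measure T f)"
    and "u \<in> {0..T} \<Longrightarrow> cdf (shape_measure T f) u = (LBINT t:{0..u}. f t)"
    and "0 \<le> T \<Longrightarrow> cdf (shape_measure T f) T = 1"
proof -
  show "real_distribution (shape_measure T f)"
  proof (intro real_distribution.intro prob_spaceI)
    show "emeasure (shape_measure T f) (space (shape_measure T f)) = 1"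
      using emeasure_shape_measure[OF f(1,2), of UNIV] f(3) by simp
  qed (simp add: real_distribution_axioms_def)
  show *: "cdf (shape_measure T f) u = (LBINT t:{0..u}. f t)" if u: "u \<in> {0..T}" for u
  proof -
    have eq: "{..u} \<inter> {0..T} = {0..u}" using u by auto
    have "emeasure (shape_measure T f) {..u} = ennreal (LBINT t:{0..u}. f t)"
      using emeasure_shape_measure[OF f(1,2), of "{..u}"] unfolding eq by simp
    moreover have "0 \<le> (LBINT t:{0..u}. f t)"
      unfolding set_lebesgue_integral_def using f(2) u
      by (intro integral_nonneg_AE AE_I2) (auto simp: indicator_def)
    ultimately show ?thesis
      by (simp add: cdf_def2 measure_def)
  qed
  show "0 \<le> T \<Longrightarrow> cdf (shape_measure T f) T = 1" using *[of T] f(3) by simp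
qed

text \<open>The law \<open>\<mu>\<close> of \<open>q(U)\<close>, with \<open>U\<close> uniform, has the Lipschitz distribution function \<open>q\<^sup>-\<^sup>1\<close>, which maps null
  sets to null sets; so \<open>\<mu>\<close> is absolutely continuous.\<close>

lemma quantile_set_realised:
  assumes q: "q \<in> quantile_set T M L" and T: "0 < T" and M: "0 < M"
  shows "\<exists>f\<in>shape_space T M L. \<forall>t\<in>{0..1}. shape_quantile T f t = q t"
proof -
  \<comment> \<open>Extending q by constants gives a continuous function on the whole line, so that
    the image of the uniform distribution is a Borel measure.\<close>
  define qc where "qc t = q (max 0 (min 1 t))" for t
  define \<mu> where "\<mu> = distr (uniform_measure lborel {0..1}) borel qc"
  have "continuous_on UNIV qc" unfolding qc_def
    by (rule continuous_on_compose2[OF quantile_set_continuous[OF q]]) (auto intro!: continuous_intros)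
  then have qc[measurable]: "qc \<in> borel_measurable borel" by (rule borel_measurable_continuous_onI)
  have ps: "prob_space (uniform_measure lborel {0..1::real})" by (intro prob_space_uniform_measure) auto
  have \<mu>: "real_distribution \<mu>" unfolding \<mu>_def by (rule prob_space.real_distribution_distr[OF ps]) simp
  then interpret real_distribution \<mu> .
  have em: "emeasure \<mu> A = emeasure lborel (qc -` A \<inter> {0..1})" if A: "A \<in> sets borel" for A
  proof -
    have "emeasure \<mu> A = emeasure (uniform_measure lborel {0..1}) (qc -` A \<inter> UNIV)"
      unfolding \<mu>_def using A by (subst emeasure_distr) auto
    also have "\<dots> = emeasure lborel (qc -` A \<inter> {0..1})"
      using measurable_sets[OF qc A] by (subst emeasure_uniform_measure) (auto simp: Int_commute divide_ennreal_def)
    finally show ?thesis .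
  qed
  have cdf: "cdf \<mu> (q s) = s" if s: "s \<in> {0..1}" for s
  proof -
    \<comment> \<open>Since M > 0, q is strictly increasing, and so the distribution function of
      \<mu> inverts q.\<close>
    have "q t \<le> q s \<longleftrightarrow> t \<le> s" if t: "t \<in> {0..1}" for t
    proof
      assume "q t \<le> q s"
      show "t \<le> s"
      proof (rule ccontr)
        assume "\<not> t \<le> s"
        then have "0 < M * (t - s)" using M by simp
        then show False using quantile_set_slope(1)[OF q M s t] \<open>q t \<le> q s\<close> \<open>\<not> t \<le> s\<close> by simp
      qed
    qed (rule quantile_set_mono[OF q M t s])
    then have "qc -` {..q s} \<inter> {0..1} = {0..s}"
      using s by (auto simp: qc_def)
    then have "emeasure \<mu> {..q s} = ennreal s" using em[of "{..q s}"] s by simp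
    then show ?thesis using s by (simp add: cdf_def2 measure_def)
  qed
  have cT: "cdf \<mu> T = 1" using cdf[of 1] quantile_setD(5)[OF q, of 0 0] by simp
  have quant: "quantile T \<mu> t = q t" if t: "t \<in> {0..1}" for t
  proof (rule antisym)
    have qt: "q t \<in> {0..T}" using quantile_setD(1)[OF q t t] .
    then show "quantile T \<mu> t \<le> q t" using quantile_le_iff[OF \<mu> cT _ _ qt, of t] cdf[OF t] t T by auto
    have v: "quantile T \<mu> t \<in> {0..T}" using quantile_mem[OF cT, of t] t T by auto
    obtain s where s: "s \<in> {0..1}" "q s = quantile T \<mu> t" using quantile_set_surj[OF q v] by blast
    have "t \<le> s" using quantile_le_iff[OF \<mu> cT _ _ v, of t] cdf[OF s(1)] s t T by auto
    then show "q t \<le> quantile T \<mu> t" using quantile_set_mono[OF q M t s(1)] s by simp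
  qed
  have range: "qc -` {0..T} \<inter> {0..1} = {0..1}" using quantile_setD(1)[OF q] by (auto simp: qc_def)
  have ac: "absolutely_continuous lborel \<mu>"
    unfolding absolutely_continuous_def
  proof
    fix A :: "real set" assume A: "A \<in> null_sets lborel"
    then have Ab: "A \<in> sets borel" by (auto simp: null_sets_def)
    have neg: "negligible (A \<inter> {0..T})"
    proof (rule negligible_subset)
      show "negligible A" unfolding negligible_iff_null_sets using A by (rule null_sets_completionI)
    qed simp
    have "negligible (cdf \<mu> ` (A \<inter> {0..T}))"
    proof (rule negligible_locally_Lipschitz_image[OF _ neg])
      fix u assume u: "u \<in> A \<inter> {0..T}"
      obtain s where s: "s \<in> {0..1}" "q s = u" using quantile_set_surj[OF q] u by blast
      \<comment> \<open>On [0, T] the distribution function is the inverse of q, so the lower bound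
        M on the slope of q becomes the Lipschitz constant 1 / M.\<close>
      have "norm (cdf \<mu> v - cdf \<mu> u) \<le> 1 / M * norm (v - u)" if v: "v \<in> A \<inter> {0..T}" for v
      proof -
        obtain t where t: "t \<in> {0..1}" "q t = v" using quantile_set_surj[OF q] v by blast
        show ?thesis using quantile_setD(2)[OF q t(1) s(1)] cdf[OF s(1)] cdf[OF t(1)] s t M
          by (simp add: field_simps)
      qed
      then show "\<exists>U B. open U \<and> u \<in> U \<and> (\<forall>v\<in>A \<inter> {0..T} \<inter> U. norm (cdf \<mu> v - cdf \<mu> u) \<le> B * norm (v - u))"
        by (intro exI[of _ UNIV] exI[of _ "1 / M"]) auto
    qed simp
    moreover have "qc -` A \<inter> {0..1} \<subseteq> cdf \<mu> ` (A \<inter> {0..T})"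
    proof
      fix t assume t: "t \<in> qc -` A \<inter> {0..1}"
      then have "q t \<in> A \<inter> {0..T}" using quantile_setD(1)[OF q, of t t] by (auto simp: qc_def)
      moreover have "t = cdf \<mu> (q t)" using cdf[of t] t by simp
      ultimately show "t \<in> cdf \<mu> ` (A \<inter> {0..T})" by blast
    qed
    ultimately have "negligible (qc -` A \<inter> {0..1})" by (rule negligible_subset)
    moreover have b: "qc -` A \<inter> {0..1} \<in> sets lborel" using measurable_sets[OF qc Ab] by simp
    ultimately have "emeasure lborel (qc -` A \<inter> {0..1}) = 0"
      unfolding negligible_iff_null_sets using null_sets_completion_iff[OF b] by blast
    then show "A \<in> null_sets \<mu>" using em[OF Ab] Ab by (auto simp: null_sets_def)
  qed
  have s\<mu>: "sets \<mu> = sets lborel" by simp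
  obtain D where D: "D \<in> borel_measurable lborel" "AE u in lborel. RN_deriv lborel \<mu> u = ennreal (D u)" "\<And>u. 0 \<le> D u"
    using sigma_finite_measure.real_RN_deriv[OF lborel.sigma_finite_measure_axioms finite_measure_axioms ac s\<mu>] by blast
  have dens: "density lborel (\<lambda>u. ennreal (D u)) = \<mu>"
    using sigma_finite_measure.density_RN_deriv[OF lborel.sigma_finite_measure_axioms ac s\<mu>] D by (subst density_cong[of _ _ "RN_deriv lborel \<mu>"]) auto
  \<comment> \<open>The Radon-Nikodym density lives on the whole line; cutting it down to [0, T]
    changes nothing because q takes its values there.\<close>
  have D1: "shape_measure T D = \<mu>"
  proof (rule measure_eqI)
    show "sets (shape_measure T D) = sets \<mu>" by simp
    fix A assume "A \<in> sets (shape_measure T D)"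
    then have A: "A \<in> sets borel" by simp
    have "emeasure (shape_measure T D) A = (\<integral>\<^sup>+t. ennreal (indicator {0..T} t * D t) * indicator A t \<partial>lborel)"
      using D A by (intro emeasure_density) auto
    also have "\<dots> = (\<integral>\<^sup>+t. ennreal (D t) * indicator (A \<inter> {0..T}) t \<partial>lborel)"
      by (intro nn_integral_cong) (auto simp: indicator_def)
    also have "\<dots> = emeasure (density lborel (\<lambda>u. ennreal (D u))) (A \<inter> {0..T})"
      using D A by (intro emeasure_density[symmetric]) auto
    also have "\<dots> = emeasure \<mu> (A \<inter> {0..T})" by (simp only: dens)
    also have "\<dots> = emeasure \<mu> A"
    proof -
      have "qc -` (A \<inter> {0..T}) \<inter> {0..1} = qc -` A \<inter> {0..1}" using range by blast
      then show ?thesis using em[OF A] em[of "A \<inter> {0..T}"] A by simp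
    qed
    finally show "emeasure (shape_measure T D) A = emeasure \<mu> A" .
  qed
  have nn: "(\<integral>\<^sup>+t. ennreal (indicator {0..T} t * D t) \<partial>lborel) = 1"
  proof -
    have "(\<integral>\<^sup>+t. ennreal (indicator {0..T} t * D t) \<partial>lborel) = emeasure (shape_measure T D) UNIV"
      using D by (subst emeasure_density) auto
    also have "\<dots> = 1" unfolding D1 using emeasure_space_1 by simp
    finally show ?thesis .
  qed
  have hbi: "has_bochner_integral lborel (\<lambda>t. indicator {0..T} t * D t) 1"
    using D nn by (intro has_bochner_integral_nn_integral) auto
  have sq: "shape_quantile T D t = q t" if "t \<in> {0..1}" for t
    unfolding shape_quantile_def D1 using quant[OF that] .
  have "D \<in> shape_space T M L"
    unfolding shape_space_def using hbi D(3) sq quantile_set_cong[of "shape_quantile T D" q] q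
    by (auto simp: set_integrable_def set_lebesgue_integral_def has_bochner_integral_iff)
  then show ?thesis using sq by blast
qed

lemma shape_space_dist:
  assumes "f \<in> shape_space T M L" "0 \<le> T"
  shows "real_distribution (shape_measure T f)" "cdf (shape_measure T f) T = 1"
    "shape_quantile T f \<in> quantile_set T M L"
  using assms shape_measure_distribution[of T f] by (auto simp: shape_space_def)
subsection \<open>Projection onto the set of quantile functions\<close>

lemma set_integrable_bounded:
  fixes h :: "real \<Rightarrow> real"
  assumes "set_borel_measurable lborel {0..1} h" "\<And>t. t \<in> {0..1} \<Longrightarrow> \<bar>h t\<bar> \<le> B"
  shows "set_integrable lborel {0..1} h"
  unfolding set_integrable_def
proof (rule Bochner_Integration.integrable_bound)
  show "integrable lborel (\<lambda>t::real. B * indicator {0..1} t)"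
    by (intro integrable_mult_right integrable_real_indicator) auto
  show "AE t in lborel. norm (indicator {0..1} t *\<^sub>R h t) \<le> norm (B * indicator {0..1} t)"
    using assms(2) by (intro AE_I2) (force simp: indicator_def)
qed (use assms(1) in \<open>simp add: set_borel_measurable_def\<close>)

lemma set_borel_measurable_diff_sq:
  fixes p q :: "real \<Rightarrow> real"
  assumes "set_borel_measurable M A p" "set_borel_measurable M A q"
  shows "set_borel_measurable M A (\<lambda>t. (p t - q t)\<^sup>2)"
proof -
  have "(\<lambda>t. indicator A t *\<^sub>R (p t - q t)\<^sup>2) = (\<lambda>t. (indicator A t *\<^sub>R p t - indicator A t *\<^sub>R q t)\<^sup>2)"
    by (auto simp: fun_eq_iff indicator_def)
  then show ?thesis using assms unfolding set_borel_measurable_def by simp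
qed

lemma set_integrable_diff_sq:
  fixes p q :: "real \<Rightarrow> real"
  assumes "set_borel_measurable lborel {0..1} p" "set_borel_measurable lborel {0..1} q"
    and "\<And>t. t \<in> {0..1} \<Longrightarrow> \<bar>p t\<bar> \<le> B" "\<And>t. t \<in> {0..1} \<Longrightarrow> \<bar>q t\<bar> \<le> C"
  shows "set_integrable lborel {0..1} (\<lambda>t. (p t - q t)\<^sup>2)"
proof (rule set_integrable_bounded)
  fix t :: real assume t: "t \<in> {0..1}"
  have "\<bar>p t - q t\<bar> \<le> B + C" using assms(3,4)[OF t] by linarith
  then show "\<bar>(p t - q t)\<^sup>2\<bar> \<le> (B + C)\<^sup>2" by (simp add: power2_le_iff_abs_le[symmetric] abs_le_square_iff[symmetric] power_mono)
qed (intro set_borel_measurable_diff_sq assms)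

lemma L2_dist_sq: "(L2_dist p q)\<^sup>2 = (LBINT t:{0..1}. (p t - q t)\<^sup>2)"
proof -
  have "0 \<le> (LBINT t:{0..1}. (p t - q t)\<^sup>2)"
    unfolding set_lebesgue_integral_def by (intro integral_nonneg_AE AE_I2) auto
  then show ?thesis by (simp add: L2_dist_def)
qed

lemma L2_dist_commute: "L2_dist p q = L2_dist q p"
  by (simp add: L2_dist_def power2_commute)

lemma L2_dist_cong:
  assumes "\<And>t. t \<in> {0..1} \<Longrightarrow> p t = p' t" "\<And>t. t \<in> {0..1} \<Longrightarrow> q t = q' t"
  shows "L2_dist p q = L2_dist p' q'"
  unfolding L2_dist_def by (intro arg_cong[of _ _ sqrt] set_lebesgue_integral_cong) (use assms in auto)

lemma L2_dist_triangle_sq: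
  fixes p q r :: "real \<Rightarrow> real"
  assumes m: "set_borel_measurable lborel {0..1} p" "set_borel_measurable lborel {0..1} q" "set_borel_measurable lborel {0..1} r"
    and b: "\<And>t. t \<in> {0..1} \<Longrightarrow> \<bar>p t\<bar> \<le> A" "\<And>t. t \<in> {0..1} \<Longrightarrow> \<bar>q t\<bar> \<le> B" "\<And>t. t \<in> {0..1} \<Longrightarrow> \<bar>r t\<bar> \<le> C"
  shows "(L2_dist p r)\<^sup>2 \<le> 2 * (L2_dist p q)\<^sup>2 + 2 * (L2_dist q r)\<^sup>2"
proof -
  have i: "set_integrable lborel {0..1} (\<lambda>t. 2 * (p t - q t)\<^sup>2)" "set_integrable lborel {0..1} (\<lambda>t. 2 * (q t - r t)\<^sup>2)"
    using set_integrable_diff_sq[OF m(1,2) b(1,2)] set_integrable_diff_sq[OF m(2,3) b(2,3)] by auto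
  have "(L2_dist p r)\<^sup>2 \<le> (LBINT t:{0..1}. 2 * (p t - q t)\<^sup>2 + 2 * (q t - r t)\<^sup>2)"
    unfolding L2_dist_sq
  proof (rule set_integral_mono)
    fix t :: real assume "t \<in> {0..1}"
    have "0 \<le> ((p t - q t) - (q t - r t))\<^sup>2" by simp
    then show "(p t - r t)\<^sup>2 \<le> 2 * (p t - q t)\<^sup>2 + 2 * (q t - r t)\<^sup>2"
      by (simp add: power2_eq_square algebra_simps)
  qed (use set_integrable_diff_sq[OF m(1,3) b(1,3)] i in auto)
  then show ?thesis using i by (simp add: L2_dist_sq set_integral_add)
qed

lemma quantile_set_measurable:
  assumes "q \<in> quantile_set T M L"
  shows "set_borel_measurable lborel {0..1} q" "\<And>t. t \<in> {0..1} \<Longrightarrow> \<bar>q t\<bar> \<le> T"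
  using quantile_setD(1)[OF assms] borel_measurable_continuous_on_indicator[OF _ quantile_set_continuous[OF assms]]
  by (auto simp: set_borel_measurable_def)

lemma quantile_set_closed:
  assumes "\<And>n. q n \<in> quantile_set T M L" "\<And>t. t \<in> {0..1} \<Longrightarrow> (\<lambda>n. q n t) \<longlonglongrightarrow> g t"
  shows "g \<in> quantile_set T M L"
proof -
  have 1: "g t \<in> {0..T}" if "t \<in> {0..1}" for t
    using tendsto_lowerbound[OF assms(2)[OF that], of 0] tendsto_upperbound[OF assms(2)[OF that], of T]
      quantile_setD(1)[OF assms(1) that that] by auto
  have 2: "g 0 = 0" "g 1 = T"
    using assms(2)[of 0] assms(2)[of 1] quantile_setD(4,5)[OF assms(1), of 0 0]
    by (auto simp: LIMSEQ_const_iff)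
  have 3: "M * \<bar>s - t\<bar> \<le> \<bar>g s - g t\<bar> \<and> \<bar>g s - g t\<bar> \<le> L * \<bar>s - t\<bar>" if st: "s \<in> {0..1}" "t \<in> {0..1}" for s t
  proof -
    have l: "(\<lambda>n. \<bar>q n s - q n t\<bar>) \<longlonglongrightarrow> \<bar>g s - g t\<bar>"
      by (intro tendsto_intros assms st)
    show ?thesis
      using tendsto_lowerbound[OF l, of "M * \<bar>s - t\<bar>"] tendsto_upperbound[OF l, of "L * \<bar>s - t\<bar>"]
        quantile_setD(2,3)[OF assms(1) st] by auto
  qed
  show ?thesis unfolding quantile_set_def using 1 2 3 by auto
qed

text \<open>Compactness provides the minimiser: a minimising sequence is uniformly bounded and
  equi-Lipschitz, so by Arzela-Ascoli a subsequence converges uniformly. The limit is again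
  admissible, and dominated convergence carries the functional to the limit.\<close>

lemma L2_projection_exists:
  fixes G :: "real \<Rightarrow> real"
  assumes ne: "quantile_set T M L \<noteq> {}"
    and G: "set_borel_measurable lborel {0..1} G" "\<And>t. t \<in> {0..1} \<Longrightarrow> \<bar>G t\<bar> \<le> B"
  shows "\<exists>q\<in>quantile_set T M L. \<forall>p\<in>quantile_set T M L. (L2_dist q G)\<^sup>2 \<le> (L2_dist p G)\<^sup>2"
proof -
  define \<phi> where "\<phi> q = (L2_dist q G)\<^sup>2" for q
  define I where "I = Inf (\<phi> ` quantile_set T M L)"
  have bdd: "bdd_below (\<phi> ` quantile_set T M L)" by (auto simp: \<phi>_def intro!: bdd_belowI[of _ 0])
  have "\<exists>q\<in>quantile_set T M L. \<phi> q < I + 1 / Suc n" for n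
  proof -
    have "Inf (\<phi> ` quantile_set T M L) < I + 1 / Suc n" by (simp add: I_def)
    then show ?thesis using cInf_less_iff[OF _ bdd] ne by auto
  qed
  then obtain q where q: "\<And>n. q n \<in> quantile_set T M L" "\<And>n. \<phi> (q n) < I + 1 / Suc n" by metis
  obtain g and k :: "nat \<Rightarrow> nat" where g: "continuous_on {0..1} g" "strict_mono k"
    "\<And>e. 0 < e \<Longrightarrow> \<exists>N. \<forall>n t. n \<ge> N \<and> t \<in> {0..1} \<longrightarrow> norm (q (k n) t - g t) < e"
  proof (rule Arzela_Ascoli[of "{0..1::real}" q T])
    show "norm (q n t) \<le> T" if "t \<in> {0..1}" for n t using quantile_setD(1)[OF q(1) that that, of n] by simp
    show "\<exists>d>0. \<forall>n y. y \<in> {0..1} \<and> norm (t - y) < d \<longrightarrow> norm (q n t - q n y) < e"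
      if t: "t \<in> {0..1}" and e: "0 < e" for t e :: real
    proof (intro exI[of _ "e / (\<bar>L\<bar> + 1)"] conjI allI impI)
      fix n y assume y: "y \<in> {0..1} \<and> norm (t - y) < e / (\<bar>L\<bar> + 1)"
      have "\<bar>q n t - q n y\<bar> \<le> L * \<bar>t - y\<bar>" using quantile_setD(3)[OF q(1) t, of y n] y by blast
      also have "\<dots> \<le> (\<bar>L\<bar> + 1) * \<bar>t - y\<bar>" by (intro mult_right_mono) auto
      also have "\<dots> < e" using y by (simp add: field_simps)
      finally show "norm (q n t - q n y) < e" by simp
    qed (use e in auto)
  qed auto
  have lim: "(\<lambda>n. q (k n) t) \<longlonglongrightarrow> g t" if "t \<in> {0..1}" for t
    using g(3) that unfolding lim_sequentially dist_real_def by (metis real_norm_def)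
  have gC: "g \<in> quantile_set T M L" by (rule quantile_set_closed[OF q(1) lim])
  have "(\<lambda>n. \<phi> (q (k n))) \<longlonglongrightarrow> \<phi> g"
    unfolding \<phi>_def L2_dist_sq set_lebesgue_integral_def
  proof (rule integral_dominated_convergence[where w = "\<lambda>t. (T + B)\<^sup>2 * indicator {0..1} t"])
    show "integrable lborel (\<lambda>t::real. (T + B)\<^sup>2 * indicator {0..1} t)"
      by (intro integrable_mult_right integrable_real_indicator) auto
    show "AE t in lborel. (\<lambda>n. indicator {0..1} t *\<^sub>R (q (k n) t - G t)\<^sup>2) \<longlonglongrightarrow> indicator {0..1} t *\<^sub>R (g t - G t)\<^sup>2"
    proof (intro AE_I2)
      fix t :: real
      show "(\<lambda>n. indicator {0..1} t *\<^sub>R (q (k n) t - G t)\<^sup>2) \<longlonglongrightarrow> indicator {0..1} t *\<^sub>R (g t - G t)\<^sup>2"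
        by (cases "t \<in> {0..1}") (auto intro!: tendsto_intros lim)
    qed
    show "AE t in lborel. norm (indicator {0..1} t *\<^sub>R (q (k n) t - G t)\<^sup>2) \<le> (T + B)\<^sup>2 * indicator {0..1} t" for n
    proof (intro AE_I2)
      fix t :: real
      have "\<bar>q (k n) t - G t\<bar> \<le> T + B" if "t \<in> {0..1}"
        using G(2)[OF that] quantile_set_measurable(2)[OF q(1) that, of "k n"] by linarith
      then have "(q (k n) t - G t)\<^sup>2 \<le> (T + B)\<^sup>2" if "t \<in> {0..1}"
        using that power_mono[of "\<bar>q (k n) t - G t\<bar>" "T + B" 2] by simp
      then show "norm (indicator {0..1} t *\<^sub>R (q (k n) t - G t)\<^sup>2) \<le> (T + B)\<^sup>2 * indicator {0..1} t"
        by (simp add: indicator_def)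
    qed
  qed (use set_borel_measurable_diff_sq[OF quantile_set_measurable(1)[OF gC] G(1)]
         set_borel_measurable_diff_sq[OF quantile_set_measurable(1)[OF q(1)] G(1)] in \<open>auto simp: set_borel_measurable_def\<close>)
  moreover have "(\<lambda>n. I + 1 / Suc n) \<longlonglongrightarrow> I + 0"
    by (intro tendsto_intros LIMSEQ_Suc[OF lim_1_over_n])
  moreover have "\<phi> (q (k n)) \<le> I + 1 / Suc n" for n
  proof -
    have "\<phi> (q (k n)) \<le> I + 1 / Suc (k n)" using q(2)[of "k n"] by simp
    also have "\<dots> \<le> I + 1 / Suc n" using seq_suble[OF g(2), of n] by (simp add: frac_le)
    finally show ?thesis .
  qed
  ultimately have "\<phi> g \<le> I" using LIMSEQ_le[of "\<lambda>n. \<phi> (q (k n))" "\<phi> g" "\<lambda>n. I + 1 / Suc n" "I + 0"] by auto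
  moreover have "I \<le> \<phi> p" if "p \<in> quantile_set T M L" for p
    unfolding I_def by (rule cInf_lower[OF _ bdd]) (use that in auto)
  ultimately show ?thesis using gC unfolding \<phi>_def by (meson order_trans)
qed

text \<open>\<open>arg_min_on\<close> is a choice operator; its value is known to be a minimiser
  once some minimiser q has been exhibited.\<close>

lemma arg_min_onI:
  fixes \<phi> :: "'b \<Rightarrow> real"
  assumes "q \<in> S" "\<And>p. p \<in> S \<Longrightarrow> \<phi> q \<le> \<phi> p"
  shows "arg_min_on \<phi> S \<in> S" "\<And>p. p \<in> S \<Longrightarrow> \<phi> (arg_min_on \<phi> S) \<le> \<phi> p"
proof -
  have "is_arg_min \<phi> (\<lambda>p. p \<in> S) q" using assms by (auto simp: is_arg_min_def not_less)
  then have "is_arg_min \<phi> (\<lambda>p. p \<in> S) (arg_min_on \<phi> S)"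
    unfolding arg_min_on_def arg_min_def by (rule someI)
  then show "arg_min_on \<phi> S \<in> S" "\<And>p. p \<in> S \<Longrightarrow> \<phi> (arg_min_on \<phi> S) \<le> \<phi> p"
    by (auto simp: is_arg_min_def not_less)
qed

text \<open>\<open>q0\<close> is itself a competitor, so minimality bounds the distance from q to G
  by that from \<open>q0\<close> to G. The triangle inequality then gives the factor 2, squared
  4.\<close>

lemma L2_projection_dist:
  fixes G :: "real \<Rightarrow> real"
  assumes G: "set_borel_measurable lborel {0..1} G" "\<And>t. t \<in> {0..1} \<Longrightarrow> \<bar>G t\<bar> \<le> B"
    and q0: "q0 \<in> quantile_set T M L"
  defines "q \<equiv> arg_min_on (\<lambda>q. (L2_dist q G)\<^sup>2) (quantile_set T M L)"
  shows "q \<in> quantile_set T M L" "(L2_dist q q0)\<^sup>2 \<le> 4 * (L2_dist q0 G)\<^sup>2"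
proof -
  have ne: "quantile_set T M L \<noteq> {}" using q0 by auto
  have *: "q \<in> quantile_set T M L" "\<And>p. p \<in> quantile_set T M L \<Longrightarrow> (L2_dist q G)\<^sup>2 \<le> (L2_dist p G)\<^sup>2"
    using L2_projection_exists[OF ne G] arg_min_onI[of _ "quantile_set T M L" "\<lambda>q. (L2_dist q G)\<^sup>2"] unfolding q_def by blast+
  show "q \<in> quantile_set T M L" by fact
  have "(L2_dist q q0)\<^sup>2 \<le> 2 * (L2_dist q G)\<^sup>2 + 2 * (L2_dist G q0)\<^sup>2"
    by (intro L2_dist_triangle_sq quantile_set_measurable(1)[OF *(1)] quantile_set_measurable(1)[OF q0] G)
       (use quantile_set_measurable(2)[OF *(1)] quantile_set_measurable(2)[OF q0] G in auto)
  then show "(L2_dist q q0)\<^sup>2 \<le> 4 * (L2_dist q0 G)\<^sup>2" using *(2)[OF q0] by (simp add: L2_dist_commute[of G])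
qed

text \<open>A Lipschitz function has no narrow spikes: a gap of size \<eta> at one point leaves a
  gap of at least \<eta> / 2 on a whole interval, which costs a fixed amount of L2 distance. This
  makes point evaluations continuous on the shape space.\<close>

lemma quantile_set_L2_pointwise:
  assumes \<eta>: "0 < \<eta>" and L: "0 < L"
  shows "\<exists>\<epsilon>>0. \<forall>p\<in>quantile_set T M L. \<forall>q\<in>quantile_set T M L. L2_dist p q < \<epsilon> \<longrightarrow> (\<forall>t\<in>{0..1}. \<bar>p t - q t\<bar> < \<eta>)"
proof -
  \<comment> \<open>Within distance l each of p and q moves by at most L l, so the gap shrinks by at
    most \<eta> / 2; and l \<le> 1/2 leaves room in [0,1] for an interval of length l on one side of
    t.\<close>
  define l where "l = min (1/2) (\<eta> / (4 * L))"
  have l: "0 < l" "l \<le> 1/2" "2 * L * l \<le> \<eta> / 2"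
    using \<eta> L by (auto simp: l_def min_def field_simps)
  have "\<bar>p t - q t\<bar> < \<eta>" if p: "p \<in> quantile_set T M L" and q: "q \<in> quantile_set T M L"
    and d: "L2_dist p q < sqrt (l * (\<eta> / 2)\<^sup>2)" and t: "t \<in> {0..1}" for p q t
  proof (rule ccontr)
    assume "\<not> \<bar>p t - q t\<bar> < \<eta>"
    define a where "a = (if t \<le> 1/2 then t else t - l)"
    have a: "{a..a + l} \<subseteq> {0..1}" "t \<in> {a..a + l}" using t l by (auto simp: a_def)
    have low: "\<eta> / 2 \<le> \<bar>p s - q s\<bar>" if s: "s \<in> {a..a + l}" for s
    proof -
      have s01: "s \<in> {0..1}" using s a by auto
      have "\<bar>s - t\<bar> \<le> l" using s a by auto
      then have "L * \<bar>s - t\<bar> \<le> L * l" using L by simp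
      then have "\<bar>p s - p t\<bar> \<le> L * l" "\<bar>q s - q t\<bar> \<le> L * l"
        using quantile_setD(3)[OF p s01 t] quantile_setD(3)[OF q s01 t] by auto
      then show ?thesis using \<open>\<not> \<bar>p t - q t\<bar> < \<eta>\<close> l(3) by linarith
    qed
    have i: "set_integrable lborel {0..1} (\<lambda>t. (p t - q t)\<^sup>2)"
      using quantile_set_measurable[OF p] quantile_set_measurable[OF q] by (blast intro: set_integrable_diff_sq)
    have "l * (\<eta> / 2)\<^sup>2 = (\<integral>s. (\<eta> / 2)\<^sup>2 * indicator {a..a + l} s \<partial>lborel)" using l by simp
    also have "\<dots> \<le> (LBINT t:{0..1}. (p t - q t)\<^sup>2)"
      unfolding set_lebesgue_integral_def real_scaleR_def
    proof (rule integral_mono)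
      show "integrable lborel (\<lambda>s. (\<eta> / 2)\<^sup>2 * indicator {a..a + l} s)"
        by (intro integrable_mult_right integrable_real_indicator) (auto simp: emeasure_lborel_Icc_eq)
      show "integrable lborel (\<lambda>x. indicator {0..1} x * (p x - q x)\<^sup>2)" using i by (simp add: set_integrable_def)
      fix s :: real
      show "(\<eta> / 2)\<^sup>2 * indicator {a..a + l} s \<le> indicator {0..1} s * (p s - q s)\<^sup>2"
      proof (cases "s \<in> {a..a + l}")
        case True
        have "(\<eta> / 2)\<^sup>2 \<le> \<bar>p s - q s\<bar>\<^sup>2" using low[OF True] \<eta> by (intro power_mono) auto
        then show ?thesis using True a(1) by (auto simp: indicator_def)
      qed auto
    qed
    finally have "sqrt (l * (\<eta> / 2)\<^sup>2) \<le> L2_dist p q" by (simp only: L2_dist_def real_sqrt_le_iff)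
    then show False using d by simp
  qed
  then show ?thesis using l \<eta> by (intro exI[of _ "sqrt (l * (\<eta> / 2)\<^sup>2)"]) auto
qed

subsection \<open>Measurability of shapes and intensities\<close>

lemma space_shape_borel: "space (shape_borel T M L) = shape_space T M L"
  unfolding shape_borel_def by (rule space_measure_of) (auto simp: shape_open_def)

lemma sets_shape_borel: "sets (shape_borel T M L) = sigma_sets (shape_space T M L) {U. shape_open T M L U}"
  unfolding shape_borel_def by (rule sets_measure_of) (auto simp: shape_open_def)

text \<open>Point evaluations are continuous in the L2 metric on bi-Lipschitz functions, so their
  strict sublevel sets are open and belong to the generator.\<close>

lemma shape_quantile_measurable:
  assumes T: "0 < T" and L: "0 < L" and t: "t \<in> {0..1}"
  shows "(\<lambda>y. shape_quantile T y t) \<in> borel_measurable (shape_borel T M L)"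
proof (rule borel_measurable_iff_less[THEN iffD2], rule allI)
  fix a
  have "shape_open T M L {y \<in> shape_space T M L. shape_quantile T y t < a}"
    unfolding shape_open_def
  proof (intro conjI ballI)
    fix y assume "y \<in> {y \<in> shape_space T M L. shape_quantile T y t < a}"
    then have y: "y \<in> shape_space T M L" "0 < a - shape_quantile T y t" by auto
    obtain \<epsilon> where \<epsilon>: "\<epsilon> > 0" "\<And>p q. p \<in> quantile_set T M L \<Longrightarrow> q \<in> quantile_set T M L \<Longrightarrow> L2_dist p q < \<epsilon> \<Longrightarrow>
       \<bar>p t - q t\<bar> < a - shape_quantile T y t"
      using quantile_set_L2_pointwise[OF y(2) L, of T M] t by meson
    show "\<exists>\<epsilon>>0. \<forall>g\<in>shape_space T M L. shape_dist T y g < \<epsilon> \<longrightarrow> g \<in> {y \<in> shape_space T M L. shape_quantile T y t < a}"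
    proof (intro exI[of _ \<epsilon>] conjI ballI impI \<epsilon>(1))
      fix g assume g: "g \<in> shape_space T M L" "shape_dist T y g < \<epsilon>"
      have "\<bar>shape_quantile T y t - shape_quantile T g t\<bar> < a - shape_quantile T y t"
        using \<epsilon>(2) shape_space_dist(3)[OF y(1)] shape_space_dist(3)[OF g(1)] g(2) T unfolding shape_dist_def by simp
      then show "g \<in> {y \<in> shape_space T M L. shape_quantile T y t < a}" using g(1) by auto
    qed
  qed auto
  then show "{w \<in> space (shape_borel T M L). shape_quantile T w t < a} \<in> sets (shape_borel T M L)"
    unfolding space_shape_borel sets_shape_borel by (intro sigma_sets.Basic) auto
qed

text \<open>Moving t to the grid point below it costs at most L / J for each of the two functions,
  and each of the two sampled values is within 1 / J of the entry of r. This is the origin of 2 + 2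
  L.\<close>

lemma shape_ball_from_grid:
  fixes J :: nat
  assumes T: "0 < T" and M: "0 < M" and L: "0 < L" and J: "0 < J"
    and y: "y \<in> shape_space T M L" "\<And>j. j \<le> J \<Longrightarrow> \<bar>shape_quantile T y (j / J) - r ! j\<bar> \<le> 1 / J"
    and z: "z \<in> shape_space T M L" "\<And>j. j \<le> J \<Longrightarrow> \<bar>shape_quantile T z (j / J) - r ! j\<bar> \<le> 1 / J"
  shows "shape_dist T y z \<le> (2 + 2 * L) / J"
proof -
  let ?p = "shape_quantile T y" and ?q = "shape_quantile T z"
  have p: "?p \<in> quantile_set T M L" and q: "?q \<in> quantile_set T M L"
    using shape_space_dist(3) y(1) z(1) T by auto
  have c: "0 \<le> (2 + 2 * L) / J" using L by simp
  have pt: "\<bar>?p t - ?q t\<bar> \<le> (2 + 2 * L) / J" if t: "t \<in> {0..1}" for t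
  proof -
    define j where "j = nat \<lfloor>t * J\<rfloor>"
    have j0: "real j = of_int \<lfloor>t * J\<rfloor>" unfolding j_def using t by simp
    have tJ: "t * J \<le> J" using t by (simp add: mult_left_le_one_le)
    have j: "real j \<le> t * J" "t * J < real j + 1" unfolding j0 by linarith+
    have "j \<le> J" using j(1) tJ by linarith
    have s: "real j / J \<in> {0..1}" using \<open>j \<le> J\<close> J by (auto simp: field_simps)
    have "t - real j / J = (t * J - j) / J" using J by (simp add: field_simps)
    then have "\<bar>t - real j / J\<bar> \<le> 1 / J" using j J by (simp add: divide_right_mono)
    then have "L * \<bar>t - real j / J\<bar> \<le> L * (1 / J)" using L by (intro mult_left_mono) auto
    then have "\<bar>?p t - ?p (j / J)\<bar> \<le> L / J" "\<bar>?q t - ?q (j / J)\<bar> \<le> L / J"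
      using quantile_setD(3)[OF p t s] quantile_setD(3)[OF q t s] by auto
    then have "\<bar>?p t - ?q t\<bar> \<le> L / J + L / J + 1 / J + 1 / J"
      using y(2)[OF \<open>j \<le> J\<close>] z(2)[OF \<open>j \<le> J\<close>] by linarith
    then show ?thesis by (simp add: add_divide_distrib)
  qed
  have "(LBINT t:{0..1}. (?p t - ?q t)\<^sup>2) \<le> (LBINT t:{0..1::real}. ((2 + 2 * L) / J)\<^sup>2)"
  proof (rule set_integral_mono)
    show "set_integrable lborel {0..1} (\<lambda>t. (?p t - ?q t)\<^sup>2)"
      using quantile_set_measurable[OF p] quantile_set_measurable[OF q] by (blast intro: set_integrable_diff_sq)
    show "(?p t - ?q t)\<^sup>2 \<le> ((2 + 2 * L) / J)\<^sup>2" if "t \<in> {0..1}" for t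
      using power_mono[OF pt[OF that], of 2] by simp
  qed (auto simp: set_integrable_def)
  also have "\<dots> = ((2 + 2 * L) / J)\<^sup>2" by (simp add: set_lebesgue_integral_def)
  finally show ?thesis unfolding shape_dist_def L2_dist_def using c by (metis real_sqrt_le_iff real_sqrt_unique)
qed

text \<open>Every open set of shapes is a countable union of sets \<open>B J r\<close>, given by finitely many conditions on the
  values of the quantile function: the space is separable because quantile functions are Lipschitz.\<close>

lemma measurable_shape_borelI:
  assumes T: "0 < T" and M: "0 < M" and L: "0 < L"
    and Y: "\<And>\<omega>. \<omega> \<in> space P \<Longrightarrow> Y \<omega> \<in> shape_space T M L"
    and m: "\<And>t. t \<in> {0..1} \<Longrightarrow> (\<lambda>\<omega>. shape_quantile T (Y \<omega>) t) \<in> borel_measurable P"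
  shows "Y \<in> P \<rightarrow>\<^sub>M shape_borel T M L"
  unfolding shape_borel_def
proof (rule measurable_measure_of)
  fix U assume "U \<in> {U. shape_open T M L U}"
  then have U: "shape_open T M L U" by simp
  define B where "B J r = {y \<in> shape_space T M L. \<forall>j\<le>J. \<bar>shape_quantile T y (j / J) - real_of_rat (r ! j)\<bar> \<le> 1 / J}" for J :: nat and r :: "rat list"
  define I where "I = {(J, r). 0 < J \<and> B J r \<subseteq> U}"
  have "U \<subseteq> (\<Union>(J, r)\<in>I. B J r)"
  proof
    fix y assume y: "y \<in> U"
    then have ys: "y \<in> shape_space T M L" using U by (auto simp: shape_open_def)
    obtain \<epsilon> where \<epsilon>: "\<epsilon> > 0" "\<And>g. g \<in> shape_space T M L \<Longrightarrow> shape_dist T y g < \<epsilon> \<Longrightarrow> g \<in> U"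
      using U y unfolding shape_open_def by meson
    \<comment> \<open>The grid is made so fine that the cell around y, whose diameter
      \<open>shape_ball_from_grid\<close> controls, lies inside the ball of radius
      \<epsilon>.\<close>
    obtain J where J: "(2 + 2 * L) / \<epsilon> < real J" using reals_Archimedean2 by blast
    have J0: "0 < J" using J \<epsilon>(1) L by (intro Nat.gr0I) (auto simp: field_simps)
    have J1: "(2 + 2 * L) / J < \<epsilon>" using J J0 \<epsilon>(1) by (simp add: field_simps)
    have "\<exists>s::rat. \<bar>shape_quantile T y (j / J) - real_of_rat s\<bar> \<le> 1 / J" for j :: nat
    proof -
      obtain s where "shape_quantile T y (j / J) < real_of_rat s" "real_of_rat s < shape_quantile T y (j / J) + 1 / J"
        using of_rat_dense[of "shape_quantile T y (j / J)" "shape_quantile T y (j / J) + 1 / J"] J0 by auto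
      then show ?thesis by (intro exI[of _ s]) auto
    qed
    then obtain s where s: "\<And>j. \<bar>shape_quantile T y (real j / J) - real_of_rat (s j)\<bar> \<le> 1 / J" by metis
    define r where "r = map s [0..<Suc J]"
    have r: "r ! j = s j" if "j \<le> J" for j using that by (simp add: r_def del: upt_Suc)
    have yB: "y \<in> B J r" using ys s r by (simp add: B_def)
    moreover have "B J r \<subseteq> U"
    proof
      fix z assume z: "z \<in> B J r"
      have "shape_dist T y z \<le> (2 + 2 * L) / J"
        using yB z by (intro shape_ball_from_grid[OF T M L J0, of y "map real_of_rat r"]) (auto simp: B_def r_def simp del: upt_Suc)
      then show "z \<in> U" using \<epsilon>(2)[of z] J1 z by (auto simp: B_def)
    qed
    ultimately show "y \<in> (\<Union>(J, r)\<in>I. B J r)" using J0 by (auto simp: I_def)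
  qed
  then have eq: "U = (\<Union>(J, r)\<in>I. B J r)" by (auto simp: I_def)
  have "Y -` U \<inter> space P = (\<Union>i\<in>I. Y -` (case i of (J, r) \<Rightarrow> B J r) \<inter> space P)" unfolding eq by auto
  also have "\<dots> \<in> sets P"
  proof (rule sets.countable_UN'')
    show "countable I" by (rule countable_subset[OF subset_UNIV]) simp
    fix i assume "i \<in> I"
    obtain J r where i: "i = (J, r)" by (cases i)
    have J: "0 < J" using \<open>i \<in> I\<close> by (simp add: I_def i)
    have [measurable]: "(\<lambda>\<omega>. shape_quantile T (Y \<omega>) (j / J)) \<in> borel_measurable P" if "j \<in> {..J}" for j
      using that J by (intro m) (auto simp: field_simps)
    have "Y -` B J r \<inter> space P = {\<omega> \<in> space P. \<forall>j\<in>{..J}. \<bar>shape_quantile T (Y \<omega>) (j / J) - real_of_rat (r ! j)\<bar> \<le> 1 / J}"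
      using Y by (auto simp: B_def)
    also have "\<dots> \<in> sets P"
      by measurable
    finally show "Y -` (case i of (J, r) \<Rightarrow> B J r) \<inter> space P \<in> sets P" by (simp add: i)
  qed
  finally show "Y -` U \<inter> space P \<in> sets P" .
qed (use Y in \<open>auto simp: shape_open_def\<close>)

section \<open>Random intensities and their quantile functions\<close>

lemma space_intensity_algebra: "space (intensity_algebra T) = intensity_set T"
  unfolding intensity_algebra_def by (rule space_measure_of) auto

lemma intensity_integral_measurable:
  assumes "A \<in> sets borel" "A \<subseteq> {0..T}"
  shows "(\<lambda>g. LBINT t:A. g t) \<in> borel_measurable (intensity_algebra T)"
proof (rule borel_measurable_iff_le[THEN iffD2], rule allI)
  fix c
  have "{g \<in> intensity_set T. (LBINT t:A. g t) \<le> c} \<in> sigma_sets (intensity_set T)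
    {{g \<in> intensity_set T. (LBINT t:A. g t) \<le> c} | A c. A \<in> sets borel \<and> A \<subseteq> {0..T}}"
    using assms by (intro sigma_sets.Basic) blast
  moreover have "sets (intensity_algebra T) = sigma_sets (intensity_set T)
    {{g \<in> intensity_set T. (LBINT t:A. g t) \<le> c} | A c. A \<in> sets borel \<and> A \<subseteq> {0..T}}"
    unfolding intensity_algebra_def by (rule sets_measure_of) auto
  ultimately show "{w \<in> space (intensity_algebra T). (LBINT t:A. w t) \<le> c} \<in> sets (intensity_algebra T)"
    by (simp add: space_intensity_algebra)
qed

lemma intensity_factor_measurable [measurable]: "intensity_factor T \<in> borel_measurable (intensity_algebra T)"
  using intensity_integral_measurable[of "{0..T}" T] by (simp add: intensity_factor_def[abs_def])

lemma shape_distribution: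
  assumes g: "g \<in> intensity_set T" and pos: "0 < intensity_factor T g"
  shows "real_distribution (shape_measure T (shape T g))"
    and "u \<in> {0..T} \<Longrightarrow> cdf (shape_measure T (shape T g)) u = (LBINT t:{0..u}. g t) / intensity_factor T g"
    and "0 \<le> T \<Longrightarrow> cdf (shape_measure T (shape T g)) T = 1"
proof -
  have f: "set_integrable lborel {0..T} (shape T g)" "\<forall>t\<in>{0..T}. 0 \<le> shape T g t" "(LBINT t:{0..T}. shape T g t) = 1"
    using g pos by (auto simp: intensity_set_def shape_def intensity_factor_def)
  show "real_distribution (shape_measure T (shape T g))"
    "u \<in> {0..T} \<Longrightarrow> cdf (shape_measure T (shape T g)) u = (LBINT t:{0..u}. g t) / intensity_factor T g"
    "0 \<le> T \<Longrightarrow> cdf (shape_measure T (shape T g)) T = 1"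
    using shape_measure_distribution[OF f] by (auto simp: shape_def)
qed

text \<open>A copy of the random intensity has the required shape only almost surely; the value 0 for a vanishing
  factor and the truncation of \<open>t\<close> make this version jointly measurable on the whole space.\<close>

definition intensity_quantile :: "real \<Rightarrow> (real \<Rightarrow> real) \<Rightarrow> real \<Rightarrow> real" where
  "intensity_quantile T g t =
    (if 0 < intensity_factor T g then shape_quantile T (shape T g) (max 0 (min 1 t)) else 0)"

lemma intensity_quantile_bounds:
  assumes "g \<in> intensity_set T" "0 \<le> T"
  shows "intensity_quantile T g t \<in> {0..T}"
  using quantile_mem[OF shape_distribution(3)[OF assms(1)] assms(2)] assms(2)
  by (auto simp: intensity_quantile_def shape_quantile_def)

text \<open>By the Galois connection a sublevel set of the quantile is described by comparing t with
  the distribution function at one fixed point, a quotient of two integrals of g. Joint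
  measurability in (t, g) is then immediate.\<close>

lemma intensity_quantile_measurable:
  assumes T: "0 \<le> T"
  shows "(\<lambda>(t, g). intensity_quantile T g t) \<in> borel_measurable (borel \<Otimes>\<^sub>M intensity_algebra T)"
proof (rule borel_measurable_iff_le[THEN iffD2], rule allI)
  fix a :: real
  let ?S = "borel \<Otimes>\<^sub>M intensity_algebra T"
  \<comment> \<open>Quantiles never exceed T, and the evaluations in
    \<open>intensity_algebra\<close> concern subsets of [0, T] only.\<close>
  define b where "b = min a T"
  have [measurable]: "(\<lambda>g. LBINT t:{0..b}. g t) \<in> borel_measurable (intensity_algebra T)"
    by (intro intensity_integral_measurable) (auto simp: b_def)
  have sp: "space ?S = UNIV \<times> intensity_set T" by (simp add: space_pair_measure space_intensity_algebra)
  show "{z \<in> space ?S. (case z of (t, g) \<Rightarrow> intensity_quantile T g t) \<le> a} \<in> sets ?S"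
  proof (cases "0 \<le> a")
    case True
    have b: "b \<in> {0..T}" using True T by (auto simp: b_def)
    have "intensity_quantile T g t \<le> a \<longleftrightarrow> intensity_factor T g \<le> 0 \<or>
        max 0 (min 1 t) \<le> (LBINT t:{0..b}. g t) / intensity_factor T g" if g: "g \<in> intensity_set T" for g t
    proof (cases "0 < intensity_factor T g")
      case pos: True
      have "intensity_quantile T g t \<le> a \<longleftrightarrow> intensity_quantile T g t \<le> b"
        using intensity_quantile_bounds[OF g T, of t] by (auto simp: b_def)
      also have "\<dots> \<longleftrightarrow> max 0 (min 1 t) \<le> cdf (shape_measure T (shape T g)) b"
        using quantile_le_iff[OF shape_distribution(1)[OF g pos] shape_distribution(3)[OF g pos T] T _ b, of "max 0 (min 1 t)"] pos
        by (simp add: intensity_quantile_def shape_quantile_def)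
      finally show ?thesis using shape_distribution(2)[OF g pos b] pos by simp
    qed (use True in \<open>simp add: intensity_quantile_def\<close>)
    then have "{z \<in> space ?S. (case z of (t, g) \<Rightarrow> intensity_quantile T g t) \<le> a} =
       {z \<in> space ?S. intensity_factor T (snd z) \<le> 0 \<or> max 0 (min 1 (fst z)) \<le> (LBINT t:{0..b}. snd z t) / intensity_factor T (snd z)}"
      unfolding sp by auto
    also have "\<dots> \<in> sets ?S" by measurable
    finally show ?thesis .
  next
    case False
    have "\<not> intensity_quantile T g t \<le> a" if "g \<in> intensity_set T" for g t
      using intensity_quantile_bounds[OF that T, of t] False by auto
    then have "{z \<in> space ?S. (case z of (t, g) \<Rightarrow> intensity_quantile T g t) \<le> a} = {}"
      unfolding sp by auto
    then show ?thesis by (simp only: sets.empty_sets)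
  qed
qed
subsection \<open>Conditional Poisson counts and averages of independent copies\<close>

lemma (in prob_space) subalgebra_sigma_finite:
  assumes "subalgebra M F"
  shows "sigma_finite_subalgebra M F"
proof -
  interpret finite_measure_subalgebra M F
    using assms by (intro finite_measure_subalgebra.intro finite_measure_axioms finite_measure_subalgebra_axioms.intro)
  show ?thesis ..
qed

text \<open>\<open>real_cond_exp\<close> is the difference of the real parts of two nonnegative
  conditional expectations. For an indicator the negative one vanishes and the positive one is at
  most 1, so no infinite value is lost, and the formula lifts to all nonnegative H.\<close>

lemma (in prob_space) nn_integral_cond_prob:
  assumes F: "subalgebra M F" and A: "A \<in> sets M"
    and p: "AE \<omega> in M. real_cond_exp M F (indicat_real A) \<omega> = p \<omega>"
    and H: "H \<in> borel_measurable F"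
  shows "(\<integral>\<^sup>+\<omega>. H \<omega> * indicator A \<omega> \<partial>M) = (\<integral>\<^sup>+\<omega>. H \<omega> * ennreal (p \<omega>) \<partial>M)"
proof -
  interpret sigma_finite_subalgebra M F using F by (rule subalgebra_sigma_finite)
  have z: "AE \<omega> in M. 0 = nn_cond_exp M F (\<lambda>_. 0) \<omega>" by (rule nn_cond_exp_F_meas) simp
  have o: "AE \<omega> in M. 1 = nn_cond_exp M F (\<lambda>_. 1) \<omega>" by (rule nn_cond_exp_F_meas) simp
  have le: "AE \<omega> in M. nn_cond_exp M F (\<lambda>\<omega>. ennreal (indicat_real A \<omega>)) \<omega> \<le> nn_cond_exp M F (\<lambda>_. 1) \<omega>"
    using A by (intro nn_cond_exp_mono AE_I2) (auto simp: indicator_def)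
  have neg: "(\<lambda>\<omega>. ennreal (- indicat_real A \<omega>)) = (\<lambda>_. 0)" by (auto simp: fun_eq_iff indicator_def ennreal_neg)
  have "AE \<omega> in M. nn_cond_exp M F (\<lambda>\<omega>. ennreal (indicat_real A \<omega>)) \<omega> = ennreal (p \<omega>)"
    using z o le p
  proof eventually_elim
    case (elim \<omega>)
    then have "nn_cond_exp M F (\<lambda>\<omega>. ennreal (indicat_real A \<omega>)) \<omega> < \<top>"
      by (simp add: le_less_trans[OF _ ennreal_one_less_top])
    then have "ennreal (enn2real (nn_cond_exp M F (\<lambda>\<omega>. ennreal (indicat_real A \<omega>)) \<omega>))
       = nn_cond_exp M F (\<lambda>\<omega>. ennreal (indicat_real A \<omega>)) \<omega>" by (rule ennreal_enn2real)
    then show ?case using elim(1,4) unfolding real_cond_exp_def neg by simp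
  qed
  then have "(\<integral>\<^sup>+\<omega>. H \<omega> * ennreal (p \<omega>) \<partial>M) = (\<integral>\<^sup>+\<omega>. H \<omega> * nn_cond_exp M F (\<lambda>\<omega>. ennreal (indicat_real A \<omega>)) \<omega> \<partial>M)"
    by (intro nn_integral_cong_AE) auto
  also have "\<dots> = (\<integral>\<^sup>+\<omega>. H \<omega> * ennreal (indicat_real A \<omega>) \<partial>M)"
    using H A by (intro nn_cond_exp_intg) auto
  finally show ?thesis by (simp add: ennreal_indicator)
qed

text \<open>\<open>(k - r)\<^sup>2 = k (k - 1) + (1 - 2 r) k + r\<^sup>2\<close>, and the factorial
  moments are shifts of the exponential series.\<close>

lemma poisson_prob_second_moment:
  assumes r: "0 \<le> r"
  shows "(\<lambda>k. (real k - r)\<^sup>2 * poisson_prob r k) sums r"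
proof -
  define e where "e = exp (- r)"
  have s0: "(\<lambda>k. r ^ k / fact k) sums exp r"
    using exp_converges[of r] by (simp add: divide_inverse mult.commute)
  have s1: "(\<lambda>k. real k * (r ^ k / fact k)) sums (r * exp r)"
  proof -
    have "(\<lambda>k. r * (r ^ k / fact k)) sums (r * exp r)" by (intro sums_mult s0)
    also have "(\<lambda>k. r * (r ^ k / fact k)) = (\<lambda>k. real (Suc k) * (r ^ Suc k / fact (Suc k)))"
      by (simp add: fun_eq_iff del: of_nat_Suc)
    finally show ?thesis by (subst (asm) sums_Suc_iff) simp
  qed
  have s2: "(\<lambda>k. real k * (real k - 1) * (r ^ k / fact k)) sums (r\<^sup>2 * exp r)"
  proof -
    have "(\<lambda>k. r * (real k * (r ^ k / fact k))) sums (r * (r * exp r))" by (intro sums_mult s1)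
    also have "(\<lambda>k. r * (real k * (r ^ k / fact k))) = (\<lambda>k. real (Suc k) * (real (Suc k) - 1) * (r ^ Suc k / fact (Suc k)))"
      by (simp add: fun_eq_iff del: of_nat_Suc)
    finally show ?thesis by (subst (asm) sums_Suc_iff) (simp add: power2_eq_square mult.assoc)
  qed
  have "(\<lambda>k. e * (real k * (real k - 1) * (r ^ k / fact k) + (1 - 2 * r) * (real k * (r ^ k / fact k)) + r\<^sup>2 * (r ^ k / fact k)))
      sums (e * (r\<^sup>2 * exp r + (1 - 2 * r) * (r * exp r) + r\<^sup>2 * exp r))"
    by (intro sums_mult sums_add s0 s1 s2)
  moreover have "e * (r\<^sup>2 * exp r + (1 - 2 * r) * (r * exp r) + r\<^sup>2 * exp r) = r * (e * exp r)"
    by (simp add: algebra_simps power2_eq_square)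
  moreover have "e * exp r = 1" by (simp add: e_def exp_minus)
  moreover have "e * (real k * (real k - 1) * (r ^ k / fact k) + (1 - 2 * r) * (real k * (r ^ k / fact k)) + r\<^sup>2 * (r ^ k / fact k))
     = (real k - r)\<^sup>2 * poisson_prob r k" for k
  proof -
    have "real k * (real k - 1) * z + (1 - 2 * r) * (real k * z) + r\<^sup>2 * z = (real k - r)\<^sup>2 * z" for z
      by (simp add: power2_eq_square algebra_simps)
    from this[of "r ^ k / fact k"] show ?thesis by (simp only: poisson_prob_def e_def mult_ac)
  qed
  ultimately show ?thesis by simp
qed

lemma poisson_prob_nonneg: "0 \<le> r \<Longrightarrow> 0 \<le> poisson_prob r k"
  by (simp add: poisson_prob_def)

text \<open>Conditionally on F the count in B is Poisson, so its conditional variance equals its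
  conditional mean. The integral is split by the value k of the count, whose conditional probability
  the model supplies, and the Poisson series is summed. The F-measurable factor W is there to carry
  kernel weights.\<close>

lemma (in prob_space) cond_poisson_second_moment:
  assumes F: "subalgebra M F" and pois: "cond_poisson_processes M F T I \<Lambda> N"
    and I: "finite I" "i \<in> I" and B: "B \<in> sets borel" "B \<subseteq> {0..T}"
    and W: "W \<in> borel_measurable F" and m: "(\<lambda>\<omega>. LBINT t:B. \<Lambda> i \<omega> t) \<in> borel_measurable F"
    and nn: "\<And>\<omega>. \<omega> \<in> space M \<Longrightarrow> 0 \<le> (LBINT t:B. \<Lambda> i \<omega> t)"
  shows "(\<integral>\<^sup>+\<omega>. W \<omega> * ennreal ((real (num_points (N i \<omega>) B) - (LBINT t:B. \<Lambda> i \<omega> t))\<^sup>2) \<partial>M)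
    = (\<integral>\<^sup>+\<omega>. W \<omega> * ennreal (LBINT t:B. \<Lambda> i \<omega> t) \<partial>M)"
proof -
  let ?l = "\<lambda>\<omega>. LBINT t:B. \<Lambda> i \<omega> t"
  let ?n = "\<lambda>\<omega>. num_points (N i \<omega>) B"
  define A where "A k = {\<omega>\<in>space M. ?n \<omega> = k}" for k
  have lM: "?l \<in> borel_measurable M" and WM: "W \<in> borel_measurable M"
    using m W measurable_from_subalg[OF F] by auto
  have nM: "?n \<in> M \<rightarrow>\<^sub>M count_space UNIV"
    using pois I(2) B(1) by (auto simp: cond_poisson_processes_def)
  have A: "A k \<in> sets M" for k unfolding A_def using nM by measurable
  note [measurable] = WM lM A
  have cond: "AE \<omega> in M. real_cond_exp M F (indicat_real (A k)) \<omega> = poisson_prob (?l \<omega>) k" for k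
  proof -
    \<comment> \<open>The model prescribes the joint counts of all processes. Giving every other
      process the empty set and the count 0 makes its condition vacuous and its factor
      \<open>poisson_prob 0 0\<close>, which is 1 because 0 ^ 0 = 1.\<close>
    define B' where "B' i' (j::nat) = (if i' = i then B else {})" for i' j
    define k' where "k' i' (j::nat) = (if i' = i then k else 0)" for i' j
    have "\<forall>i\<in>I. disjoint_family_on (B' i) {..<1::nat} \<and> (\<forall>j<1. B' i j \<in> sets borel \<and> B' i j \<subseteq> {0..T})"
      using B by (auto simp: B'_def disjoint_family_on_def)
    then have *: "AE \<omega> in M. real_cond_exp M F
        (indicat_real {\<omega>\<in>space M. \<forall>i\<in>I. \<forall>j<1. num_points (N i \<omega>) (B' i j) = k' i j}) \<omega>
        = (\<Prod>i\<in>I. \<Prod>j<1. poisson_prob (LBINT t:B' i j. \<Lambda> i \<omega> t) (k' i j))"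
      using pois unfolding cond_poisson_processes_def by blast
    have 1: "{\<omega>\<in>space M. \<forall>i\<in>I. \<forall>j<1. num_points (N i \<omega>) (B' i j) = k' i j} = A k"
      using I(2) by (auto simp: A_def B'_def k'_def num_points_def)
    have 2: "(\<Prod>i\<in>I. \<Prod>j<1. poisson_prob (LBINT t:B' i j. \<Lambda> i \<omega> t) (k' i j)) = poisson_prob (?l \<omega>) k" for \<omega>
    proof -
      have "(\<Prod>j<1. poisson_prob (LBINT t:B' i' j. \<Lambda> i' \<omega> t) (k' i' j)) = (if i' = i then poisson_prob (?l \<omega>) k else 1)" for i'
        by (simp add: B'_def k'_def set_lebesgue_integral_def poisson_prob_def lessThan_Suc)
      then show ?thesis using I by simp
    qed
    show ?thesis using * unfolding 1 2 .
  qed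
  have "(\<integral>\<^sup>+\<omega>. W \<omega> * ennreal ((real (?n \<omega>) - ?l \<omega>)\<^sup>2) \<partial>M)
     = (\<integral>\<^sup>+\<omega>. (\<Sum>k. (W \<omega> * ennreal ((real k - ?l \<omega>)\<^sup>2)) * indicator (A k) \<omega>) \<partial>M)"
  proof (intro nn_integral_cong)
    fix \<omega> assume "\<omega> \<in> space M"
    then have "(\<lambda>k. (W \<omega> * ennreal ((real k - ?l \<omega>)\<^sup>2)) * indicator (A k) \<omega>)
      = (\<lambda>k. if k = ?n \<omega> then W \<omega> * ennreal ((real (?n \<omega>) - ?l \<omega>)\<^sup>2) else 0)"
      by (auto simp: A_def fun_eq_iff)
    then show "W \<omega> * ennreal ((real (?n \<omega>) - ?l \<omega>)\<^sup>2) = (\<Sum>k. (W \<omega> * ennreal ((real k - ?l \<omega>)\<^sup>2)) * indicator (A k) \<omega>)"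
      using sums_single[of "?n \<omega>" "\<lambda>_. W \<omega> * ennreal ((real (?n \<omega>) - ?l \<omega>)\<^sup>2)"] by (simp add: sums_iff)
  qed
  also have "\<dots> = (\<Sum>k. \<integral>\<^sup>+\<omega>. (W \<omega> * ennreal ((real k - ?l \<omega>)\<^sup>2)) * indicator (A k) \<omega> \<partial>M)"
    by (intro nn_integral_suminf) measurable
  also have "\<dots> = (\<Sum>k. \<integral>\<^sup>+\<omega>. (W \<omega> * ennreal ((real k - ?l \<omega>)\<^sup>2)) * ennreal (poisson_prob (?l \<omega>) k) \<partial>M)"
  proof (intro suminf_cong nn_integral_cond_prob[OF F A cond])
    fix k :: nat
    note [measurable del] = WM lM and [measurable] = W m
    show "(\<lambda>\<omega>. W \<omega> * ennreal ((real k - ?l \<omega>)\<^sup>2)) \<in> borel_measurable F" by measurable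
  qed
  also have "\<dots> = (\<integral>\<^sup>+\<omega>. (\<Sum>k. (W \<omega> * ennreal ((real k - ?l \<omega>)\<^sup>2)) * ennreal (poisson_prob (?l \<omega>) k)) \<partial>M)"
    unfolding poisson_prob_def by (intro nn_integral_suminf[symmetric]) measurable
  also have "\<dots> = (\<integral>\<^sup>+\<omega>. W \<omega> * ennreal (?l \<omega>) \<partial>M)"
  proof (intro nn_integral_cong)
    fix \<omega> assume w: "\<omega> \<in> space M"
    have "(\<Sum>k. (W \<omega> * ennreal ((real k - ?l \<omega>)\<^sup>2)) * ennreal (poisson_prob (?l \<omega>) k))
      = (\<Sum>k. W \<omega> * ennreal ((real k - ?l \<omega>)\<^sup>2 * poisson_prob (?l \<omega>) k))"
      using poisson_prob_nonneg[OF nn[OF w]] by (intro suminf_cong) (simp add: ennreal_mult mult.assoc)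
    also have "\<dots> = W \<omega> * (\<Sum>k. ennreal ((real k - ?l \<omega>)\<^sup>2 * poisson_prob (?l \<omega>) k))"
      by (rule ennreal_suminf_cmult)
    also have "(\<Sum>k. ennreal ((real k - ?l \<omega>)\<^sup>2 * poisson_prob (?l \<omega>) k)) = ennreal (?l \<omega>)"
      using poisson_prob_second_moment[OF nn[OF w]] poisson_prob_nonneg[OF nn[OF w]]
      by (subst suminf_ennreal2) (auto simp: sums_iff)
    finally show "(\<Sum>k. (W \<omega> * ennreal ((real k - ?l \<omega>)\<^sup>2)) * ennreal (poisson_prob (?l \<omega>) k)) = W \<omega> * ennreal (?l \<omega>)" .
  qed
  finally show ?thesis .
qed

text \<open>Expanding the square gives n diagonal terms with the second moment and off-diagonal
  terms that factor into the squared mean by independence. Squared bias and variance are thus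
  bounded in one estimate.\<close>

lemma (in prob_space) iid_mean_square:
  fixes \<phi> :: "'b \<Rightarrow> real"
  assumes ind: "indep_vars (\<lambda>_. S) Z {1::nat..}"
    and distr: "\<And>i. i \<ge> 1 \<Longrightarrow> distr M S (Z i) = distr M S Z0" and Z0: "Z0 \<in> M \<rightarrow>\<^sub>M S"
    and \<phi>: "\<phi> \<in> borel_measurable S" and sq: "integrable M (\<lambda>\<omega>. (\<phi> (Z0 \<omega>))\<^sup>2)" and n: "1 \<le> n"
  shows "integrable M (\<lambda>\<omega>. ((\<Sum>i=1..n. \<phi> (Z i \<omega>)) / real n)\<^sup>2)"
    and "expectation (\<lambda>\<omega>. ((\<Sum>i=1..n. \<phi> (Z i \<omega>)) / real n)\<^sup>2)
      \<le> (expectation (\<lambda>\<omega>. \<phi> (Z0 \<omega>)))\<^sup>2 + expectation (\<lambda>\<omega>. (\<phi> (Z0 \<omega>))\<^sup>2) / real n"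
proof -
  define Y where "Y i \<omega> = \<phi> (Z i \<omega>)" for i \<omega>
  define a where "a = expectation (\<lambda>\<omega>. \<phi> (Z0 \<omega>))"
  define v where "v = expectation (\<lambda>\<omega>. (\<phi> (Z0 \<omega>))\<^sup>2)"
  have Zm: "Z i \<in> M \<rightarrow>\<^sub>M S" if "i \<ge> 1" for i using ind that by (auto simp: indep_vars_def)
  have Ym: "Y i \<in> borel_measurable M" if "i \<ge> 1" for i
    unfolding Y_def using measurable_compose[OF Zm[OF that] \<phi>] by simp
  have indY: "indep_vars (\<lambda>_. borel) Y {1..}"
    using indep_vars_compose2[OF ind, of "\<lambda>_. \<phi>" "\<lambda>_. borel"] \<phi> by (simp add: Y_def[abs_def])
  have i0: "integrable M (\<lambda>\<omega>. \<phi> (Z0 \<omega>))"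
    using square_integrable_imp_integrable[OF measurable_compose[OF Z0 \<phi>] sq] .
  have tr_int: "integrable M (\<lambda>\<omega>. \<psi> (Z i \<omega>)) \<longleftrightarrow> integrable M (\<lambda>\<omega>. \<psi> (Z0 \<omega>))"
    and tr_E: "expectation (\<lambda>\<omega>. \<psi> (Z i \<omega>)) = expectation (\<lambda>\<omega>. \<psi> (Z0 \<omega>))"
    if "i \<ge> 1" "\<psi> \<in> borel_measurable S" for i and \<psi> :: "'b \<Rightarrow> real"
    using integrable_distr_eq[OF Zm[OF that(1)] that(2)] integrable_distr_eq[OF Z0 that(2)]
      integral_distr[OF Zm[OF that(1)] that(2)] integral_distr[OF Z0 that(2)] distr[OF that(1)] by simp_all
  have \<phi>2: "(\<lambda>z. (\<phi> z)\<^sup>2) \<in> borel_measurable S" using \<phi> by simp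
  have Yi: "integrable M (Y i)" and YE: "expectation (Y i) = a" if "i \<ge> 1" for i
    using tr_int[OF that \<phi>] tr_E[OF that \<phi>] i0 by (simp_all add: Y_def[abs_def] a_def)
  have prod: "integrable M (\<lambda>\<omega>. Y i \<omega> * Y j \<omega>) \<and>
     expectation (\<lambda>\<omega>. Y i \<omega> * Y j \<omega>) = (if i = j then v else a\<^sup>2)" if ij: "i \<ge> 1" "j \<ge> 1" for i j
  proof (cases "i = j")
    case True
    then show ?thesis using tr_int[OF ij(1) \<phi>2] tr_E[OF ij(1) \<phi>2] sq
      by (simp add: Y_def v_def power2_eq_square)
  next
    case False
    have sub: "indep_vars (\<lambda>_. borel) Y {i, j}" using indep_vars_subset[OF indY, of "{i,j}"] ij by auto
    have int: "integrable M (Y k)" if "k \<in> {i, j}" for k using Yi ij that by auto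
    show ?thesis
      using indep_vars_lebesgue_integral[OF _ sub int] indep_vars_integrable[OF _ sub int] False YE ij
      by (simp add: power2_eq_square)
  qed
  have sq_eq: "((\<Sum>i=1..n. \<phi> (Z i \<omega>)) / real n)\<^sup>2 = (\<Sum>i=1..n. \<Sum>j=1..n. Y i \<omega> * Y j \<omega>) / (real n)\<^sup>2" for \<omega>
    by (simp add: Y_def power_divide power2_eq_square sum_product)
  have int_sum: "integrable M (\<lambda>\<omega>. \<Sum>i=1..n. \<Sum>j=1..n. Y i \<omega> * Y j \<omega>)"
    using prod by (intro Bochner_Integration.integrable_sum) auto
  then show "integrable M (\<lambda>\<omega>. ((\<Sum>i=1..n. \<phi> (Z i \<omega>)) / real n)\<^sup>2)" unfolding sq_eq by simp
  have v0: "0 \<le> v" unfolding v_def by simp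
  have "expectation (\<lambda>\<omega>. \<Sum>i=1..n. \<Sum>j=1..n. Y i \<omega> * Y j \<omega>) = (\<Sum>i=1..n. \<Sum>j=1..n. if i = j then v else a\<^sup>2)"
    using prod by (subst Bochner_Integration.integral_sum) (auto intro!: sum.cong Bochner_Integration.integrable_sum simp: Bochner_Integration.integral_sum)
  \<comment> \<open>Counting the squared mean on the diagonal as well only enlarges the sum and
    avoids the factor n (n - 1).\<close>
  also have "\<dots> \<le> (\<Sum>i=1..n. \<Sum>j=1..n. (if i = j then v else 0) + a\<^sup>2)"
    using v0 by (intro sum_mono) auto
  also have "\<dots> = real n * v + (real n)\<^sup>2 * a\<^sup>2"
    by (simp add: sum.distrib power2_eq_square algebra_simps)
  finally have "expectation (\<lambda>\<omega>. ((\<Sum>i=1..n. \<phi> (Z i \<omega>)) / real n)\<^sup>2) \<le> (real n * v + (real n)\<^sup>2 * a\<^sup>2) / (real n)\<^sup>2"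
    unfolding sq_eq by (simp add: divide_right_mono)
  also have "\<dots> = a\<^sup>2 + v / real n" using n by (simp add: field_simps power2_eq_square)
  finally show "expectation (\<lambda>\<omega>. ((\<Sum>i=1..n. \<phi> (Z i \<omega>)) / real n)\<^sup>2)
      \<le> (expectation (\<lambda>\<omega>. \<phi> (Z0 \<omega>)))\<^sup>2 + expectation (\<lambda>\<omega>. (\<phi> (Z0 \<omega>))\<^sup>2) / real n"
    by (simp add: a_def v_def)
qed
subsection \<open>Smooth conditional densities\<close>

lemma twice_cont_diffD:
  assumes "twice_cont_diff g"
  shows "(g has_real_derivative deriv g u) (at u)"
    and "(deriv g has_real_derivative deriv (deriv g) u) (at u)"
    and "isCont g u" "isCont (deriv g) u" "isCont (deriv (deriv g)) u" "g \<in> borel_measurable borel"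
proof -
  have *: "g differentiable at u" "deriv g differentiable at u" for u
    using assms by (auto simp: twice_cont_diff_def differentiable_on_def)
  show g: "(g has_real_derivative deriv g u) (at u)" for u
    using *[of u] by (metis DERIV_imp_deriv real_differentiable_def)
  show g': "(deriv g has_real_derivative deriv (deriv g) u) (at u)"
    using *[of u] by (metis DERIV_imp_deriv real_differentiable_def)
  show "isCont g u" for u using g DERIV_isCont by blast
  show "isCont (deriv g) u" using g' DERIV_isCont by blast
  show "isCont (deriv (deriv g)) u"
    using assms by (simp add: twice_cont_diff_def continuous_on_eq_continuous_at)
  show "g \<in> borel_measurable borel"
    using g DERIV_isCont by (intro borel_measurable_continuous_onI continuous_at_imp_continuous_on) blast
qed

text \<open>Two applications of the mean value theorem, to g and to its derivative, give the
  quadratic order; the constant C instead of C / 2 is immaterial for rates.\<close>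

lemma taylor_remainder_bound:
  assumes g: "twice_cont_diff g" and C: "\<And>v. \<bar>v - x\<bar> \<le> \<bar>u - x\<bar> \<Longrightarrow> \<bar>deriv (deriv g) v\<bar> \<le> C"
  shows "\<bar>g u - g x - deriv g x * (u - x)\<bar> \<le> C * (u - x)\<^sup>2"
proof (cases "u = x")
  case False
  have mvt: "\<exists>z. \<bar>z - a\<bar> \<le> \<bar>b - a\<bar> \<and> h b - h a = deriv h z * (b - a)"
    if D: "\<And>z. (h has_real_derivative deriv h z) (at z)" for h :: "real \<Rightarrow> real" and a b
  proof (cases a b rule: linorder_cases)
    case less
    then obtain z where z: "a < z" "z < b" "h b - h a = (b - a) * deriv h z" using MVT2[OF less D] by blast
    then have "h b - h a = deriv h z * (b - a)" by (simp only: mult.commute)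
    then show ?thesis using z(1,2) by (intro exI[of _ z]) simp
  next
    case greater
    then obtain z where z: "b < z" "z < a" "h a - h b = (a - b) * deriv h z" using MVT2[OF greater D] by blast
    have "h b - h a = - (h a - h b)" "deriv h z * (b - a) = - ((a - b) * deriv h z)" by (simp_all add: algebra_simps)
    then have "h b - h a = deriv h z * (b - a)" using z(3) by simp
    then show ?thesis using z(1,2) by (intro exI[of _ z]) simp
  qed auto
  obtain z where z: "\<bar>z - x\<bar> \<le> \<bar>u - x\<bar>" "g u - g x = deriv g z * (u - x)"
    using mvt[OF twice_cont_diffD(1)[OF g]] by blast
  obtain w where w: "\<bar>w - x\<bar> \<le> \<bar>z - x\<bar>" "deriv g z - deriv g x = deriv (deriv g) w * (z - x)"
    using mvt[OF twice_cont_diffD(2)[OF g]] by blast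
  have "g u - g x - deriv g x * (u - x) = (deriv g z - deriv g x) * (u - x)" using z(2) by (simp add: left_diff_distrib)
  then have "\<bar>g u - g x - deriv g x * (u - x)\<bar> = \<bar>deriv (deriv g) w\<bar> * \<bar>z - x\<bar> * \<bar>u - x\<bar>"
    using w(2) by (simp add: abs_mult)
  also have "\<dots> \<le> C * \<bar>u - x\<bar> * \<bar>u - x\<bar>"
    using C[of w] w(1) z(1) by (intro mult_right_mono mult_mono) auto
  finally show ?thesis by (simp add: power2_eq_square)
qed (simp add: C)

text \<open>A density with bounded second derivative cannot be large anywhere: its mass near a high or
  steep point would exceed 1.\<close>

lemma smooth_density_bound:
  fixes g :: "real \<Rightarrow> real"
  assumes g: "twice_cont_diff g" "\<And>u. 0 \<le> g u" and C: "\<And>u. \<bar>deriv (deriv g) u\<bar> \<le> C"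
    and one: "emeasure (density lborel (\<lambda>u. ennreal (g u))) UNIV = 1"
  shows "g u + \<bar>deriv g u\<bar> / 2 \<le> 2 + C"
proof (rule ccontr)
  assume neg: "\<not> ?thesis"
  define c where "c = g u + \<bar>deriv g u\<bar> / 2 - C"
  have c: "2 < c" using neg by (simp add: c_def)
  \<comment> \<open>A has length 1/2, lies at distance between 1/2 and 1 from u, and is on the side
    where the linear Taylor term is nonnegative. There this term gains at least half the absolute
    slope while the remainder loses at most C, so g \<ge> c on A and the mass c / 2 exceeds
    1.\<close>
  define A where "A = (if 0 \<le> deriv g u then {u + 1/2..u + 1} else {u - 1..u - 1/2})"
  have C0: "0 \<le> C" using C[of 0] by linarith
  have low: "c \<le> g v" if v: "v \<in> A" for v
  proof -
    have r: "\<bar>v - u\<bar> \<le> 1" "\<bar>deriv g u\<bar> / 2 \<le> deriv g u * (v - u)"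
    proof -
      show "\<bar>v - u\<bar> \<le> 1" using v by (auto simp: A_def split: if_splits)
      show "\<bar>deriv g u\<bar> / 2 \<le> deriv g u * (v - u)"
      proof (cases "0 \<le> deriv g u")
        case True
        then have "deriv g u * (1/2) \<le> deriv g u * (v - u)" using v by (intro mult_left_mono) (auto simp: A_def)
        then show ?thesis using True by simp
      next
        case False
        then have "- deriv g u * (1/2) \<le> - deriv g u * (u - v)" using v by (intro mult_left_mono) (auto simp: A_def)
        then show ?thesis using False by (simp add: algebra_simps)
      qed
    qed
    have "C * (v - u)\<^sup>2 \<le> C * 1" using r(1) C0 by (intro mult_left_mono) (auto simp: power2_le_iff_abs_le abs_square_le_1)
    then show ?thesis using taylor_remainder_bound[OF g(1), where u = v and x = u and C = C] C r(2) unfolding c_def by force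
  qed
  have m[measurable]: "g \<in> borel_measurable borel" by (rule twice_cont_diffD(6)[OF g(1)])
  have A: "emeasure lborel A = ennreal (1/2)" "A \<in> sets borel" by (auto simp: A_def emeasure_lborel_Icc_eq)
  have "ennreal (c * (1/2)) = ennreal c * emeasure lborel A"
    unfolding A(1) using c by (intro ennreal_mult) auto
  also have "\<dots> = (\<integral>\<^sup>+v. ennreal c * indicator A v \<partial>lborel)"
    using A by (subst nn_integral_cmult_indicator) auto
  also have "\<dots> \<le> (\<integral>\<^sup>+v. ennreal (g v) * indicator UNIV v \<partial>lborel)"
    using low by (intro nn_integral_mono) (auto simp: indicator_def intro!: ennreal_leI)
  also have "\<dots> = 1" using one by (subst (asm) emeasure_density) auto
  finally show False using c by (simp add: ennreal_le_1)
qed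

text \<open>Rounding u down to a multiple of 1 / (k + 1) leaves countably many values, for which
  joint measurability is clear; continuity in u recovers h as the limit.\<close>

lemma borel_measurable_caratheodory:
  fixes h :: "'b \<Rightarrow> real \<Rightarrow> real"
  assumes m: "\<And>u. (\<lambda>y. h y u) \<in> borel_measurable R" and c: "\<And>y u. y \<in> space R \<Longrightarrow> isCont (h y) u"
  shows "(\<lambda>(y, u). h y u) \<in> borel_measurable (R \<Otimes>\<^sub>M borel)"
proof (rule borel_measurable_LIMSEQ_real)
  define s where "s k u = of_int \<lfloor>u * real (Suc k)\<rfloor> / real (Suc k)" for k and u :: real
  have s: "(\<lambda>k. s k u) \<longlonglongrightarrow> u" for u
  proof (rule LIMSEQ_I)
    fix e :: real assume "0 < e"
    then obtain n where n: "1 / real (Suc n) < e" using nat_approx_posE by blast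
    have "norm (s k u - u) < e" if "k \<ge> n" for k
    proof -
      have "s k u - u = (of_int \<lfloor>u * real (Suc k)\<rfloor> - u * real (Suc k)) / real (Suc k)"
        unfolding s_def by (simp add: diff_divide_distrib del: of_nat_Suc)
      also have "\<bar>\<dots>\<bar> \<le> 1 / real (Suc k)"
        unfolding abs_divide by (intro divide_mono) (linarith | simp)+
      also have "\<dots> \<le> 1 / real (Suc n)" using that by (intro divide_left_mono) auto
      finally show ?thesis using n by simp
    qed
    then show "\<exists>no. \<forall>k\<ge>no. norm (s k u - u) < e" by blast
  qed
  show "(\<lambda>k. case z of (y, u) \<Rightarrow> h y (s k u)) \<longlonglongrightarrow> (case z of (y, u) \<Rightarrow> h y u)" if "z \<in> space (R \<Otimes>\<^sub>M borel)" for z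
    using that c by (auto simp: space_pair_measure intro!: isCont_tendsto_compose[OF _ s])
  show "(\<lambda>z. case z of (y, u) \<Rightarrow> h y (s k u)) \<in> borel_measurable (R \<Otimes>\<^sub>M borel)" for k
  proof -
    have "(\<lambda>z. h (fst z) (of_int i / real (Suc k))) \<in> borel_measurable (R \<Otimes>\<^sub>M borel)" for i
      by (rule measurable_compose[OF measurable_fst m])
    moreover have "(\<lambda>z::'b \<times> real. \<lfloor>snd z * real (Suc k)\<rfloor>) \<in> R \<Otimes>\<^sub>M borel \<rightarrow>\<^sub>M count_space UNIV"
      by measurable
    ultimately have "(\<lambda>z. h (fst z) (of_int \<lfloor>snd z * real (Suc k)\<rfloor> / real (Suc k))) \<in> borel_measurable (R \<Otimes>\<^sub>M borel)"
      by (rule measurable_compose_countable)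
    then show ?thesis unfolding s_def split_beta' .
  qed
qed

text \<open>A difference at x would persist on an interval around x, which is not a null set. This
  is the means of passing from almost every covariate value to the fixed one.\<close>

lemma AE_eq_imp_eq_at_continuity:
  fixes p q :: "real \<Rightarrow> real"
  assumes ae: "AE u in lborel. p u = q u" and c: "isCont p x" "isCont q x"
  shows "p x = q x"
proof (rule ccontr)
  assume ne: "p x \<noteq> q x"
  define w where "w u = \<bar>p u - q u\<bar>" for u
  have "isCont w x" unfolding w_def by (intro continuous_intros c)
  then have "(w \<longlongrightarrow> w x) (nhds x)" by (simp only: tendsto_at_iff_tendsto_nhds isCont_def)
  then have "eventually (\<lambda>u. 0 < w u) (nhds x)" by (rule order_tendstoD(1)) (simp add: w_def ne)
  then obtain d where d: "0 < d" "\<And>u. dist u x < d \<Longrightarrow> 0 < w u" unfolding eventually_nhds_metric by blast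
  have "AE u in lborel. u \<notin> {x - d<..<x + d}" using ae
  proof eventually_elim
    case (elim u) then show ?case using d(2)[of u] by (auto simp: dist_real_def w_def abs_less_iff)
  qed
  then have "{x - d<..<x + d} \<in> null_sets lborel" by (subst AE_iff_null_sets) auto
  then show False using d(1) by (auto simp: null_sets_def)
qed

text \<open>The value space R of f stays abstract: the argument by Bayes' formula rests only on
  smooth conditional densities of X with a common bound C on their second derivatives.\<close>

locale smooth_conditional_density = prob_space P for P :: "'a measure" +
  fixes R :: "'b measure" and X :: "'a \<Rightarrow> real" and f :: "'a \<Rightarrow> 'b" and g :: "'b \<Rightarrow> real \<Rightarrow> real" and C :: real
  assumes X[measurable]: "X \<in> borel_measurable P" and f[measurable]: "f \<in> P \<rightarrow>\<^sub>M R"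
    and g_cond: "regular_cond_distr P borel X R f (\<lambda>y. density lborel (\<lambda>u. ennreal (g y u)))"
    and g_nonneg: "\<And>y u. y \<in> space R \<Longrightarrow> 0 \<le> g y u"
    and g_smooth: "\<And>y. y \<in> space R \<Longrightarrow> twice_cont_diff (g y)"
    and g_bound: "\<And>y u. y \<in> space R \<Longrightarrow> \<bar>deriv (deriv (g y)) u\<bar> \<le> C"
begin

definition \<rho> where "\<rho> = distr P R f"

sublocale rho: prob_space \<rho> unfolding \<rho>_def by (rule prob_space_distr) simp

lemma sets_\<rho>[measurable_cong, simp]: "sets \<rho> = sets R" by (simp add: \<rho>_def)

lemma space_\<rho>[simp]: "space \<rho> = space R" by (simp add: \<rho>_def)

lemma kernel: "(\<lambda>y. density lborel (\<lambda>u. ennreal (g y u))) \<in> R \<rightarrow>\<^sub>M prob_algebra borel"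
  using g_cond by (simp add: regular_cond_distr_def)

lemma g_emeasure_UNIV: "y \<in> space R \<Longrightarrow> emeasure (density lborel (\<lambda>u. ennreal (g y u))) UNIV = 1"
  using measurable_space[OF kernel, of y] prob_space.emeasure_space_1[of "density lborel (\<lambda>u. ennreal (g y u))"]
  by (simp add: space_prob_algebra)

text \<open>The bound on second derivatives alone already bounds all densities and their slopes
  uniformly in y, so the integrals over y below exist with uniform estimates.\<close>

lemma g_le: assumes y: "y \<in> space R" shows "g y u \<le> 2 + C" "\<bar>deriv (g y) u\<bar> \<le> 2 * (2 + C)"
  using smooth_density_bound[OF g_smooth[OF y] g_nonneg[OF y] g_bound[OF y] g_emeasure_UNIV[OF y], of u] g_nonneg[OF y, of u]
  by auto

lemma C_nonneg: "0 \<le> C"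
proof -
  obtain y where "y \<in> space R" using rho.not_empty by auto
  then show ?thesis using g_bound[of y 0] by linarith
qed

lemma g_taylor: "y \<in> space R \<Longrightarrow> \<bar>g y u - g y x - deriv (g y) x * (u - x)\<bar> \<le> C * (u - x)\<^sup>2"
  by (rule taylor_remainder_bound) (auto intro: g_smooth g_bound)

text \<open>The conditional kernel only makes probabilities of sets measurable in y. The value of
  the continuous density at u is recovered as the limit of k + 1 times the mass of a half-open
  interval of length 1 / (k + 1) to the right of u.\<close>

lemma g_measurable_fst [measurable]: "(\<lambda>y. g y u) \<in> borel_measurable R"
proof -
  define G where "G y v = measure (density lborel (\<lambda>u. ennreal (g y u))) {u<..v}" for y v
  have "(\<lambda>y. density lborel (\<lambda>u. ennreal (g y u))) \<in> R \<rightarrow>\<^sub>M subprob_algebra borel"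
    using kernel by (rule measurable_prob_algebraD)
  then have Gm: "(\<lambda>y. G y v) \<in> borel_measurable R" for v unfolding G_def
    by (rule measurable_compose[OF _ measurable_measure_subprob_algebra]) simp
  have lim: "(\<lambda>k. real (Suc k) * G y (u + 1 / real (Suc k))) \<longlonglongrightarrow> g y u" if y: "y \<in> space R" for y
  proof -
    have gm: "g y \<in> borel_measurable borel" and cont: "isCont (g y) v" for v using twice_cont_diffD[OF g_smooth[OF y]] by auto
    have bd: "\<bar>real (Suc k) * G y (u + 1 / real (Suc k)) - g y u\<bar> \<le> e"
      if e: "0 < e" and close: "\<And>v. \<bar>v - u\<bar> \<le> 1 / real (Suc k) \<Longrightarrow> \<bar>g y v - g y u\<bar> \<le> e" for e k
    proof -
      define d where "d = 1 / real (Suc k)"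
      have d: "0 < d" by (simp add: d_def)
      have close': "\<bar>g y v - g y u\<bar> \<le> e" if "\<bar>v - u\<bar> \<le> d" for v using close that unfolding d_def .
      have i: "integrable lborel (\<lambda>v. indicator {u<..u+d} v * g y v)"
      proof (rule Bochner_Integration.integrable_bound[of _ "\<lambda>v. (2 + C) * indicator {u<..u+d} v"])
        show "integrable lborel (\<lambda>v. (2 + C) * indicator {u<..u+d} v)"
          by (intro integrable_mult_right integrable_real_indicator) (use d in auto)
      qed (use gm g_le(1)[OF y] g_nonneg[OF y] C_nonneg in \<open>auto simp: indicator_def\<close>)
      have "emeasure (density lborel (\<lambda>u. ennreal (g y u))) {u<..u+d} = (\<integral>\<^sup>+v. ennreal (indicator {u<..u+d} v * g y v) \<partial>lborel)"
        using gm by (subst emeasure_density) (auto intro!: nn_integral_cong simp: indicator_def)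
      also have "\<dots> = ennreal (\<integral>v. indicator {u<..u+d} v * g y v \<partial>lborel)"
        using g_nonneg[OF y] by (intro nn_integral_eq_integral i) auto
      finally have G: "G y (u + d) = (\<integral>v. indicator {u<..u+d} v * g y v \<partial>lborel)"
        using g_nonneg[OF y] by (simp add: G_def measure_def integral_nonneg_AE)
      have j: "integrable lborel (\<lambda>v. c * indicator {u<..u+d} v)" for c :: real
        by (intro integrable_mult_right integrable_real_indicator) (use d in auto)
      have v: "(\<integral>v. c * indicator {u<..u+d} v \<partial>lborel) = c * d" for c :: real using d by simp
      have "G y (u + d) \<le> (g y u + e) * d" unfolding G v[symmetric]
      proof (rule integral_mono[OF i j])
        fix v show "indicator {u<..u+d} v * g y v \<le> (g y u + e) * indicator {u<..u+d} v"
          using close'[of v] by (auto simp: indicator_def)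
      qed
      moreover have "(g y u - e) * d \<le> G y (u + d)" unfolding G v[symmetric]
      proof (rule integral_mono[OF j i])
        fix v show "(g y u - e) * indicator {u<..u+d} v \<le> indicator {u<..u+d} v * g y v"
          using close'[of v] by (auto simp: indicator_def)
      qed
      ultimately have "G y (u + d) / d \<le> g y u + e" "g y u - e \<le> G y (u + d) / d"
        using d by (auto simp: field_simps)
      moreover have "real (Suc k) * G y (u + d) = G y (u + d) / d" by (simp add: d_def)
      ultimately show ?thesis unfolding d_def[symmetric] by linarith
    qed
    show ?thesis
    proof (rule LIMSEQ_I)
      fix r :: real assume r: "0 < r"
      obtain s where s: "0 < s" "\<And>v. dist v u < s \<Longrightarrow> dist (g y v) (g y u) < r / 2"
        using cont[of u] r unfolding continuous_at_eps_delta dist_real_def[symmetric] by (meson half_gt_zero)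
      obtain n where n: "1 / real (Suc n) < s" using nat_approx_posE[OF s(1)] by blast
      have "norm (real (Suc k) * G y (u + 1 / real (Suc k)) - g y u) < r" if "n \<le> k" for k
      proof -
        have "1 / real (Suc k) \<le> 1 / real (Suc n)" using that by (intro divide_left_mono) auto
        then have "\<bar>real (Suc k) * G y (u + 1 / real (Suc k)) - g y u\<bar> \<le> r / 2"
        proof (intro bd)
          fix v assume "\<bar>v - u\<bar> \<le> 1 / real (Suc k)"
          then have "dist v u < s" using n \<open>1 / real (Suc k) \<le> 1 / real (Suc n)\<close> unfolding dist_real_def by linarith
          then show "\<bar>g y v - g y u\<bar> \<le> r / 2" using s(2)[of v] by (simp add: dist_real_def)
        qed (use r in simp)
        then show ?thesis using r by simp
      qed
      then show "\<exists>no. \<forall>k\<ge>no. norm (real (Suc k) * G y (u + 1 / real (Suc k)) - g y u) < r" by blast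
    qed
  qed
  show ?thesis
    by (rule borel_measurable_LIMSEQ_real[OF lim]) (use Gm in measurable)
qed

lemma g_measurable [measurable]: "(\<lambda>(y, u). g y u) \<in> borel_measurable (R \<Otimes>\<^sub>M borel)"
  by (rule borel_measurable_caratheodory) (auto intro: twice_cont_diffD(3)[OF g_smooth])

lemma deriv_g_measurable [measurable]: "(\<lambda>y. deriv (g y) x) \<in> borel_measurable R"
proof (rule borel_measurable_LIMSEQ_real)
  fix y assume y: "y \<in> space R"
  have d: "((\<lambda>h. (g y (x + h) - g y x) / h) \<longlongrightarrow> deriv (g y) x) (at 0)"
    using twice_cont_diffD(1)[OF g_smooth[OF y], of x] by (simp add: DERIV_def)
  have l: "(\<lambda>k. 1 / real (Suc k)) \<longlonglongrightarrow> 0" by (rule LIMSEQ_Suc[OF lim_1_over_n])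
  show "(\<lambda>k. (g y (x + 1 / real (Suc k)) - g y x) / (1 / real (Suc k))) \<longlonglongrightarrow> deriv (g y) x"
    by (rule filterlim_compose[OF d]) (use l in \<open>simp add: filterlim_at\<close>)
qed measurable

end

section \<open>Joint law of shape and covariate, and Bayes' formula\<close>

context smooth_conditional_density
begin

text \<open>Disintegration along f: given f = y the covariate has density g y. Both sides are
  compared on rectangles, which form a generator stable under intersections.\<close>

lemma joint_law:
  "distr P (R \<Otimes>\<^sub>M borel) (\<lambda>\<omega>. (f \<omega>, X \<omega>)) = density (\<rho> \<Otimes>\<^sub>M lborel) (\<lambda>(y, u). ennreal (g y u))"
proof -
  define J where "J = distr P (R \<Otimes>\<^sub>M borel) (\<lambda>\<omega>. (f \<omega>, X \<omega>))"
  define D where "D = density (\<rho> \<Otimes>\<^sub>M lborel) (\<lambda>(y, u). ennreal (g y u))"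
  let ?E = "{A \<times> B | A B. A \<in> sets R \<and> B \<in> sets (borel :: real measure)}"
  let ?F = "vimage_algebra (space P) f R"
  have fF: "f \<in> ?F \<rightarrow>\<^sub>M R" by (rule measurable_vimage_algebra1) (use measurable_space[OF f] in auto)
  have sub: "subalgebra P ?F"
    unfolding subalgebra_def using f by (auto simp: sets_vimage_algebra2 measurable_space[OF f] measurable_sets)
  have eq: "emeasure J (A \<times> B) = emeasure D (A \<times> B)" if A: "A \<in> sets R" and B: "B \<in> sets borel" for A B
  proof -
    note [measurable] = A B
    have "emeasure J (A \<times> B) = emeasure P ((\<lambda>\<omega>. (f \<omega>, X \<omega>)) -` (A \<times> B) \<inter> space P)"
      unfolding J_def by (subst emeasure_distr) auto
    also have "\<dots> = (\<integral>\<^sup>+\<omega>. indicator ((\<lambda>\<omega>. (f \<omega>, X \<omega>)) -` (A \<times> B) \<inter> space P) \<omega> \<partial>P)"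
      by (rule nn_integral_indicator[symmetric]) measurable
    also have "\<dots> = (\<integral>\<^sup>+\<omega>. indicator A (f \<omega>) * indicator (X -` B \<inter> space P) \<omega> \<partial>P)"
      by (intro nn_integral_cong) (auto simp: indicator_def)
    also have "\<dots> = (\<integral>\<^sup>+\<omega>. indicator A (f \<omega>) * ennreal (measure (density lborel (\<lambda>u. ennreal (g (f \<omega>) u))) B) \<partial>P)"
    proof (rule nn_integral_cond_prob[OF sub])
      show "AE \<omega> in P. real_cond_exp P ?F (indicat_real (X -` B \<inter> space P)) \<omega> = measure (density lborel (\<lambda>u. ennreal (g (f \<omega>) u))) B"
        using g_cond B by (simp add: regular_cond_distr_def)
      show "(\<lambda>\<omega>. indicator A (f \<omega>)) \<in> borel_measurable ?F"
        by (rule measurable_compose[OF fF]) (use A in measurable)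
    qed measurable
    also have "\<dots> = (\<integral>\<^sup>+\<omega>. indicator A (f \<omega>) * (\<integral>\<^sup>+u. ennreal (g (f \<omega>) u) * indicator B u \<partial>lborel) \<partial>P)"
    proof (intro nn_integral_cong)
      fix \<omega> assume "\<omega> \<in> space P"
      then have y: "f \<omega> \<in> space R" by (rule measurable_space[OF f])
      interpret K: prob_space "density lborel (\<lambda>u. ennreal (g (f \<omega>) u))"
        using measurable_space[OF kernel y] by (simp add: space_prob_algebra)
      have "ennreal (measure (density lborel (\<lambda>u. ennreal (g (f \<omega>) u))) B) = (\<integral>\<^sup>+u. ennreal (g (f \<omega>) u) * indicator B u \<partial>lborel)"
        using B twice_cont_diffD(6)[OF g_smooth[OF y]] unfolding K.emeasure_eq_measure[symmetric] by (subst emeasure_density) auto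
      then show "indicator A (f \<omega>) * ennreal (measure (density lborel (\<lambda>u. ennreal (g (f \<omega>) u))) B) =
          indicator A (f \<omega>) * (\<integral>\<^sup>+u. ennreal (g (f \<omega>) u) * indicator B u \<partial>lborel)" by simp
    qed
    also have "\<dots> = (\<integral>\<^sup>+y. indicator A y * (\<integral>\<^sup>+u. ennreal (g y u) * indicator B u \<partial>lborel) \<partial>\<rho>)"
      unfolding \<rho>_def by (subst nn_integral_distr) measurable
    also have "\<dots> = (\<integral>\<^sup>+y. (\<integral>\<^sup>+u. (case (y, u) of (y, u) \<Rightarrow> ennreal (g y u) * indicator (A \<times> B) (y, u)) \<partial>lborel) \<partial>\<rho>)"
    proof (intro nn_integral_cong)
      fix y assume "y \<in> space \<rho>"
      then have y: "y \<in> space R" by simp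
      note [measurable] = twice_cont_diffD(6)[OF g_smooth[OF y]]
      show "indicator A y * (\<integral>\<^sup>+u. ennreal (g y u) * indicator B u \<partial>lborel)
        = (\<integral>\<^sup>+u. (case (y, u) of (y, u) \<Rightarrow> ennreal (g y u) * indicator (A \<times> B) (y, u)) \<partial>lborel)"
        by (subst nn_integral_cmult[symmetric]) (auto intro!: nn_integral_cong simp: indicator_def)
    qed
    also have "\<dots> = (\<integral>\<^sup>+z. (case z of (y, u) \<Rightarrow> ennreal (g y u) * indicator (A \<times> B) (y, u)) \<partial>(\<rho> \<Otimes>\<^sub>M lborel))"
      by (rule lborel.nn_integral_fst) measurable
    also have "\<dots> = (\<integral>\<^sup>+z. (case z of (y, u) \<Rightarrow> ennreal (g y u)) * indicator (A \<times> B) z \<partial>(\<rho> \<Otimes>\<^sub>M lborel))"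
      by (intro nn_integral_cong) auto
    also have "\<dots> = emeasure D (A \<times> B)"
      unfolding D_def by (rule emeasure_density[symmetric]) measurable
    finally show ?thesis .
  qed
  have "J = D"
  proof (rule measure_eqI_generator_eq[where E = ?E and A = "\<lambda>_. space R \<times> UNIV" and \<Omega> = "space R \<times> UNIV"])
    show "Int_stable ?E" by (rule Int_stable_pair_measure_generator)
    show "?E \<subseteq> Pow (space R \<times> UNIV)" using sets.sets_into_space[of _ R] by blast
    show "emeasure J Z = emeasure D Z" if "Z \<in> ?E" for Z using that eq by blast
    show "sets J = sigma_sets (space R \<times> UNIV) ?E" by (simp add: J_def sets_pair_measure)
    have "sets D = sets (R \<Otimes>\<^sub>M (borel :: real measure))" unfolding D_def sets_density
      by (rule sets_pair_measure_cong) auto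
    then show "sets D = sigma_sets (space R \<times> UNIV) ?E" by (simp add: sets_pair_measure)
    have "space R \<times> (UNIV :: real set) \<in> ?E" by (intro CollectI exI conjI, rule refl) simp_all
    then show "range (\<lambda>_::nat. space R \<times> UNIV) \<subseteq> ?E" by (intro image_subsetI)
    have "prob_space J" unfolding J_def by (rule prob_space_distr) measurable
    then show "emeasure J (space R \<times> UNIV) \<noteq> \<infinity>" for i :: nat
      by (simp add: prob_space.finite_measure finite_measure.emeasure_finite)
  qed simp
  then show ?thesis by (simp add: J_def D_def)
qed

text \<open>By Bayes' formula \<open>G q u\<close> is E(q(f) | X = u) times the density of X at u.
  \<open>G'\<close> is the candidate derivative, with differentiation carried out under the
  integral.\<close>

definition G where "G q u = (\<integral>y. q y * g y u \<partial>\<rho>)"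
definition G' where "G' q u = (\<integral>y. q y * deriv (g y) u \<partial>\<rho>)"

lemma integrable_\<rho>:
  assumes "h \<in> borel_measurable R" "\<And>y. y \<in> space R \<Longrightarrow> \<bar>h y\<bar> \<le> (B::real)"
  shows "integrable \<rho> h"
  using assms by (intro rho.integrable_const_bound[where B = B] AE_I2) (auto cong: measurable_cong_sets)

lemma abs_integral_\<rho>_le:
  assumes "h \<in> borel_measurable R" "\<And>y. y \<in> space R \<Longrightarrow> \<bar>h y\<bar> \<le> (B::real)"
  shows "\<bar>\<integral>y. h y \<partial>\<rho>\<bar> \<le> B"
proof -
  have "\<bar>\<integral>y. h y \<partial>\<rho>\<bar> \<le> (\<integral>y. \<bar>h y\<bar> \<partial>\<rho>)" by (rule integral_abs_bound)
  also have "\<dots> \<le> (\<integral>y. B \<partial>\<rho>)"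
    using assms by (intro integral_mono integrable_abs integrable_\<rho>[OF assms]) auto
  finally show ?thesis using rho.prob_space by simp
qed

context
  fixes q :: "'b \<Rightarrow> real" and B :: real
  assumes q[measurable]: "q \<in> borel_measurable R" and B: "\<And>y. y \<in> space R \<Longrightarrow> \<bar>q y\<bar> \<le> B"
begin

lemma B_nonneg: "0 \<le> B"
proof -
  obtain y where "y \<in> space R" using rho.not_empty by auto
  then show ?thesis using B[of y] by linarith
qed

lemma qg_le: "y \<in> space R \<Longrightarrow> \<bar>q y * g y u\<bar> \<le> B * (2 + C)"
  unfolding abs_mult using g_le(1)[of y u] g_nonneg[of y u] B[of y] B_nonneg by (intro mult_mono) auto

lemma qg'_le: "y \<in> space R \<Longrightarrow> \<bar>q y * deriv (g y) u\<bar> \<le> B * (2 * (2 + C))"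
  unfolding abs_mult using g_le(2)[of y u] B[of y] B_nonneg by (intro mult_mono) auto

lemma G_le: "\<bar>G q u\<bar> \<le> B * (2 + C)" "\<bar>G' q u\<bar> \<le> B * (2 * (2 + C))"
  unfolding G_def G'_def
  by (rule abs_integral_\<rho>_le, measurable, erule qg_le) (rule abs_integral_\<rho>_le, measurable, erule qg'_le)

text \<open>The Taylor expansion is integrated over y pointwise, which gives the quadratic remainder
  with an explicit constant and bypasses differentiation under the integral sign.\<close>

lemma G_taylor: "\<bar>G q u - G q x - G' q x * (u - x)\<bar> \<le> B * (C * (u - x)\<^sup>2)"
proof -
  have i: "integrable \<rho> (\<lambda>y. q y * g y v)" "integrable \<rho> (\<lambda>y. q y * deriv (g y) x)" for v
    by (rule integrable_\<rho>, measurable, erule qg_le) (rule integrable_\<rho>, measurable, erule qg'_le)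
  have "G q u - G q x - G' q x * (u - x) = (\<integral>y. q y * (g y u - g y x - deriv (g y) x * (u - x)) \<partial>\<rho>)"
    unfolding G_def G'_def using i by (simp add: right_diff_distrib mult.assoc[symmetric])
  also have "\<bar>\<dots>\<bar> \<le> B * (C * (u - x)\<^sup>2)"
    using g_taylor[of _ u x] B B_nonneg by (intro abs_integral_\<rho>_le) (auto simp: abs_mult intro!: mult_mono)
  finally show ?thesis .
qed

lemma G_isCont: "isCont (G q) x"
proof -
  have "((\<lambda>u. G q u - G q x) \<longlongrightarrow> 0) (at x)"
  proof (rule Lim_null_comparison)
    show "eventually (\<lambda>u. norm (G q u - G q x) \<le> B * (C * (u - x)\<^sup>2) + \<bar>G' q x\<bar> * \<bar>u - x\<bar>) (at x)"
    proof (rule always_eventually, rule allI)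
      fix u
      have "\<bar>G q u - G q x\<bar> \<le> \<bar>G q u - G q x - G' q x * (u - x)\<bar> + \<bar>G' q x * (u - x)\<bar>" by linarith
      then show "norm (G q u - G q x) \<le> B * (C * (u - x)\<^sup>2) + \<bar>G' q x\<bar> * \<bar>u - x\<bar>"
        using G_taylor[of u x] by (simp add: abs_mult)
    qed
    have "((\<lambda>u. B * (C * (u - x)\<^sup>2) + \<bar>G' q x\<bar> * \<bar>u - x\<bar>) \<longlongrightarrow> B * (C * (x - x)\<^sup>2) + \<bar>G' q x\<bar> * \<bar>x - x\<bar>) (at x)"
      by (intro tendsto_intros)
    then show "((\<lambda>u. B * (C * (u - x)\<^sup>2) + \<bar>G' q x\<bar> * \<bar>u - x\<bar>) \<longlongrightarrow> 0) (at x)" by simp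
  qed
  then show ?thesis by (simp add: isCont_def LIM_zero_iff)
qed

lemma G_measurable [measurable]: "G q \<in> borel_measurable borel"
  using G_isCont by (intro borel_measurable_continuous_onI continuous_at_imp_continuous_on) blast

text \<open>Fubini for the joint density reduces expectations of kernel weights times q(f) to
  one-dimensional integrals against \<open>G q\<close>. The product is dominated by a multiple of
  \<phi>, since q and g are bounded.\<close>

lemma integral_joint:
  assumes \<phi>[measurable]: "\<phi> \<in> borel_measurable borel" and i: "integrable lborel \<phi>"
  shows "integrable P (\<lambda>\<omega>. \<phi> (X \<omega>) * q (f \<omega>))"
    and "expectation (\<lambda>\<omega>. \<phi> (X \<omega>) * q (f \<omega>)) = (\<integral>u. \<phi> u * G q u \<partial>lborel)"
proof -
  interpret pair_sigma_finite \<rho> lborel ..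
  let ?H = "\<lambda>(y, u). g y u * (\<phi> u * q y)"
  have gp: "AE z in \<rho> \<Otimes>\<^sub>M lborel. 0 \<le> (\<lambda>(y, u). g y u) z"
    by (intro AE_I2) (auto simp: space_pair_measure g_nonneg)
  have b: "\<bar>g y u * (\<phi> u * q y)\<bar> \<le> B * (2 + C) * \<bar>\<phi> u\<bar>" if y: "y \<in> space R" for y u
  proof -
    have "\<bar>g y u * (\<phi> u * q y)\<bar> = \<bar>q y * g y u\<bar> * \<bar>\<phi> u\<bar>" by (simp add: abs_mult)
    also have "\<dots> \<le> B * (2 + C) * \<bar>\<phi> u\<bar>" by (intro mult_right_mono qg_le y) auto
    finally show ?thesis .
  qed
  have i': "integrable lborel (\<lambda>u. g y u * (\<phi> u * q y))" if y: "y \<in> space R" for y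
  proof (rule Bochner_Integration.integrable_bound[of _ "\<lambda>u. B * (2 + C) * \<bar>\<phi> u\<bar>"])
    show "(\<lambda>u. g y u * (\<phi> u * q y)) \<in> borel_measurable lborel"
      using twice_cont_diffD(6)[OF g_smooth[OF y]] by measurable
    show "AE u in lborel. norm (g y u * (\<phi> u * q y)) \<le> norm (B * (2 + C) * \<bar>\<phi> u\<bar>)"
      using b[OF y] B_nonneg C_nonneg by (intro AE_I2) (simp add: abs_mult)
  qed (use i in auto)
  have H: "integrable (\<rho> \<Otimes>\<^sub>M lborel) ?H"
  proof (rule Fubini_integrable)
    show "integrable \<rho> (\<lambda>y. \<integral>u. norm (?H (y, u)) \<partial>lborel)"
    proof (rule integrable_\<rho>)
      show "(\<lambda>y. \<integral>u. norm (?H (y, u)) \<partial>lborel) \<in> borel_measurable R" by measurable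
      fix y assume y: "y \<in> space R"
      have "(\<integral>u. norm (?H (y, u)) \<partial>lborel) \<le> (\<integral>u. B * (2 + C) * \<bar>\<phi> u\<bar> \<partial>lborel)"
        using i'[OF y] i b[OF y] by (intro integral_mono) auto
      then show "\<bar>\<integral>u. norm (?H (y, u)) \<partial>lborel\<bar> \<le> (\<integral>u. B * (2 + C) * \<bar>\<phi> u\<bar> \<partial>lborel)" by simp
    qed
  qed (use i' in auto)
  have m: "(\<lambda>z. \<phi> (snd z) * q (fst z)) \<in> borel_measurable (R \<Otimes>\<^sub>M borel)" by measurable
  have m': "(\<lambda>z. \<phi> (snd z) * q (fst z)) \<in> borel_measurable (\<rho> \<Otimes>\<^sub>M lborel)" by measurable
  have gm: "(\<lambda>(y, u). g y u) \<in> borel_measurable (\<rho> \<Otimes>\<^sub>M lborel)" by measurable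
  have H': "?H = (\<lambda>z. (case z of (y, u) \<Rightarrow> g y u) *\<^sub>R (\<phi> (snd z) * q (fst z)))" by auto
  have d: "density (\<rho> \<Otimes>\<^sub>M lborel) (\<lambda>(y, u). ennreal (g y u)) = density (\<rho> \<Otimes>\<^sub>M lborel) (\<lambda>z. ennreal (case z of (y, u) \<Rightarrow> g y u))"
    by (intro arg_cong2[of _ _ _ _ density]) auto
  have fX[measurable]: "(\<lambda>\<omega>. (f \<omega>, X \<omega>)) \<in> P \<rightarrow>\<^sub>M R \<Otimes>\<^sub>M borel" by measurable
  have "integrable (distr P (R \<Otimes>\<^sub>M borel) (\<lambda>\<omega>. (f \<omega>, X \<omega>))) (\<lambda>z. \<phi> (snd z) * q (fst z))"
    unfolding joint_law d using H unfolding H' by (subst integrable_density[OF m' gm gp])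
  then show "integrable P (\<lambda>\<omega>. \<phi> (X \<omega>) * q (f \<omega>))"
    using integrable_distr_eq[OF fX m] by simp
  have "expectation (\<lambda>\<omega>. \<phi> (X \<omega>) * q (f \<omega>)) = (\<integral>z. \<phi> (snd z) * q (fst z) \<partial>distr P (R \<Otimes>\<^sub>M borel) (\<lambda>\<omega>. (f \<omega>, X \<omega>)))"
    using integral_distr[OF fX m] by simp
  also have "\<dots> = (\<integral>z. ?H z \<partial>(\<rho> \<Otimes>\<^sub>M lborel))"
    unfolding joint_law d H' by (rule integral_density[OF m' gm gp])
  also have "\<dots> = (\<integral>u. (\<integral>y. g y u * (\<phi> u * q y) \<partial>\<rho>) \<partial>lborel)"
    using integral_snd[OF H] by simp
  also have "\<dots> = (\<integral>u. \<phi> u * G q u \<partial>lborel)"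
    unfolding G_def by (simp add: mult_ac flip: integral_mult_right_zero)
  finally show "expectation (\<lambda>\<omega>. \<phi> (X \<omega>) * q (f \<omega>)) = (\<integral>u. \<phi> u * G q u \<partial>lborel)" .
qed

end

text \<open>For an open \<open>U\<close>, Bayes' formula gives \<open>P(f \<in> U | X = u) f\<^sub>X(u) = E(g\<^sub>f(u); f \<in> U)\<close> for almost every \<open>u\<close>; both
  sides are continuous, so equality holds at the point \<open>x\<close> itself.\<close>

lemma conditional_law_eq:
  assumes D: "distributed P lborel X (\<lambda>u. ennreal (fX u))" and fX: "\<And>u. isCont fX u" "\<And>u. 0 < fX u"
    and Pf: "regular_cond_distr P R f borel X Pf"
    and E: "Int_stable E" "E \<subseteq> Pow (space R)" "sets R = sigma_sets (space R) E" "space R \<in> E"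
    and cont: "\<And>U. U \<in> E \<Longrightarrow> continuous_on UNIV (\<lambda>u. measure (Pf u) U)"
  shows "Pf x = density \<rho> (\<lambda>y. ennreal (g y x / fX x))"
proof -
  interpret pair_sigma_finite \<rho> lborel ..
  let ?F = "vimage_algebra (space P) X borel"
  have XF: "X \<in> ?F \<rightarrow>\<^sub>M borel" by (rule measurable_vimage_algebra1) auto
  have sub: "subalgebra P ?F"
    unfolding subalgebra_def using X by (auto simp: sets_vimage_algebra2 measurable_sets)
  have fXm[measurable]: "fX \<in> borel_measurable borel"
    using fX(1) by (intro borel_measurable_continuous_onI continuous_at_imp_continuous_on) blast
  have key: "fX x * measure (Pf x) U = G (indicator U) x" if U: "U \<in> E" for x U
  proof (rule AE_eq_imp_eq_at_continuity[where p = "\<lambda>u. fX u * measure (Pf u) U" and q = "G (indicator U)"])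
    have UR[measurable]: "U \<in> sets R" unfolding E(3) by (rule sigma_sets.Basic[OF U])
    have c: "isCont (\<lambda>u. measure (Pf u) U) u" for u
      using cont[OF U] by (simp add: continuous_on_eq_continuous_at)
    have pm[measurable]: "(\<lambda>u. measure (Pf u) U) \<in> borel_measurable borel"
      by (rule borel_measurable_continuous_onI[OF cont[OF U]])
    have iU: "(indicator U :: 'b \<Rightarrow> real) \<in> borel_measurable R" by measurable
    have bU: "\<bar>indicator U y :: real\<bar> \<le> 1" for y by (simp add: indicator_def)
    note Gm[measurable] = G_measurable[OF iU bU]
    show "isCont (\<lambda>u. fX u * measure (Pf u) U) x" by (intro continuous_intros c fX)
    show "isCont (G (indicator U)) x" by (rule G_isCont[OF iU bU])
    \<comment> \<open>Both measures give A the mass P(f \<in> U, X \<in> A): one is computed by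
      conditioning on X, the other from the joint density.\<close>
    have "emeasure (density lborel (\<lambda>u. ennreal (fX u * measure (Pf u) U))) A = emeasure (density lborel (\<lambda>u. ennreal (G (indicator U) u))) A"
      if A[measurable]: "A \<in> sets borel" for A
    proof -
      have "emeasure (density lborel (\<lambda>u. ennreal (fX u * measure (Pf u) U))) A
          = (\<integral>\<^sup>+u. ennreal (fX u) * (indicator A u * ennreal (measure (Pf u) U)) \<partial>lborel)"
        using fX(2) by (subst emeasure_density) (auto intro!: nn_integral_cong simp: ennreal_mult less_imp_le indicator_def)
      also have "\<dots> = (\<integral>\<^sup>+\<omega>. indicator A (X \<omega>) * ennreal (measure (Pf (X \<omega>)) U) \<partial>P)"
        by (rule distributed_nn_integral[OF D]) measurable
      also have "\<dots> = (\<integral>\<^sup>+\<omega>. indicator A (X \<omega>) * indicator (f -` U \<inter> space P) \<omega> \<partial>P)"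
      proof (rule nn_integral_cond_prob[OF sub, symmetric])
        show "AE \<omega> in P. real_cond_exp P ?F (indicat_real (f -` U \<inter> space P)) \<omega> = measure (Pf (X \<omega>)) U"
          using Pf UR by (simp add: regular_cond_distr_def)
        show "(\<lambda>\<omega>. indicator A (X \<omega>)) \<in> borel_measurable ?F"
          by (rule measurable_compose[OF XF]) (use A in measurable)
      qed measurable
      also have "\<dots> = (\<integral>\<^sup>+\<omega>. indicator (U \<times> A) (f \<omega>, X \<omega>) \<partial>P)"
        by (intro nn_integral_cong) (auto simp: indicator_def)
      also have "\<dots> = (\<integral>\<^sup>+z. indicator (U \<times> A) z \<partial>distr P (R \<Otimes>\<^sub>M borel) (\<lambda>\<omega>. (f \<omega>, X \<omega>)))"
        by (subst nn_integral_distr) measurable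
      also have "\<dots> = (\<integral>\<^sup>+z. (case z of (y, u) \<Rightarrow> ennreal (g y u)) * indicator (U \<times> A) z \<partial>(\<rho> \<Otimes>\<^sub>M lborel))"
        unfolding joint_law by (subst nn_integral_density) measurable
      also have "\<dots> = (\<integral>\<^sup>+z. (case z of (y, u) \<Rightarrow> ennreal (indicator U y * g y u) * indicator A u) \<partial>(\<rho> \<Otimes>\<^sub>M lborel))"
        by (intro nn_integral_cong) (auto simp: indicator_times_eq_if indicator_def of_bool_def split: if_splits)
      also have "\<dots> = (\<integral>\<^sup>+u. \<integral>\<^sup>+y. ennreal (indicator U y * g y u) * indicator A u \<partial>\<rho> \<partial>lborel)"
      proof -
        have "(\<lambda>(y, u). ennreal (indicator U y * g y u) * indicator A u) \<in> borel_measurable (\<rho> \<Otimes>\<^sub>M lborel)"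
          by measurable
        from nn_integral_snd[OF this] show ?thesis by simp
      qed
      also have "\<dots> = (\<integral>\<^sup>+u. ennreal (G (indicator U) u) * indicator A u \<partial>lborel)"
      proof (intro nn_integral_cong)
        fix u
        have "(\<integral>\<^sup>+y. ennreal (indicator U y * g y u) \<partial>\<rho>) = ennreal (G (indicator U) u)"
          unfolding G_def
        proof (rule nn_integral_eq_integral)
          show "integrable \<rho> (\<lambda>y. indicator U y * g y u)"
            by (rule integrable_\<rho>, measurable, erule qg_le[OF iU bU])
        qed (auto simp: g_nonneg)
        then show "(\<integral>\<^sup>+y. ennreal (indicator U y * g y u) * indicator A u \<partial>\<rho>) = ennreal (G (indicator U) u) * indicator A u"
          by (subst nn_integral_multc) auto
      qed
      also have "\<dots> = emeasure (density lborel (\<lambda>u. ennreal (G (indicator U) u))) A"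
        by (subst emeasure_density) auto
      finally show ?thesis .
    qed
    then have "density lborel (\<lambda>u. ennreal (fX u * measure (Pf u) U)) = density lborel (\<lambda>u. ennreal (G (indicator U) u))"
      by (intro measure_eqI) auto
    then have "AE u in lborel. ennreal (fX u * measure (Pf u) U) = ennreal (G (indicator U) u)"
      by (intro sigma_finite_measure.density_unique[OF lborel.sigma_finite_measure_axioms]) measurable
    moreover have "0 \<le> G (indicator U) u" for u
      unfolding G_def by (intro integral_nonneg_AE AE_I2) (auto simp: g_nonneg)
    ultimately show "AE u in lborel. fX u * measure (Pf u) U = G (indicator U) u"
      using fX(2) by (auto simp: less_imp_le elim!: eventually_mono)
  qed
  have PfR: "prob_space (Pf x)" "sets (Pf x) = sets R" for x
    using Pf measurable_space[of Pf borel "prob_algebra R" x] by (auto simp: regular_cond_distr_def space_prob_algebra)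
  show ?thesis
  proof (rule measure_eqI_generator_eq[OF E(1,2), where A = "\<lambda>_. space R"])
    fix U assume U: "U \<in> E"
    interpret Pf: prob_space "Pf x" by (rule PfR)
    have UR[measurable]: "U \<in> sets R" unfolding E(3) by (rule sigma_sets.Basic[OF U])
    have iU: "(indicator U :: 'b \<Rightarrow> real) \<in> borel_measurable R" by measurable
    have bU: "\<bar>indicator U y :: real\<bar> \<le> 1" for y by (simp add: indicator_def)
    have int: "integrable \<rho> (\<lambda>y. indicator U y * g y x)"
      by (rule integrable_\<rho>, measurable, erule qg_le[OF iU bU])
    have "emeasure (density \<rho> (\<lambda>y. ennreal (g y x / fX x))) U = (\<integral>\<^sup>+y. ennreal (indicator U y * g y x / fX x) \<partial>\<rho>)"
      by (subst emeasure_density) (auto intro!: nn_integral_cong simp: indicator_def)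
    also have "\<dots> = ennreal (\<integral>y. indicator U y * g y x / fX x \<partial>\<rho>)"
      using int fX(2)[of x] by (intro nn_integral_eq_integral) (auto simp: g_nonneg less_imp_le)
    also have "(\<integral>y. indicator U y * g y x / fX x \<partial>\<rho>) = measure (Pf x) U"
      using key[OF U, of x] fX(2)[of x] unfolding G_def by (simp add: field_simps)
    finally show "emeasure (Pf x) U = emeasure (density \<rho> (\<lambda>y. ennreal (g y x / fX x))) U"
      by (simp add: Pf.emeasure_eq_measure)
  next
    show "emeasure (Pf x) (space R) \<noteq> \<infinity>" for i :: nat
      by (simp add: finite_measure.emeasure_finite prob_space.finite_measure PfR)
  qed (use E PfR in auto)
qed

lemma conditional_expectation_eq:
  assumes D: "distributed P lborel X (\<lambda>u. ennreal (fX u))" and fX: "\<And>u. isCont fX u" "\<And>u. 0 < fX u"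
    and Pf: "regular_cond_distr P R f borel X Pf"
    and E: "Int_stable E" "E \<subseteq> Pow (space R)" "sets R = sigma_sets (space R) E" "space R \<in> E"
    and cont: "\<And>U. U \<in> E \<Longrightarrow> continuous_on UNIV (\<lambda>u. measure (Pf u) U)"
    and q[measurable]: "q \<in> borel_measurable R"
  shows "integral\<^sup>L (Pf x) q = G q x / fX x"
proof -
  have "integral\<^sup>L (Pf x) q = (\<integral>y. (g y x / fX x) *\<^sub>R q y \<partial>\<rho>)"
    by (subst conditional_law_eq[OF D fX Pf E cont], assumption, rule integral_density) (use fX(2)[of x] in \<open>auto simp: g_nonneg less_imp_le\<close>)
  also have "\<dots> = G q x / fX x" unfolding G_def by (simp add: mult.commute)
  finally show ?thesis .
qed

end
subsection \<open>Local linear weights\<close>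

text \<open>The monomial is taken in (u - x) / h instead of u - x, so that the integral does not
  depend on h; the powers of h cancel in the local weights.\<close>

definition kern :: "(real \<Rightarrow> real) \<Rightarrow> real \<Rightarrow> real \<Rightarrow> nat \<Rightarrow> real \<Rightarrow> real" where
  "kern K x h j u = K ((u - x) / h) * ((u - x) / h) ^ j / h"

lemma smoothing_kernelD:
  assumes K: "smoothing_kernel K"
  shows "\<bar>v\<bar> > 1 \<Longrightarrow> K v = 0" and "0 \<le> K v" and "K \<in> borel_measurable borel"
    and "integrable lborel K" "integral\<^sup>L lborel K = 1" "K (- v) = K v"
proof -
  show "K v = 0" if "\<bar>v\<bar> > 1"
  proof (rule ccontr)
    assume "K v \<noteq> 0"
    then have "v \<in> closure {u. K u \<noteq> 0}" by (intro subsetD[OF closure_subset]) simp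
    then show False using K that by (auto simp: smoothing_kernel_def)
  qed
  show "K \<in> borel_measurable borel"
    using K by (intro borel_measurable_continuous_onI) (simp add: smoothing_kernel_def)
qed (use K in \<open>auto simp: smoothing_kernel_def has_bochner_integral_iff\<close>)

lemma smoothing_kernel_bounded:
  assumes K: "smoothing_kernel K"
  obtains B where "0 < B" "\<And>v. K v \<le> B"
proof -
  have "continuous_on {-1..1} K" using K by (auto simp: smoothing_kernel_def intro: continuous_on_subset)
  then have "bounded (K ` {-1..1})" by (intro compact_imp_bounded compact_continuous_image) auto
  then obtain b where b: "\<And>v. v \<in> {-1..1} \<Longrightarrow> norm (K v) \<le> b" unfolding bounded_iff by blast
  have "K v \<le> \<bar>b\<bar> + 1" for v
  proof (cases "\<bar>v\<bar> > 1")
    case False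
    then have "- 1 \<le> v \<and> v \<le> 1" by linarith
    then have "\<bar>K v\<bar> \<le> b" using b[of v] by simp
    then show ?thesis by linarith
  qed (simp add: smoothing_kernelD(1)[OF K])
  then show ?thesis using that[of "\<bar>b\<bar> + 1"] by simp
qed

lemma kernel_moment_le:
  assumes K: "smoothing_kernel K"
  shows "\<bar>K v * v ^ j\<bar> \<le> K v"
proof (cases "\<bar>v\<bar> > 1")
  case False
  then have "\<bar>v\<bar> ^ j \<le> 1" by (intro power_le_one) auto
  then have "K v * \<bar>v\<bar> ^ j \<le> K v * 1" using smoothing_kernelD(2)[OF K] by (intro mult_left_mono)
  then show ?thesis using smoothing_kernelD(2)[OF K, of v] by (simp add: abs_mult power_abs)
qed (simp add: smoothing_kernelD(1)[OF K])

lemma kernel_moment_integrable: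
  assumes K: "smoothing_kernel K"
  shows "integrable lborel (\<lambda>v. K v * v ^ j)"
proof (rule Bochner_Integration.integrable_bound[OF smoothing_kernelD(4)[OF K]])
  show "(\<lambda>v. K v * v ^ j) \<in> borel_measurable lborel" using smoothing_kernelD(3)[OF K] by measurable
qed (use kernel_moment_le[OF K] smoothing_kernelD(2)[OF K] in auto)

definition kernel_moment :: "(real \<Rightarrow> real) \<Rightarrow> nat \<Rightarrow> real" where
  "kernel_moment K j = (\<integral>v. K v * v ^ j \<partial>lborel)"

lemma kernel_moment_values:
  assumes K: "smoothing_kernel K"
  shows "kernel_moment K 0 = 1" "kernel_moment K 1 = 0" "0 < kernel_moment K 2"
proof -
  show "kernel_moment K 0 = 1" using smoothing_kernelD(5)[OF K] by (simp add: kernel_moment_def)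
  have "kernel_moment K 1 = (\<integral>v. K (- v) * (- v) ^ 1 \<partial>lborel)"
    unfolding kernel_moment_def by (subst lborel_integral_real_affine[where c = "-1" and t = 0]) auto
  also have "\<dots> = - kernel_moment K 1"
    unfolding kernel_moment_def by (simp add: smoothing_kernelD(6)[OF K])
  finally show "kernel_moment K 1 = 0" by simp
  have nn: "0 \<le> K v * v ^ 2" for v using smoothing_kernelD(2)[OF K, of v] by simp
  \<comment> \<open>A vanishing second moment would make K zero almost everywhere, contradicting its
    integral 1.\<close>
  have "kernel_moment K 2 \<noteq> 0"
  proof
    assume "kernel_moment K 2 = 0"
    then have "AE v in lborel. K v * v ^ 2 = 0"
      unfolding kernel_moment_def using nn by (subst (asm) integral_nonneg_eq_0_iff_AE[OF kernel_moment_integrable[OF K]]) auto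
    then have "AE v in lborel. K v = 0" using AE_lborel_singleton[of 0] by eventually_elim auto
    then have "integral\<^sup>L lborel K = (\<integral>v. 0 \<partial>(lborel :: real measure))"
      using smoothing_kernelD(3)[OF K] by (intro integral_cong_AE) auto
    then show False using smoothing_kernelD(5)[OF K] by simp
  qed
  moreover have "0 \<le> kernel_moment K 2" unfolding kernel_moment_def using nn by (intro integral_nonneg_AE) auto
  ultimately show "0 < kernel_moment K 2" by simp
qed

lemma kern_props:
  assumes K: "smoothing_kernel K" and h: "0 < h"
  shows "kern K x h j \<in> borel_measurable borel" and "\<bar>kern K x h j u\<bar> \<le> kern K x h 0 u"
    and "\<bar>u - x\<bar> > h \<Longrightarrow> kern K x h j u = 0"
    and "integrable lborel (kern K x h j)" and "integral\<^sup>L lborel (kern K x h j) = kernel_moment K j"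
    and "0 \<le> kern K x h 0 u" and "(\<And>v. K v \<le> B) \<Longrightarrow> kern K x h 0 u \<le> B / h"
proof -
  show "kern K x h j \<in> borel_measurable borel" unfolding kern_def using smoothing_kernelD(3)[OF K] by measurable
  show "\<bar>kern K x h j u\<bar> \<le> kern K x h 0 u"
    using divide_right_mono[OF kernel_moment_le[OF K, of "(u - x) / h" j], of h] h by (simp add: kern_def abs_mult)
  show "\<bar>u - x\<bar> > h \<Longrightarrow> kern K x h j u = 0"
    using smoothing_kernelD(1)[OF K, of "(u - x) / h"] h by (simp add: kern_def field_simps)
  have aff: "kern K x h j (x + h * v) = K v * v ^ j / h" for v using h by (simp add: kern_def)
  show "integrable lborel (kern K x h j)"
    using lborel_integrable_real_affine_iff[of h "kern K x h j" x] kernel_moment_integrable[OF K, of j] h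
    by (simp add: aff)
  show "integral\<^sup>L lborel (kern K x h j) = kernel_moment K j"
    using h by (subst lborel_integral_real_affine[where c = h and t = x]) (simp_all add: aff kernel_moment_def)
  show "0 \<le> kern K x h 0 u" using smoothing_kernelD(2)[OF K] h by (simp add: kern_def)
  show "(\<And>v. K v \<le> B) \<Longrightarrow> kern K x h 0 u \<le> B / h" using h by (simp add: kern_def divide_right_mono)
qed

lemma kern_Suc: "h \<noteq> 0 \<Longrightarrow> kern K x h j u * (u - x) = h * kern K x h (Suc j) u"
  by (simp add: kern_def)

text \<open>The kernel of order 0 is a probability density supported in the window, and it dominates
  the kernels of every order j. So a remainder of order \<open>h\<^sup>2\<close> on the window stays
  of that order after averaging.\<close>

lemma integral_kern_remainder:
  assumes K: "smoothing_kernel K" and h: "0 < h" and r: "r \<in> borel_measurable borel"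
    and b: "\<And>u. \<bar>u - x\<bar> \<le> h \<Longrightarrow> \<bar>r u\<bar> \<le> b"
  shows "integrable lborel (\<lambda>u. kern K x h j u * r u)" "\<bar>\<integral>u. kern K x h j u * r u \<partial>lborel\<bar> \<le> b"
proof -
  note kp = kern_props[OF K h]
  have b0: "0 \<le> b" using b[of x] h by auto
  have le: "\<bar>kern K x h j u * r u\<bar> \<le> b * kern K x h 0 u" for u
  proof (cases "\<bar>u - x\<bar> \<le> h")
    case True
    have "\<bar>kern K x h j u\<bar> * \<bar>r u\<bar> \<le> kern K x h 0 u * b" using kp(2,6) b[OF True] by (intro mult_mono) auto
    then show ?thesis by (simp add: abs_mult mult.commute)
  qed (use kp(3) kp(6) b0 in auto)
  show i: "integrable lborel (\<lambda>u. kern K x h j u * r u)"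
  proof (rule Bochner_Integration.integrable_bound)
    show "integrable lborel (\<lambda>u. b * kern K x h 0 u)" using kp(4) by simp
    show "AE u in lborel. norm (kern K x h j u * r u) \<le> norm (b * kern K x h 0 u)"
      using le b0 kp(6) by (auto simp: abs_mult)
  qed (use kp(1) r in measurable)
  have "\<bar>\<integral>u. kern K x h j u * r u \<partial>lborel\<bar> \<le> (\<integral>u. \<bar>kern K x h j u * r u\<bar> \<partial>lborel)" by (rule integral_abs_bound)
  also have "\<dots> \<le> (\<integral>u. b * kern K x h 0 u \<partial>lborel)"
    using i le kp(4) by (intro integral_mono) auto
  also have "\<dots> = b" using kp(5)[of x 0] kernel_moment_values(1)[OF K] by simp
  finally show "\<bar>\<integral>u. kern K x h j u * r u \<partial>lborel\<bar> \<le> b" .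
qed

definition local_average ::
    "(real \<Rightarrow> real) \<Rightarrow> real \<Rightarrow> real \<Rightarrow> nat \<Rightarrow> (nat \<Rightarrow> real) \<Rightarrow> (nat \<Rightarrow> real) \<Rightarrow> nat \<Rightarrow> real" where
  "local_average K x h n X r j = (\<Sum>i=1..n. kern K x h j (X i) * r i) / real n"

abbreviation local_moment :: "(real \<Rightarrow> real) \<Rightarrow> real \<Rightarrow> real \<Rightarrow> nat \<Rightarrow> (nat \<Rightarrow> real) \<Rightarrow> nat \<Rightarrow> real" where
  "local_moment K x h n X \<equiv> local_average K x h n X (\<lambda>_. 1)"

abbreviation design_det :: "(real \<Rightarrow> real) \<Rightarrow> real \<Rightarrow> real \<Rightarrow> nat \<Rightarrow> (nat \<Rightarrow> real) \<Rightarrow> real" where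
  "design_det K x h n X \<equiv> local_moment K x h n X 0 * local_moment K x h n X 2 - (local_moment K x h n X 1)\<^sup>2"

text \<open>Numerator and \<open>sigma0_sq\<close> both carry the factor \<open>h\<^sup>2\<close>,
  so the weight can be written in rescaled moments, which converge to constants.\<close>

lemma local_weight_eq:
  assumes h: "0 < h"
  shows "local_weight K h x n X i =
    (local_moment K x h n X 2 * kern K x h 0 (X i) - local_moment K x h n X 1 * kern K x h 1 (X i)) / design_det K x h n X"
proof -
  let ?S = "local_moment K x h n X"
  have u: "u_hat K h x n X j = h ^ j * ?S j" for j
  proof -
    have "scaled_kernel K h (X i - x) * (X i - x) ^ j = h ^ j * kern K x h j (X i)" for i
      using h by (simp add: scaled_kernel_def kern_def power_divide)
    then show ?thesis by (simp add: u_hat_def local_average_def sum_distrib_left)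
  qed
  have sk: "scaled_kernel K h (X i - x) = kern K x h 0 (X i)" by (simp add: scaled_kernel_def kern_def)
  have k1: "kern K x h 0 (X i) * (X i - x) = h * kern K x h 1 (X i)" using kern_Suc[of h K x 0] h by simp
  have s: "sigma0_sq K h x n X = h\<^sup>2 * design_det K x h n X"
    by (simp add: sigma0_sq_def u power2_eq_square algebra_simps)
  have "kern K x h 0 (X i) * (h ^ 2 * ?S 2 - h ^ 1 * ?S 1 * (X i - x))
      = h\<^sup>2 * (?S 2 * kern K x h 0 (X i)) - h * ?S 1 * (kern K x h 0 (X i) * (X i - x))"
    by (simp add: algebra_simps)
  also have "\<dots> = h\<^sup>2 * (?S 2 * kern K x h 0 (X i) - ?S 1 * kern K x h 1 (X i))"
    unfolding k1 by (simp add: algebra_simps power2_eq_square)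
  finally show ?thesis unfolding local_weight_def sk u s using h by simp
qed

lemma local_weight_sum:
  assumes h: "0 < h"
  shows "(\<Sum>i=1..n. local_weight K h x n X i * r i) / real n =
    (local_moment K x h n X 2 * local_average K x h n X r 0 - local_moment K x h n X 1 * local_average K x h n X r 1)
      / design_det K x h n X"
proof -
  have eq: "(\<Sum>i=1..n. (a * p i - b * q i) / d * r i) / real n
     = (a * ((\<Sum>i=1..n. p i * r i) / real n) - b * ((\<Sum>i=1..n. q i * r i) / real n)) / d" for a b d :: real and p q
  proof -
    have "(\<Sum>i=1..n. (a * p i - b * q i) / d * r i) = (\<Sum>i=1..n. a / d * (p i * r i) - b / d * (q i * r i))"
      by (intro sum.cong refl) (simp add: diff_divide_distrib left_diff_distrib)
    then have "(\<Sum>i=1..n. (a * p i - b * q i) / d * r i) = a / d * (\<Sum>i=1..n. p i * r i) - b / d * (\<Sum>i=1..n. q i * r i)"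
      by (simp only: sum_subtractf sum_distrib_left)
    then show ?thesis by (simp add: diff_divide_distrib mult.commute)
  qed
  show ?thesis unfolding local_weight_eq[OF h] local_average_def[of K x h n X r] by (rule eq)
qed

text \<open>The weights reproduce affine functions, so the value and the slope of the regression function at
  \<open>x\<close> may be subtracted from the responses.\<close>

lemma local_weight_affine:
  assumes h: "0 < h" and d: "design_det K x h n X \<noteq> 0"
  shows "(\<Sum>i=1..n. local_weight K h x n X i * Y i) / real n - y =
    (\<Sum>i=1..n. local_weight K h x n X i * (Y i - y - b * (X i - x))) / real n"
proof -
  let ?w = "local_weight K h x n X"
  have one: "(\<Sum>i=1..n. ?w i * 1) / real n = 1"
    unfolding local_weight_sum[OF h] using d by (simp add: power2_eq_square mult.commute)
  have "local_average K x h n X (\<lambda>i. X i - x) j = h * local_moment K x h n X (Suc j)" for j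
    unfolding local_average_def using kern_Suc[of h K x j] h by (simp add: sum_distrib_left)
  then have zero: "(\<Sum>i=1..n. ?w i * (X i - x)) / real n = 0"
    unfolding local_weight_sum[OF h] by (simp add: numeral_2_eq_2)
  have "(\<Sum>i=1..n. ?w i * (Y i - y - b * (X i - x))) / real n
     = (\<Sum>i=1..n. ?w i * Y i) / real n - y * ((\<Sum>i=1..n. ?w i * 1) / real n) - b * ((\<Sum>i=1..n. ?w i * (X i - x)) / real n)"
  proof -
    have "(\<Sum>i=1..n. ?w i * (Y i - y - b * (X i - x)))
      = (\<Sum>i=1..n. ?w i * Y i - y * (?w i * 1) - b * (?w i * (X i - x)))"
      by (intro sum.cong refl) (simp add: algebra_simps)
    then show ?thesis by (simp only: sum_subtractf sum_distrib_left[symmetric] diff_divide_distrib times_divide_eq_right)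
  qed
  then show ?thesis unfolding one zero by simp
qed

text \<open>Domination in absolute value by the kernel. It gives up all cancellation and serves for
  errors that are individually small, namely the Poisson noise and the quantile errors.\<close>

lemma local_weight_bound:
  assumes K: "smoothing_kernel K" and h: "0 < h" and d: "0 < d" "d \<le> design_det K x h n X"
    and s: "\<bar>local_moment K x h n X 1\<bar> \<le> s" "\<bar>local_moment K x h n X 2\<bar> \<le> s"
  shows "\<bar>local_weight K h x n X i\<bar> \<le> 2 * s / d * kern K x h 0 (X i)"
proof -
  let ?S = "local_moment K x h n X"
  note kp = kern_props[OF K h]
  have s0: "0 \<le> s" using s(1) by linarith
  have "\<bar>?S 2 * kern K x h 0 (X i) - ?S 1 * kern K x h 1 (X i)\<bar> \<le> \<bar>?S 2\<bar> * \<bar>kern K x h 0 (X i)\<bar> + \<bar>?S 1\<bar> * \<bar>kern K x h 1 (X i)\<bar>"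
    unfolding abs_mult[symmetric] by linarith
  also have "\<dots> \<le> s * kern K x h 0 (X i) + s * kern K x h 0 (X i)"
    using s s0 kp(2,6) by (intro add_mono mult_mono) auto
  finally have "\<bar>local_weight K h x n X i\<bar> \<le> (2 * s * kern K x h 0 (X i)) / design_det K x h n X"
    unfolding local_weight_eq[OF h] abs_divide using d by (simp add: divide_right_mono)
  also have "\<dots> \<le> (2 * s * kern K x h 0 (X i)) / d"
    using d s0 kp(6) by (intro divide_left_mono) auto
  finally show ?thesis by simp
qed

text \<open>The random moments are pulled out of the sum. What remains are kernel averages of r in
  which residuals of opposite sign still cancel, as the bias and variance estimates require.\<close>

lemma local_weight_sum_sq_bound:
  assumes h: "0 < h" and d: "0 < d" "d \<le> design_det K x h n X"
    and s: "\<bar>local_moment K x h n X 1\<bar> \<le> s" "\<bar>local_moment K x h n X 2\<bar> \<le> s"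
  shows "((\<Sum>i=1..n. local_weight K h x n X i * r i) / real n)\<^sup>2
    \<le> 2 * (s / d)\<^sup>2 * ((local_average K x h n X r 0)\<^sup>2 + (local_average K x h n X r 1)\<^sup>2)"
proof -
  let ?S = "local_moment K x h n X" and ?A = "local_average K x h n X r" and ?D = "design_det K x h n X"
  have s0: "0 \<le> s" using s(1) by linarith
  have q: "\<bar>?S j / ?D\<bar> \<le> s / d" if "\<bar>?S j\<bar> \<le> s" for j
    unfolding abs_divide using that d s0 by (intro frac_le) auto
  have q2: "(?S j / ?D)\<^sup>2 \<le> (s / d)\<^sup>2" if "\<bar>?S j\<bar> \<le> s" for j
    using power_mono[OF q[OF that], of 2] unfolding power2_abs by simp
  have ab: "(a - b)\<^sup>2 \<le> 2 * a\<^sup>2 + 2 * b\<^sup>2" for a b :: real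
  proof -
    have "0 \<le> (a + b)\<^sup>2" by simp
    then show ?thesis by (simp add: power2_eq_square algebra_simps)
  qed
  have "((\<Sum>i=1..n. local_weight K h x n X i * r i) / real n)\<^sup>2 = (?S 2 / ?D * ?A 0 - ?S 1 / ?D * ?A 1)\<^sup>2"
    unfolding local_weight_sum[OF h] by (simp add: diff_divide_distrib)
  also have "\<dots> \<le> 2 * (?S 2 / ?D * ?A 0)\<^sup>2 + 2 * (?S 1 / ?D * ?A 1)\<^sup>2" by (rule ab)
  also have "\<dots> = 2 * ((?S 2 / ?D)\<^sup>2 * (?A 0)\<^sup>2) + 2 * ((?S 1 / ?D)\<^sup>2 * (?A 1)\<^sup>2)" by (simp only: power_mult_distrib)
  also have "\<dots> \<le> 2 * ((s / d)\<^sup>2 * (?A 0)\<^sup>2) + 2 * ((s / d)\<^sup>2 * (?A 1)\<^sup>2)"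
    using q2 s by (intro add_mono mult_left_mono mult_right_mono) auto
  finally show ?thesis by (simp add: algebra_simps)
qed

text \<open>Cauchy-Schwarz with the absolute weight split into two square roots; local linear
  weights may be negative, hence the absolute values in both factors.\<close>

lemma weighted_mean_sq_le:
  fixes w a :: "nat \<Rightarrow> real"
  shows "((\<Sum>i\<in>I. w i * a i) / real n)\<^sup>2 \<le> ((\<Sum>i\<in>I. \<bar>w i\<bar>) / real n) * ((\<Sum>i\<in>I. \<bar>w i\<bar> * (a i)\<^sup>2) / real n)"
proof -
  have "\<bar>\<Sum>i\<in>I. w i * a i\<bar> \<le> (\<Sum>i\<in>I. sqrt \<bar>w i\<bar> * (sqrt \<bar>w i\<bar> * \<bar>a i\<bar>))"
    by (rule order_trans[OF sum_abs]) (simp add: abs_mult mult.assoc[symmetric])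
  then have "(\<Sum>i\<in>I. w i * a i)\<^sup>2 \<le> (\<Sum>i\<in>I. sqrt \<bar>w i\<bar> * (sqrt \<bar>w i\<bar> * \<bar>a i\<bar>))\<^sup>2"
    by (metis abs_ge_zero power2_abs power_mono)
  also have "\<dots> \<le> (\<Sum>i\<in>I. (sqrt \<bar>w i\<bar>)\<^sup>2) * (\<Sum>i\<in>I. (sqrt \<bar>w i\<bar> * \<bar>a i\<bar>)\<^sup>2)"
    by (rule Cauchy_Schwarz_ineq_sum)
  also have "\<dots> = (\<Sum>i\<in>I. \<bar>w i\<bar>) * (\<Sum>i\<in>I. \<bar>w i\<bar> * (a i)\<^sup>2)" by (simp add: power_mult_distrib)
  finally show ?thesis by (simp add: power_divide power2_eq_square divide_right_mono)
qed

text \<open>R may be nonmeasurable. Its exceptional event is covered by the complement of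
  \<open>Good\<close> together with an event about the measurable dominating variable Y, to which
  Markov's inequality applies.\<close>

lemma big_O_p_from_second_moment:
  assumes P: "prob_space P" and c: "0 < c"
    and good: "eventually (\<lambda>n. Good n \<in> sets P) sequentially" "(\<lambda>n. measure P (space P - Good n)) \<longlonglongrightarrow> 0"
    and Y: "eventually (\<lambda>n. Y n \<in> borel_measurable P \<and> (\<integral>\<^sup>+\<omega>. ennreal (Y n \<omega>) \<partial>P) \<le> ennreal (c * (r n)\<^sup>2) \<and> 0 < r n) sequentially"
    and R: "eventually (\<lambda>n. \<forall>\<omega>\<in>Good n. (R n \<omega>)\<^sup>2 \<le> Y n \<omega>) sequentially"
  shows "big_O_p P R r"
  unfolding big_O_p_def
proof (intro allI impI)
  fix \<epsilon> :: real assume \<epsilon>: "0 < \<epsilon>"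
  interpret prob_space P by fact
  \<comment> \<open>The choice makes the Markov bound \<open>c / C\<^sup>2\<close> at most
    \<epsilon> / 2; the other half is left for the complement of the good event.\<close>
  define C where "C = sqrt (2 * c / \<epsilon>) + 1"
  have C: "0 < C" using c \<epsilon> by (simp add: C_def add_nonneg_pos)
  have "2 * c / \<epsilon> = (sqrt (2 * c / \<epsilon>))\<^sup>2" using c \<epsilon> by simp
  also have "\<dots> \<le> C\<^sup>2" unfolding C_def using c \<epsilon> by (intro power_mono) auto
  finally have "2 * c / \<epsilon> \<le> C\<^sup>2" .
  then have C2: "c / C\<^sup>2 \<le> \<epsilon> / 2" using \<epsilon> C by (simp add: field_simps)
  have "eventually (\<lambda>n. measure P (space P - Good n) < \<epsilon> / 2) sequentially"
    using good(2) \<epsilon> by (intro order_tendstoD(2)) auto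
  with good(1) Y R
  have "eventually (\<lambda>n. \<exists>A\<in>sets P. {\<omega>\<in>space P. \<bar>R n \<omega>\<bar> > C * r n} \<subseteq> A \<and> measure P A \<le> \<epsilon>) sequentially"
  proof eventually_elim
    case (elim n)
    have Ym[measurable]: "Y n \<in> borel_measurable P" and EY: "(\<integral>\<^sup>+\<omega>. ennreal (Y n \<omega>) \<partial>P) \<le> ennreal (c * (r n)\<^sup>2)" and r: "0 < r n"
      using elim by auto
    define B where "B = {\<omega> \<in> space P. (C * r n)\<^sup>2 \<le> Y n \<omega>}"
    have Bm: "B \<in> sets P" unfolding B_def by measurable
    have Cr: "0 < (C * r n)\<^sup>2" using C r by simp
    have "ennreal ((C * r n)\<^sup>2) * emeasure P B = (\<integral>\<^sup>+\<omega>. ennreal ((C * r n)\<^sup>2) * indicator B \<omega> \<partial>P)"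
      using Bm by (simp add: nn_integral_cmult_indicator)
    also have "\<dots> \<le> (\<integral>\<^sup>+\<omega>. ennreal (Y n \<omega>) \<partial>P)"
      by (intro nn_integral_mono) (auto simp: B_def indicator_def ennreal_leI)
    also have "\<dots> \<le> ennreal (c * (r n)\<^sup>2)" by (rule EY)
    finally have "ennreal ((C * r n)\<^sup>2 * measure P B) \<le> ennreal (c * (r n)\<^sup>2)"
      by (simp add: emeasure_eq_measure ennreal_mult)
    then have "(C * r n)\<^sup>2 * measure P B \<le> c * (r n)\<^sup>2" using c by (subst (asm) ennreal_le_iff) auto
    then have "measure P B \<le> c * (r n)\<^sup>2 / (C * r n)\<^sup>2" using Cr by (simp add: pos_le_divide_eq mult.commute)
    also have "\<dots> = c / C\<^sup>2" using r by (simp add: power_mult_distrib)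
    finally have mB: "measure P B \<le> \<epsilon> / 2" using C2 by linarith
    show ?case
    proof (intro bexI conjI)
      show "{\<omega> \<in> space P. C * r n < \<bar>R n \<omega>\<bar>} \<subseteq> (space P - Good n) \<union> B"
      proof
        fix \<omega> assume w: "\<omega> \<in> {\<omega> \<in> space P. C * r n < \<bar>R n \<omega>\<bar>}"
        have "(C * r n)\<^sup>2 \<le> \<bar>R n \<omega>\<bar>\<^sup>2" using w C r by (intro power_mono) auto
        then show "\<omega> \<in> (space P - Good n) \<union> B" using w elim(3) by (force simp: B_def)
      qed
      have "measure P ((space P - Good n) \<union> B) \<le> measure P (space P - Good n) + measure P B"
        using elim(1) Bm by (intro measure_Un_le) auto
      then show "measure P ((space P - Good n) \<union> B) \<le> \<epsilon>" using mB elim(4) by simp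
      show "(space P - Good n) \<union> B \<in> sets P" using elim(1) Bm by auto
    qed
  qed
  then show "\<exists>C>0. \<forall>\<^sub>F n in sequentially. \<exists>A\<in>sets P. {\<omega>\<in>space P. \<bar>R n \<omega>\<bar> > C * r n} \<subseteq> A \<and> measure P A \<le> \<epsilon>"
    using C by blast
qed
subsection \<open>The population model\<close>

text \<open>D is one common bound: for the kernel, for the density of X and for the second
  derivatives of that density and of m near x, and for the second derivatives of all conditional
  densities. All later constants are built from such data and do not involve the sample
  size.\<close>

locale intensity_model = prob_space P for P :: "'a measure" +
  fixes T M L :: real and X :: "'a \<Rightarrow> real" and \<Lambda> :: "'a \<Rightarrow> real \<Rightarrow> real" and K :: "real \<Rightarrow> real"
    and x \<kappa> M1 c0 D :: real and fX m :: "real \<Rightarrow> real" and g :: "(real \<Rightarrow> real) \<Rightarrow> real \<Rightarrow> real"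
    and Pf :: "real \<Rightarrow> (real \<Rightarrow> real) measure"
  assumes TML: "0 < T" "0 < M" "M < L"
    and X_meas[measurable]: "X \<in> borel_measurable P"
    and \<Lambda>_meas[measurable]: "\<Lambda> \<in> P \<rightarrow>\<^sub>M intensity_algebra T"
    and K: "smoothing_kernel K"
    and f_shape: "\<And>\<omega>. \<omega> \<in> space P \<Longrightarrow> shape T (\<Lambda> \<omega>) \<in> shape_space T M L"
    and \<tau>_bounds: "0 < \<kappa>" "\<kappa> \<le> M1" "AE \<omega> in P. \<kappa> \<le> intensity_factor T (\<Lambda> \<omega>) \<and> intensity_factor T (\<Lambda> \<omega>) \<le> M1"
    and fX: "distributed P lborel X (\<lambda>u. ennreal (fX u))" "twice_cont_diff fX"
    and g_cond: "regular_cond_distr P borel X (shape_borel T M L) (\<lambda>\<omega>. shape T (\<Lambda> \<omega>))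
          (\<lambda>y. density lborel (\<lambda>u. ennreal (g y u)))"
    and g_nonneg: "\<And>y u. y \<in> shape_space T M L \<Longrightarrow> 0 \<le> g y u"
    and g_smooth: "\<And>y. y \<in> shape_space T M L \<Longrightarrow> twice_cont_diff (g y)"
    and g_bound: "\<And>y u. y \<in> shape_space T M L \<Longrightarrow> \<bar>deriv (deriv (g y)) u\<bar> \<le> D"
    and Pf_cond: "regular_cond_distr P (shape_borel T M L) (\<lambda>\<omega>. shape T (\<Lambda> \<omega>)) borel X Pf"
    and Pf_cont: "\<And>U. shape_open T M L U \<Longrightarrow> continuous_on UNIV (\<lambda>u. measure (Pf u) U)"
    and fX_pos: "\<And>u. 0 < fX u"
    and m: "regression_function P X (\<lambda>\<omega>. intensity_factor T (\<Lambda> \<omega>)) m" "twice_cont_diff m"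
    and c0: "0 < c0"
    and D: "\<And>v. K v \<le> D" "\<And>u. \<bar>u - x\<bar> \<le> c0 \<Longrightarrow> fX u \<le> D"
      "\<And>u. \<bar>u - x\<bar> \<le> c0 \<Longrightarrow> \<bar>deriv (deriv fX) u\<bar> \<le> D"
      "\<And>u. \<bar>u - x\<bar> \<le> c0 \<Longrightarrow> \<bar>deriv (deriv m) u\<bar> \<le> D"
begin

abbreviation "\<tau> \<omega> \<equiv> intensity_factor T (\<Lambda> \<omega>)"
abbreviation "f \<omega> \<equiv> shape T (\<Lambda> \<omega>)"
abbreviation "SB \<equiv> shape_borel T M L"

text \<open>Truncating t gives a function that is bounded, continuous in t and jointly measurable on
  the whole line, so integrals over t and over shapes can be exchanged.\<close>

definition Q :: "real \<Rightarrow> (real \<Rightarrow> real) \<Rightarrow> real" where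
  "Q t y = shape_quantile T y (max 0 (min 1 t))"

lemma D_pos: "0 < D"
  using D(2)[of x] c0 fX_pos[of x] by simp

lemma \<Lambda>_mem: "\<omega> \<in> space P \<Longrightarrow> \<Lambda> \<omega> \<in> intensity_set T"
  using measurable_space[OF \<Lambda>_meas] by (simp add: space_intensity_algebra)

text \<open>Positivity holds everywhere, not just almost surely: with a vanishing factor the
  convention a / 0 = 0 makes the shape zero, and the zero function does not integrate to 1.\<close>

lemma \<tau>_pos: assumes "\<omega> \<in> space P" shows "0 < \<tau> \<omega>"
proof (rule ccontr)
  assume "\<not> 0 < \<tau> \<omega>"
  moreover have "0 \<le> \<tau> \<omega>"
    using \<Lambda>_mem[OF assms] unfolding intensity_factor_def set_lebesgue_integral_def intensity_set_def
    by (intro integral_nonneg_AE AE_I2) (auto simp: indicator_def)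
  ultimately have "\<tau> \<omega> = 0" by simp
  then have "f \<omega> = (\<lambda>_. 0)" by (simp add: shape_def fun_eq_iff)
  then show False using f_shape[OF assms] by (simp add: shape_space_def)
qed

lemma Q_eq_intensity_quantile: "\<omega> \<in> space P \<Longrightarrow> intensity_quantile T (\<Lambda> \<omega>) t = Q t (f \<omega>)"
  using \<tau>_pos by (simp add: intensity_quantile_def Q_def)

lemma intensity_quantile_measurable_snd [measurable]: "(\<lambda>h. intensity_quantile T h t) \<in> borel_measurable (intensity_algebra T)"
  using measurable_compose[OF _ intensity_quantile_measurable[of T], of "\<lambda>h. (t, h)" "intensity_algebra T"] TML(1) by simp

lemma f_measurable: "f \<in> P \<rightarrow>\<^sub>M SB"
proof (rule measurable_shape_borelI)
  fix t :: real assume t: "t \<in> {0..1}"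
  have iq: "(\<lambda>\<omega>. intensity_quantile T (\<Lambda> \<omega>) t) \<in> borel_measurable P" by measurable
  have eq: "intensity_quantile T (\<Lambda> \<omega>) t = shape_quantile T (f \<omega>) t" if "\<omega> \<in> space P" for \<omega>
    using Q_eq_intensity_quantile[OF that, of t] t by (simp add: Q_def)
  show "(\<lambda>\<omega>. shape_quantile T (f \<omega>) t) \<in> borel_measurable P"
    by (rule measurable_cong[THEN iffD1, rotated, OF iq]) (rule eq)
qed (use TML f_shape in auto)

sublocale smooth_conditional_density P SB X f g D
  by unfold_locales (auto simp: space_shape_borel f_measurable g_cond g_nonneg g_smooth g_bound)

lemma Q_bounds: "y \<in> shape_space T M L \<Longrightarrow> Q t y \<in> {0..T}"
  using quantile_setD(1)[OF shape_space_dist(3), of y T M L "max 0 (min 1 t)" 0] TML by (simp add: Q_def)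

lemma Q_measurable_fst [measurable]: "Q t \<in> borel_measurable SB"
  unfolding Q_def[abs_def] using TML by (intro shape_quantile_measurable) auto

lemma Q_isCont: assumes "y \<in> shape_space T M L" shows "isCont (\<lambda>t. Q t y) t"
proof -
  have "continuous_on UNIV (\<lambda>t. Q t y)" unfolding Q_def
    by (rule continuous_on_compose2[OF quantile_set_continuous[OF shape_space_dist(3)[OF assms]]])
       (use TML in \<open>auto intro!: continuous_intros\<close>)
  then show ?thesis by (simp add: continuous_on_eq_continuous_at)
qed

lemma Q_measurable [measurable]: "(\<lambda>(y, t). Q t y) \<in> borel_measurable (SB \<Otimes>\<^sub>M borel)"
  by (rule borel_measurable_caratheodory) (auto simp: Q_isCont space_shape_borel)

lemma Q_abs_le: "y \<in> space SB \<Longrightarrow> \<bar>Q t y\<bar> \<le> T"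
  using Q_bounds[of y t] by (auto simp: space_shape_borel)

definition q0 where "q0 t = (\<integral>y. Q t y \<partial>Pf x)"
text \<open>\<open>b0 t\<close> is the slope for which \<open>G (Q t) u - (q0 t + b0 t * (u - x)) * fX u\<close> is \<open>O((u - x)\<^sup>2)\<close>.\<close>

definition b0 where "b0 t = (G' (Q t) x - q0 t * deriv fX x) / fX x"

lemma shape_open_generates:
  "Int_stable {U. shape_open T M L U}" "{U. shape_open T M L U} \<subseteq> Pow (space SB)"
  "sets SB = sigma_sets (space SB) {U. shape_open T M L U}" "space SB \<in> {U. shape_open T M L U}"
proof -
  show "Int_stable {U. shape_open T M L U}"
  proof (rule Int_stableI, clarify)
    fix U V assume U: "shape_open T M L U" and V: "shape_open T M L V"
    show "shape_open T M L (U \<inter> V)" unfolding shape_open_def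
    proof (intro conjI ballI)
      fix y assume y: "y \<in> U \<inter> V"
      obtain a where a: "a > 0" "\<forall>z\<in>shape_space T M L. shape_dist T y z < a \<longrightarrow> z \<in> U"
        using U y unfolding shape_open_def by blast
      obtain b where b: "b > 0" "\<forall>z\<in>shape_space T M L. shape_dist T y z < b \<longrightarrow> z \<in> V"
        using V y unfolding shape_open_def by blast
      show "\<exists>\<epsilon>>0. \<forall>z\<in>shape_space T M L. shape_dist T y z < \<epsilon> \<longrightarrow> z \<in> U \<inter> V"
        by (intro exI[of _ "min a b"]) (use a b in auto)
    qed (use U in \<open>auto simp: shape_open_def\<close>)
  qed
  show "{U. shape_open T M L U} \<subseteq> Pow (space SB)" by (auto simp: shape_open_def space_shape_borel)
  show "sets SB = sigma_sets (space SB) {U. shape_open T M L U}" by (simp add: sets_shape_borel space_shape_borel)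
  show "space SB \<in> {U. shape_open T M L U}" by (auto simp: shape_open_def space_shape_borel intro: exI[of _ 1])
qed

lemma Pf_x: "prob_space (Pf x)" "sets (Pf x) = sets SB" "space (Pf x) = shape_space T M L"
proof -
  show *: "prob_space (Pf x)" "sets (Pf x) = sets SB"
    using Pf_cond measurable_space[of Pf borel "prob_algebra SB" x] by (auto simp: regular_cond_distr_def space_prob_algebra)
  show "space (Pf x) = shape_space T M L" using sets_eq_imp_space_eq[OF *(2)] by (simp add: space_shape_borel)
qed

text \<open>This links the target, an integral against the conditional law at x, with
  \<open>G\<close>, whose Taylor expansion at x is available.\<close>

lemma q0_eq: "q0 t = G (Q t) x / fX x"
  unfolding q0_def
  by (rule conditional_expectation_eq[OF fX(1) _ fX_pos Pf_cond shape_open_generates])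
     (auto intro: twice_cont_diffD(3)[OF fX(2)] Pf_cont)

lemma q0_measurable [measurable]: "q0 \<in> borel_measurable borel"
  unfolding q0_eq[abs_def] G_def
  by (intro borel_measurable_divide borel_measurable_const rho.borel_measurable_lebesgue_integral) measurable

lemma b0_measurable [measurable]: "b0 \<in> borel_measurable borel"
  unfolding b0_def[abs_def] G'_def
  by (intro borel_measurable_divide borel_measurable_diff borel_measurable_times borel_measurable_const
      rho.borel_measurable_lebesgue_integral) measurable

lemma Q_integrable: "integrable (Pf x) (Q t)"
proof -
  interpret Pf: prob_space "Pf x" by (rule Pf_x)
  have "Q t \<in> borel_measurable (Pf x)" using Q_measurable_fst[of t] by (simp cong: measurable_cong_sets add: Pf_x(2))
  then show ?thesis
    by (intro Pf.integrable_const_bound[where B = T] AE_I2) (use Q_abs_le[of _ t] in \<open>auto simp: Pf_x space_shape_borel\<close>)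
qed

text \<open>Increments of quantile functions lie between M (t - s) and L (t - s) without absolute
  values, and these bounds survive integration over the conditional law.\<close>

lemma q0_mem: "q0 \<in> quantile_set T M L"
proof -
  interpret Pf: prob_space "Pf x" by (rule Pf_x)
  have Qe: "Q t y = shape_quantile T y t" if "t \<in> {0..1}" for t y using that by (simp add: Q_def)
  have qs: "shape_quantile T y \<in> quantile_set T M L" if "y \<in> shape_space T M L" for y
    using shape_space_dist(3)[OF that] TML by simp
  have slope: "M * (t - s) \<le> q0 t - q0 s \<and> q0 t - q0 s \<le> L * (t - s)" if st: "s \<in> {0..1}" "t \<in> {0..1}" "s \<le> t" for s t
  proof -
    have d: "q0 t - q0 s = (\<integral>y. Q t y - Q s y \<partial>Pf x)" unfolding q0_def using Q_integrable by simp
    have i: "integrable (Pf x) (\<lambda>y. Q t y - Q s y)" using Q_integrable by simp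
    have "(\<integral>y. M * (t - s) \<partial>Pf x) \<le> (\<integral>y. Q t y - Q s y \<partial>Pf x)"
      using quantile_set_slope(1)[OF qs TML(2) st] Qe st Pf_x(3) by (intro integral_mono i) auto
    moreover have "(\<integral>y. Q t y - Q s y \<partial>Pf x) \<le> (\<integral>y. L * (t - s) \<partial>Pf x)"
      using quantile_set_slope(2)[OF qs TML(2) st] Qe st Pf_x(3) by (intro integral_mono i) auto
    ultimately show ?thesis using d Pf.prob_space by simp
  qed
  have "q0 0 = (\<integral>y. 0 \<partial>Pf x)" unfolding q0_def
    using quantile_setD(4)[OF qs, of _ 0 0] Pf_x(3) Qe by (intro Bochner_Integration.integral_cong) auto
  then have e0: "q0 0 = 0" by simp
  have "q0 1 = (\<integral>y. T \<partial>Pf x)" unfolding q0_def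
    using quantile_setD(5)[OF qs, of _ 0 0] Pf_x(3) Qe by (intro Bochner_Integration.integral_cong) auto
  then have e1: "q0 1 = T" using Pf.prob_space by simp
  have bi: "M * \<bar>s - t\<bar> \<le> \<bar>q0 s - q0 t\<bar> \<and> \<bar>q0 s - q0 t\<bar> \<le> L * \<bar>s - t\<bar>" if st: "s \<in> {0..1}" "t \<in> {0..1}" for s t
  proof -
    have "M * \<bar>s - t\<bar> \<ge> 0" using TML by simp
    then show ?thesis using slope[OF st] slope[OF st(2,1)] by (cases "s \<le> t") auto
  qed
  have "q0 t \<in> {0..T}" if t: "t \<in> {0..1}" for t
  proof -
    have "0 \<le> M * (t - 0)" "0 \<le> M * (1 - t)" using t TML by auto
    then show ?thesis using slope[of 0 t] slope[of t 1] t e0 e1 by auto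
  qed
  then show ?thesis unfolding quantile_set_def using e0 e1 bi by auto
qed

text \<open>The usual decomposition: the expected squared distance to p is a constant plus the
  squared distance from \<open>q0\<close> to the quantile function of p. Since \<open>q0\<close> is
  the quantile function of some shape, that second term vanishes at every minimiser, in particular
  at the chosen one.\<close>

lemma frechet_mean_quantile:
  shows "frechet_mean T M L (Pf x) \<in> shape_space T M L"
    and "L2_dist (shape_quantile T (frechet_mean T M L (Pf x))) q0 = 0"
proof -
  interpret Pf: prob_space "Pf x" by (rule Pf_x)
  interpret pp: pair_sigma_finite "Pf x" lborel ..
  define V where "V = (\<integral>y. (L2_dist (shape_quantile T y) q0)\<^sup>2 \<partial>Pf x)"
  have Qm: "(\<lambda>(y, t). Q t y) \<in> borel_measurable (Pf x \<Otimes>\<^sub>M lborel)"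
    using Q_measurable by (simp cong: measurable_cong_sets sets_pair_measure_cong add: Pf_x(2))
  note [measurable] = Qm
  have qs: "shape_quantile T y \<in> quantile_set T M L" if "y \<in> shape_space T M L" for y
    using shape_space_dist(3)[OF that] TML by simp
  have Qy: "shape_quantile T y t = Q t y" if "t \<in> {0..1}" for y t using that by (simp add: Q_def)
  have QT: "\<bar>Q t y\<bar> \<le> T" if "y \<in> shape_space T M L" for t y using Q_abs_le[of y t] that by (simp add: space_shape_borel)
  have dec: "(LINT y|Pf x. (shape_dist T y p)\<^sup>2) = V + (L2_dist q0 (shape_quantile T p))\<^sup>2" if p: "p \<in> shape_space T M L" for p
  proof -
    define P' where "P' t = Q t p" for t
    have P'm[measurable]: "P' \<in> borel_measurable borel" unfolding P'_def
      using Q_isCont[OF p] by (intro borel_measurable_continuous_onI continuous_at_imp_continuous_on) blast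
    have P'T: "\<bar>P' t\<bar> \<le> T" for t unfolding P'_def by (rule QT[OF p])
    let ?I = "\<lambda>t. indicator {0..1} t :: real"
    have q0T: "\<bar>?I t * q0 t\<bar> \<le> T" for t using quantile_set_measurable(2)[OF q0_mem, of t] TML by (auto simp: indicator_def)
    have bnd: "integrable (Pf x \<Otimes>\<^sub>M lborel) (\<lambda>(y, t). ?I t * h y t)"
      if hm: "(\<lambda>(y, t). h y t) \<in> borel_measurable (Pf x \<Otimes>\<^sub>M lborel)"
        and hb: "\<And>y t. y \<in> shape_space T M L \<Longrightarrow> t \<in> {0..1} \<Longrightarrow> \<bar>h y t\<bar> \<le> B" for h :: "(real \<Rightarrow> real) \<Rightarrow> real \<Rightarrow> real" and B :: real
    proof -
      have B: "0 \<le> B" by (rule order_trans[OF abs_ge_zero hb[OF p, of 0]]) simp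
      have fin: "emeasure (Pf x \<Otimes>\<^sub>M lborel) (space (Pf x) \<times> {0..1::real}) < \<infinity>"
        by (subst lborel.emeasure_pair_measure_Times) (auto simp: Pf.emeasure_space_1)
      show ?thesis
      proof (rule Bochner_Integration.integrable_bound)
        show "integrable (Pf x \<Otimes>\<^sub>M lborel) (\<lambda>z. B * indicator (space (Pf x) \<times> {0..1::real}) z)"
          by (intro integrable_mult_right integrable_real_indicator pair_measureI) (use fin in auto)
        show "(\<lambda>(y, t). ?I t * h y t) \<in> borel_measurable (Pf x \<Otimes>\<^sub>M lborel)" using hm by measurable
        show "AE z in Pf x \<Otimes>\<^sub>M lborel. norm (case z of (y, t) \<Rightarrow> ?I t * h y t) \<le> norm (B * indicator (space (Pf x) \<times> {0..1::real}) z)"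
          using hb B by (intro AE_I2) (auto simp: space_pair_measure Pf_x(3) indicator_def)
      qed
    qed
    have i1: "integrable (Pf x \<Otimes>\<^sub>M lborel) (\<lambda>(y, t). ?I t * (Q t y - q0 t)\<^sup>2)"
    proof (rule bnd)
      fix y t assume "y \<in> shape_space T M L" "t \<in> {0..1::real}"
      then have "\<bar>Q t y - q0 t\<bar> \<le> 2 * T" using QT[of y t] quantile_set_measurable(2)[OF q0_mem, of t] by linarith
      then show "\<bar>(Q t y - q0 t)\<^sup>2\<bar> \<le> (2 * T)\<^sup>2" using power_mono[of "\<bar>Q t y - q0 t\<bar>" "2 * T" 2] by simp
    qed measurable
    have i2: "integrable (Pf x \<Otimes>\<^sub>M lborel) (\<lambda>(y, t). ?I t * ((Q t y - q0 t) * (q0 t - P' t)))"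
    proof (rule bnd)
      fix y t assume "y \<in> shape_space T M L" "t \<in> {0..1::real}"
      then have "\<bar>Q t y - q0 t\<bar> \<le> 2 * T" "\<bar>q0 t - P' t\<bar> \<le> 2 * T"
        using QT[of y t] P'T[of t] quantile_set_measurable(2)[OF q0_mem, of t] by linarith+
      then show "\<bar>(Q t y - q0 t) * (q0 t - P' t)\<bar> \<le> (2 * T) * (2 * T)" unfolding abs_mult by (intro mult_mono) (use TML in auto)
    qed measurable
    have i3: "integrable lborel (\<lambda>t. ?I t * (q0 t - P' t)\<^sup>2)"
      using set_integrable_diff_sq[OF quantile_set_measurable(1)[OF q0_mem], of P' T T] quantile_set_measurable(2)[OF q0_mem] P'T
      by (auto simp: set_integrable_def set_borel_measurable_def)
    have inner1: "integrable lborel (\<lambda>t. ?I t * (Q t y - q0 t)\<^sup>2)" "integrable lborel (\<lambda>t. ?I t * ((Q t y - q0 t) * (q0 t - P' t)))"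
      if y: "y \<in> shape_space T M L" for y
    proof -
      have [measurable]: "(\<lambda>t. Q t y) \<in> borel_measurable borel"
        using Q_isCont[OF y] by (intro borel_measurable_continuous_onI continuous_at_imp_continuous_on) blast
      have b1: "\<bar>Q t y - q0 t\<bar> \<le> 2 * T" "\<bar>q0 t - P' t\<bar> \<le> 2 * T" if "t \<in> {0..1}" for t
        using QT[OF y, of t] P'T[of t] quantile_set_measurable(2)[OF q0_mem that] by linarith+
      have "set_integrable lborel {0..1} (\<lambda>t. (Q t y - q0 t)\<^sup>2)"
      proof (rule set_integrable_bounded)
        show "\<bar>(Q t y - q0 t)\<^sup>2\<bar> \<le> (2 * T)\<^sup>2" if "t \<in> {0..1}" for t
          using power_mono[OF b1(1)[OF that], of 2] by simp
      qed (simp add: set_borel_measurable_def)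
      then show "integrable lborel (\<lambda>t. ?I t * (Q t y - q0 t)\<^sup>2)" by (simp add: set_integrable_def)
      have "set_integrable lborel {0..1} (\<lambda>t. (Q t y - q0 t) * (q0 t - P' t))"
      proof (rule set_integrable_bounded)
        show "\<bar>(Q t y - q0 t) * (q0 t - P' t)\<bar> \<le> (2 * T) * (2 * T)" if "t \<in> {0..1}" for t
          unfolding abs_mult using b1[OF that] TML by (intro mult_mono) auto
      qed (simp add: set_borel_measurable_def)
      then show "integrable lborel (\<lambda>t. ?I t * ((Q t y - q0 t) * (q0 t - P' t)))" by (simp add: set_integrable_def)
    qed
    have pt: "(shape_dist T y p)\<^sup>2 = (\<integral>t. ?I t * (Q t y - q0 t)\<^sup>2 \<partial>lborel)
        + 2 * (\<integral>t. ?I t * ((Q t y - q0 t) * (q0 t - P' t)) \<partial>lborel) + (\<integral>t. ?I t * (q0 t - P' t)\<^sup>2 \<partial>lborel)"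
      if y: "y \<in> shape_space T M L" for y
    proof -
      have "(shape_dist T y p)\<^sup>2 = (\<integral>t. ?I t * (shape_quantile T y t - shape_quantile T p t)\<^sup>2 \<partial>lborel)"
        by (simp add: shape_dist_def L2_dist_sq set_lebesgue_integral_def)
      also have "\<dots> = (\<integral>t. ?I t * (Q t y - q0 t)\<^sup>2 + 2 * (?I t * ((Q t y - q0 t) * (q0 t - P' t))) + ?I t * (q0 t - P' t)\<^sup>2 \<partial>lborel)"
        by (intro Bochner_Integration.integral_cong) (auto simp: indicator_def Qy P'_def power2_eq_square algebra_simps)
      finally show ?thesis using inner1[OF y] i3 by simp
    qed
    \<comment> \<open>After exchanging the integrals the cross term vanishes for each t, because
      \<open>q0 t\<close> is the mean of \<open>Q t\<close>.\<close>
    have a: "(\<integral>y. (\<integral>t. ?I t * ((Q t y - q0 t) * (q0 t - P' t)) \<partial>lborel) \<partial>Pf x) = 0"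
    proof -
      have "(\<integral>y. (\<integral>t. ?I t * ((Q t y - q0 t) * (q0 t - P' t)) \<partial>lborel) \<partial>Pf x)
         = (\<integral>t. (\<integral>y. ?I t * ((Q t y - q0 t) * (q0 t - P' t)) \<partial>Pf x) \<partial>lborel)"
        using pp.Fubini_integral[OF i2] by simp
      also have "\<dots> = (\<integral>t. 0 \<partial>(lborel :: real measure))"
      proof (intro Bochner_Integration.integral_cong refl)
        fix t
        have "(\<integral>y. ?I t * ((Q t y - q0 t) * (q0 t - P' t)) \<partial>Pf x) = ?I t * (\<integral>y. Q t y - q0 t \<partial>Pf x) * (q0 t - P' t)"
          by (simp add: mult.assoc)
        also have "(\<integral>y. Q t y - q0 t \<partial>Pf x) = 0" using Q_integrable[of t] Pf.prob_space by (simp add: q0_def)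
        finally show "(\<integral>y. ?I t * ((Q t y - q0 t) * (q0 t - P' t)) \<partial>Pf x) = 0" by simp
      qed
      finally show ?thesis by simp
    qed
    have "(LINT y|Pf x. (shape_dist T y p)\<^sup>2) = (\<integral>y. (\<integral>t. ?I t * (Q t y - q0 t)\<^sup>2 \<partial>lborel)
        + 2 * (\<integral>t. ?I t * ((Q t y - q0 t) * (q0 t - P' t)) \<partial>lborel) + (\<integral>t. ?I t * (q0 t - P' t)\<^sup>2 \<partial>lborel) \<partial>Pf x)"
      using pt by (intro Bochner_Integration.integral_cong) (auto simp: Pf_x(3))
    also have "\<dots> = (\<integral>y. (\<integral>t. ?I t * (Q t y - q0 t)\<^sup>2 \<partial>lborel) \<partial>Pf x) + (\<integral>t. ?I t * (q0 t - P' t)\<^sup>2 \<partial>lborel)"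
      using pp.integrable_fst[OF i1] pp.integrable_fst[OF i2] a Pf.prob_space by simp
    also have "(\<integral>y. (\<integral>t. ?I t * (Q t y - q0 t)\<^sup>2 \<partial>lborel) \<partial>Pf x) = V"
      unfolding V_def L2_dist_sq set_lebesgue_integral_def
      by (intro Bochner_Integration.integral_cong refl) (auto simp: indicator_def Qy)
    also have "(\<integral>t. ?I t * (q0 t - P' t)\<^sup>2 \<partial>lborel) = (L2_dist q0 (shape_quantile T p))\<^sup>2"
      unfolding L2_dist_sq set_lebesgue_integral_def
      by (intro Bochner_Integration.integral_cong refl) (auto simp: indicator_def Qy P'_def)
    finally show ?thesis .
  qed
  obtain p0 where p0: "p0 \<in> shape_space T M L" "\<And>t. t \<in> {0..1} \<Longrightarrow> shape_quantile T p0 t = q0 t"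
    using quantile_set_realised[OF q0_mem] TML by blast
  have d0: "L2_dist q0 (shape_quantile T p0) = 0"
  proof -
    have "L2_dist q0 (shape_quantile T p0) = L2_dist q0 q0" using p0(2) by (intro L2_dist_cong) auto
    then show ?thesis by (simp add: L2_dist_def)
  qed
  have min: "(LINT y|Pf x. (shape_dist T y p0)\<^sup>2) \<le> (LINT y|Pf x. (shape_dist T y p)\<^sup>2)" if "p \<in> shape_space T M L" for p
    unfolding dec[OF that] dec[OF p0(1)] d0 by simp
  have am: "frechet_mean T M L (Pf x) \<in> shape_space T M L"
    "\<And>p. p \<in> shape_space T M L \<Longrightarrow> (LINT y|Pf x. (shape_dist T y (frechet_mean T M L (Pf x)))\<^sup>2) \<le> (LINT y|Pf x. (shape_dist T y p)\<^sup>2)"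
    unfolding frechet_mean_def
    by (rule arg_min_onI[OF p0(1), where \<phi> = "\<lambda>p. LINT y|Pf x. (shape_dist T y p)\<^sup>2"], erule min)
       (rule arg_min_onI(2)[OF p0(1), where \<phi> = "\<lambda>p. LINT y|Pf x. (shape_dist T y p)\<^sup>2"], erule min)
  show "frechet_mean T M L (Pf x) \<in> shape_space T M L" by (rule am)
  have "(L2_dist q0 (shape_quantile T (frechet_mean T M L (Pf x))))\<^sup>2 \<le> 0"
    using am(2)[OF p0(1)] unfolding dec[OF am(1)] dec[OF p0(1)] d0 by simp
  then show "L2_dist (shape_quantile T (frechet_mean T M L (Pf x))) q0 = 0" by (simp add: L2_dist_commute)
qed

end

section \<open>Bias of kernel averages\<close>

context intensity_model
begin

lemma fX_measurable [measurable]: "fX \<in> borel_measurable borel" "m \<in> borel_measurable borel"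
  using twice_cont_diffD(6)[OF fX(2)] twice_cont_diffD(6)[OF m(2)] by auto

lemma expect_kern:
  assumes h: "0 < h" and r[measurable]: "r \<in> borel_measurable borel"
    and b: "\<And>u. \<bar>u - x\<bar> \<le> h \<Longrightarrow> \<bar>r u\<bar> \<le> b"
  shows "integrable P (\<lambda>\<omega>. kern K x h j (X \<omega>) * r (X \<omega>))"
    and "expectation (\<lambda>\<omega>. kern K x h j (X \<omega>) * r (X \<omega>)) = (\<integral>u. kern K x h j u * (r u * fX u) \<partial>lborel)"
proof -
  note kp = kern_props[OF K h]
  note [measurable] = kp(1)[of x j]
  have b0: "0 \<le> b" using b[of x] h by auto
  have bd: "\<bar>kern K x h j u * r u\<bar> \<le> D / h * b" for u
  proof (cases "\<bar>u - x\<bar> \<le> h")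
    case True
    have "\<bar>kern K x h j u\<bar> \<le> D / h" using kp(2,7) D(1) order_trans by blast
    then show ?thesis unfolding abs_mult using b[OF True] D_pos h by (intro mult_mono) auto
  qed (use kp(3) b0 D_pos h in auto)
  show "integrable P (\<lambda>\<omega>. kern K x h j (X \<omega>) * r (X \<omega>))"
    by (rule integrable_const_bound[where B = "D / h * b"]) (use bd in \<open>auto intro!: AE_I2\<close>)
  have "(\<integral>u. fX u * (kern K x h j u * r u) \<partial>lborel) = expectation (\<lambda>\<omega>. kern K x h j (X \<omega>) * r (X \<omega>))"
    by (rule distributed_integral[OF fX(1)]) (auto simp: less_imp_le fX_pos)
  then show "expectation (\<lambda>\<omega>. kern K x h j (X \<omega>) * r (X \<omega>)) = (\<integral>u. kern K x h j u * (r u * fX u) \<partial>lborel)"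
    by (simp add: mult_ac)
qed

lemma expect_kern_0:
  assumes h: "0 < h" "h \<le> c0"
  shows "integrable P (\<lambda>\<omega>. kern K x h 0 (X \<omega>))" "expectation (\<lambda>\<omega>. kern K x h 0 (X \<omega>)) \<le> D"
proof -
  have "\<bar>\<integral>u. kern K x h 0 u * fX u \<partial>lborel\<bar> \<le> D"
    using D(2) h fX_pos by (intro integral_kern_remainder(2)[OF K]) (auto simp: less_imp_le)
  then show "integrable P (\<lambda>\<omega>. kern K x h 0 (X \<omega>))" "expectation (\<lambda>\<omega>. kern K x h 0 (X \<omega>)) \<le> D"
    using expect_kern[OF h(1), of "\<lambda>_. 1" 1 0] by auto
qed

lemma sq_le_of_abs_le: "\<bar>u - x\<bar> \<le> h \<Longrightarrow> (u - x)\<^sup>2 \<le> (h::real)\<^sup>2"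
  using power_mono[of "\<bar>u - x\<bar>" h 2] by simp

lemma fX_taylor: "\<bar>u - x\<bar> \<le> c0 \<Longrightarrow> \<bar>fX u - fX x - deriv fX x * (u - x)\<bar> \<le> D * (u - x)\<^sup>2"
  by (rule taylor_remainder_bound[OF fX(2)]) (auto intro: D)

lemma m_taylor: "\<bar>u - x\<bar> \<le> c0 \<Longrightarrow> \<bar>m u - m x - deriv m x * (u - x)\<bar> \<le> D * (u - x)\<^sup>2"
  by (rule taylor_remainder_bound[OF m(2)]) (auto intro: D)

text \<open>\<open>Bb\<close> bounds the slopes \<open>b0 t\<close>. The three summands of
  \<open>Bq\<close> come from the Taylor remainder of \<open>G\<close>, from the product of the two
  linear terms, and from the Taylor remainder of the density of X times the affine function.\<close>

definition Bb where "Bb = (T * (2 * (2 + D)) + T * \<bar>deriv fX x\<bar>) / fX x"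
definition Bq where "Bq = T * D + Bb * \<bar>deriv fX x\<bar> + (T + Bb * c0) * D"

lemma q0_abs_le: "\<bar>q0 t\<bar> \<le> T"
proof -
  have "q0 t = q0 (max 0 (min 1 t))" unfolding q0_def Q_def by simp
  then show ?thesis using quantile_set_measurable(2)[OF q0_mem, of "max 0 (min 1 t)"] by simp
qed

lemma b0_abs_le: "\<bar>b0 t\<bar> \<le> Bb"
proof -
  have "\<bar>q0 t * deriv fX x\<bar> \<le> T * \<bar>deriv fX x\<bar>" unfolding abs_mult using q0_abs_le by (intro mult_right_mono) auto
  then have "\<bar>G' (Q t) x - q0 t * deriv fX x\<bar> \<le> T * (2 * (2 + D)) + T * \<bar>deriv fX x\<bar>"
    using G_le(2)[OF Q_measurable_fst Q_abs_le, of t x] by linarith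
  then show ?thesis unfolding b0_def Bb_def abs_divide using fX_pos[of x] by (simp add: divide_right_mono)
qed

lemma Bb_nonneg: "0 \<le> Bb" using b0_abs_le[of 0] by linarith

text \<open>The slope \<open>b0 t\<close> is chosen such that value and first derivative of the
  integrand against the kernel cancel at x. The remainder is quadratic with a constant independent
  of t and j.\<close>

lemma shape_bias:
  assumes h: "0 < h" "h \<le> c0"
  shows "\<bar>expectation (\<lambda>\<omega>. kern K x h j (X \<omega>) * (Q t (f \<omega>) - q0 t - b0 t * (X \<omega> - x)))\<bar> \<le> Bq * h\<^sup>2"
proof -
  let ?G = "G (Q t)" and ?k = "kern K x h j"
  note kp = kern_props[OF K h(1)]
  note Gt = G_measurable[OF Q_measurable_fst Q_abs_le, of t]
  note [measurable] = Gt kp(1)[of x j]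
  let ?r = "\<lambda>u. q0 t + b0 t * (u - x)"
  have r_le: "\<bar>?r u\<bar> \<le> T + Bb * c0" if u: "\<bar>u - x\<bar> \<le> c0" for u
  proof -
    have "\<bar>b0 t * (u - x)\<bar> \<le> Bb * c0" unfolding abs_mult using u b0_abs_le Bb_nonneg by (intro mult_mono) auto
    then show ?thesis using q0_abs_le[of t] by linarith
  qed
  have rem: "\<bar>?G u - ?r u * fX u\<bar> \<le> Bq * (u - x)\<^sup>2" if u: "\<bar>u - x\<bar> \<le> c0" for u
  proof -
    have g0: "?G x = q0 t * fX x" using q0_eq[of t] fX_pos[of x] by simp
    have g1: "G' (Q t) x = b0 t * fX x + q0 t * deriv fX x" using fX_pos[of x] by (simp add: b0_def)
    let ?R1 = "?G u - ?G x - G' (Q t) x * (u - x)" and ?R2 = "fX u - fX x - deriv fX x * (u - x)"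
    \<comment> \<open>\<open>g0\<close> and \<open>g1\<close> cancel the constant and linear parts;
      two Taylor remainders and the product of the slopes are left.\<close>
    have eq: "?G u - ?r u * fX u = ?R1 - b0 t * deriv fX x * (u - x)\<^sup>2 - ?r u * ?R2"
      unfolding g0 g1 by (simp add: algebra_simps power2_eq_square)
    have a1: "\<bar>?R1\<bar> \<le> T * D * (u - x)\<^sup>2"
      using G_taylor[OF Q_measurable_fst Q_abs_le, of t u x] by (simp add: mult.assoc)
    have a2: "\<bar>b0 t * deriv fX x * (u - x)\<^sup>2\<bar> \<le> Bb * \<bar>deriv fX x\<bar> * (u - x)\<^sup>2"
      unfolding abs_mult using b0_abs_le by (intro mult_mono mult_right_mono) (auto simp: Bb_nonneg)
    have a3: "\<bar>?r u * ?R2\<bar> \<le> (T + Bb * c0) * (D * (u - x)\<^sup>2)"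
      unfolding abs_mult using r_le[OF u] fX_taylor[OF u] TML(1) Bb_nonneg c0 by (intro mult_mono) auto
    have tri: "\<bar>a - b - c\<bar> \<le> A + B + C" if "\<bar>a\<bar> \<le> A" "\<bar>b\<bar> \<le> B" "\<bar>c\<bar> \<le> C" for a b c A B C :: real
      using that by linarith
    have "Bq * (u - x)\<^sup>2 = T * D * (u - x)\<^sup>2 + Bb * \<bar>deriv fX x\<bar> * (u - x)\<^sup>2 + (T + Bb * c0) * (D * (u - x)\<^sup>2)"
      unfolding Bq_def by (simp only: distrib_right mult.assoc)
    then show ?thesis using tri[OF a1 a2 a3] unfolding eq by (simp only:)
  qed
  have Bq0: "0 \<le> Bq" unfolding Bq_def using TML(1) D_pos Bb_nonneg c0 by (intro add_nonneg_nonneg mult_nonneg_nonneg) auto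
  have i1: "integrable P (\<lambda>\<omega>. ?k (X \<omega>) * Q t (f \<omega>))" "expectation (\<lambda>\<omega>. ?k (X \<omega>) * Q t (f \<omega>)) = (\<integral>u. ?k u * ?G u \<partial>lborel)"
    by (rule integral_joint(1)[OF Q_measurable_fst Q_abs_le kp(1) kp(4)], assumption) (rule integral_joint(2)[OF Q_measurable_fst Q_abs_le kp(1) kp(4)])
  have i2: "integrable P (\<lambda>\<omega>. ?k (X \<omega>) * ?r (X \<omega>))" "expectation (\<lambda>\<omega>. ?k (X \<omega>) * ?r (X \<omega>)) = (\<integral>u. ?k u * (?r u * fX u) \<partial>lborel)"
    using h r_le by (intro expect_kern[OF h(1), where b = "T + Bb * c0"]; force)+
  have j1: "integrable lborel (\<lambda>u. ?k u * ?G u)"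
    using G_le(1)[OF Q_measurable_fst Q_abs_le, of t] by (intro integral_kern_remainder(1)[OF K h(1)]) auto
  have j2: "integrable lborel (\<lambda>u. ?k u * (?r u * fX u))"
  proof (rule integral_kern_remainder(1)[OF K h(1)])
    show "\<bar>?r u * fX u\<bar> \<le> (T + Bb * c0) * D" if "\<bar>u - x\<bar> \<le> h" for u
      unfolding abs_mult using r_le[of u] D(2)[of u] that h fX_pos[of u] by (intro mult_mono) auto
  qed measurable
  have "expectation (\<lambda>\<omega>. ?k (X \<omega>) * (Q t (f \<omega>) - q0 t - b0 t * (X \<omega> - x)))
     = expectation (\<lambda>\<omega>. ?k (X \<omega>) * Q t (f \<omega>) - ?k (X \<omega>) * ?r (X \<omega>))"
    by (intro Bochner_Integration.integral_cong) (simp_all add: algebra_simps)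
  also have "\<dots> = (\<integral>u. ?k u * (?G u - ?r u * fX u) \<partial>lborel)"
    unfolding Bochner_Integration.integral_diff[OF i1(1) i2(1)] i1(2) i2(2) Bochner_Integration.integral_diff[OF j1 j2, symmetric]
    by (simp only: right_diff_distrib)
  finally have eq: "expectation (\<lambda>\<omega>. ?k (X \<omega>) * (Q t (f \<omega>) - q0 t - b0 t * (X \<omega> - x))) = (\<integral>u. ?k u * (?G u - ?r u * fX u) \<partial>lborel)" .
  show ?thesis unfolding eq
  proof (rule integral_kern_remainder(2)[OF K h(1)])
    fix u assume u: "\<bar>u - x\<bar> \<le> h"
    have "\<bar>?G u - ?r u * fX u\<bar> \<le> Bq * (u - x)\<^sup>2" using rem u h by simp
    also have "\<dots> \<le> Bq * h\<^sup>2" using sq_le_of_abs_le[OF u] Bq0 by (intro mult_left_mono)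
    finally show "\<bar>?G u - ?r u * fX u\<bar> \<le> Bq * h\<^sup>2" .
  qed measurable
qed

lemma \<tau>_integrable: "integrable P \<tau>"
proof (rule integrable_const_bound)
  show "AE \<omega> in P. norm (\<tau> \<omega>) \<le> M1" using \<tau>_bounds(3) by eventually_elim (use \<tau>_bounds(1) in auto)
qed measurable

lemma E\<tau>_bounds: "expectation \<tau> \<le> M1" "0 \<le> expectation \<tau>"
proof -
  have "expectation \<tau> \<le> expectation (\<lambda>_. M1)"
    using \<tau>_bounds \<tau>_integrable by (intro integral_mono_AE) auto
  then show "expectation \<tau> \<le> M1" by (simp add: prob_space)
  have "AE \<omega> in P. 0 \<le> \<tau> \<omega>" using \<tau>_bounds(3) by eventually_elim (use \<tau>_bounds(1) in auto)
  then show "0 \<le> expectation \<tau>" by (rule integral_nonneg_AE)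
qed

lemma E\<tau>_ge: "\<kappa> \<le> expectation \<tau>"
proof -
  have "expectation (\<lambda>_. \<kappa>) \<le> expectation \<tau>"
    using \<tau>_bounds \<tau>_integrable by (intro integral_mono_AE) auto
  then show ?thesis by (simp add: prob_space)
qed

text \<open>Conditioning on X replaces the factor by m(X), whose Taylor remainder on the window is
  at most \<open>D h\<^sup>2\<close>; the second D bounds the density of X.\<close>

lemma tau_bias:
  assumes h: "0 < h" "h \<le> c0"
  shows "\<bar>expectation (\<lambda>\<omega>. kern K x h j (X \<omega>) * (\<tau> \<omega> - m x - deriv m x * (X \<omega> - x)))\<bar> \<le> D * D * h\<^sup>2"
proof -
  let ?k = "kern K x h j" and ?F = "vimage_algebra (space P) X borel" and ?l = "\<lambda>u. m x + deriv m x * (u - x)"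
  note kp = kern_props[OF K h(1)]
  note [measurable] = kp(1)[of x j]
  have sub: "subalgebra P ?F"
    unfolding subalgebra_def using X_meas by (auto simp: sets_vimage_algebra2 measurable_sets)
  interpret F: sigma_finite_subalgebra P ?F by (rule subalgebra_sigma_finite[OF sub])
  have "continuous_on {x - c0..x + c0} (\<lambda>u. m u)" "continuous_on {x - c0..x + c0} ?l"
    using twice_cont_diffD(3)[OF m(2)] by (auto intro!: continuous_at_imp_continuous_on continuous_intros)
  then have "bounded (m ` {x - c0..x + c0})" "bounded (?l ` {x - c0..x + c0})"
    by (auto intro!: compact_imp_bounded compact_continuous_image)
  then obtain B1 B2 where B': "\<forall>v\<in>m ` {x - c0..x + c0}. norm v \<le> B1" "\<forall>v\<in>?l ` {x - c0..x + c0}. norm v \<le> B2"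
    unfolding bounded_iff by blast
  have mem: "u \<in> {x - c0..x + c0}" if "\<bar>u - x\<bar> \<le> c0" for u using that by (auto simp: abs_le_iff)
  have B: "\<bar>m u\<bar> \<le> B1" "\<bar>?l u\<bar> \<le> B2" if "\<bar>u - x\<bar> \<le> c0" for u
    using bspec[OF B'(1) imageI[OF mem[OF that]]] bspec[OF B'(2) imageI[OF mem[OF that]]] by simp_all
  have kX: "\<bar>?k u\<bar> \<le> D / h" for u using kp(2,7) D(1) order_trans by blast
  have i0: "integrable P (\<lambda>\<omega>. ?k (X \<omega>) * \<tau> \<omega>)"
  proof (rule integrable_const_bound)
    show "AE \<omega> in P. norm (?k (X \<omega>) * \<tau> \<omega>) \<le> D / h * M1"
      using \<tau>_bounds(3)
    proof eventually_elim
      case (elim \<omega>)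
      then show ?case unfolding real_norm_def abs_mult using kX[of "X \<omega>"] \<tau>_bounds(1) D_pos h by (intro mult_mono) auto
    qed
  qed measurable
  have XF: "X \<in> ?F \<rightarrow>\<^sub>M borel" by (rule measurable_vimage_algebra1) auto
  have kF: "(\<lambda>\<omega>. ?k (X \<omega>)) \<in> borel_measurable ?F" by (rule measurable_compose[OF XF]) measurable
  have "expectation (\<lambda>\<omega>. ?k (X \<omega>) * \<tau> \<omega>) = expectation (\<lambda>\<omega>. ?k (X \<omega>) * real_cond_exp P ?F \<tau> \<omega>)"
    by (rule F.real_cond_exp_intg(2)[symmetric, OF i0 kF]) measurable
  also have "\<dots> = expectation (\<lambda>\<omega>. ?k (X \<omega>) * m (X \<omega>))"
  proof (rule integral_cong_AE)
    show "AE \<omega> in P. ?k (X \<omega>) * real_cond_exp P ?F \<tau> \<omega> = ?k (X \<omega>) * m (X \<omega>)"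
      using m(1) unfolding regression_function_def by (auto elim!: eventually_mono)
  qed measurable
  finally have e0: "expectation (\<lambda>\<omega>. ?k (X \<omega>) * \<tau> \<omega>) = expectation (\<lambda>\<omega>. ?k (X \<omega>) * m (X \<omega>))" .
  have i1: "integrable P (\<lambda>\<omega>. ?k (X \<omega>) * m (X \<omega>))"
    by (rule expect_kern(1)[OF h(1), where b = B1]) (use B h in auto)
  have i2: "integrable P (\<lambda>\<omega>. ?k (X \<omega>) * ?l (X \<omega>))"
    by (rule expect_kern(1)[OF h(1), where b = B2]) (use B h in auto)
  have bd: "\<bar>m u - ?l u\<bar> \<le> D * h\<^sup>2" if u: "\<bar>u - x\<bar> \<le> h" for u
  proof -
    have "\<bar>m u - m x - deriv m x * (u - x)\<bar> \<le> D * (u - x)\<^sup>2" using m_taylor u h by simp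
    also have "\<dots> \<le> D * h\<^sup>2" using sq_le_of_abs_le[OF u] D_pos by (intro mult_left_mono) auto
    finally show ?thesis by (simp add: algebra_simps)
  qed
  have "expectation (\<lambda>\<omega>. ?k (X \<omega>) * (\<tau> \<omega> - m x - deriv m x * (X \<omega> - x)))
     = expectation (\<lambda>\<omega>. ?k (X \<omega>) * \<tau> \<omega> - ?k (X \<omega>) * ?l (X \<omega>))"
    by (intro Bochner_Integration.integral_cong) (simp_all add: algebra_simps)
  also have "\<dots> = expectation (\<lambda>\<omega>. ?k (X \<omega>) * m (X \<omega>) - ?k (X \<omega>) * ?l (X \<omega>))"
    unfolding Bochner_Integration.integral_diff[OF i0 i2] Bochner_Integration.integral_diff[OF i1 i2] e0 ..
  also have "\<dots> = expectation (\<lambda>\<omega>. ?k (X \<omega>) * (m (X \<omega>) - ?l (X \<omega>)))"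
    by (simp only: right_diff_distrib)
  also have "\<dots> = (\<integral>u. ?k u * ((m u - ?l u) * fX u) \<partial>lborel)"
    by (rule expect_kern(2)[OF h(1) _ bd]) measurable
  finally have eq: "expectation (\<lambda>\<omega>. ?k (X \<omega>) * (\<tau> \<omega> - m x - deriv m x * (X \<omega> - x))) = (\<integral>u. ?k u * ((m u - ?l u) * fX u) \<partial>lborel)" .
  have "\<bar>\<integral>u. ?k u * ((m u - ?l u) * fX u) \<partial>lborel\<bar> \<le> D * h\<^sup>2 * D"
  proof (rule integral_kern_remainder(2)[OF K h(1)])
    show "\<bar>(m u - ?l u) * fX u\<bar> \<le> D * h\<^sup>2 * D" if u: "\<bar>u - x\<bar> \<le> h" for u
      unfolding abs_mult using bd[OF u] D(2)[of u] u h fX_pos[of u] D_pos by (intro mult_mono) auto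
  qed measurable
  then show ?thesis unfolding eq by (simp only: mult_ac)
qed

text \<open>First order in h is enough here, since the design moments only have to be close to their
  limits and do not enter the rate.\<close>

lemma design_bias:
  assumes h: "0 < h" "h \<le> c0"
  shows "\<bar>expectation (\<lambda>\<omega>. kern K x h j (X \<omega>)) - fX x * kernel_moment K j\<bar> \<le> (\<bar>deriv fX x\<bar> + D * c0) * h"
proof -
  let ?k = "kern K x h j"
  note kp = kern_props[OF K h(1)]
  note [measurable] = kp(1)[of x j]
  have bd: "\<bar>fX u - fX x\<bar> \<le> (\<bar>deriv fX x\<bar> + D * c0) * h" if u: "\<bar>u - x\<bar> \<le> h" for u
  proof -
    have uc: "\<bar>u - x\<bar> \<le> c0" using u h by simp
    have "D * (u - x)\<^sup>2 = D * (\<bar>u - x\<bar> * \<bar>u - x\<bar>)" by (simp add: power2_eq_square)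
    also have "\<dots> \<le> D * (c0 * h)" using u uc D_pos by (intro mult_left_mono mult_mono) auto
    finally have a: "D * (u - x)\<^sup>2 \<le> D * c0 * h" by simp
    have b: "\<bar>deriv fX x * (u - x)\<bar> \<le> \<bar>deriv fX x\<bar> * h" unfolding abs_mult using u by (intro mult_left_mono) auto
    show ?thesis using fX_taylor[OF uc] a b by (simp add: distrib_right)
  qed
  have i: "integrable lborel (\<lambda>u. ?k u * fX u)"
    using D(2) h fX_pos by (intro integral_kern_remainder(1)[OF K, where b = D]) (auto simp: less_imp_le)
  have "expectation (\<lambda>\<omega>. ?k (X \<omega>)) = (\<integral>u. ?k u * fX u \<partial>lborel)"
    using expect_kern(2)[OF h(1), of "\<lambda>_. 1" 1 j] by simp
  then have "expectation (\<lambda>\<omega>. ?k (X \<omega>)) - fX x * kernel_moment K j = (\<integral>u. ?k u * fX u - ?k u * fX x \<partial>lborel)"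
    using i kp(4)[of x j] kp(5)[of x j] by simp
  also have "\<dots> = (\<integral>u. ?k u * (fX u - fX x) \<partial>lborel)" by (simp only: right_diff_distrib)
  finally have eq: "expectation (\<lambda>\<omega>. ?k (X \<omega>)) - fX x * kernel_moment K j = (\<integral>u. ?k u * (fX u - fX x) \<partial>lborel)" .
  show ?thesis unfolding eq
    using bd by (intro integral_kern_remainder(2)[OF K h(1)]) auto
qed

end

subsection \<open>A sample of fixed size\<close>

text \<open>Sample size, \<alpha> and bandwidth are fixed, while all constants come from the
  population model and are therefore uniform in them. The condition h \<le> c0 keeps the kernel
  window inside the neighbourhood of x where D is a bound.\<close>

locale intensity_sample = intensity_model P T M L X \<Lambda> K x \<kappa> M1 c0 D fX m g Pf
  for P :: "'a measure" and T M L and X :: "'a \<Rightarrow> real" and \<Lambda> :: "'a \<Rightarrow> real \<Rightarrow> real" and K x \<kappa> M1 c0 D fX m g Pf +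
  fixes Xs :: "nat \<Rightarrow> 'a \<Rightarrow> real" and \<Lambda>s :: "nat \<Rightarrow> 'a \<Rightarrow> real \<Rightarrow> real"
    and N :: "nat \<Rightarrow> 'a \<Rightarrow> real multiset" and \<alpha> h :: real and n :: nat
  assumes copies_indep: "indep_vars (\<lambda>_. borel \<Otimes>\<^sub>M intensity_algebra T) (\<lambda>i \<omega>. (Xs i \<omega>, \<Lambda>s i \<omega>)) {1..}"
    and copies_distr: "\<And>i. i \<ge> 1 \<Longrightarrow>
          distr P (borel \<Otimes>\<^sub>M intensity_algebra T) (\<lambda>\<omega>. (Xs i \<omega>, \<Lambda>s i \<omega>)) =
          distr P (borel \<Otimes>\<^sub>M intensity_algebra T) (\<lambda>\<omega>. (X \<omega>, \<Lambda> \<omega>))"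
    and n: "1 \<le> n" and \<alpha>: "0 < \<alpha>" and h: "0 < h" "h \<le> c0"
    and N_poisson: "cond_poisson_processes P
          (vimage_algebra (space P) (\<lambda>\<omega>. \<lambda>i\<in>{1..n}. (Xs i \<omega>, \<Lambda>s i \<omega>))
            (\<Pi>\<^sub>M i\<in>{1..n}. borel \<Otimes>\<^sub>M intensity_algebra T))
          T {1..n} (\<lambda>i \<omega> t. \<alpha> * \<Lambda>s i \<omega> t) N"
begin

abbreviation "S \<equiv> (borel :: real measure) \<Otimes>\<^sub>M intensity_algebra T"
abbreviation "Z i \<omega> \<equiv> (Xs i \<omega>, \<Lambda>s i \<omega>)"
abbreviation "\<tau>s i \<omega> \<equiv> intensity_factor T (\<Lambda>s i \<omega>)"

lemma Z_measurable: "i \<ge> 1 \<Longrightarrow> Z i \<in> P \<rightarrow>\<^sub>M S"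
  using copies_indep by (auto simp: indep_vars_def)

lemma Xs_measurable [measurable]: "i \<ge> 1 \<Longrightarrow> Xs i \<in> borel_measurable P"
  and \<Lambda>s_measurable [measurable]: "i \<ge> 1 \<Longrightarrow> \<Lambda>s i \<in> P \<rightarrow>\<^sub>M intensity_algebra T"
  using measurable_compose[OF Z_measurable measurable_fst] measurable_compose[OF Z_measurable measurable_snd] by auto

lemma Z0_measurable [measurable]: "(\<lambda>\<omega>. (X \<omega>, \<Lambda> \<omega>)) \<in> P \<rightarrow>\<^sub>M S" by measurable

lemma \<Lambda>s_mem: "i \<ge> 1 \<Longrightarrow> \<omega> \<in> space P \<Longrightarrow> \<Lambda>s i \<omega> \<in> intensity_set T"
  using measurable_space[OF \<Lambda>s_measurable] by (simp add: space_intensity_algebra)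

lemma \<tau>s_bounds: assumes i: "i \<ge> 1" shows "AE \<omega> in P. \<kappa> \<le> \<tau>s i \<omega> \<and> \<tau>s i \<omega> \<le> M1"
proof -
  have "AE z in distr P S (\<lambda>\<omega>. (X \<omega>, \<Lambda> \<omega>)). \<kappa> \<le> intensity_factor T (snd z) \<and> intensity_factor T (snd z) \<le> M1"
    using \<tau>_bounds(3) by (subst AE_distr_iff) auto
  then have "AE z in distr P S (Z i). \<kappa> \<le> intensity_factor T (snd z) \<and> intensity_factor T (snd z) \<le> M1"
    by (simp only: copies_distr[OF i])
  then show ?thesis by (subst (asm) AE_distr_iff[OF Z_measurable[OF i]]) auto
qed

lemma transfer_integrable:
  fixes \<phi> :: "_ \<Rightarrow> real"
  assumes "i \<ge> 1" "\<phi> \<in> borel_measurable S"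
  shows "integrable P (\<lambda>\<omega>. \<phi> (Z i \<omega>)) \<longleftrightarrow> integrable P (\<lambda>\<omega>. \<phi> (X \<omega>, \<Lambda> \<omega>))"
    and "expectation (\<lambda>\<omega>. \<phi> (Z i \<omega>)) = expectation (\<lambda>\<omega>. \<phi> (X \<omega>, \<Lambda> \<omega>))"
  using integrable_distr_eq[OF Z_measurable[OF assms(1)] assms(2)] integrable_distr_eq[OF Z0_measurable assms(2)]
    integral_distr[OF Z_measurable[OF assms(1)] assms(2)] integral_distr[OF Z0_measurable assms(2)] copies_distr[OF assms(1)] by simp_all

lemma mean_square:
  assumes "\<phi> \<in> borel_measurable S" "integrable P (\<lambda>\<omega>. (\<phi> (X \<omega>, \<Lambda> \<omega>))\<^sup>2)"
    and "\<bar>expectation (\<lambda>\<omega>. \<phi> (X \<omega>, \<Lambda> \<omega>))\<bar> \<le> b" "expectation (\<lambda>\<omega>. (\<phi> (X \<omega>, \<Lambda> \<omega>))\<^sup>2) \<le> v"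
  shows "integrable P (\<lambda>\<omega>. ((\<Sum>i=1..n. \<phi> (Z i \<omega>)) / real n)\<^sup>2)"
    and "expectation (\<lambda>\<omega>. ((\<Sum>i=1..n. \<phi> (Z i \<omega>)) / real n)\<^sup>2) \<le> b\<^sup>2 + v / real n"
proof -
  note * = iid_mean_square[OF copies_indep copies_distr Z0_measurable assms(1,2) n]
  show "integrable P (\<lambda>\<omega>. ((\<Sum>i=1..n. \<phi> (Z i \<omega>)) / real n)\<^sup>2)" by (rule *)
  have "(expectation (\<lambda>\<omega>. \<phi> (X \<omega>, \<Lambda> \<omega>)))\<^sup>2 \<le> b\<^sup>2" using power_mono[OF assms(3), of 2] by simp
  moreover have "expectation (\<lambda>\<omega>. (\<phi> (X \<omega>, \<Lambda> \<omega>))\<^sup>2) / real n \<le> v / real n" using assms(4) by (simp add: divide_right_mono)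
  ultimately show "expectation (\<lambda>\<omega>. ((\<Sum>i=1..n. \<phi> (Z i \<omega>)) / real n)\<^sup>2) \<le> b\<^sup>2 + v / real n"
    using *(2) by linarith
qed

text \<open>The square of a kernel weight is at most D / h times the kernel of order 0, whose
  expectation is at most D; this is the source of 1 / (n h). The bias bound b enters separately and
  may be far smaller than the residual bound B.\<close>

lemma local_average_mean_square:
  assumes r[measurable]: "r \<in> borel_measurable S"
    and B: "AE \<omega> in P. \<bar>X \<omega> - x\<bar> \<le> h \<longrightarrow> \<bar>r (X \<omega>, \<Lambda> \<omega>)\<bar> \<le> B"
    and b: "\<bar>expectation (\<lambda>\<omega>. kern K x h j (X \<omega>) * r (X \<omega>, \<Lambda> \<omega>))\<bar> \<le> b"
  shows "integrable P (\<lambda>\<omega>. (local_average K x h n (\<lambda>i. Xs i \<omega>) (\<lambda>i. r (Z i \<omega>)) j)\<^sup>2)"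
    and "expectation (\<lambda>\<omega>. (local_average K x h n (\<lambda>i. Xs i \<omega>) (\<lambda>i. r (Z i \<omega>)) j)\<^sup>2) \<le> b\<^sup>2 + (B\<^sup>2 * D * D / h) / real n"
proof -
  note kp = kern_props[OF K h(1)]
  note [measurable] = kp(1)[of x j] kp(1)[of x 0]
  define \<phi> where "\<phi> z = kern K x h j (fst z) * r z" for z
  have \<phi>m[measurable]: "\<phi> \<in> borel_measurable S" unfolding \<phi>_def by measurable
  have le: "AE \<omega> in P. (\<phi> (X \<omega>, \<Lambda> \<omega>))\<^sup>2 \<le> B\<^sup>2 * D / h * kern K x h 0 (X \<omega>)"
    using B
  proof eventually_elim
    case (elim \<omega>)
    show ?case
    proof (cases "\<bar>X \<omega> - x\<bar> \<le> h")
      case True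
      then have "(r (X \<omega>, \<Lambda> \<omega>))\<^sup>2 \<le> B\<^sup>2" using elim power_mono[of "\<bar>r (X \<omega>, \<Lambda> \<omega>)\<bar>" B 2] by simp
      moreover have "(kern K x h j (X \<omega>))\<^sup>2 \<le> kern K x h 0 (X \<omega>) * (D / h)"
      proof -
        have "(kern K x h j (X \<omega>))\<^sup>2 \<le> (kern K x h 0 (X \<omega>))\<^sup>2"
          using power_mono[OF kp(2)[of x j "X \<omega>"], of 2] by simp
        also have "\<dots> \<le> kern K x h 0 (X \<omega>) * (D / h)"
          unfolding power2_eq_square using kp(6) kp(7)[OF D(1)] by (intro mult_left_mono) auto
        finally show ?thesis .
      qed
      ultimately have "(kern K x h j (X \<omega>))\<^sup>2 * (r (X \<omega>, \<Lambda> \<omega>))\<^sup>2 \<le> (kern K x h 0 (X \<omega>) * (D / h)) * B\<^sup>2"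
        using kp(6) D_pos h by (intro mult_mono) auto
      then show ?thesis by (simp add: \<phi>_def power_mult_distrib mult_ac)
    qed (use kp(3,6) D_pos h in \<open>simp add: \<phi>_def\<close>)
  qed
  have i: "integrable P (\<lambda>\<omega>. B\<^sup>2 * D / h * kern K x h 0 (X \<omega>))" using expect_kern_0[OF h] by simp
  have i2: "integrable P (\<lambda>\<omega>. (\<phi> (X \<omega>, \<Lambda> \<omega>))\<^sup>2)"
  proof (rule Bochner_Integration.integrable_bound[OF i])
    show "AE \<omega> in P. norm ((\<phi> (X \<omega>, \<Lambda> \<omega>))\<^sup>2) \<le> norm (B\<^sup>2 * D / h * kern K x h 0 (X \<omega>))"
      using le
    proof eventually_elim
      case (elim \<omega>)
      have "0 \<le> B\<^sup>2 * D / h * kern K x h 0 (X \<omega>)" using kp(6) D_pos h by simp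
      then show ?case using elim by (simp only: real_norm_def abs_of_nonneg zero_le_power2)
    qed
  qed measurable
  have "expectation (\<lambda>\<omega>. (\<phi> (X \<omega>, \<Lambda> \<omega>))\<^sup>2) \<le> expectation (\<lambda>\<omega>. B\<^sup>2 * D / h * kern K x h 0 (X \<omega>))"
    by (rule integral_mono_AE[OF i2 i le])
  also have "\<dots> \<le> B\<^sup>2 * D / h * D"
    unfolding integral_mult_right_zero using expect_kern_0(2)[OF h] D_pos h by (intro mult_left_mono) auto
  finally have v: "expectation (\<lambda>\<omega>. (\<phi> (X \<omega>, \<Lambda> \<omega>))\<^sup>2) \<le> B\<^sup>2 * D * D / h" by (simp add: mult_ac)
  show "integrable P (\<lambda>\<omega>. (local_average K x h n (\<lambda>i. Xs i \<omega>) (\<lambda>i. r (Z i \<omega>)) j)\<^sup>2)"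
    "expectation (\<lambda>\<omega>. (local_average K x h n (\<lambda>i. Xs i \<omega>) (\<lambda>i. r (Z i \<omega>)) j)\<^sup>2) \<le> b\<^sup>2 + (B\<^sup>2 * D * D / h) / real n"
    using mean_square[OF \<phi>m i2 _ v, of b] b by (simp_all add: \<phi>_def local_average_def)
qed

end

section \<open>Empirical distributions and scaled counts\<close>

lemma cdf_measure_pmf_real_distribution:
  "real_distribution (distr (measure_pmf p) borel id)" "cdf (distr (measure_pmf p) borel id) = cdf (measure_pmf p)"
proof -
  show "real_distribution (distr (measure_pmf p) borel id)"
    using prob_space.real_distribution_distr[OF prob_space_measure_pmf, of id p] by simp
  show "cdf (distr (measure_pmf p) borel id) = cdf (measure_pmf p)"
    by (rule ext) (simp add: cdf_def2 measure_distr)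
qed

lemma measure_pmf_of_multiset:
  assumes "N \<noteq> {#}"
  shows "measure (measure_pmf (pmf_of_multiset N)) B = real (num_points N B) / real (size N)"
proof -
  have "measure (measure_pmf (pmf_of_multiset N)) B = measure (measure_pmf (pmf_of_multiset N)) (B \<inter> set_mset N)"
    using measure_Int_set_pmf[of "pmf_of_multiset N" B] unfolding set_pmf_of_multiset[OF assms] by (rule sym)
  also have "\<dots> = (\<Sum>t\<in>B \<inter> set_mset N. count N t / size N)"
    using assms by (subst measure_measure_pmf_finite) auto
  also have "\<dots> = real (\<Sum>t\<in>B \<inter> set_mset N. count N t) / size N" by (simp add: sum_divide_distrib)
  also have "(\<Sum>t\<in>B \<inter> set_mset N. count N t) = num_points N B"
    unfolding num_points_def size_multiset_overloaded_eq by (intro sum.cong) auto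
  finally show ?thesis .
qed

text \<open>The empirical measure of a pattern is discrete, with every set measurable; its image on
  the Borel sets has the same distribution function and hence the same quantiles. For the empty
  pattern no formula for the distribution function is claimed.\<close>

lemma empirical_distribution:
  assumes T: "0 < T" and N: "set_mset N \<subseteq> {0..T}"
  obtains \<mu> where "real_distribution \<mu>" "cdf \<mu> T = 1" "empirical_quantile T N = quantile T \<mu>"
    "\<And>u. N \<noteq> {#} \<Longrightarrow> 0 \<le> u \<Longrightarrow> cdf \<mu> u = real (num_points N {0..u}) / real (size N)"
proof (cases "N = {#}")
  case True
  have ps: "prob_space (uniform_measure lborel {0..T})" using T by (intro prob_space_uniform_measure) auto
  have "measure (uniform_measure lborel {0..T}) {..T} = 1"
    using T by (subst measure_uniform_measure) (auto simp: Int_absorb2 Int_absorb1 divide_self)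
  then show ?thesis using that[of "uniform_measure lborel {0..T}"] True ps
    by (simp add: empirical_quantile_def cdf_def2 real_distribution_def real_distribution_axioms_def)
next
  case False
  let ?p = "pmf_of_multiset N"
  have eq: "num_points N {..u} = num_points N {0..u}" if "0 \<le> u" for u
  proof -
    have "{#t \<in># N. t \<in> {..u}#} = {#t \<in># N. t \<in> {0..u}#}" using N by (intro filter_mset_cong) auto
    then show ?thesis by (simp only: num_points_def)
  qed
  have full: "num_points N {0..T} = size N"
  proof -
    have "{#t \<in># N. t \<in> {0..T}#} = N" using N by (subst filter_mset_eq_conv) auto
    then show ?thesis by (simp only: num_points_def)
  qed
  have c: "cdf (distr (measure_pmf ?p) borel id) u = real (num_points N {0..u}) / real (size N)" if "0 \<le> u" for u
    unfolding cdf_measure_pmf_real_distribution(2) cdf_def2 measure_pmf_of_multiset[OF False] eq[OF that] ..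
  have "quantile T (measure_pmf ?p) = quantile T (distr (measure_pmf ?p) borel id)"
    by (rule ext) (simp only: quantile_def cdf_measure_pmf_real_distribution(2))
  then show ?thesis
    using that[OF cdf_measure_pmf_real_distribution(1)[of ?p]] c full False T
    by (simp add: empirical_quantile_def)
qed

lemma num_points_all: "set_mset N \<subseteq> {0..T} \<Longrightarrow> num_points N {0..T} = size N"
proof -
  assume N: "set_mset N \<subseteq> {0..T}"
  have "{#t \<in># N. t \<in> {0..T}#} = N" using N by (subst filter_mset_eq_conv) auto
  then show ?thesis by (simp only: num_points_def)
qed

lemma num_points_le: "num_points N B \<le> size N"
  unfolding num_points_def by (rule size_mset_mono) simp

text \<open>The difference of quotients is rewritten with A / S as the coefficient of the error of
  S. As A / S \<le> 1, the random denominator S never has to be bounded away from 0.\<close>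

lemma ratio_deviation:
  fixes A S l \<tau> \<alpha> :: real
  assumes "0 \<le> A" "A \<le> S" "0 < S" "0 < \<tau>" "0 < \<alpha>"
  shows "\<bar>A / S - l / \<tau>\<bar> \<le> (\<bar>A / \<alpha> - l\<bar> + \<bar>S / \<alpha> - \<tau>\<bar>) / \<tau>"
proof -
  have "A / S - l / \<tau> = (A / S) * ((\<tau> - S / \<alpha>) / \<tau>) + (A / \<alpha> - l) / \<tau>"
    using assms by (simp add: field_simps)
  also have "\<bar>\<dots>\<bar> \<le> (A / S) * (\<bar>S / \<alpha> - \<tau>\<bar> / \<tau>) + \<bar>A / \<alpha> - l\<bar> / \<tau>"
    using assms by (intro order_trans[OF abs_triangle_ineq]) (simp add: abs_mult abs_minus_commute)
  also have "\<dots> \<le> 1 * (\<bar>S / \<alpha> - \<tau>\<bar> / \<tau>) + \<bar>A / \<alpha> - l\<bar> / \<tau>"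
    using assms by (intro add_mono mult_right_mono) auto
  finally show ?thesis by (simp add: add_divide_distrib add.commute)
qed

text \<open>The inequality of arithmetic and geometric mean. For z with second moment of order 1 /
  \<alpha>, the choice s = \<open>sqrt \<alpha>\<close> gives both terms the order 1 /
  \<open>sqrt \<alpha>\<close>.\<close>

lemma abs_le_square_balance:
  fixes z s :: real
  assumes "0 < s"
  shows "\<bar>z\<bar> \<le> (s * z\<^sup>2 + 1 / s) / 2"
proof -
  have "0 \<le> (sqrt s * \<bar>z\<bar> - 1 / sqrt s)\<^sup>2" by simp
  also have "\<dots> = s * z\<^sup>2 - 2 * \<bar>z\<bar> + 1 / s"
    using assms by (simp add: power2_diff power_mult_distrib power_divide)
  finally show ?thesis by simp
qed

context intensity_model
begin

text \<open>Bounds, uniform in the sample size, for the bias of the design moments (\<open>Bd\<close>), the residuals of the two local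
  linear fits (\<open>B\<tau>\<close>, \<open>Br\<close>) and the error of the empirical quantile functions (\<open>BD\<close>).\<close>

definition Bd where "Bd = \<bar>deriv fX x\<bar> + D * c0"
definition B\<tau> where "B\<tau> = M1 + \<bar>m x\<bar> + \<bar>deriv m x\<bar> * c0"
definition Br where "Br = 2 * T + Bb * c0"
definition BD where "BD = T\<^sup>2 * D * (1 + (M1 + 1) / \<kappa>)"

end

section \<open>Mean squares of the averages over the sample\<close>

context intensity_sample
begin

lemma design_mean_square:
  shows "integrable P (\<lambda>\<omega>. (local_moment K x h n (\<lambda>i. Xs i \<omega>) j - fX x * kernel_moment K j)\<^sup>2)"
    and "expectation (\<lambda>\<omega>. (local_moment K x h n (\<lambda>i. Xs i \<omega>) j - fX x * kernel_moment K j)\<^sup>2)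
      \<le> (Bd * h)\<^sup>2 + (2 * D * D / h + 2 * (fX x * kernel_moment K j)\<^sup>2) / real n"
proof -
  note kp = kern_props[OF K h(1)]
  note [measurable] = kp(1)[of x j]
  define c where "c = fX x * kernel_moment K j"
  define \<phi> where "\<phi> z = kern K x h j (fst z) - c" for z :: "real \<times> (real \<Rightarrow> real)"
  have \<phi>m[measurable]: "\<phi> \<in> borel_measurable S" unfolding \<phi>_def by measurable
  have le: "(\<phi> (u, l))\<^sup>2 \<le> 2 * D / h * kern K x h 0 u + 2 * c\<^sup>2" for u l
  proof -
    have "(kern K x h j u)\<^sup>2 \<le> (kern K x h 0 u)\<^sup>2" using power_mono[OF kp(2)[of x j u], of 2] by simp
    also have "\<dots> \<le> kern K x h 0 u * (D / h)"
      unfolding power2_eq_square using kp(6) kp(7)[OF D(1)] by (intro mult_left_mono) auto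
    finally have a: "(kern K x h j u)\<^sup>2 \<le> D / h * kern K x h 0 u" by (simp add: mult.commute)
    have "0 \<le> (kern K x h j u + c)\<^sup>2" by simp
    then have "(kern K x h j u - c)\<^sup>2 \<le> 2 * (kern K x h j u)\<^sup>2 + 2 * c\<^sup>2"
      by (simp add: power2_eq_square algebra_simps)
    then show ?thesis using a by (simp add: \<phi>_def)
  qed
  have i: "integrable P (\<lambda>\<omega>. 2 * D / h * kern K x h 0 (X \<omega>) + 2 * c\<^sup>2)" using expect_kern_0[OF h] by simp
  have i2: "integrable P (\<lambda>\<omega>. (\<phi> (X \<omega>, \<Lambda> \<omega>))\<^sup>2)"
  proof (rule Bochner_Integration.integrable_bound[OF i])
    show "AE \<omega> in P. norm ((\<phi> (X \<omega>, \<Lambda> \<omega>))\<^sup>2) \<le> norm (2 * D / h * kern K x h 0 (X \<omega>) + 2 * c\<^sup>2)"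
    proof (rule AE_I2)
      fix \<omega>
      have "0 \<le> 2 * D / h * kern K x h 0 (X \<omega>) + 2 * c\<^sup>2" using kp(6) D_pos h by simp
      then show "norm ((\<phi> (X \<omega>, \<Lambda> \<omega>))\<^sup>2) \<le> norm (2 * D / h * kern K x h 0 (X \<omega>) + 2 * c\<^sup>2)"
        using le by (simp only: real_norm_def abs_of_nonneg zero_le_power2)
    qed
  qed measurable
  have "expectation (\<lambda>\<omega>. (\<phi> (X \<omega>, \<Lambda> \<omega>))\<^sup>2) \<le> expectation (\<lambda>\<omega>. 2 * D / h * kern K x h 0 (X \<omega>) + 2 * c\<^sup>2)"
    by (intro integral_mono i2 i le)
  also have "\<dots> = 2 * D / h * expectation (\<lambda>\<omega>. kern K x h 0 (X \<omega>)) + 2 * c\<^sup>2"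
    using expect_kern_0[OF h] by (simp add: prob_space)
  also have "\<dots> \<le> 2 * D / h * D + 2 * c\<^sup>2"
    using expect_kern_0(2)[OF h] D_pos h by (intro add_right_mono mult_left_mono) auto
  finally have v: "expectation (\<lambda>\<omega>. (\<phi> (X \<omega>, \<Lambda> \<omega>))\<^sup>2) \<le> 2 * D * D / h + 2 * c\<^sup>2" by simp
  have "integrable P (\<lambda>\<omega>. kern K x h j (X \<omega>))" using expect_kern(1)[OF h(1), of "\<lambda>_. 1" 1 j] by simp
  then have b: "\<bar>expectation (\<lambda>\<omega>. \<phi> (X \<omega>, \<Lambda> \<omega>))\<bar> \<le> Bd * h"
    using design_bias[OF h, of j] by (simp add: \<phi>_def c_def Bd_def prob_space)
  have "(\<Sum>i=1..n. \<phi> (Z i \<omega>)) / real n = local_moment K x h n (\<lambda>i. Xs i \<omega>) j - c" for \<omega>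
    using n by (simp add: \<phi>_def local_average_def sum_subtractf diff_divide_distrib)
  then show "integrable P (\<lambda>\<omega>. (local_moment K x h n (\<lambda>i. Xs i \<omega>) j - fX x * kernel_moment K j)\<^sup>2)"
    "expectation (\<lambda>\<omega>. (local_moment K x h n (\<lambda>i. Xs i \<omega>) j - fX x * kernel_moment K j)\<^sup>2)
      \<le> (Bd * h)\<^sup>2 + (2 * D * D / h + 2 * (fX x * kernel_moment K j)\<^sup>2) / real n"
    using mean_square[OF \<phi>m i2 b v] by (simp_all only: c_def)
qed

lemma tau_mean_square:
  shows "integrable P (\<lambda>\<omega>. ((\<Sum>i=1..n. \<tau>s i \<omega>) / real n - expectation \<tau>)\<^sup>2)"
    and "expectation (\<lambda>\<omega>. ((\<Sum>i=1..n. \<tau>s i \<omega>) / real n - expectation \<tau>)\<^sup>2) \<le> M1\<^sup>2 / real n"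
proof -
  define c where "c = expectation \<tau>"
  define \<phi> where "\<phi> z = intensity_factor T (snd z) - c" for z :: "real \<times> (real \<Rightarrow> real)"
  have \<phi>m[measurable]: "\<phi> \<in> borel_measurable S" unfolding \<phi>_def by measurable
  have le: "AE \<omega> in P. (\<phi> (X \<omega>, \<Lambda> \<omega>))\<^sup>2 \<le> M1\<^sup>2"
    using \<tau>_bounds(3)
  proof eventually_elim
    case (elim \<omega>)
    then have "\<bar>\<phi> (X \<omega>, \<Lambda> \<omega>)\<bar> \<le> M1" using E\<tau>_bounds \<tau>_bounds(1) by (simp add: \<phi>_def c_def abs_le_iff)
    then show ?case using power_mono[of "\<bar>\<phi> (X \<omega>, \<Lambda> \<omega>)\<bar>" M1 2] by simp
  qed
  have i2: "integrable P (\<lambda>\<omega>. (\<phi> (X \<omega>, \<Lambda> \<omega>))\<^sup>2)"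
    by (rule integrable_const_bound[where B = "M1\<^sup>2"]) (use le in auto)
  have v: "expectation (\<lambda>\<omega>. (\<phi> (X \<omega>, \<Lambda> \<omega>))\<^sup>2) \<le> M1\<^sup>2"
    using integral_mono_AE[OF i2 _ le] by (simp add: prob_space)
  have b: "\<bar>expectation (\<lambda>\<omega>. \<phi> (X \<omega>, \<Lambda> \<omega>))\<bar> \<le> 0"
    using \<tau>_integrable by (simp add: \<phi>_def c_def prob_space)
  have "(\<Sum>i=1..n. \<phi> (Z i \<omega>)) / real n = (\<Sum>i=1..n. \<tau>s i \<omega>) / real n - c" for \<omega>
    using n by (simp add: \<phi>_def sum_subtractf diff_divide_distrib)
  then show "integrable P (\<lambda>\<omega>. ((\<Sum>i=1..n. \<tau>s i \<omega>) / real n - expectation \<tau>)\<^sup>2)"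
    "expectation (\<lambda>\<omega>. ((\<Sum>i=1..n. \<tau>s i \<omega>) / real n - expectation \<tau>)\<^sup>2) \<le> M1\<^sup>2 / real n"
    using mean_square[OF \<phi>m i2 b v] by (simp_all add: c_def)
qed

lemma tau_local_average:
  shows "integrable P (\<lambda>\<omega>. (local_average K x h n (\<lambda>i. Xs i \<omega>) (\<lambda>i. \<tau>s i \<omega> - m x - deriv m x * (Xs i \<omega> - x)) j)\<^sup>2)"
    and "expectation (\<lambda>\<omega>. (local_average K x h n (\<lambda>i. Xs i \<omega>) (\<lambda>i. \<tau>s i \<omega> - m x - deriv m x * (Xs i \<omega> - x)) j)\<^sup>2)
      \<le> (D * D * h\<^sup>2)\<^sup>2 + (B\<tau>\<^sup>2 * D * D / h) / real n"
proof -
  let ?r = "\<lambda>z. intensity_factor T (snd z) - m x - deriv m x * (fst z - x)"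
  have r: "?r \<in> borel_measurable S" by measurable
  have B: "AE \<omega> in P. \<bar>X \<omega> - x\<bar> \<le> h \<longrightarrow> \<bar>?r (X \<omega>, \<Lambda> \<omega>)\<bar> \<le> B\<tau>"
    using \<tau>_bounds(3)
  proof eventually_elim
    case (elim \<omega>)
    have "\<bar>deriv m x * (X \<omega> - x)\<bar> \<le> \<bar>deriv m x\<bar> * c0" if "\<bar>X \<omega> - x\<bar> \<le> h"
      unfolding abs_mult using that h by (intro mult_left_mono) auto
    then show ?case using elim \<tau>_bounds(1) unfolding B\<tau>_def fst_conv snd_conv by linarith
  qed
  have b: "\<bar>expectation (\<lambda>\<omega>. kern K x h j (X \<omega>) * ?r (X \<omega>, \<Lambda> \<omega>))\<bar> \<le> D * D * h\<^sup>2"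
    using tau_bias[OF h, of j] by simp
  show "integrable P (\<lambda>\<omega>. (local_average K x h n (\<lambda>i. Xs i \<omega>) (\<lambda>i. \<tau>s i \<omega> - m x - deriv m x * (Xs i \<omega> - x)) j)\<^sup>2)"
    "expectation (\<lambda>\<omega>. (local_average K x h n (\<lambda>i. Xs i \<omega>) (\<lambda>i. \<tau>s i \<omega> - m x - deriv m x * (Xs i \<omega> - x)) j)\<^sup>2)
      \<le> (D * D * h\<^sup>2)\<^sup>2 + (B\<tau>\<^sup>2 * D * D / h) / real n"
    using local_average_mean_square[OF r B b] by simp_all
qed

text \<open>The residual of the affine approximation at level t, as a measurable function on the
  space of pairs. It can then be evaluated at the copies, of which only the law is known.\<close>

definition resid :: "real \<Rightarrow> real \<times> (real \<Rightarrow> real) \<Rightarrow> real" where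
  "resid t z = intensity_quantile T (snd z) t - q0 t - b0 t * (fst z - x)"

lemma resid_measurable [measurable]: "(\<lambda>(t, z). resid t z) \<in> borel_measurable (borel \<Otimes>\<^sub>M S)"
proof -
  have [measurable]: "(\<lambda>(t, g). intensity_quantile T g t) \<in> borel_measurable (borel \<Otimes>\<^sub>M intensity_algebra T)"
    using intensity_quantile_measurable TML by simp
  have "(\<lambda>w. (\<lambda>(t, g). intensity_quantile T g t) (fst w, snd (snd w))) \<in> borel_measurable (borel \<Otimes>\<^sub>M S)"
    by measurable
  then have [measurable]: "(\<lambda>w. intensity_quantile T (snd (snd w)) (fst w)) \<in> borel_measurable (borel \<Otimes>\<^sub>M S)" by simp
  show ?thesis unfolding resid_def split_beta' by measurable
qed

lemma resid_bound:
  assumes "snd z \<in> intensity_set T" "\<bar>fst z - x\<bar> \<le> h"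
  shows "\<bar>resid t z\<bar> \<le> Br"
proof -
  have "\<bar>b0 t * (fst z - x)\<bar> \<le> Bb * c0" unfolding abs_mult using assms(2) h b0_abs_le Bb_nonneg by (intro mult_mono) auto
  moreover have "\<bar>intensity_quantile T (snd z) t\<bar> \<le> T" using intensity_quantile_bounds[OF assms(1), of t] TML by auto
  ultimately show ?thesis using q0_abs_le[of t] unfolding resid_def Br_def by linarith
qed

abbreviation "shape_average j t \<omega> \<equiv> local_average K x h n (\<lambda>i. Xs i \<omega>) (\<lambda>i. resid t (Z i \<omega>)) j"

lemma shape_average_pointwise:
  shows "integrable P (\<lambda>\<omega>. (shape_average j t \<omega>)\<^sup>2)"
    and "expectation (\<lambda>\<omega>. (shape_average j t \<omega>)\<^sup>2) \<le> (Bq * h\<^sup>2)\<^sup>2 + (Br\<^sup>2 * D * D / h) / real n"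
proof -
  have r: "resid t \<in> borel_measurable S"
    using measurable_compose[OF _ resid_measurable, of "\<lambda>z. (t, z)" S] by simp
  have B: "AE \<omega> in P. \<bar>X \<omega> - x\<bar> \<le> h \<longrightarrow> \<bar>resid t (X \<omega>, \<Lambda> \<omega>)\<bar> \<le> Br"
    using resid_bound[of "(X _, \<Lambda> _)"] \<Lambda>_mem by (intro AE_I2) auto
  have "expectation (\<lambda>\<omega>. kern K x h j (X \<omega>) * resid t (X \<omega>, \<Lambda> \<omega>))
      = expectation (\<lambda>\<omega>. kern K x h j (X \<omega>) * (Q t (f \<omega>) - q0 t - b0 t * (X \<omega> - x)))"
    by (intro Bochner_Integration.integral_cong) (auto simp: resid_def Q_eq_intensity_quantile)
  then have b: "\<bar>expectation (\<lambda>\<omega>. kern K x h j (X \<omega>) * resid t (X \<omega>, \<Lambda> \<omega>))\<bar> \<le> Bq * h\<^sup>2"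
    using shape_bias[OF h, of j t] by simp
  show "integrable P (\<lambda>\<omega>. (shape_average j t \<omega>)\<^sup>2)"
    "expectation (\<lambda>\<omega>. (shape_average j t \<omega>)\<^sup>2) \<le> (Bq * h\<^sup>2)\<^sup>2 + (Br\<^sup>2 * D * D / h) / real n"
    using local_average_mean_square[OF r B b] by simp_all
qed

lemma shape_average_abs_le:
  assumes w: "\<omega> \<in> space P"
  shows "\<bar>shape_average j t \<omega>\<bar> \<le> D / h * Br"
proof -
  note kp = kern_props[OF K h(1)]
  have Br0: "0 \<le> Br" unfolding Br_def using TML Bb_nonneg c0 by (intro add_nonneg_nonneg mult_nonneg_nonneg) auto
  have tm: "\<bar>kern K x h j (Xs i \<omega>) * resid t (Z i \<omega>)\<bar> \<le> D / h * Br" if i: "i \<in> {1..n}" for i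
  proof (cases "\<bar>Xs i \<omega> - x\<bar> \<le> h")
    case True
    have "\<bar>resid t (Z i \<omega>)\<bar> \<le> Br" using True \<Lambda>s_mem[OF _ w, of i] i by (intro resid_bound) auto
    moreover have "\<bar>kern K x h j (Xs i \<omega>)\<bar> \<le> D / h" using kp(2,7) D(1) order_trans by blast
    ultimately show ?thesis unfolding abs_mult using D_pos h by (intro mult_mono) auto
  qed (use kp(3) D_pos h Br0 in auto)
  have "\<bar>\<Sum>i=1..n. kern K x h j (Xs i \<omega>) * resid t (Z i \<omega>)\<bar> \<le> (\<Sum>i=1..n. D / h * Br)"
    by (rule order_trans[OF sum_abs sum_mono[OF tm]])
  also have "\<dots> = real n * (D / h * Br)" by simp
  finally have "\<bar>\<Sum>i=1..n. kern K x h j (Xs i \<omega>) * resid t (Z i \<omega>)\<bar> \<le> (D / h * Br) * real n" by (simp only: mult.commute)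
  then show ?thesis unfolding local_average_def abs_divide using n by (simp add: pos_divide_le_eq)
qed

lemma shape_average_measurable [measurable]: "(\<lambda>(\<omega>, t). shape_average j t \<omega>) \<in> borel_measurable (P \<Otimes>\<^sub>M borel)"
proof -
  note kp = kern_props[OF K h(1)]
  note [measurable] = kp(1)[of x j]
  have m: "(\<lambda>w. kern K x h j (Xs i (fst w)) * resid (snd w) (Z i (fst w))) \<in> borel_measurable (P \<Otimes>\<^sub>M borel)"
    if "i \<in> {1..n}" for i
  proof -
    have i: "i \<ge> 1" using that by auto
    note [measurable] = Xs_measurable[OF i] \<Lambda>s_measurable[OF i]
    have "(\<lambda>w. (\<lambda>(t, z). resid t z) (snd w, Z i (fst w))) \<in> borel_measurable (P \<Otimes>\<^sub>M borel)" by measurable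
    then have [measurable]: "(\<lambda>w. resid (snd w) (Z i (fst w))) \<in> borel_measurable (P \<Otimes>\<^sub>M borel)" by simp
    show ?thesis by measurable
  qed
  show ?thesis unfolding local_average_def split_beta'
    by (intro borel_measurable_divide borel_measurable_sum borel_measurable_const m)
qed

lemma shape_average_section:
  assumes w: "\<omega> \<in> space P"
  shows "set_borel_measurable lborel {0..1} (\<lambda>t. shape_average j t \<omega>)"
    "set_integrable lborel {0..1} (\<lambda>t. (shape_average j t \<omega>)\<^sup>2)"
proof -
  have m: "(\<lambda>t. shape_average j t \<omega>) \<in> borel_measurable borel"
    using measurable_compose[OF measurable_Pair1'[OF w, of borel] shape_average_measurable[of j]] by simp
  then show "set_borel_measurable lborel {0..1} (\<lambda>t. shape_average j t \<omega>)" by (simp add: set_borel_measurable_def)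
  show "set_integrable lborel {0..1} (\<lambda>t. (shape_average j t \<omega>)\<^sup>2)"
  proof (rule set_integrable_bounded)
    show "\<bar>(shape_average j t \<omega>)\<^sup>2\<bar> \<le> (D / h * Br)\<^sup>2" for t
      using power_mono[OF shape_average_abs_le[OF w, of t j], of 2] by simp
  qed (use m in \<open>simp add: set_borel_measurable_def\<close>)
qed

text \<open>The bound at a single level is uniform in t, so Fubini over the unit interval keeps it
  unchanged.\<close>

lemma shape_average_L2:
  shows "integrable P (\<lambda>\<omega>. LBINT t:{0..1}. (shape_average j t \<omega>)\<^sup>2)"
    and "expectation (\<lambda>\<omega>. LBINT t:{0..1}. (shape_average j t \<omega>)\<^sup>2) \<le> (Bq * h\<^sup>2)\<^sup>2 + (Br\<^sup>2 * D * D / h) / real n"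
proof -
  interpret pp: pair_sigma_finite P lborel ..
  let ?I = "indicator {0..1::real} :: real \<Rightarrow> real"
  have i: "integrable (P \<Otimes>\<^sub>M lborel) (\<lambda>(\<omega>, t). ?I t * (shape_average j t \<omega>)\<^sup>2)"
  proof (rule Bochner_Integration.integrable_bound)
    have fin: "emeasure (P \<Otimes>\<^sub>M lborel) (space P \<times> {0..1::real}) < \<infinity>"
      by (subst lborel.emeasure_pair_measure_Times) (auto simp: emeasure_space_1)
    show "integrable (P \<Otimes>\<^sub>M lborel) (\<lambda>z. (D / h * Br)\<^sup>2 * indicator (space P \<times> {0..1::real}) z)"
      by (intro integrable_mult_right integrable_real_indicator pair_measureI) (use fin in auto)
    have [measurable]: "(\<lambda>(\<omega>, t). shape_average j t \<omega>) \<in> borel_measurable (P \<Otimes>\<^sub>M lborel)"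
      using shape_average_measurable[of j] by (simp cong: measurable_cong_sets sets_pair_measure_cong)
    show "(\<lambda>(\<omega>, t). ?I t * (shape_average j t \<omega>)\<^sup>2) \<in> borel_measurable (P \<Otimes>\<^sub>M lborel)" by measurable
    show "AE z in P \<Otimes>\<^sub>M lborel. norm (case z of (\<omega>, t) \<Rightarrow> ?I t * (shape_average j t \<omega>)\<^sup>2)
       \<le> norm ((D / h * Br)\<^sup>2 * indicator (space P \<times> {0..1::real}) z)"
    proof (rule AE_I2)
      fix z assume "z \<in> space (P \<Otimes>\<^sub>M (lborel :: real measure))"
      then obtain \<omega> t where z: "z = (\<omega>, t)" "\<omega> \<in> space P" by (auto simp: space_pair_measure)
      have "(shape_average j t \<omega>)\<^sup>2 \<le> (D / h * Br)\<^sup>2"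
        using power_mono[OF shape_average_abs_le[OF z(2), of t j], of 2] by simp
      then show "norm (case z of (\<omega>, t) \<Rightarrow> ?I t * (shape_average j t \<omega>)\<^sup>2)
         \<le> norm ((D / h * Br)\<^sup>2 * indicator (space P \<times> {0..1::real}) z)"
        using z by (simp add: indicator_def)
    qed
  qed
  show "integrable P (\<lambda>\<omega>. LBINT t:{0..1}. (shape_average j t \<omega>)\<^sup>2)"
    using pp.integrable_fst[OF i] by (simp add: set_lebesgue_integral_def)
  let ?c = "(Bq * h\<^sup>2)\<^sup>2 + (Br\<^sup>2 * D * D / h) / real n"
  have "expectation (\<lambda>\<omega>. LBINT t:{0..1}. (shape_average j t \<omega>)\<^sup>2)
     = (\<integral>t. expectation (\<lambda>\<omega>. ?I t * (shape_average j t \<omega>)\<^sup>2) \<partial>lborel)"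
    unfolding set_lebesgue_integral_def using pp.Fubini_integral[OF i] by simp
  also have "\<dots> \<le> (\<integral>t. ?c * ?I t \<partial>(lborel :: real measure))"
  proof (rule integral_mono)
    show "integrable lborel (\<lambda>t. expectation (\<lambda>\<omega>. ?I t * (shape_average j t \<omega>)\<^sup>2))" by (rule pp.integrable_snd[OF i])
    show "integrable lborel (\<lambda>t. ?c * ?I t)" by (intro integrable_mult_right integrable_real_indicator) auto
    show "expectation (\<lambda>\<omega>. ?I t * (shape_average j t \<omega>)\<^sup>2) \<le> ?c * ?I t" for t
      using shape_average_pointwise(2)[of t j] by (simp add: indicator_def)
  qed
  also have "\<dots> = ?c" by simp
  finally show "expectation (\<lambda>\<omega>. LBINT t:{0..1}. (shape_average j t \<omega>)\<^sup>2) \<le> ?c" .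
qed

end

section \<open>Poisson noise and the error of the empirical quantile functions\<close>

context intensity_sample
begin

abbreviation "sample_algebra \<equiv> vimage_algebra (space P) (\<lambda>\<omega>. \<lambda>i\<in>{1..n}. Z i \<omega>) (\<Pi>\<^sub>M i\<in>{1..n}. S)"

lemma sample_algebra: "subalgebra P sample_algebra"
  and Z_sample_measurable: "i \<in> {1..n} \<Longrightarrow> Z i \<in> sample_algebra \<rightarrow>\<^sub>M S"
proof -
  have Zm: "(\<lambda>\<omega>. \<lambda>i\<in>{1..n}. Z i \<omega>) \<in> P \<rightarrow>\<^sub>M (\<Pi>\<^sub>M i\<in>{1..n}. S)"
    by (rule measurable_restrict) (use Z_measurable in auto)
  show "subalgebra P sample_algebra"
    unfolding subalgebra_def using Zm by (auto simp: sets_vimage_algebra2 measurable_space[OF Zm] measurable_sets simp del: One_nat_def)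
  have Zs: "(\<lambda>\<omega>. \<lambda>i\<in>{1..n}. Z i \<omega>) \<in> sample_algebra \<rightarrow>\<^sub>M (\<Pi>\<^sub>M i\<in>{1..n}. S)"
    by (rule measurable_vimage_algebra1) (use measurable_space[OF Zm] in auto)
  show "Z i \<in> sample_algebra \<rightarrow>\<^sub>M S" if i: "i \<in> {1..n}"
    using measurable_compose[OF Zs measurable_component_singleton[OF i]] i by simp
qed

text \<open>The scaled count minus its conditional mean given the sample; its conditional variance
  is the integral of the intensity over B divided by \<alpha>.\<close>

definition noise :: "nat \<Rightarrow> real set \<Rightarrow> 'a \<Rightarrow> real" where
  "noise i B \<omega> = real (num_points (N i \<omega>) B) / \<alpha> - (LBINT t:B. \<Lambda>s i \<omega> t)"

lemma num_points_measurable: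
  assumes "i \<in> {1..n}" "B \<in> sets borel"
  shows "(\<lambda>\<omega>. num_points (N i \<omega>) B) \<in> P \<rightarrow>\<^sub>M count_space UNIV"
  using N_poisson assms by (auto simp: cond_poisson_processes_def)

lemma N_subset: "i \<in> {1..n} \<Longrightarrow> \<omega> \<in> space P \<Longrightarrow> set_mset (N i \<omega>) \<subseteq> {0..T}"
  using N_poisson by (auto simp: cond_poisson_processes_def)

lemma noise_measurable:
  assumes i: "i \<in> {1..n}" and B: "B \<in> sets borel" "B \<subseteq> {0..T}"
  shows "noise i B \<in> borel_measurable P"
proof -
  note [measurable] = num_points_measurable[OF i B(1)]
  have [measurable]: "(\<lambda>\<omega>. LBINT t:B. \<Lambda>s i \<omega> t) \<in> borel_measurable P"
    using measurable_compose[OF \<Lambda>s_measurable intensity_integral_measurable[OF B]] i by auto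
  show ?thesis unfolding noise_def[abs_def] by measurable
qed

lemma intensity_integral_bounds:
  assumes l: "l \<in> intensity_set T" and B: "B \<in> sets borel" "B \<subseteq> {0..T}"
  shows "0 \<le> (LBINT t:B. l t)" "(LBINT t:B. l t) \<le> intensity_factor T l"
proof -
  have i: "set_integrable lborel {0..T} l" and nn: "\<And>t. t \<in> {0..T} \<Longrightarrow> 0 \<le> l t" using l by (auto simp: intensity_set_def)
  show "0 \<le> (LBINT t:B. l t)" unfolding set_lebesgue_integral_def
    using nn B by (intro integral_nonneg_AE AE_I2) (auto simp: indicator_def)
  have j: "set_integrable lborel B l" by (rule set_integrable_subset[OF i]) (use B in auto)
  show "(LBINT t:B. l t) \<le> intensity_factor T l"
    unfolding intensity_factor_def set_lebesgue_integral_def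
    using i j B nn by (intro integral_mono) (auto simp: set_integrable_def indicator_def)
qed

text \<open>The weight depends on the covariate only and is therefore measurable in the conditioning
  algebra; given the sample, the squared noise has mean at most M1 / \<alpha>. Nonnegative integrals
  are used first, and integrability follows from the finite bound.\<close>

lemma noise_second_moment:
  assumes i: "i \<in> {1..n}" and B: "B \<in> sets borel" "B \<subseteq> {0..T}"
    and w: "w \<in> borel_measurable borel" "\<And>u. 0 \<le> w u" "integrable P (\<lambda>\<omega>. w (X \<omega>))"
  shows "integrable P (\<lambda>\<omega>. w (Xs i \<omega>) * (noise i B \<omega>)\<^sup>2)"
    and "expectation (\<lambda>\<omega>. w (Xs i \<omega>) * (noise i B \<omega>)\<^sup>2) \<le> M1 / \<alpha> * expectation (\<lambda>\<omega>. w (X \<omega>))"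
proof -
  have i1: "i \<ge> 1" using i by auto
  define l where "l \<omega> = (LBINT t:B. \<Lambda>s i \<omega> t)" for \<omega>
  have l\<alpha>: "(LBINT t:B. \<alpha> * \<Lambda>s i \<omega> t) = \<alpha> * l \<omega>" for \<omega> by (simp add: l_def)
  have lF: "l \<in> borel_measurable sample_algebra" unfolding l_def
    using measurable_compose[OF measurable_compose[OF Z_sample_measurable[OF i] measurable_snd] intensity_integral_measurable[OF B]] by simp
  have XF: "Xs i \<in> borel_measurable sample_algebra"
    using measurable_compose[OF Z_sample_measurable[OF i] measurable_fst] by simp
  have l0: "0 \<le> l \<omega>" if "\<omega> \<in> space P" for \<omega>
    unfolding l_def by (rule intensity_integral_bounds(1)[OF \<Lambda>s_mem[OF i1 that] B])
  have wm: "(\<lambda>z. w (fst z)) \<in> borel_measurable S" using w(1) by measurable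
  have wi: "integrable P (\<lambda>\<omega>. w (Xs i \<omega>))" "expectation (\<lambda>\<omega>. w (Xs i \<omega>)) = expectation (\<lambda>\<omega>. w (X \<omega>))"
    using transfer_integrable[OF i1 wm] w(3) by simp_all
  let ?W = "\<lambda>\<omega>. ennreal (w (Xs i \<omega>) / \<alpha>\<^sup>2)"
  have nm: "(\<lambda>\<omega>. w (Xs i \<omega>) * (noise i B \<omega>)\<^sup>2) \<in> borel_measurable P"
    using noise_measurable[OF i B] Xs_measurable[OF i1] w(1) by measurable
  have "(\<integral>\<^sup>+\<omega>. ennreal (w (Xs i \<omega>) * (noise i B \<omega>)\<^sup>2) \<partial>P)
     = (\<integral>\<^sup>+\<omega>. ?W \<omega> * ennreal ((real (num_points (N i \<omega>) B) - (LBINT t:B. \<alpha> * \<Lambda>s i \<omega> t))\<^sup>2) \<partial>P)"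
  proof (intro nn_integral_cong)
    fix \<omega>
    have "noise i B \<omega> = (real (num_points (N i \<omega>) B) - \<alpha> * l \<omega>) / \<alpha>"
      using \<alpha> by (simp add: noise_def l_def diff_divide_distrib)
    then show "ennreal (w (Xs i \<omega>) * (noise i B \<omega>)\<^sup>2)
      = ?W \<omega> * ennreal ((real (num_points (N i \<omega>) B) - (LBINT t:B. \<alpha> * \<Lambda>s i \<omega> t))\<^sup>2)"
      unfolding l\<alpha> using w(2) by (subst ennreal_mult[symmetric]) (auto simp: power_divide)
  qed
  also have "\<dots> = (\<integral>\<^sup>+\<omega>. ?W \<omega> * ennreal (LBINT t:B. \<alpha> * \<Lambda>s i \<omega> t) \<partial>P)"
  proof (rule cond_poisson_second_moment[OF sample_algebra N_poisson _ i B])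
    show "?W \<in> borel_measurable sample_algebra" using w(1) XF by measurable
    show "(\<lambda>\<omega>. LBINT t:B. \<alpha> * \<Lambda>s i \<omega> t) \<in> borel_measurable sample_algebra" unfolding l\<alpha> using lF by measurable
    show "0 \<le> (LBINT t:B. \<alpha> * \<Lambda>s i \<omega> t)" if "\<omega> \<in> space P" for \<omega> unfolding l\<alpha> using l0[OF that] \<alpha> by simp
  qed simp
  also have "\<dots> \<le> (\<integral>\<^sup>+\<omega>. ennreal (M1 / \<alpha> * w (Xs i \<omega>)) \<partial>P)"
  proof (rule nn_integral_mono_AE)
    show "AE \<omega> in P. ?W \<omega> * ennreal (LBINT t:B. \<alpha> * \<Lambda>s i \<omega> t) \<le> ennreal (M1 / \<alpha> * w (Xs i \<omega>))"
      using \<tau>s_bounds[OF i1] AE_space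
    proof eventually_elim
      case (elim \<omega>)
      have "l \<omega> \<le> M1" using intensity_integral_bounds(2)[OF \<Lambda>s_mem[OF i1 elim(2)] B] elim(1) by (simp add: l_def)
      then have "w (Xs i \<omega>) / \<alpha> * l \<omega> \<le> w (Xs i \<omega>) / \<alpha> * M1" using w(2) \<alpha> by (intro mult_left_mono) auto
      moreover have "w (Xs i \<omega>) / \<alpha>\<^sup>2 * (\<alpha> * l \<omega>) = w (Xs i \<omega>) / \<alpha> * l \<omega>" using \<alpha> by (simp add: power2_eq_square)
      ultimately have "w (Xs i \<omega>) / \<alpha>\<^sup>2 * (\<alpha> * l \<omega>) \<le> M1 / \<alpha> * w (Xs i \<omega>)" by (simp add: mult.commute)
      then show ?case unfolding l\<alpha> using w(2) l0[OF elim(2)] \<alpha>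
        by (subst ennreal_mult[symmetric]) (auto intro: ennreal_leI)
    qed
  qed
  also have "\<dots> = ennreal (M1 / \<alpha> * expectation (\<lambda>\<omega>. w (X \<omega>)))"
    using wi w(2) \<alpha> \<tau>_bounds by (subst nn_integral_eq_integral) auto
  finally have le: "(\<integral>\<^sup>+\<omega>. ennreal (w (Xs i \<omega>) * (noise i B \<omega>)\<^sup>2) \<partial>P) \<le> ennreal (M1 / \<alpha> * expectation (\<lambda>\<omega>. w (X \<omega>)))" .
  show int: "integrable P (\<lambda>\<omega>. w (Xs i \<omega>) * (noise i B \<omega>)\<^sup>2)"
    by (rule integrableI_nonneg[OF nm]) (use w(2) le_less_trans[OF le] in auto)
  have "ennreal (expectation (\<lambda>\<omega>. w (Xs i \<omega>) * (noise i B \<omega>)\<^sup>2)) \<le> ennreal (M1 / \<alpha> * expectation (\<lambda>\<omega>. w (X \<omega>)))"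
    using le w(2) by (subst (asm) nn_integral_eq_integral[OF int]) auto
  moreover have "0 \<le> M1 / \<alpha> * expectation (\<lambda>\<omega>. w (X \<omega>))"
    using w(2) \<alpha> \<tau>_bounds by (intro mult_nonneg_nonneg integral_nonneg_AE) auto
  ultimately show "expectation (\<lambda>\<omega>. w (Xs i \<omega>) * (noise i B \<omega>)\<^sup>2) \<le> M1 / \<alpha> * expectation (\<lambda>\<omega>. w (X \<omega>))"
    by (simp add: ennreal_le_iff)
qed

text \<open>An upper bound for the squared distance of the empirical to the true quantile function, with the absolute
  deviations \<open>\<bar>z\<bar>\<close> of the counts replaced by \<open>(\<surd>\<alpha> z\<^sup>2 + 1 / \<surd>\<alpha>) / 2\<close>, so that only second moments of
  Poisson counts are needed.\<close>

definition J where "J = nat \<lceil>sqrt \<alpha>\<rceil>"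

definition quantile_error :: "nat \<Rightarrow> 'a \<Rightarrow> real" where
  "quantile_error i \<omega> = T\<^sup>2 / real J * (1 + (\<Sum>j<J. (sqrt \<alpha> * (noise i {0..real j * T / real J} \<omega>)\<^sup>2 + 1 / sqrt \<alpha>
      + (sqrt \<alpha> * (noise i {0..T} \<omega>)\<^sup>2 + 1 / sqrt \<alpha>)) / (2 * \<kappa>)))"

text \<open>With at least \<open>sqrt \<alpha>\<close> cells the discretisation error
  \<open>T\<^sup>2 / J\<close> does not exceed the order of the stochastic error.\<close>

lemma J: "0 < J" "sqrt \<alpha> \<le> real J"
  using \<alpha> by (simp_all add: J_def real_nat_ceiling_ge)

lemma grid_mem: "j < J \<Longrightarrow> real j * T / real J \<in> {0..T}"
  using TML(1) J by (auto simp: divide_simps mult_right_mono)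

text \<open>Each balanced term has weighted mean at most (M1 + 1) D / \<open>sqrt \<alpha>\<close>.
  There are J grid points and a prefactor 1 / J, so the sum keeps this order; the summand 1 in
  \<open>BD\<close> stems from the discretisation error.\<close>

lemma quantile_error_expectation:
  assumes i: "i \<in> {1..n}"
  shows "integrable P (\<lambda>\<omega>. kern K x h 0 (Xs i \<omega>) * quantile_error i \<omega>)"
    and "expectation (\<lambda>\<omega>. kern K x h 0 (Xs i \<omega>) * quantile_error i \<omega>) \<le> BD / sqrt \<alpha>"
proof -
  note kp = kern_props[OF K h(1)]
  let ?s = "sqrt \<alpha>" and ?u = "\<lambda>j. real j * T / real J"
  define w where "w = kern K x h 0"
  define E where "E = expectation (\<lambda>\<omega>. w (X \<omega>))"
  have s: "0 < ?s" "?s * ?s = \<alpha>" using \<alpha> by auto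
  have i1: "i \<ge> 1" using i by auto
  have w: "w \<in> borel_measurable borel" "\<And>u. 0 \<le> w u" "integrable P (\<lambda>\<omega>. w (X \<omega>))" "E \<le> D"
    using kp(1,6) expect_kern_0[OF h] by (auto simp: w_def E_def)
  have E0: "0 \<le> E" unfolding E_def using w(2) by (intro integral_nonneg_AE) auto
  have wm: "(\<lambda>z. w (fst z)) \<in> borel_measurable S" using w(1) by measurable
  have wi: "integrable P (\<lambda>\<omega>. w (Xs i \<omega>))" "expectation (\<lambda>\<omega>. w (Xs i \<omega>)) = E"
    using transfer_integrable[OF i1 wm] w(3) by (simp_all add: E_def)
  have part: "{0..u} \<in> sets borel \<and> {0..u} \<subseteq> {0..T}" if "u \<in> {0..T}" for u using that by auto
  have nz: "integrable P (\<lambda>\<omega>. w (Xs i \<omega>) * (noise i {0..u} \<omega>)\<^sup>2)"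
    "expectation (\<lambda>\<omega>. w (Xs i \<omega>) * (noise i {0..u} \<omega>)\<^sup>2) \<le> M1 / \<alpha> * E" if "u \<in> {0..T}" for u
    using noise_second_moment[OF i _ _ w(1,2,3), of "{0..u}"] part[OF that] by (auto simp: E_def)
  define q where "q u \<omega> = w (Xs i \<omega>) * (?s * (noise i {0..u} \<omega>)\<^sup>2 + 1 / ?s)" for u \<omega>
  have q: "integrable P (q u)" "expectation (q u) \<le> (M1 + 1) * E / ?s" if u: "u \<in> {0..T}" for u
  proof -
    have eq: "q u = (\<lambda>\<omega>. ?s * (w (Xs i \<omega>) * (noise i {0..u} \<omega>)\<^sup>2) + w (Xs i \<omega>) / ?s)"
      by (simp add: q_def fun_eq_iff distrib_left mult_ac)
    show "integrable P (q u)" unfolding eq using nz[OF u] wi by simp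
    have "expectation (q u) = ?s * expectation (\<lambda>\<omega>. w (Xs i \<omega>) * (noise i {0..u} \<omega>)\<^sup>2) + E / ?s"
      unfolding eq using nz[OF u] wi by simp
    also have "\<dots> \<le> ?s * (M1 / \<alpha> * E) + E / ?s" using nz(2)[OF u] s by (intro add_right_mono mult_left_mono) auto
    also have "?s * (M1 / \<alpha> * E) = M1 * E / ?s"
    proof -
      have "?s * (M1 / (?s * ?s) * E) = M1 * E / ?s" using s(1) by (simp add: field_simps)
      then show ?thesis by (simp only: s(2))
    qed
    finally show "expectation (q u) \<le> (M1 + 1) * E / ?s" by (simp add: add_divide_distrib distrib_right)
  qed
  have Teq: "T \<in> {0..T}" using TML(1) by simp
  have eq: "(\<lambda>\<omega>. w (Xs i \<omega>) * quantile_error i \<omega>) = (\<lambda>\<omega>. T\<^sup>2 / real J * (w (Xs i \<omega>) + (\<Sum>j<J. (q (?u j) \<omega> + q T \<omega>) / (2 * \<kappa>))))"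
  proof
    fix \<omega>
    have "w (Xs i \<omega>) * (c * (1 + (\<Sum>j<J. (a j + b) / k))) = c * (w (Xs i \<omega>) + (\<Sum>j<J. (w (Xs i \<omega>) * a j + w (Xs i \<omega>) * b) / k))"
      for a :: "nat \<Rightarrow> real" and b c k
      by (simp add: distrib_left[symmetric] sum_distrib_left[symmetric] times_divide_eq_right[symmetric] del: times_divide_eq_right) (simp add: algebra_simps)
    then show "w (Xs i \<omega>) * quantile_error i \<omega> = T\<^sup>2 / real J * (w (Xs i \<omega>) + (\<Sum>j<J. (q (?u j) \<omega> + q T \<omega>) / (2 * \<kappa>)))"
      unfolding quantile_error_def q_def .
  qed
  have int: "integrable P (\<lambda>\<omega>. w (Xs i \<omega>) * quantile_error i \<omega>)" unfolding eq
    using wi q(1)[OF grid_mem] q(1)[OF Teq]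
    by (intro integrable_mult_right Bochner_Integration.integrable_add Bochner_Integration.integrable_sum integrable_divide) auto
  then show "integrable P (\<lambda>\<omega>. kern K x h 0 (Xs i \<omega>) * quantile_error i \<omega>)" by (simp add: w_def)
  have "expectation (\<lambda>\<omega>. w (Xs i \<omega>) * quantile_error i \<omega>)
     = T\<^sup>2 / real J * (E + (\<Sum>j<J. (expectation (q (?u j)) + expectation (q T)) / (2 * \<kappa>)))"
  proof -
    have "expectation (\<lambda>\<omega>. \<Sum>j<J. (q (?u j) \<omega> + q T \<omega>) / (2 * \<kappa>)) = (\<Sum>j<J. (expectation (q (?u j)) + expectation (q T)) / (2 * \<kappa>))"
      using q(1)[OF grid_mem] q(1)[OF Teq] by (subst Bochner_Integration.integral_sum) (auto intro!: sum.cong)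
    moreover have "integrable P (\<lambda>\<omega>. \<Sum>j<J. (q (?u j) \<omega> + q T \<omega>) / (2 * \<kappa>))"
      using q(1)[OF grid_mem] q(1)[OF Teq]
      by (intro Bochner_Integration.integrable_sum integrable_divide Bochner_Integration.integrable_add) auto
    ultimately show ?thesis unfolding eq integral_mult_right_zero
      using wi by (subst Bochner_Integration.integral_add) auto
  qed
  also have "\<dots> \<le> T\<^sup>2 / real J * (E + (\<Sum>j<J. ((M1 + 1) * E / ?s + (M1 + 1) * E / ?s) / (2 * \<kappa>)))"
    using q(2)[OF grid_mem] q(2)[OF Teq] \<tau>_bounds(1)
    by (intro mult_left_mono add_left_mono sum_mono divide_right_mono add_mono) auto
  also have "\<dots> = T\<^sup>2 * (E / real J + (M1 + 1) / \<kappa> * E / ?s)"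
  proof -
    have "T\<^sup>2 / real J * (E + (\<Sum>j<J. (a + a) / (2 * \<kappa>))) = T\<^sup>2 * (E / real J + a / \<kappa>)" for a
      using J(1) \<tau>_bounds(1) by (simp add: field_simps)
    moreover have "(M1 + 1) * E / ?s / \<kappa> = (M1 + 1) / \<kappa> * E / ?s" by simp
    ultimately show ?thesis by (simp only:)
  qed
  also have "\<dots> \<le> T\<^sup>2 * (D / ?s + (M1 + 1) / \<kappa> * D / ?s)"
  proof (intro mult_left_mono add_mono)
    show "E / real J \<le> D / ?s" using w(4) E0 J s(1) by (intro frac_le) auto
    show "(M1 + 1) / \<kappa> * E / ?s \<le> (M1 + 1) / \<kappa> * D / ?s"
      using w(4) s(1) \<tau>_bounds by (intro divide_right_mono mult_left_mono) auto
  qed simp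
  also have "\<dots> = BD / ?s"
  proof -
    have "T\<^sup>2 * (D / s + c * D / s) = T\<^sup>2 * D * (1 + c) / s" for c s :: real
      by (simp add: add_divide_distrib algebra_simps)
    then show ?thesis by (simp only: BD_def)
  qed
  finally show "expectation (\<lambda>\<omega>. kern K x h 0 (Xs i \<omega>) * quantile_error i \<omega>) \<le> BD / ?s" by (simp only: w_def)
qed

lemma quantile_error_nonneg: "0 \<le> quantile_error i \<omega>"
  unfolding quantile_error_def using \<tau>_bounds(1) \<alpha> by (intro mult_nonneg_nonneg add_nonneg_nonneg sum_nonneg divide_nonneg_nonneg) auto

lemma empirical_quantile_dist:
  assumes i: "i \<in> {1..n}" and w: "\<omega> \<in> space P" and \<tau>: "\<kappa> \<le> \<tau>s i \<omega>"
  shows "(L2_dist (empirical_quantile T (N i \<omega>)) (intensity_quantile T (\<Lambda>s i \<omega>)))\<^sup>2 \<le> quantile_error i \<omega>"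
    and "set_borel_measurable lborel {0..1} (empirical_quantile T (N i \<omega>))"
    and "t \<in> {0..1} \<Longrightarrow> \<bar>empirical_quantile T (N i \<omega>) t\<bar> \<le> T"
    and "set_borel_measurable lborel {0..1} (intensity_quantile T (\<Lambda>s i \<omega>))"
proof -
  let ?u = "\<lambda>j. real j * T / real J"
  have i1: "i \<ge> 1" using i by auto
  have T0: "0 \<le> T" using TML by simp
  obtain \<mu> where \<mu>: "real_distribution \<mu>" "cdf \<mu> T = 1" "empirical_quantile T (N i \<omega>) = quantile T \<mu>"
    "\<And>u. N i \<omega> \<noteq> {#} \<Longrightarrow> 0 \<le> u \<Longrightarrow> cdf \<mu> u = real (num_points (N i \<omega>) {0..u}) / real (size (N i \<omega>))"
    using empirical_distribution[OF TML(1) N_subset[OF i w]] by metis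
  have g: "\<Lambda>s i \<omega> \<in> intensity_set T" using \<Lambda>s_mem[OF i1 w] .
  have pos: "0 < \<tau>s i \<omega>" using \<tau> \<tau>_bounds(1) by simp
  define \<nu> where "\<nu> = shape_measure T (shape T (\<Lambda>s i \<omega>))"
  have \<nu>: "real_distribution \<nu>" "cdf \<nu> T = 1" "\<And>u. u \<in> {0..T} \<Longrightarrow> cdf \<nu> u = (LBINT t:{0..u}. \<Lambda>s i \<omega> t) / \<tau>s i \<omega>"
    using shape_distribution[OF g pos] T0 by (auto simp: \<nu>_def)
  have iq: "intensity_quantile T (\<Lambda>s i \<omega>) t = quantile T \<nu> t" if "t \<in> {0..1}" for t
    using that pos by (simp add: intensity_quantile_def shape_quantile_def \<nu>_def)
  have meas: "set_borel_measurable lborel {0..1} (quantile T \<eta>)" if "cdf \<eta> T = 1" for \<eta>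
  proof -
    \<comment> \<open>Empirical quantile functions are discontinuous; measurability in t comes from
      monotonicity.\<close>
    have "mono_on {0..1} (quantile T \<eta>)" using quantile_mono[OF that T0] by (auto intro!: mono_onI)
    then have "quantile T \<eta> \<in> borel_measurable (restrict_space borel {0..1})" by (rule borel_measurable_mono_on_fnc)
    then show ?thesis unfolding set_borel_measurable_def
      by (subst (asm) borel_measurable_restrict_space_iff) auto
  qed
  show "set_borel_measurable lborel {0..1} (empirical_quantile T (N i \<omega>))" unfolding \<mu>(3) by (rule meas[OF \<mu>(2)])
  have "(\<lambda>t. indicator {0..1} t *\<^sub>R intensity_quantile T (\<Lambda>s i \<omega>) t) = (\<lambda>t. indicator {0..1} t *\<^sub>R quantile T \<nu> t)"
    using iq by (auto simp: fun_eq_iff indicator_def)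
  then show "set_borel_measurable lborel {0..1} (intensity_quantile T (\<Lambda>s i \<omega>))"
    using meas[OF \<nu>(2)] by (simp only: set_borel_measurable_def)
  show "t \<in> {0..1} \<Longrightarrow> \<bar>empirical_quantile T (N i \<omega>) t\<bar> \<le> T"
    using quantile_mem[OF \<mu>(2) T0, of t] by (auto simp: \<mu>(3))
  have grid: "\<bar>cdf \<mu> u - cdf \<nu> u\<bar> \<le> (sqrt \<alpha> * (noise i {0..u} \<omega>)\<^sup>2 + 1 / sqrt \<alpha> + (sqrt \<alpha> * (noise i {0..T} \<omega>)\<^sup>2 + 1 / sqrt \<alpha>)) / (2 * \<kappa>)"
    if u: "u \<in> {0..T}" for u
  proof -
    have zT: "noise i {0..T} \<omega> = real (size (N i \<omega>)) / \<alpha> - \<tau>s i \<omega>"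
      using num_points_all[OF N_subset[OF i w]] by (simp add: noise_def intensity_factor_def)
    have "\<bar>cdf \<mu> u - cdf \<nu> u\<bar> \<le> (\<bar>noise i {0..u} \<omega>\<bar> + \<bar>noise i {0..T} \<omega>\<bar>) / \<tau>s i \<omega>"
    proof (cases "N i \<omega> = {#}")
      case True
      have "\<bar>cdf \<mu> u - cdf \<nu> u\<bar> \<le> 1"
        using real_distribution.cdf_bounded_prob[OF \<mu>(1), of u] real_distribution.cdf_bounded_prob[OF \<nu>(1), of u]
          finite_borel_measure.cdf_nonneg[OF real_distribution.finite_borel_measure_M[OF \<mu>(1)], of u]
          finite_borel_measure.cdf_nonneg[OF real_distribution.finite_borel_measure_M[OF \<nu>(1)], of u] by linarith
      \<comment> \<open>For an empty pattern the noise on [0, T] is exactly minus the factor, so the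
        bound is at least 1 and absorbs whatever default distribution is used.\<close>
      also have "1 = \<bar>noise i {0..T} \<omega>\<bar> / \<tau>s i \<omega>" unfolding zT True using pos by simp
      also have "\<dots> \<le> (\<bar>noise i {0..u} \<omega>\<bar> + \<bar>noise i {0..T} \<omega>\<bar>) / \<tau>s i \<omega>" using pos by (intro divide_right_mono) auto
      finally show ?thesis .
    next
      case False
      have sz: "0 < real (size (N i \<omega>))" using False by (simp add: nonempty_has_size)
      have "\<bar>real (num_points (N i \<omega>) {0..u}) / real (size (N i \<omega>)) - (LBINT t:{0..u}. \<Lambda>s i \<omega> t) / \<tau>s i \<omega>\<bar>
          \<le> (\<bar>real (num_points (N i \<omega>) {0..u}) / \<alpha> - (LBINT t:{0..u}. \<Lambda>s i \<omega> t)\<bar> + \<bar>real (size (N i \<omega>)) / \<alpha> - \<tau>s i \<omega>\<bar>) / \<tau>s i \<omega>"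
        by (rule ratio_deviation) (use num_points_le sz pos \<alpha> in auto)
      then show ?thesis using u unfolding zT by (simp add: \<mu>(4)[OF False] \<nu>(3)[OF u] noise_def[of i "{0..u}"])
    qed
    also have "\<dots> \<le> (\<bar>noise i {0..u} \<omega>\<bar> + \<bar>noise i {0..T} \<omega>\<bar>) / \<kappa>"
      using \<tau> \<tau>_bounds(1) by (intro divide_left_mono) auto
    also have "\<dots> \<le> ((sqrt \<alpha> * (noise i {0..u} \<omega>)\<^sup>2 + 1 / sqrt \<alpha>) / 2 + (sqrt \<alpha> * (noise i {0..T} \<omega>)\<^sup>2 + 1 / sqrt \<alpha>) / 2) / \<kappa>"
      using \<alpha> \<tau>_bounds(1) by (intro divide_right_mono add_mono abs_le_square_balance) auto
    finally show ?thesis by (simp only: add_divide_distrib[symmetric] divide_divide_eq_left)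
  qed
  have "(L2_dist (empirical_quantile T (N i \<omega>)) (intensity_quantile T (\<Lambda>s i \<omega>)))\<^sup>2 = (LBINT t:{0..1}. (quantile T \<mu> t - quantile T \<nu> t)\<^sup>2)"
    unfolding L2_dist_sq \<mu>(3) by (intro set_lebesgue_integral_cong) (auto simp: iq)
  also have "\<dots> \<le> T\<^sup>2 / real J * (1 + (\<Sum>j<J. \<bar>cdf \<mu> (?u j) - cdf \<nu> (?u j)\<bar>))"
    by (rule L2_dist_quantile_le_grid[OF \<mu>(1,2) \<nu>(1,2) TML(1) J(1)])
  also have "\<dots> \<le> quantile_error i \<omega>" unfolding quantile_error_def
    using grid[OF grid_mem] by (intro mult_left_mono add_left_mono sum_mono) auto
  finally show "(L2_dist (empirical_quantile T (N i \<omega>)) (intensity_quantile T (\<Lambda>s i \<omega>)))\<^sup>2 \<le> quantile_error i \<omega>" .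
qed

end
subsection \<open>The estimation error on the good event\<close>

context intensity_model
begin

text \<open>Moments 0 and 2 within \<eta> of their limits are at least half of them, so their
  product is at least a quarter of the limiting determinant. Moment 1 has limit 0 and its square
  stays below an eighth, which leaves \<open>dmin\<close>.\<close>

definition \<eta> where
  "\<eta> = min (fX x / 2) (min (fX x * kernel_moment K 2 / 2) (sqrt ((fX x)\<^sup>2 * kernel_moment K 2 / 8)))"
definition dmin where "dmin = (fX x)\<^sup>2 * kernel_moment K 2 / 8"
definition smax where "smax = fX x * (1 + kernel_moment K 2) + \<eta>"
definition Cfin where
  "Cfin = 64 * (1 + smax) * (smax / dmin)\<^sup>2 * (1 + (2 * M1 / \<kappa>)\<^sup>2) + 4 * (2 * \<bar>m x\<bar> / \<kappa>)\<^sup>2"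

lemma \<eta>_pos: "0 < \<eta>" and dmin_pos: "0 < dmin" and smax_pos: "0 < smax" and Cfin_nonneg: "0 \<le> Cfin"
proof -
  have k: "0 < kernel_moment K 2" by (rule kernel_moment_values(3)[OF K])
  show "0 < \<eta>" "0 < dmin" using fX_pos[of x] k by (auto simp: \<eta>_def dmin_def)
  then show "0 < smax" using fX_pos[of x] k by (auto simp: smax_def intro!: add_pos_pos mult_pos_pos)
  then show "0 \<le> Cfin" unfolding Cfin_def by (intro add_nonneg_nonneg mult_nonneg_nonneg) auto
qed

lemma design_det_bounds:
  assumes "\<And>j. j \<in> {0, 1, 2} \<Longrightarrow> \<bar>s j - fX x * kernel_moment K j\<bar> < \<eta>"
  shows "dmin \<le> s 0 * s 2 - (s 1)\<^sup>2" "\<bar>s 0\<bar> \<le> smax" "\<bar>s 1\<bar> \<le> smax" "\<bar>s 2\<bar> \<le> smax"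
proof -
  let ?p = "fX x" and ?k = "kernel_moment K 2"
  have k: "0 < ?k" "kernel_moment K 0 = 1" "kernel_moment K 1 = 0" using kernel_moment_values[OF K] by auto
  have p: "0 < ?p" by (rule fX_pos)
  have s: "\<bar>s 0 - ?p\<bar> < \<eta>" "\<bar>s 1\<bar> < \<eta>" "\<bar>s 2 - ?p * ?k\<bar> < \<eta>"
    using assms[of 0] assms[of 1] assms[of 2] k by simp_all
  have e: "\<eta> \<le> ?p / 2" "\<eta> \<le> ?p * ?k / 2" "\<eta> \<le> sqrt (?p\<^sup>2 * ?k / 8)" by (auto simp: \<eta>_def)
  have "?p / 2 \<le> s 0" "?p * ?k / 2 \<le> s 2" using s e by linarith+
  then have "(?p / 2) * (?p * ?k / 2) \<le> s 0 * s 2" using p k by (intro mult_mono) auto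
  then have a: "?p\<^sup>2 * ?k / 4 \<le> s 0 * s 2" by (simp add: power2_eq_square)
  have "\<bar>s 1\<bar> \<le> sqrt (?p\<^sup>2 * ?k / 8)" using s(2) e(3) by linarith
  then have "\<bar>s 1\<bar>\<^sup>2 \<le> (sqrt (?p\<^sup>2 * ?k / 8))\<^sup>2" by (intro power_mono) auto
  then have "(s 1)\<^sup>2 \<le> ?p\<^sup>2 * ?k / 8" using k by simp
  then show "dmin \<le> s 0 * s 2 - (s 1)\<^sup>2" using a unfolding dmin_def by linarith
  have "0 < ?p * ?k" using p k by simp
  then show "\<bar>s 0\<bar> \<le> smax" "\<bar>s 1\<bar> \<le> smax" "\<bar>s 2\<bar> \<le> smax"
    unfolding smax_def distrib_left using s p by linarith+
qed

end

context intensity_sample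
begin

abbreviation "X\<omega> \<omega> \<equiv> \<lambda>i. Xs i \<omega>"
abbreviation "N\<omega> \<omega> \<equiv> \<lambda>i. N i \<omega>"
abbreviation "wt \<omega> i \<equiv> local_weight K h x n (X\<omega> \<omega>) i"
definition "nbar \<omega> = mean_count n (N\<omega> \<omega>) / \<alpha>"
definition "tau_average j \<omega> = local_average K x h n (X\<omega> \<omega>) (\<lambda>i. \<tau>s i \<omega> - m x - deriv m x * (Xs i \<omega> - x)) j"
definition "shape_energy j \<omega> = (LBINT t:{0..1}. (shape_average j t \<omega>)\<^sup>2)"
definition "weighted_noise \<omega> = (\<Sum>i=1..n. kern K x h 0 (Xs i \<omega>) * (noise i {0..T} \<omega>)\<^sup>2) / real n"
definition "mean_noise \<omega> = (\<Sum>i=1..n. (noise i {0..T} \<omega>)\<^sup>2) / real n"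
definition "tau_deviation \<omega> = ((\<Sum>i=1..n. \<tau>s i \<omega>) / real n - expectation \<tau>)\<^sup>2"
definition "quantile_noise \<omega> = (\<Sum>i=1..n. kern K x h 0 (Xs i \<omega>) * quantile_error i \<omega>) / real n"

text \<open>The bounds on the factors are included because for the copies they hold only almost
  surely. The last condition keeps the scaled mean count above \<kappa> / 2, so the normalisation is
  harmless.\<close>

definition good :: "'a set" where
  "good = {\<omega> \<in> space P. (\<forall>i\<in>{1..n}. \<kappa> \<le> \<tau>s i \<omega> \<and> \<tau>s i \<omega> \<le> M1) \<and>
     (\<forall>j\<in>{0,1,2}. \<bar>local_moment K x h n (X\<omega> \<omega>) j - fX x * kernel_moment K j\<bar> < \<eta>) \<and>
     \<bar>nbar \<omega> - expectation \<tau>\<bar> < \<kappa> / 2}"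

text \<open>These are the random quantities that survive once the weights have been bounded by
  constants and kernels; each is nonnegative with a computable expectation.\<close>

definition "error_budget \<omega> = (tau_average 0 \<omega>)\<^sup>2 + (tau_average 1 \<omega>)\<^sup>2 + shape_energy 0 \<omega> + shape_energy 1 \<omega>
   + weighted_noise \<omega> + quantile_noise \<omega> + mean_noise \<omega> + tau_deviation \<omega>"

lemma size_eq_noise:
  assumes "i \<in> {1..n}" "\<omega> \<in> space P"
  shows "real (size (N i \<omega>)) / \<alpha> = \<tau>s i \<omega> + noise i {0..T} \<omega>"
  using num_points_all[OF N_subset[OF assms]] by (simp add: noise_def intensity_factor_def)

lemma nbar_deviation:
  assumes w: "\<omega> \<in> space P"
  shows "(nbar \<omega> - expectation \<tau>)\<^sup>2 \<le> 2 * mean_noise \<omega> + 2 * tau_deviation \<omega>"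
proof -
  have "nbar \<omega> = (\<Sum>i=1..n. real (size (N i \<omega>)) / \<alpha>) / real n"
    by (simp add: nbar_def mean_count_def sum_divide_distrib mult.commute)
  also have "\<dots> = (\<Sum>i=1..n. \<tau>s i \<omega> + noise i {0..T} \<omega>) / real n"
    using size_eq_noise[OF _ w] by (intro arg_cong2[of _ _ _ _ "(/)"] sum.cong) auto
  finally have nb: "nbar \<omega> = (\<Sum>i=1..n. \<tau>s i \<omega>) / real n + (\<Sum>i=1..n. noise i {0..T} \<omega>) / real n"
    by (simp add: sum.distrib add_divide_distrib)
  have c: "((\<Sum>i=1..n. noise i {0..T} \<omega>) / real n)\<^sup>2 \<le> mean_noise \<omega>"
    using weighted_mean_sq_le[of "\<lambda>_. 1" "\<lambda>i. noise i {0..T} \<omega>" "{1..n}" n] n by (simp add: mean_noise_def)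
  have ab: "(a + b - e)\<^sup>2 \<le> 2 * b\<^sup>2 + 2 * (a - e)\<^sup>2" for a b e :: real
  proof -
    have "0 \<le> (b - (a - e))\<^sup>2" by simp
    then show ?thesis by (simp add: power2_eq_square algebra_simps)
  qed
  show ?thesis unfolding nb tau_deviation_def by (rule order_trans[OF ab]) (use c in simp)
qed

lemma good_weights:
  assumes "\<omega> \<in> good"
  shows "dmin \<le> design_det K x h n (X\<omega> \<omega>)"
    and "\<bar>local_moment K x h n (X\<omega> \<omega>) 1\<bar> \<le> smax" "\<bar>local_moment K x h n (X\<omega> \<omega>) 2\<bar> \<le> smax"
    and "\<bar>wt \<omega> i\<bar> \<le> 2 * smax / dmin * kern K x h 0 (Xs i \<omega>)"
    and "(\<Sum>i=1..n. \<bar>wt \<omega> i\<bar>) / real n \<le> 2 * smax / dmin * smax"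
proof -
  have b: "dmin \<le> design_det K x h n (X\<omega> \<omega>)" "\<bar>local_moment K x h n (X\<omega> \<omega>) 0\<bar> \<le> smax"
    "\<bar>local_moment K x h n (X\<omega> \<omega>) 1\<bar> \<le> smax" "\<bar>local_moment K x h n (X\<omega> \<omega>) 2\<bar> \<le> smax"
    using design_det_bounds[of "local_moment K x h n (X\<omega> \<omega>)"] assms by (auto simp: good_def)
  then show "dmin \<le> design_det K x h n (X\<omega> \<omega>)" "\<bar>local_moment K x h n (X\<omega> \<omega>) 1\<bar> \<le> smax" "\<bar>local_moment K x h n (X\<omega> \<omega>) 2\<bar> \<le> smax"
    by auto
  show wt: "\<bar>wt \<omega> i\<bar> \<le> 2 * smax / dmin * kern K x h 0 (Xs i \<omega>)" for i
    by (rule local_weight_bound[OF K h(1) dmin_pos b(1,3,4)])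
  have "(\<Sum>i=1..n. \<bar>wt \<omega> i\<bar>) / real n \<le> (\<Sum>i=1..n. 2 * smax / dmin * kern K x h 0 (Xs i \<omega>)) / real n"
    by (intro divide_right_mono sum_mono wt) auto
  also have "\<dots> = 2 * smax / dmin * local_moment K x h n (X\<omega> \<omega>) 0"
    by (simp add: local_average_def sum_distrib_left)
  also have "\<dots> \<le> 2 * smax / dmin * smax" using b(2) smax_pos dmin_pos by (intro mult_left_mono) auto
  finally show "(\<Sum>i=1..n. \<bar>wt \<omega> i\<bar>) / real n \<le> 2 * smax / dmin * smax" .
qed

text \<open>Of the two factors produced by Cauchy-Schwarz, the total absolute weight is bounded by a
  constant, and in the other the weights are replaced by kernel values.\<close>

lemma weighted_mean_good:
  assumes "\<omega> \<in> good" "\<And>i. i \<in> {1..n} \<Longrightarrow> (a i)\<^sup>2 \<le> c i"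
  shows "((\<Sum>i=1..n. \<bar>wt \<omega> i\<bar>) / real n) * ((\<Sum>i=1..n. \<bar>wt \<omega> i\<bar> * (a i)\<^sup>2) / real n)
    \<le> 4 * (smax / dmin)\<^sup>2 * smax * ((\<Sum>i=1..n. kern K x h 0 (Xs i \<omega>) * c i) / real n)"
proof -
  let ?r = "2 * smax / dmin"
  note kp = kern_props[OF K h(1)]
  have r: "0 \<le> ?r" using smax_pos dmin_pos by simp
  have tm: "\<bar>wt \<omega> i\<bar> * (a i)\<^sup>2 \<le> ?r * (kern K x h 0 (Xs i \<omega>) * c i)" if "i \<in> {1..n}" for i
    unfolding mult.assoc[symmetric] using good_weights(4)[OF assms(1)] assms(2)[OF that] r kp(6)
    by (intro mult_mono mult_nonneg_nonneg) auto
  have "((\<Sum>i=1..n. \<bar>wt \<omega> i\<bar>) / real n) * ((\<Sum>i=1..n. \<bar>wt \<omega> i\<bar> * (a i)\<^sup>2) / real n)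
     \<le> (?r * smax) * ((\<Sum>i=1..n. ?r * (kern K x h 0 (Xs i \<omega>) * c i)) / real n)"
  proof (rule mult_mono)
    show "(\<Sum>i=1..n. \<bar>wt \<omega> i\<bar>) / real n \<le> ?r * smax" by (rule good_weights(5)[OF assms(1)])
    show "(\<Sum>i=1..n. \<bar>wt \<omega> i\<bar> * (a i)\<^sup>2) / real n \<le> (\<Sum>i=1..n. ?r * (kern K x h 0 (Xs i \<omega>) * c i)) / real n"
      by (intro divide_right_mono sum_mono tm) simp_all
    show "0 \<le> ?r * smax" using r smax_pos by (intro mult_nonneg_nonneg) auto
    show "0 \<le> (\<Sum>i=1..n. \<bar>wt \<omega> i\<bar> * (a i)\<^sup>2) / real n"
      by (intro divide_nonneg_nonneg sum_nonneg mult_nonneg_nonneg) auto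
  qed
  also have "\<dots> = 4 * (smax / dmin)\<^sup>2 * smax * ((\<Sum>i=1..n. kern K x h 0 (Xs i \<omega>) * c i) / real n)"
    unfolding sum_distrib_left[symmetric] by (simp add: power2_eq_square)
  finally show ?thesis .
qed

text \<open>Dividing by the mean count cancels \<alpha>, so the estimator targets m(x) / E(\<tau>).
  With a the local average of the scaled counts and b the scaled mean count, the error splits into
  that of a, which is bias plus sampling error plus Poisson noise, and that of b.\<close>

lemma tau_error:
  assumes g: "\<omega> \<in> good"
  shows "(expectation \<tau> * tau_tilde K h x n (X\<omega> \<omega>) (N\<omega> \<omega>) - max (m x) 0)\<^sup>2
    \<le> 2 * (2 * M1 / \<kappa>)\<^sup>2 * (4 * (smax / dmin)\<^sup>2 * ((tau_average 0 \<omega>)\<^sup>2 + (tau_average 1 \<omega>)\<^sup>2)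
        + 8 * (smax / dmin)\<^sup>2 * smax * weighted_noise \<omega>)
      + 4 * (2 * \<bar>m x\<bar> / \<kappa>)\<^sup>2 * (mean_noise \<omega> + tau_deviation \<omega>)"
proof -
  let ?e = "expectation \<tau>" and ?z = "\<lambda>i. noise i {0..T} \<omega>"
  have w: "\<omega> \<in> space P" using g by (auto simp: good_def)
  define b where "b = nbar \<omega>"
  have "\<bar>b - ?e\<bar> < \<kappa> / 2" using g by (simp add: good_def b_def)
  then have b: "\<kappa> / 2 < b" "0 < b" using E\<tau>_ge \<tau>_bounds(1) by linarith+
  define a where "a = (\<Sum>i=1..n. wt \<omega> i * (\<tau>s i \<omega> + ?z i)) / real n"
  have mc: "mean_count n (N\<omega> \<omega>) = \<alpha> * b" using \<alpha> by (simp add: b_def nbar_def)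
  have "(\<Sum>i=1..n. wt \<omega> i * real (size (N i \<omega>)) / mean_count n (N\<omega> \<omega>)) / real n = a / b"
  proof -
    have "(\<Sum>i=1..n. wt \<omega> i * real (size (N i \<omega>)) / mean_count n (N\<omega> \<omega>)) = (\<Sum>i=1..n. wt \<omega> i * (\<tau>s i \<omega> + ?z i) / b)"
      unfolding mc
    proof (intro sum.cong refl)
      fix i assume i: "i \<in> {1..n}"
      have "wt \<omega> i * real (size (N i \<omega>)) / (\<alpha> * b) = wt \<omega> i * (real (size (N i \<omega>)) / \<alpha>) / b" by simp
      then show "wt \<omega> i * real (size (N i \<omega>)) / (\<alpha> * b) = wt \<omega> i * (\<tau>s i \<omega> + ?z i) / b"
        by (simp only: size_eq_noise[OF i w])
    qed
    then show ?thesis by (simp add: a_def sum_divide_distrib[symmetric] mult.commute)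
  qed
  then have tt: "tau_tilde K h x n (X\<omega> \<omega>) (N\<omega> \<omega>) = max 0 (a / b)" by (simp add: tau_tilde_def)
  have e0: "0 \<le> ?e" "?e \<le> M1" by (rule E\<tau>_bounds)+
  \<comment> \<open>E(\<tau>) is nonnegative and moves inside the positive part, and the positive
    part is 1-Lipschitz.\<close>
  have "\<bar>?e * max 0 (a / b) - max (m x) 0\<bar> \<le> \<bar>?e * (a / b) - m x\<bar>"
  proof -
    have "?e * max 0 (a / b) = max 0 (?e * (a / b))" using e0(1) by (simp add: max_mult_distrib_left)
    then show ?thesis by (auto simp: max_def)
  qed
  \<comment> \<open>The identity separates the error of the numerator from that of the
    normalisation, with coefficients bounded because b > \<kappa> / 2.\<close>
  also have "?e * (a / b) - m x = ?e / b * (a - m x) - m x / b * (b - ?e)"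
    using b by (simp add: field_simps)
  also have "\<bar>\<dots>\<bar> \<le> ?e / b * \<bar>a - m x\<bar> + \<bar>m x\<bar> / b * \<bar>b - ?e\<bar>"
    using b e0 by (intro order_trans[OF abs_triangle_ineq4]) (simp add: abs_mult)
  also have "\<dots> \<le> 2 * M1 / \<kappa> * \<bar>a - m x\<bar> + 2 * \<bar>m x\<bar> / \<kappa> * \<bar>b - ?e\<bar>"
  proof -
    have "?e / b \<le> M1 / (\<kappa> / 2)" using b e0 \<tau>_bounds by (intro frac_le) auto
    moreover have "\<bar>m x\<bar> / b \<le> \<bar>m x\<bar> / (\<kappa> / 2)" using b \<tau>_bounds by (intro divide_left_mono) auto
    ultimately show ?thesis by (intro add_mono mult_right_mono) (auto simp: mult.commute)
  qed
  finally have dev: "\<bar>?e * max 0 (a / b) - max (m x) 0\<bar> \<le> 2 * M1 / \<kappa> * \<bar>a - m x\<bar> + 2 * \<bar>m x\<bar> / \<kappa> * \<bar>b - ?e\<bar>" .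
  have sq2: "(u + v)\<^sup>2 \<le> 2 * u\<^sup>2 + 2 * v\<^sup>2" for u v :: real
  proof -
    have "0 \<le> (u - v)\<^sup>2" by simp
    then show ?thesis by (simp add: power2_eq_square algebra_simps)
  qed
  have "(?e * max 0 (a / b) - max (m x) 0)\<^sup>2 \<le> (2 * M1 / \<kappa> * \<bar>a - m x\<bar> + 2 * \<bar>m x\<bar> / \<kappa> * \<bar>b - ?e\<bar>)\<^sup>2"
    using power_mono[OF dev, of 2] by simp
  also have "\<dots> \<le> 2 * (2 * M1 / \<kappa> * \<bar>a - m x\<bar>)\<^sup>2 + 2 * (2 * \<bar>m x\<bar> / \<kappa> * \<bar>b - ?e\<bar>)\<^sup>2" by (rule sq2)
  also have "\<dots> = 2 * (2 * M1 / \<kappa>)\<^sup>2 * (a - m x)\<^sup>2 + 2 * (2 * \<bar>m x\<bar> / \<kappa>)\<^sup>2 * (b - ?e)\<^sup>2"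
    by (simp only: power_mult_distrib[of _ "\<bar>_\<bar>"] power2_abs mult.assoc)
  finally have main: "(?e * max 0 (a / b) - max (m x) 0)\<^sup>2 \<le> 2 * (2 * M1 / \<kappa>)\<^sup>2 * (a - m x)\<^sup>2 + 2 * (2 * \<bar>m x\<bar> / \<kappa>)\<^sup>2 * (b - ?e)\<^sup>2" .
  have d: "design_det K x h n (X\<omega> \<omega>) \<noteq> 0" using good_weights(1)[OF g] dmin_pos by linarith
  let ?R = "\<lambda>i. \<tau>s i \<omega> - m x - deriv m x * (Xs i \<omega> - x)"
  have "a - m x = ((\<Sum>i=1..n. wt \<omega> i * \<tau>s i \<omega>) / real n - m x) + (\<Sum>i=1..n. wt \<omega> i * ?z i) / real n"
    by (simp add: a_def distrib_left sum.distrib add_divide_distrib)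
  also have "(\<Sum>i=1..n. wt \<omega> i * \<tau>s i \<omega>) / real n - m x = (\<Sum>i=1..n. wt \<omega> i * ?R i) / real n"
    by (rule local_weight_affine[OF h(1) d])
  finally have am: "a - m x = (\<Sum>i=1..n. wt \<omega> i * ?R i) / real n + (\<Sum>i=1..n. wt \<omega> i * ?z i) / real n" .
  have p1: "((\<Sum>i=1..n. wt \<omega> i * ?R i) / real n)\<^sup>2 \<le> 2 * (smax / dmin)\<^sup>2 * ((tau_average 0 \<omega>)\<^sup>2 + (tau_average 1 \<omega>)\<^sup>2)"
    unfolding tau_average_def by (rule local_weight_sum_sq_bound[OF h(1) dmin_pos good_weights(1-3)[OF g]])
  have p2: "((\<Sum>i=1..n. wt \<omega> i * ?z i) / real n)\<^sup>2 \<le> 4 * (smax / dmin)\<^sup>2 * smax * weighted_noise \<omega>"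
    unfolding weighted_noise_def by (rule order_trans[OF weighted_mean_sq_le weighted_mean_good[OF g]]) simp
  have "(a - m x)\<^sup>2 \<le> 2 * ((\<Sum>i=1..n. wt \<omega> i * ?R i) / real n)\<^sup>2 + 2 * ((\<Sum>i=1..n. wt \<omega> i * ?z i) / real n)\<^sup>2"
    unfolding am by (rule sq2)
  then have p: "(a - m x)\<^sup>2 \<le> 4 * (smax / dmin)\<^sup>2 * ((tau_average 0 \<omega>)\<^sup>2 + (tau_average 1 \<omega>)\<^sup>2) + 8 * (smax / dmin)\<^sup>2 * smax * weighted_noise \<omega>"
    using p1 p2 by (simp add: mult.assoc)
  have "2 * (2 * M1 / \<kappa>)\<^sup>2 * (a - m x)\<^sup>2 + 2 * (2 * \<bar>m x\<bar> / \<kappa>)\<^sup>2 * (b - ?e)\<^sup>2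
    \<le> 2 * (2 * M1 / \<kappa>)\<^sup>2 * (4 * (smax / dmin)\<^sup>2 * ((tau_average 0 \<omega>)\<^sup>2 + (tau_average 1 \<omega>)\<^sup>2) + 8 * (smax / dmin)\<^sup>2 * smax * weighted_noise \<omega>)
      + 2 * (2 * \<bar>m x\<bar> / \<kappa>)\<^sup>2 * (2 * mean_noise \<omega> + 2 * tau_deviation \<omega>)"
    using nbar_deviation[OF w] p unfolding b_def by (intro add_mono mult_left_mono) auto
  then show ?thesis using main unfolding tt by (simp add: distrib_left mult.assoc)
qed

text \<open>The chain runs from the Frechet mean to \<open>q0\<close>, from there to the projection,
  and then through the average \<open>Gi\<close> of true quantile functions to the average
  \<open>Gh\<close> of empirical ones. The affine reproduction of the weights handles
  \<open>q0\<close> against \<open>Gi\<close>; Cauchy-Schwarz over the sample handles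
  \<open>Gi\<close> against \<open>Gh\<close>.\<close>

lemma shape_error:
  assumes g: "\<omega> \<in> good"
  shows "(shape_dist T (frechet_mean T M L (Pf x)) (f_tilde T M L K h x n (X\<omega> \<omega>) (N\<omega> \<omega>)))\<^sup>2
    \<le> 64 * (smax / dmin)\<^sup>2 * smax * quantile_noise \<omega> + 32 * (smax / dmin)\<^sup>2 * (shape_energy 0 \<omega> + shape_energy 1 \<omega>)"
proof -
  have w: "\<omega> \<in> space P" and \<tau>w: "\<And>i. i \<in> {1..n} \<Longrightarrow> \<kappa> \<le> \<tau>s i \<omega>" using g by (auto simp: good_def)
  define Qh where "Qh i = empirical_quantile T (N i \<omega>)" for i
  define Qi where "Qi i = intensity_quantile T (\<Lambda>s i \<omega>)" for i
  define Gh where "Gh t = (\<Sum>i=1..n. wt \<omega> i * Qh i t) / real n" for t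
  define Gi where "Gi t = (\<Sum>i=1..n. wt \<omega> i * Qi i t) / real n" for t
  define W where "W = (\<Sum>i=1..n. \<bar>wt \<omega> i\<bar>) / real n"
  have Qh: "set_borel_measurable lborel {0..1} (Qh i)" "\<And>t. t \<in> {0..1} \<Longrightarrow> \<bar>Qh i t\<bar> \<le> T"
    and Qi: "set_borel_measurable lborel {0..1} (Qi i)" "\<And>t. t \<in> {0..1} \<Longrightarrow> \<bar>Qi i t\<bar> \<le> T"
    and QD: "(L2_dist (Qh i) (Qi i))\<^sup>2 \<le> quantile_error i \<omega>" if i: "i \<in> {1..n}" for i
  proof -
    show "set_borel_measurable lborel {0..1} (Qh i)" "\<And>t. t \<in> {0..1} \<Longrightarrow> \<bar>Qh i t\<bar> \<le> T"
      "set_borel_measurable lborel {0..1} (Qi i)" "(L2_dist (Qh i) (Qi i))\<^sup>2 \<le> quantile_error i \<omega>"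
      unfolding Qh_def Qi_def using empirical_quantile_dist[OF i w \<tau>w[OF i]] by auto
    show "\<bar>Qi i t\<bar> \<le> T" if "t \<in> {0..1}" for t
      using intensity_quantile_bounds[OF \<Lambda>s_mem[OF _ w], of i t] i TML(1) by (auto simp: Qi_def)
  qed
  have avg_m: "set_borel_measurable lborel {0..1} (\<lambda>t. (\<Sum>i=1..n. wt \<omega> i * q i t) / real n)"
    if "\<And>i. i \<in> {1..n} \<Longrightarrow> set_borel_measurable lborel {0..1} (q i)" for q
  proof -
    have "(\<lambda>t. indicator {0..1} t *\<^sub>R ((\<Sum>i=1..n. wt \<omega> i * q i t) / real n)) = (\<lambda>t. (\<Sum>i=1..n. wt \<omega> i * (indicator {0..1} t *\<^sub>R q i t)) / real n)"
      by (auto simp: fun_eq_iff sum_distrib_left mult_ac)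
    then show ?thesis using that unfolding set_borel_measurable_def by simp
  qed
  have avg_b: "\<bar>(\<Sum>i=1..n. wt \<omega> i * q i t) / real n\<bar> \<le> W * T"
    if "\<And>i. i \<in> {1..n} \<Longrightarrow> \<bar>q i t\<bar> \<le> T" for q and t :: real
  proof -
    have "\<bar>\<Sum>i=1..n. wt \<omega> i * q i t\<bar> \<le> (\<Sum>i=1..n. \<bar>wt \<omega> i\<bar> * T)"
      by (rule order_trans[OF sum_abs]) (auto intro!: sum_mono mult_left_mono that simp: abs_mult)
    then show ?thesis by (simp add: W_def abs_divide sum_distrib_right[symmetric] divide_right_mono)
  qed
  have Gh: "set_borel_measurable lborel {0..1} Gh" "\<And>t. t \<in> {0..1} \<Longrightarrow> \<bar>Gh t\<bar> \<le> W * T"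
    unfolding Gh_def[abs_def] by (intro avg_m Qh(1), assumption) (intro avg_b Qh(2))
  have Gi: "set_borel_measurable lborel {0..1} Gi" "\<And>t. t \<in> {0..1} \<Longrightarrow> \<bar>Gi t\<bar> \<le> W * T"
    unfolding Gi_def[abs_def] by (intro avg_m Qi(1), assumption) (intro avg_b Qi(2))
  define qt where "qt = Q_tilde T M L K h x n (X\<omega> \<omega>) (N\<omega> \<omega>)"
  have qt_eq: "qt = arg_min_on (\<lambda>q. (L2_dist q Gh)\<^sup>2) (quantile_set T M L)"
    unfolding qt_def Q_tilde_def Gh_def[abs_def] Qh_def ..
  have qt: "qt \<in> quantile_set T M L" "(L2_dist qt q0)\<^sup>2 \<le> 4 * (L2_dist q0 Gh)\<^sup>2"
    unfolding qt_eq by (rule L2_projection_dist[OF Gh q0_mem], assumption) (rule L2_projection_dist(2)[OF Gh q0_mem])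
  let ?ft = "f_tilde T M L K h x n (X\<omega> \<omega>) (N\<omega> \<omega>)" and ?fm = "frechet_mean T M L (Pf x)"
  \<comment> \<open>The projection is the quantile function of some shape, so the choice in
    \<open>f_tilde\<close> is not void.\<close>
  have "\<exists>y. y \<in> shape_space T M L \<and> (\<forall>t\<in>{0..1}. shape_quantile T y t = qt t)"
    using quantile_set_realised[OF qt(1) TML(1,2)] by blast
  then have ft: "?ft \<in> shape_space T M L \<and> (\<forall>t\<in>{0..1}. shape_quantile T ?ft t = qt t)"
    unfolding f_tilde_def qt_def by (rule someI_ex)
  have fm: "shape_quantile T ?fm \<in> quantile_set T M L"
    using shape_space_dist(3)[OF frechet_mean_quantile(1)] TML by simp
  have "(shape_dist T ?fm ?ft)\<^sup>2 = (L2_dist (shape_quantile T ?fm) qt)\<^sup>2"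
    unfolding shape_dist_def using ft by (intro arg_cong[of _ _ "\<lambda>r. r\<^sup>2"] L2_dist_cong) auto
  also have "\<dots> \<le> 2 * (L2_dist (shape_quantile T ?fm) q0)\<^sup>2 + 2 * (L2_dist q0 qt)\<^sup>2"
    by (rule L2_dist_triangle_sq[OF quantile_set_measurable(1)[OF fm] quantile_set_measurable(1)[OF q0_mem] quantile_set_measurable(1)[OF qt(1)]
         quantile_set_measurable(2)[OF fm] quantile_set_measurable(2)[OF q0_mem] quantile_set_measurable(2)[OF qt(1)]])
  \<comment> \<open>The first distance is 0, and the projection contributes the factor 4.\<close>
  also have "\<dots> \<le> 8 * (L2_dist q0 Gh)\<^sup>2"
    using qt(2) by (simp add: frechet_mean_quantile(2) L2_dist_commute[of q0 qt])
  also have "(L2_dist q0 Gh)\<^sup>2 \<le> 2 * (L2_dist q0 Gi)\<^sup>2 + 2 * (L2_dist Gi Gh)\<^sup>2"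
    by (rule L2_dist_triangle_sq[OF quantile_set_measurable(1)[OF q0_mem] Gi(1) Gh(1) quantile_set_measurable(2)[OF q0_mem] Gi(2) Gh(2)])
  finally have main: "(shape_dist T ?fm ?ft)\<^sup>2 \<le> 16 * (L2_dist q0 Gi)\<^sup>2 + 16 * (L2_dist Gi Gh)\<^sup>2" by simp
  have d: "design_det K x h n (X\<omega> \<omega>) \<noteq> 0" using good_weights(1)[OF g] dmin_pos by linarith
  have e1: "(L2_dist q0 Gi)\<^sup>2 \<le> 2 * (smax / dmin)\<^sup>2 * (shape_energy 0 \<omega> + shape_energy 1 \<omega>)"
  proof -
    let ?A = "\<lambda>t. (shape_average 0 t \<omega>)\<^sup>2 + (shape_average 1 t \<omega>)\<^sup>2"
    have i: "set_integrable lborel {0..1} ?A" by (intro set_integral_add shape_average_section[OF w])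
    have "(L2_dist q0 Gi)\<^sup>2 \<le> (LBINT t:{0..1}. 2 * (smax / dmin)\<^sup>2 * ?A t)"
      unfolding L2_dist_sq
    proof (rule set_integral_mono)
      show "set_integrable lborel {0..1} (\<lambda>t. (q0 t - Gi t)\<^sup>2)"
        by (rule set_integrable_diff_sq[OF quantile_set_measurable(1)[OF q0_mem] Gi(1) quantile_set_measurable(2)[OF q0_mem] Gi(2)])
      show "set_integrable lborel {0..1} (\<lambda>t. 2 * (smax / dmin)\<^sup>2 * ?A t)" using i by (intro set_integrable_mult_right)
      fix t :: real
      have "Gi t - q0 t = (\<Sum>i=1..n. wt \<omega> i * (Qi i t - q0 t - b0 t * (Xs i \<omega> - x))) / real n"
        unfolding Gi_def by (rule local_weight_affine[OF h(1) d])
      also have "\<dots> = (\<Sum>i=1..n. wt \<omega> i * resid t (Z i \<omega>)) / real n" by (simp add: resid_def Qi_def)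
      finally have eq: "Gi t - q0 t = (\<Sum>i=1..n. wt \<omega> i * resid t (Z i \<omega>)) / real n" .
      have "(q0 t - Gi t)\<^sup>2 = (Gi t - q0 t)\<^sup>2" by (rule power2_commute)
      also have "\<dots> \<le> 2 * (smax / dmin)\<^sup>2 * ?A t"
        unfolding eq by (rule local_weight_sum_sq_bound[OF h(1) dmin_pos good_weights(1-3)[OF g]])
      finally show "(q0 t - Gi t)\<^sup>2 \<le> 2 * (smax / dmin)\<^sup>2 * ?A t" .
    qed
    also have "\<dots> = 2 * (smax / dmin)\<^sup>2 * (shape_energy 0 \<omega> + shape_energy 1 \<omega>)"
      unfolding shape_energy_def set_integral_mult_right
      by (subst set_integral_add(2)[OF shape_average_section(2)[OF w] shape_average_section(2)[OF w]]) simp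
    finally show ?thesis .
  qed
  have e2: "(L2_dist Gi Gh)\<^sup>2 \<le> 4 * (smax / dmin)\<^sup>2 * smax * quantile_noise \<omega>"
  proof -
    have iD: "set_integrable lborel {0..1} (\<lambda>t. \<bar>wt \<omega> i\<bar> * (Qh i t - Qi i t)\<^sup>2)" if "i \<in> {1..n}" for i
      by (intro set_integrable_mult_right set_integrable_diff_sq[OF Qh(1)[OF that] Qi(1)[OF that] Qh(2)[OF that] Qi(2)[OF that]])
    have iS: "set_integrable lborel {0..1} (\<lambda>t. \<Sum>i=1..n. \<bar>wt \<omega> i\<bar> * (Qh i t - Qi i t)\<^sup>2)"
      unfolding set_integrable_def scaleR_sum_right using iD
      by (intro Bochner_Integration.integrable_sum) (simp only: set_integrable_def)
    have "(L2_dist Gi Gh)\<^sup>2 = (L2_dist Gh Gi)\<^sup>2" by (simp only: L2_dist_commute)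
    also have "\<dots> \<le> (LBINT t:{0..1}. (W / real n) * (\<Sum>i=1..n. \<bar>wt \<omega> i\<bar> * (Qh i t - Qi i t)\<^sup>2))"
      unfolding L2_dist_sq
    proof (rule set_integral_mono)
      show "set_integrable lborel {0..1} (\<lambda>t. (Gh t - Gi t)\<^sup>2)"
        by (rule set_integrable_diff_sq[OF Gh(1) Gi(1) Gh(2) Gi(2)])
      show "set_integrable lborel {0..1} (\<lambda>t. (W / real n) * (\<Sum>i=1..n. \<bar>wt \<omega> i\<bar> * (Qh i t - Qi i t)\<^sup>2))"
        using iS by (intro set_integrable_mult_right)
      fix t :: real
      have "Gh t - Gi t = (\<Sum>i=1..n. wt \<omega> i * (Qh i t - Qi i t)) / real n"
        by (simp add: Gh_def Gi_def right_diff_distrib sum_subtractf diff_divide_distrib)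
      then show "(Gh t - Gi t)\<^sup>2 \<le> (W / real n) * (\<Sum>i=1..n. \<bar>wt \<omega> i\<bar> * (Qh i t - Qi i t)\<^sup>2)"
        using weighted_mean_sq_le[of "wt \<omega>" "\<lambda>i. Qh i t - Qi i t" "{1..n}" n] by (simp add: W_def)
    qed
    also have "\<dots> = W * ((\<Sum>i=1..n. \<bar>wt \<omega> i\<bar> * (L2_dist (Qh i) (Qi i))\<^sup>2) / real n)"
    proof -
      have "(LBINT t:{0..1}. \<Sum>i=1..n. \<bar>wt \<omega> i\<bar> * (Qh i t - Qi i t)\<^sup>2) = (\<Sum>i=1..n. LBINT t:{0..1}. \<bar>wt \<omega> i\<bar> * (Qh i t - Qi i t)\<^sup>2)"
        unfolding set_lebesgue_integral_def scaleR_sum_right using iD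
        by (intro Bochner_Integration.integral_sum) (simp only: set_integrable_def)
      then show ?thesis by (simp add: L2_dist_sq)
    qed
    also have "\<dots> \<le> 4 * (smax / dmin)\<^sup>2 * smax * quantile_noise \<omega>"
      unfolding W_def quantile_noise_def by (rule weighted_mean_good[OF g QD])
    finally show ?thesis .
  qed
  show ?thesis using main e1 e2 by (simp add: distrib_left mult.assoc)
qed

end

section \<open>Expected error and probability of the bad event\<close>

context intensity_model
begin

definition budget_bound :: "real \<Rightarrow> nat \<Rightarrow> real \<Rightarrow> real" where
  "budget_bound h n \<alpha> = 2 * ((D * D * h\<^sup>2)\<^sup>2 + (B\<tau>\<^sup>2 * D * D / h) / real n)
     + 2 * ((Bq * h\<^sup>2)\<^sup>2 + (Br\<^sup>2 * D * D / h) / real n) + M1 / \<alpha> * D + BD / sqrt \<alpha> + M1 / \<alpha> + M1\<^sup>2 / real n"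

text \<open>Chebyshev bounds for the three design moments missing their limits by \<eta> and for the
  scaled mean count missing E(\<tau>) by \<kappa> / 2. The factor
  \<open>1 + kernel_moment K 2\<close> dominates the kernel moments of order 0, 1 and 2
  together.\<close>

definition bad_bound :: "real \<Rightarrow> nat \<Rightarrow> real \<Rightarrow> real" where
  "bad_bound h n \<alpha> = 3 * (((Bd * h)\<^sup>2 + (2 * D * D / h + 2 * (fX x * (1 + kernel_moment K 2))\<^sup>2) / real n) / \<eta>\<^sup>2)
     + (2 * (M1 / \<alpha>) + 2 * (M1\<^sup>2 / real n)) / (\<kappa> / 2)\<^sup>2"

end

context intensity_sample
begin

lemma budget_terms_nonneg: "0 \<le> weighted_noise \<omega>" "0 \<le> mean_noise \<omega>" "0 \<le> tau_deviation \<omega>" "0 \<le> quantile_noise \<omega>" "0 \<le> shape_energy j \<omega>"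
proof -
  note kp = kern_props(6)[OF K h(1)]
  show "0 \<le> weighted_noise \<omega>" "0 \<le> mean_noise \<omega>" "0 \<le> tau_deviation \<omega>" "0 \<le> quantile_noise \<omega>"
    unfolding weighted_noise_def mean_noise_def tau_deviation_def quantile_noise_def
    by (auto intro!: divide_nonneg_nonneg sum_nonneg mult_nonneg_nonneg kp quantile_error_nonneg)
  show "0 \<le> shape_energy j \<omega>" unfolding shape_energy_def set_lebesgue_integral_def
    by (intro integral_nonneg_AE AE_I2) auto
qed

lemma error_budget_nonneg: "0 \<le> error_budget \<omega>"
  unfolding error_budget_def using budget_terms_nonneg by (intro add_nonneg_nonneg) auto

lemma error_bound:
  assumes g: "\<omega> \<in> good"
  shows "(intensity_dist T (max (m x) 0, frechet_mean T M L (Pf x))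
      (expectation \<tau> * tau_tilde K h x n (X\<omega> \<omega>) (N\<omega> \<omega>), f_tilde T M L K h x n (X\<omega> \<omega>) (N\<omega> \<omega>)))\<^sup>2
    \<le> Cfin * error_budget \<omega>"
proof -
  define V a c where "V = (smax / dmin)\<^sup>2" and "a = (2 * M1 / \<kappa>)\<^sup>2" and "c = (2 * \<bar>m x\<bar> / \<kappa>)\<^sup>2"
  have nn: "0 \<le> V" "0 \<le> a" "0 \<le> c" "0 \<le> smax" using smax_pos by (auto simp: V_def a_def c_def)
  \<comment> \<open>Expanded in this form, the constant visibly dominates each of the five
    coefficients that multiply the parts of the budget.\<close>
  have Cf: "Cfin = 64 * V + 64 * (V * a) + 64 * (V * smax) + 64 * (V * smax * a) + 4 * c"
    unfolding Cfin_def V_def[symmetric] a_def[symmetric] c_def[symmetric] by (simp add: algebra_simps)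
  have pr: "0 \<le> V * a" "0 \<le> V * smax" "0 \<le> V * smax * a" using nn by auto
  let ?A = "(tau_average 0 \<omega>)\<^sup>2 + (tau_average 1 \<omega>)\<^sup>2" and ?E = "shape_energy 0 \<omega> + shape_energy 1 \<omega>"
  have t: "8 * (V * a) * ?A \<le> Cfin * ?A" "16 * (V * smax * a) * weighted_noise \<omega> \<le> Cfin * weighted_noise \<omega>"
    "4 * c * (mean_noise \<omega> + tau_deviation \<omega>) \<le> Cfin * (mean_noise \<omega> + tau_deviation \<omega>)"
    "64 * (V * smax) * quantile_noise \<omega> \<le> Cfin * quantile_noise \<omega>" "32 * V * ?E \<le> Cfin * ?E"
    using nn pr budget_terms_nonneg unfolding Cf by (intro mult_right_mono; simp)+
  have "(intensity_dist T (max (m x) 0, frechet_mean T M L (Pf x))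
      (expectation \<tau> * tau_tilde K h x n (X\<omega> \<omega>) (N\<omega> \<omega>), f_tilde T M L K h x n (X\<omega> \<omega>) (N\<omega> \<omega>)))\<^sup>2
    = (expectation \<tau> * tau_tilde K h x n (X\<omega> \<omega>) (N\<omega> \<omega>) - max (m x) 0)\<^sup>2
      + (shape_dist T (frechet_mean T M L (Pf x)) (f_tilde T M L K h x n (X\<omega> \<omega>) (N\<omega> \<omega>)))\<^sup>2"
    unfolding intensity_dist_def by (simp add: power2_commute)
  also have "\<dots> \<le> (2 * a * (4 * V * ?A + 8 * V * smax * weighted_noise \<omega>) + 4 * c * (mean_noise \<omega> + tau_deviation \<omega>))
      + (64 * V * smax * quantile_noise \<omega> + 32 * V * ?E)"
    unfolding V_def a_def c_def by (rule add_mono[OF tau_error[OF g] shape_error[OF g]])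
  also have "\<dots> = 8 * (V * a) * ?A + 16 * (V * smax * a) * weighted_noise \<omega> + 4 * c * (mean_noise \<omega> + tau_deviation \<omega>)
      + 64 * (V * smax) * quantile_noise \<omega> + 32 * V * ?E"
    by (simp add: algebra_simps)
  also have "\<dots> \<le> Cfin * ?A + Cfin * weighted_noise \<omega> + Cfin * (mean_noise \<omega> + tau_deviation \<omega>)
      + Cfin * quantile_noise \<omega> + Cfin * ?E"
    by (intro add_mono t)
  also have "\<dots> = Cfin * error_budget \<omega>" unfolding error_budget_def by (simp add: algebra_simps)
  finally show ?thesis .
qed

lemma mean_le:
  assumes "\<And>i. i \<in> {1..n} \<Longrightarrow> integrable P (Y i)" "\<And>i. i \<in> {1..n} \<Longrightarrow> expectation (Y i) \<le> b"
  shows "integrable P (\<lambda>\<omega>. (\<Sum>i=1..n. Y i \<omega>) / real n)" "expectation (\<lambda>\<omega>. (\<Sum>i=1..n. Y i \<omega>) / real n) \<le> b"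
proof -
  show "integrable P (\<lambda>\<omega>. (\<Sum>i=1..n. Y i \<omega>) / real n)"
    using assms(1) by (intro integrable_divide Bochner_Integration.integrable_sum) auto
  have "expectation (\<lambda>\<omega>. (\<Sum>i=1..n. Y i \<omega>) / real n) = (\<Sum>i=1..n. expectation (Y i)) / real n"
    using assms(1) by (simp add: Bochner_Integration.integral_sum)
  also have "\<dots> \<le> (\<Sum>i=1..n. b) / real n" by (intro divide_right_mono sum_mono assms(2)) auto
  also have "\<dots> = b" using n by simp
  finally show "expectation (\<lambda>\<omega>. (\<Sum>i=1..n. Y i \<omega>) / real n) \<le> b" .
qed

lemma mean_noise_expectation: "integrable P mean_noise" "expectation mean_noise \<le> M1 / \<alpha>"
proof -
  have T: "{0..T} \<in> sets borel" "{0..T} \<subseteq> {0..T}" by auto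
  have *: "integrable P (\<lambda>\<omega>. (noise i {0..T} \<omega>)\<^sup>2) \<and> expectation (\<lambda>\<omega>. (noise i {0..T} \<omega>)\<^sup>2) \<le> M1 / \<alpha>" if "i \<in> {1..n}" for i
  proof -
    have "integrable P (\<lambda>\<omega>. 1 * (noise i {0..T} \<omega>)\<^sup>2)"
      by (rule noise_second_moment(1)[OF that T, where w = "\<lambda>_. 1"]) simp_all
    moreover have "expectation (\<lambda>\<omega>. 1 * (noise i {0..T} \<omega>)\<^sup>2) \<le> M1 / \<alpha> * expectation (\<lambda>_. 1)"
      by (rule noise_second_moment(2)[OF that T, where w = "\<lambda>_. 1"]) simp_all
    ultimately show ?thesis unfolding mult_1 by (simp add: prob_space)
  qed
  show "integrable P mean_noise" "expectation mean_noise \<le> M1 / \<alpha>"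
    unfolding mean_noise_def[abs_def] by (rule mean_le[OF *[THEN conjunct1] *[THEN conjunct2]]; assumption)+
qed

lemma weighted_noise_expectation: "integrable P weighted_noise" "expectation weighted_noise \<le> M1 / \<alpha> * D"
proof -
  have T: "{0..T} \<in> sets borel" "{0..T} \<subseteq> {0..T}" by auto
  note kp = kern_props[OF K h(1)]
  have *: "integrable P (\<lambda>\<omega>. kern K x h 0 (Xs i \<omega>) * (noise i {0..T} \<omega>)\<^sup>2)
     \<and> expectation (\<lambda>\<omega>. kern K x h 0 (Xs i \<omega>) * (noise i {0..T} \<omega>)\<^sup>2) \<le> M1 / \<alpha> * D" if i: "i \<in> {1..n}" for i
  proof -
    note e = noise_second_moment[OF i T kp(1) kp(6) expect_kern_0(1)[OF h]]
    have "M1 / \<alpha> * expectation (\<lambda>\<omega>. kern K x h 0 (X \<omega>)) \<le> M1 / \<alpha> * D"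
      using expect_kern_0(2)[OF h] \<tau>_bounds \<alpha> by (intro mult_left_mono) auto
    then show ?thesis using e by linarith
  qed
  show "integrable P weighted_noise" "expectation weighted_noise \<le> M1 / \<alpha> * D"
    unfolding weighted_noise_def[abs_def] by (rule mean_le[OF *[THEN conjunct1] *[THEN conjunct2]]; assumption)+
qed

lemma quantile_noise_expectation: "integrable P quantile_noise" "expectation quantile_noise \<le> BD / sqrt \<alpha>"
  unfolding quantile_noise_def[abs_def] by (rule mean_le[OF quantile_error_expectation]; assumption)+

lemma error_budget_expectation:
  "integrable P error_budget" "expectation error_budget \<le> budget_bound h n \<alpha>"
proof -
  note i = tau_local_average(1) shape_average_L2(1) weighted_noise_expectation(1) quantile_noise_expectation(1)
    mean_noise_expectation(1) tau_mean_square(1)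
  note e = tau_local_average(2) shape_average_L2(2) weighted_noise_expectation(2) quantile_noise_expectation(2)
    mean_noise_expectation(2) tau_mean_square(2)
  have i': "integrable P (\<lambda>\<omega>. (tau_average j \<omega>)\<^sup>2)" "integrable P (shape_energy j)" "integrable P tau_deviation" for j
    using i unfolding tau_average_def[abs_def] shape_energy_def[abs_def] tau_deviation_def[abs_def] by auto
  have e': "expectation (\<lambda>\<omega>. (tau_average j \<omega>)\<^sup>2) \<le> (D * D * h\<^sup>2)\<^sup>2 + (B\<tau>\<^sup>2 * D * D / h) / real n"
    "expectation (shape_energy j) \<le> (Bq * h\<^sup>2)\<^sup>2 + (Br\<^sup>2 * D * D / h) / real n"
    "expectation tau_deviation \<le> M1\<^sup>2 / real n" for j
    using e unfolding tau_average_def[abs_def] shape_energy_def[abs_def] tau_deviation_def[abs_def] by auto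
  note ii = i' weighted_noise_expectation(1) quantile_noise_expectation(1) mean_noise_expectation(1)
  show "integrable P error_budget" unfolding error_budget_def[abs_def] using ii by (intro Bochner_Integration.integrable_add)
  have "expectation error_budget = expectation (\<lambda>\<omega>. (tau_average 0 \<omega>)\<^sup>2) + expectation (\<lambda>\<omega>. (tau_average 1 \<omega>)\<^sup>2)
     + expectation (shape_energy 0) + expectation (shape_energy 1)
     + expectation weighted_noise + expectation quantile_noise + expectation mean_noise + expectation tau_deviation"
    unfolding error_budget_def[abs_def] using ii by simp
  also have "\<dots> \<le> ((D * D * h\<^sup>2)\<^sup>2 + (B\<tau>\<^sup>2 * D * D / h) / real n) + ((D * D * h\<^sup>2)\<^sup>2 + (B\<tau>\<^sup>2 * D * D / h) / real n)
     + ((Bq * h\<^sup>2)\<^sup>2 + (Br\<^sup>2 * D * D / h) / real n) + ((Bq * h\<^sup>2)\<^sup>2 + (Br\<^sup>2 * D * D / h) / real n)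
     + M1 / \<alpha> * D + BD / sqrt \<alpha> + M1 / \<alpha> + M1\<^sup>2 / real n"
    by (intro add_mono e' weighted_noise_expectation(2) quantile_noise_expectation(2) mean_noise_expectation(2))
  also have "\<dots> = budget_bound h n \<alpha>" unfolding budget_bound_def by (simp only: mult_2 add.assoc)
  finally show "expectation error_budget \<le> budget_bound h n \<alpha>" .
qed

lemma good_complement:
  "good \<in> sets P" "prob (space P - good) \<le> bad_bound h n \<alpha>"
proof -
  let ?S = "\<lambda>j \<omega>. local_moment K x h n (X\<omega> \<omega>) j - fX x * kernel_moment K j"
  let ?b = "((Bd * h)\<^sup>2 + (2 * D * D / h + 2 * (fX x * (1 + kernel_moment K 2))\<^sup>2) / real n)"
  have Sm[measurable]: "(\<lambda>\<omega>. ?S j \<omega>) \<in> borel_measurable P" for j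
  proof -
    have "(\<lambda>\<omega>. kern K x h j (Xs i \<omega>) * 1) \<in> borel_measurable P" if "i \<in> {1..n}" for i
      using measurable_compose[OF Xs_measurable kern_props(1)[OF K h(1)]] that by simp
    then show ?thesis unfolding local_average_def
      by (intro borel_measurable_diff borel_measurable_divide borel_measurable_sum borel_measurable_const)
  qed
  have \<tau>m: "(\<lambda>\<omega>. \<tau>s i \<omega>) \<in> borel_measurable P" if "i \<in> {1..n}" for i
    using measurable_compose[OF \<Lambda>s_measurable intensity_factor_measurable] that by simp
  have bm[measurable]: "nbar \<in> borel_measurable P"
  proof -
    have T: "{0..T} \<in> sets borel" "{0..T} \<subseteq> {0..T}" by auto
    have "(\<lambda>\<omega>. (\<Sum>i=1..n. \<tau>s i \<omega> + noise i {0..T} \<omega>) / real n) \<in> borel_measurable P"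
      by (intro borel_measurable_divide borel_measurable_sum borel_measurable_add \<tau>m noise_measurable T borel_measurable_const)
    moreover have "(\<Sum>i=1..n. \<tau>s i \<omega> + noise i {0..T} \<omega>) / real n = nbar \<omega>" if "\<omega> \<in> space P" for \<omega>
    proof -
      have "nbar \<omega> = (\<Sum>i=1..n. real (size (N i \<omega>)) / \<alpha>) / real n"
        by (simp add: nbar_def mean_count_def sum_divide_distrib mult.commute)
      also have "\<dots> = (\<Sum>i=1..n. \<tau>s i \<omega> + noise i {0..T} \<omega>) / real n"
        using size_eq_noise[OF _ that] by (intro arg_cong2[of _ _ _ _ "(/)"] sum.cong) auto
      finally show ?thesis ..
    qed
    ultimately show ?thesis by (rule measurable_cong[THEN iffD1, rotated])
  qed
  have "good = (\<Inter>i\<in>{1..n}. {\<omega> \<in> space P. \<kappa> \<le> \<tau>s i \<omega> \<and> \<tau>s i \<omega> \<le> M1})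
     \<inter> (\<Inter>j\<in>{0,1,2}. {\<omega> \<in> space P. \<bar>?S j \<omega>\<bar> < \<eta>}) \<inter> {\<omega> \<in> space P. \<bar>nbar \<omega> - expectation \<tau>\<bar> < \<kappa> / 2}"
    using n by (auto simp: good_def)
  also have "\<dots> \<in> sets P"
  proof (intro sets.Int sets.finite_INT)
    show "{\<omega> \<in> space P. \<kappa> \<le> \<tau>s i \<omega> \<and> \<tau>s i \<omega> \<le> M1} \<in> sets P" if "i \<in> {1..n}" for i
      using \<tau>m[OF that] by measurable
  qed (use n in auto)
  finally show gm: "good \<in> sets P" .
  define B where "B j = {\<omega> \<in> space P. \<eta>\<^sup>2 \<le> (?S j \<omega>)\<^sup>2}" for j
  define B' where "B' = {\<omega> \<in> space P. (\<kappa> / 2)\<^sup>2 \<le> (nbar \<omega> - expectation \<tau>)\<^sup>2}"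
  have Bm: "B j \<in> sets P" "B' \<in> sets P" for j unfolding B_def B'_def by measurable
  have sqle: "c\<^sup>2 \<le> z\<^sup>2" if "0 < c" "\<not> \<bar>z\<bar> < c" for c z :: real
    using that power_mono[of c "\<bar>z\<bar>" 2] by simp
  \<comment> \<open>The factor bounds hold for the copies only almost surely, so the bad event is
    covered by the four deviation events up to a null set.\<close>
  have ae: "AE \<omega> in P. \<omega> \<in> space P - good \<longrightarrow> \<omega> \<in> B 0 \<union> B 1 \<union> B 2 \<union> B'"
  proof -
    have "AE \<omega> in P. \<forall>i\<in>{1..n}. \<kappa> \<le> \<tau>s i \<omega> \<and> \<tau>s i \<omega> \<le> M1"
    proof (rule AE_finite_allI)
      show "AE \<omega> in P. \<kappa> \<le> \<tau>s i \<omega> \<and> \<tau>s i \<omega> \<le> M1" if "i \<in> {1..n}" for i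
        by (rule \<tau>s_bounds) (use that in simp)
    qed simp
    then show ?thesis
    proof eventually_elim
      case (elim \<omega>)
      show ?case
      proof
        assume w: "\<omega> \<in> space P - good"
        then have "\<not> (\<forall>j\<in>{0,1,2}. \<bar>?S j \<omega>\<bar> < \<eta>) \<or> \<not> \<bar>nbar \<omega> - expectation \<tau>\<bar> < \<kappa> / 2"
          using elim unfolding good_def by blast
        then have "\<not> \<bar>?S 0 \<omega>\<bar> < \<eta> \<or> \<not> \<bar>?S 1 \<omega>\<bar> < \<eta> \<or> \<not> \<bar>?S 2 \<omega>\<bar> < \<eta> \<or> \<not> \<bar>nbar \<omega> - expectation \<tau>\<bar> < \<kappa> / 2"
          by blast
        then show "\<omega> \<in> B 0 \<union> B 1 \<union> B 2 \<union> B'"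
          using sqle[OF \<eta>_pos] sqle[of "\<kappa> / 2"] \<tau>_bounds(1) w unfolding B_def B'_def by auto
      qed
    qed
  qed
  have pB: "prob (B j) \<le> ?b / \<eta>\<^sup>2" if j: "j \<in> {0, 1, 2}" for j
  proof -
    have k: "\<bar>kernel_moment K j\<bar> \<le> 1 + kernel_moment K 2" "0 < kernel_moment K 2" using j kernel_moment_values[OF K] by auto
    have "(fX x * kernel_moment K j)\<^sup>2 \<le> (fX x * (1 + kernel_moment K 2))\<^sup>2"
      unfolding power_mult_distrib using power_mono[OF k(1), of 2] by (intro mult_left_mono) auto
    then have "expectation (\<lambda>\<omega>. (?S j \<omega>)\<^sup>2) \<le> ?b"
      by (intro order_trans[OF design_mean_square(2)[of j]] add_left_mono divide_right_mono) auto
    moreover have "prob (B j) \<le> expectation (\<lambda>\<omega>. (?S j \<omega>)\<^sup>2) / \<eta>\<^sup>2"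
      unfolding B_def using design_mean_square(1)[of j] \<eta>_pos
      by (intro integral_Markov_inequality_measure[where A = "{}"]) auto
    ultimately show ?thesis using \<eta>_pos by (meson divide_right_mono order_trans zero_le_power2)
  qed
  have pB': "prob B' \<le> (2 * (M1 / \<alpha>) + 2 * (M1\<^sup>2 / real n)) / (\<kappa> / 2)\<^sup>2"
  proof -
    have td: "integrable P tau_deviation" "expectation tau_deviation \<le> M1\<^sup>2 / real n"
      using tau_mean_square unfolding tau_deviation_def[abs_def] by auto
    have "integrable P (\<lambda>\<omega>. 2 * mean_noise \<omega> + 2 * tau_deviation \<omega>)" using mean_noise_expectation td by simp
    then have "prob {\<omega> \<in> space P. (\<kappa> / 2)\<^sup>2 \<le> 2 * mean_noise \<omega> + 2 * tau_deviation \<omega>}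
      \<le> expectation (\<lambda>\<omega>. 2 * mean_noise \<omega> + 2 * tau_deviation \<omega>) / (\<kappa> / 2)\<^sup>2"
      using \<tau>_bounds(1) budget_terms_nonneg by (intro integral_Markov_inequality_measure[where A = "{}"]) auto
    moreover have "expectation (\<lambda>\<omega>. 2 * mean_noise \<omega> + 2 * tau_deviation \<omega>) \<le> 2 * (M1 / \<alpha>) + 2 * (M1\<^sup>2 / real n)"
      using mean_noise_expectation td by simp
    moreover have "prob B' \<le> prob {\<omega> \<in> space P. (\<kappa> / 2)\<^sup>2 \<le> 2 * mean_noise \<omega> + 2 * tau_deviation \<omega>}"
    proof (rule finite_measure_mono)
      show "B' \<subseteq> {\<omega> \<in> space P. (\<kappa> / 2)\<^sup>2 \<le> 2 * mean_noise \<omega> + 2 * tau_deviation \<omega>}"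
        unfolding B'_def using nbar_deviation by force
      show "{\<omega> \<in> space P. (\<kappa> / 2)\<^sup>2 \<le> 2 * mean_noise \<omega> + 2 * tau_deviation \<omega>} \<in> events"
        using borel_measurable_integrable[OF mean_noise_expectation(1)] borel_measurable_integrable[OF td(1)] by measurable
    qed
    ultimately show ?thesis by (meson divide_right_mono order_trans zero_le_power2)
  qed
  have "prob (space P - good) \<le> prob (B 0 \<union> B 1 \<union> B 2 \<union> B')"
    using ae Bm by (intro finite_measure_mono_AE) auto
  also have "\<dots> \<le> prob (B 0) + prob (B 1) + prob (B 2) + prob B'"
    using measure_Un_le[of "B 0 \<union> B 1 \<union> B 2" P B'] measure_Un_le[of "B 0 \<union> B 1" P "B 2"] measure_Un_le[of "B 0" P "B 1"] Bm
    by (auto simp: sets.Un)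
  also have "\<dots> \<le> bad_bound h n \<alpha>"
  proof -
    have t: "3 * q + q' = q + q + q + q'" for q q' :: real by simp
    show ?thesis unfolding bad_bound_def t by (intro add_mono pB pB') auto
  qed
  finally show "prob (space P - good) \<le> bad_bound h n \<alpha>" .
qed

text \<open>The good event and the dominating variable are hidden behind an existential quantifier,
  so that the result for one sample size can be used for a whole sequence.\<close>

lemma sample_error:
  "\<exists>A Y. A \<in> sets P \<and> prob (space P - A) \<le> bad_bound h n \<alpha> \<and> Y \<in> borel_measurable P \<and>
    (\<integral>\<^sup>+\<omega>. ennreal (Y \<omega>) \<partial>P) \<le> ennreal (Cfin * budget_bound h n \<alpha>) \<and>
    (\<forall>\<omega>\<in>A. (intensity_dist T (max (m x) 0, frechet_mean T M L (Pf x))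
      (expectation \<tau> * tau_tilde K h x n (X\<omega> \<omega>) (N\<omega> \<omega>), f_tilde T M L K h x n (X\<omega> \<omega>) (N\<omega> \<omega>)))\<^sup>2 \<le> Y \<omega>)"
proof (intro exI conjI ballI)
  have i: "integrable P (\<lambda>\<omega>. Cfin * error_budget \<omega>)" using error_budget_expectation(1) by simp
  show "(\<lambda>\<omega>. Cfin * error_budget \<omega>) \<in> borel_measurable P" using i by (rule borel_measurable_integrable)
  have "(\<integral>\<^sup>+\<omega>. ennreal (Cfin * error_budget \<omega>) \<partial>P) = ennreal (Cfin * expectation error_budget)"
    using Cfin_nonneg error_budget_nonneg by (subst nn_integral_eq_integral[OF i]) auto
  also have "\<dots> \<le> ennreal (Cfin * budget_bound h n \<alpha>)"
    using Cfin_nonneg error_budget_expectation(2) by (intro ennreal_leI mult_left_mono)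
  finally show "(\<integral>\<^sup>+\<omega>. ennreal (Cfin * error_budget \<omega>) \<partial>P) \<le> ennreal (Cfin * budget_bound h n \<alpha>)" .
qed (rule good_complement error_bound | assumption)+

end
subsection \<open>The rate of convergence\<close>

text \<open>The exponent -1/5 balances the squared bias \<open>h\<^sup>4\<close> against the
  variance 1 / (n h): both have the order n^(-4/5), which also dominates 1 / n.\<close>

lemma bandwidth_facts:
  assumes "1 \<le> n" "0 < c"
  shows "0 < c * real n powr (-1/5)" "c * real n powr (-1/5) \<le> c"
    and "(c * real n powr (-1/5))\<^sup>2 = c\<^sup>2 * real n powr (-2/5)"
    and "((c * real n powr (-1/5))\<^sup>2)\<^sup>2 = (c\<^sup>2)\<^sup>2 * real n powr (-4/5)"
    and "a / (c * real n powr (-1/5)) / real n = a / c * real n powr (-4/5)"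
    and "1 / real n \<le> real n powr (-4/5)"
proof -
  have n: "1 \<le> real n" "0 < real n" using assms by auto
  show "0 < c * real n powr (-1/5)" using assms n by simp
  have "real n powr (-1/5) \<le> real n powr 0" using n by (intro powr_mono) auto
  then show "c * real n powr (-1/5) \<le> c" using assms n by simp
  have sq: "(real n powr a)\<^sup>2 = real n powr (2 * a)" for a
    by (simp add: power2_eq_square powr_add[symmetric])
  show h2: "(c * real n powr (-1/5))\<^sup>2 = c\<^sup>2 * real n powr (-2/5)"
    using sq[of "-1/5"] by (simp add: power_mult_distrib)
  show "((c * real n powr (-1/5))\<^sup>2)\<^sup>2 = (c\<^sup>2)\<^sup>2 * real n powr (-4/5)"
    unfolding h2 power_mult_distrib sq by simp
  have "real n powr (-1/5) * real n * real n powr (-4/5) = real n powr (-1/5 + 1 + -4/5)"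
    unfolding powr_add using n by simp
  then have one: "real n powr (-1/5) * real n * real n powr (-4/5) = 1" using n by simp
  have "a / (c * real n powr (-1/5)) / real n
     = a / (c * real n powr (-1/5)) / real n * (real n powr (-1/5) * real n * real n powr (-4/5))" by (simp only: one mult_1_right)
  also have "\<dots> = a / c * real n powr (-4/5)" using n assms by simp
  finally show "a / (c * real n powr (-1/5)) / real n = a / c * real n powr (-4/5)" .
  have "real n powr (-1) \<le> real n powr (-4/5)" using n by (intro powr_mono) auto
  then show "1 / real n \<le> real n powr (-4/5)" using n by (simp add: powr_minus_divide)
qed

context intensity_model
begin

definition rate_const where
  "rate_const = 2 * ((D * D)\<^sup>2 * (c0\<^sup>2)\<^sup>2 + B\<tau>\<^sup>2 * D * D / c0) + 2 * (Bq\<^sup>2 * (c0\<^sup>2)\<^sup>2 + Br\<^sup>2 * D * D / c0)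
    + M1 * D + BD + M1 + M1\<^sup>2"

text \<open>Every summand is of order n^(-4/5) or, since 1 / a \<le> 1 / \<open>sqrt a\<close> for a
  \<ge> 1, of order 1 / \<open>sqrt a\<close>. These are the squares of the two parts of the rate,
  and a sum of squares is at most the square of the sum.\<close>

lemma budget_rate:
  assumes n: "1 \<le> n" and a: "1 \<le> a"
  shows "budget_bound (c0 * real n powr (-1/5)) n a \<le> rate_const * (real n powr (-2/5) + a powr (-1/4))\<^sup>2"
    and "0 \<le> rate_const"
proof -
  note b = bandwidth_facts[OF n c0]
  define v where "v = real n powr (-4/5)"
  define u where "u = 1 / sqrt a"
  have u: "0 \<le> u" "1 / a \<le> u"
  proof -
    have "sqrt a * 1 \<le> sqrt a * sqrt a" using a by (intro mult_left_mono) auto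
    then have "sqrt a \<le> a" using a by simp
    then have "1 / a \<le> 1 / sqrt a" using a by (intro divide_left_mono) auto
    then show "0 \<le> u" "1 / a \<le> u" using a by (simp_all add: u_def)
  qed
  have v: "0 \<le> v" "1 / real n \<le> v" using b(6) by (auto simp: v_def)
  have nn: "0 \<le> M1" "0 \<le> D" "0 \<le> BD" using \<tau>_bounds D_pos by (auto simp: BD_def intro!: mult_nonneg_nonneg add_nonneg_nonneg)
  let ?p = "2 * ((D * D)\<^sup>2 * (c0\<^sup>2)\<^sup>2 + B\<tau>\<^sup>2 * D * D / c0) + 2 * (Bq\<^sup>2 * (c0\<^sup>2)\<^sup>2 + Br\<^sup>2 * D * D / c0) + M1\<^sup>2"
  let ?q = "M1 * D + BD + M1"
  have pq: "0 \<le> ?p" "0 \<le> ?q" using nn c0 by (auto intro!: add_nonneg_nonneg mult_nonneg_nonneg divide_nonneg_nonneg)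
  have rc: "rate_const = ?p + ?q" unfolding rate_const_def by simp
  then show "0 \<le> rate_const" using pq by simp
  have "budget_bound (c0 * real n powr (-1/5)) n a = 2 * ((D * D)\<^sup>2 * ((c0\<^sup>2)\<^sup>2 * v) + B\<tau>\<^sup>2 * D * D / c0 * v)
      + 2 * (Bq\<^sup>2 * ((c0\<^sup>2)\<^sup>2 * v) + Br\<^sup>2 * D * D / c0 * v) + M1 * D * (1 / a) + BD * u + M1 * (1 / a) + M1\<^sup>2 * (1 / real n)"
    unfolding budget_bound_def power_mult_distrib[of "D * D"] power_mult_distrib[of Bq] b(4,5) v_def u_def by simp
  also have "\<dots> \<le> 2 * ((D * D)\<^sup>2 * ((c0\<^sup>2)\<^sup>2 * v) + B\<tau>\<^sup>2 * D * D / c0 * v)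
      + 2 * (Bq\<^sup>2 * ((c0\<^sup>2)\<^sup>2 * v) + Br\<^sup>2 * D * D / c0 * v) + M1 * D * u + BD * u + M1 * u + M1\<^sup>2 * v"
    using u v nn by (intro add_mono order_refl mult_left_mono) auto
  also have "\<dots> = ?p * v + ?q * u" by (simp add: algebra_simps)
  also have "\<dots> \<le> (?p + ?q) * (v + u)"
  proof -
    have "0 \<le> ?p * u" "0 \<le> ?q * v" using pq u v by (auto intro: mult_nonneg_nonneg)
    then show ?thesis unfolding distrib_right distrib_left by linarith
  qed
  also have "v + u \<le> (real n powr (-2/5) + a powr (-1/4))\<^sup>2"
  proof -
    have "(real n powr (-2/5))\<^sup>2 = v" by (simp add: v_def power2_eq_square powr_add[symmetric])
    moreover have "(a powr (-1/4))\<^sup>2 = u"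
    proof -
      have "(a powr (-1/4))\<^sup>2 = a powr (-1/2)" by (simp add: power2_eq_square powr_add[symmetric])
      also have "\<dots> = u" using a by (simp add: u_def powr_minus_divide powr_half_sqrt)
      finally show ?thesis .
    qed
    ultimately show ?thesis by (simp add: power2_sum)
  qed
  then have "(?p + ?q) * (v + u) \<le> (?p + ?q) * (real n powr (-2/5) + a powr (-1/4))\<^sup>2"
    using pq by (intro mult_left_mono) auto
  finally show "budget_bound (c0 * real n powr (-1/5)) n a \<le> rate_const * (real n powr (-2/5) + a powr (-1/4))\<^sup>2"
    unfolding rc .
qed

lemma bad_bound_tendsto_0:
  assumes a: "filterlim a at_top sequentially"
  shows "(\<lambda>n. bad_bound (c0 * real n powr (-1/5)) n (a n)) \<longlonglongrightarrow> 0"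
proof -
  have p: "(\<lambda>n. real n powr (-e)) \<longlonglongrightarrow> 0" if "0 < e" for e
    using tendsto_neg_powr[of "-e" real sequentially] that filterlim_real_sequentially by simp
  have ia: "(\<lambda>n. 1 / a n) \<longlonglongrightarrow> 0"
    using tendsto_inverse_0_at_top[OF a] by (simp add: inverse_eq_divide)
  let ?k = "2 * (fX x * (1 + kernel_moment K 2))\<^sup>2"
  have "(\<lambda>n. 3 * ((Bd\<^sup>2 * (c0\<^sup>2 * real n powr (-(2/5))) + (2 * D * D / c0 * real n powr (-(4/5)) + ?k * (1 / real n))) / \<eta>\<^sup>2)
     + (2 * (M1 * (1 / a n)) + 2 * (M1\<^sup>2 * (1 / real n))) / (\<kappa> / 2)\<^sup>2)
     \<longlonglongrightarrow> 3 * ((Bd\<^sup>2 * (c0\<^sup>2 * 0) + (2 * D * D / c0 * 0 + ?k * 0)) / \<eta>\<^sup>2) + (2 * (M1 * 0) + 2 * (M1\<^sup>2 * 0)) / (\<kappa> / 2)\<^sup>2"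
    using \<eta>_pos \<tau>_bounds(1) by (intro tendsto_intros p ia lim_1_over_n) auto
  moreover have "eventually (\<lambda>n. 3 * ((Bd\<^sup>2 * (c0\<^sup>2 * real n powr (-(2/5))) + (2 * D * D / c0 * real n powr (-(4/5)) + ?k * (1 / real n))) / \<eta>\<^sup>2)
     + (2 * (M1 * (1 / a n)) + 2 * (M1\<^sup>2 * (1 / real n))) / (\<kappa> / 2)\<^sup>2 = bad_bound (c0 * real n powr (-1/5)) n (a n)) sequentially"
    using eventually_ge_at_top[of 1]
  proof eventually_elim
    case (elim n)
    note b = bandwidth_facts[OF elim c0]
    show ?case
      unfolding bad_bound_def power_mult_distrib[of Bd] b(3) add_divide_distrib[of "2 * D * D / _"] b(5) by simp
  qed
  ultimately show ?thesis by (simp add: tendsto_cong)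
qed

lemma estimator_rate:
  assumes smp: "\<And>n. 1 \<le> n \<Longrightarrow> intensity_sample P T M L X \<Lambda> K x \<kappa> M1 c0 D fX m g Pf Xs \<Lambda>s (N n) (\<alpha> n) (h n) n"
    and h: "\<And>n. n \<ge> 1 \<Longrightarrow> h n = c0 * real n powr (-1/5)"
    and \<alpha>: "filterlim \<alpha> at_top sequentially"
  shows "big_O_p P
     (\<lambda>n \<omega>. intensity_dist T (max (m x) 0, frechet_mean T M L (Pf x))
        (expectation \<tau> * tau_tilde K (h n) x n (\<lambda>i. Xs i \<omega>) (\<lambda>i. N n i \<omega>),
         f_tilde T M L K (h n) x n (\<lambda>i. Xs i \<omega>) (\<lambda>i. N n i \<omega>)))
     (\<lambda>n. real n powr (-2/5) + \<alpha> n powr (-1/4))"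
proof -
  \<comment> \<open>Samples are available for n \<ge> 1 only; the implication allows a choice of
    good event and dominating variable, packed as a pair, for all n at once.\<close>
  have "\<exists>AY. 1 \<le> n \<longrightarrow> fst AY \<in> sets P \<and> prob (space P - fst AY) \<le> bad_bound (h n) n (\<alpha> n) \<and> snd AY \<in> borel_measurable P \<and>
    (\<integral>\<^sup>+\<omega>. ennreal (snd AY \<omega>) \<partial>P) \<le> ennreal (Cfin * budget_bound (h n) n (\<alpha> n)) \<and>
    (\<forall>\<omega>\<in>fst AY. (intensity_dist T (max (m x) 0, frechet_mean T M L (Pf x))
      (expectation \<tau> * tau_tilde K (h n) x n (\<lambda>i. Xs i \<omega>) (\<lambda>i. N n i \<omega>),
       f_tilde T M L K (h n) x n (\<lambda>i. Xs i \<omega>) (\<lambda>i. N n i \<omega>)))\<^sup>2 \<le> snd AY \<omega>)" for n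
  proof (cases "1 \<le> n")
    case True
    show ?thesis using intensity_sample.sample_error[OF smp[OF True]] by force
  qed simp
  then obtain AY where AY: "\<And>n. 1 \<le> n \<Longrightarrow> fst (AY n) \<in> sets P \<and> prob (space P - fst (AY n)) \<le> bad_bound (h n) n (\<alpha> n) \<and> snd (AY n) \<in> borel_measurable P \<and>
    (\<integral>\<^sup>+\<omega>. ennreal (snd (AY n) \<omega>) \<partial>P) \<le> ennreal (Cfin * budget_bound (h n) n (\<alpha> n)) \<and>
    (\<forall>\<omega>\<in>fst (AY n). (intensity_dist T (max (m x) 0, frechet_mean T M L (Pf x))
      (expectation \<tau> * tau_tilde K (h n) x n (\<lambda>i. Xs i \<omega>) (\<lambda>i. N n i \<omega>),
       f_tilde T M L K (h n) x n (\<lambda>i. Xs i \<omega>) (\<lambda>i. N n i \<omega>)))\<^sup>2 \<le> snd (AY n) \<omega>)" by metis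
  have n1: "eventually (\<lambda>n::nat. 1 \<le> n) sequentially" by (rule eventually_ge_at_top)
  have a1: "eventually (\<lambda>n. 1 \<le> \<alpha> n) sequentially" using \<alpha> by (simp add: filterlim_at_top)
  \<comment> \<open>The product is known to be nonnegative only; adding 1 makes the constant
    strictly positive.\<close>
  define c where "c = Cfin * rate_const + 1"
  have c: "0 < c" unfolding c_def using Cfin_nonneg budget_rate(2)[of 1 1] by (simp add: add_nonneg_pos)
  show ?thesis
  proof (rule big_O_p_from_second_moment[where Good = "\<lambda>n. fst (AY n)" and Y = "\<lambda>n. snd (AY n)", OF prob_space_axioms c])
    show "eventually (\<lambda>n. fst (AY n) \<in> sets P) sequentially"
      using n1 by eventually_elim (simp add: AY)
    show "(\<lambda>n. prob (space P - fst (AY n))) \<longlonglongrightarrow> 0"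
    proof (rule tendsto_sandwich[OF _ _ tendsto_const bad_bound_tendsto_0[OF \<alpha>]])
      show "eventually (\<lambda>n. prob (space P - fst (AY n)) \<le> bad_bound (c0 * real n powr (-1/5)) n (\<alpha> n)) sequentially"
        using n1
      proof eventually_elim
        case (elim n)
        show ?case using AY[OF elim] unfolding h[OF elim] by blast
      qed
    qed simp
    show "eventually (\<lambda>n. snd (AY n) \<in> borel_measurable P \<and> (\<integral>\<^sup>+\<omega>. ennreal (snd (AY n) \<omega>) \<partial>P)
        \<le> ennreal (c * (real n powr (-2/5) + \<alpha> n powr (-1/4))\<^sup>2) \<and> 0 < real n powr (-2/5) + \<alpha> n powr (-1/4)) sequentially"
      using n1 a1
    proof eventually_elim
      case (elim n)
      let ?r = "(real n powr (-2/5) + \<alpha> n powr (-1/4))\<^sup>2"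
      have "Cfin * budget_bound (h n) n (\<alpha> n) \<le> Cfin * (rate_const * ?r)"
        unfolding h[OF elim(1)] by (intro mult_left_mono budget_rate(1) elim Cfin_nonneg)
      also have "\<dots> \<le> c * ?r" by (simp add: c_def distrib_right mult.assoc)
      finally have "ennreal (Cfin * budget_bound (h n) n (\<alpha> n)) \<le> ennreal (c * ?r)" by (rule ennreal_leI)
      moreover have "0 < real n powr (-2/5)" using elim(1) by simp
      moreover have "0 \<le> \<alpha> n powr (-1/4)" by simp
      ultimately show ?case using AY[OF elim(1)] by (meson add_pos_nonneg order_trans)
    qed
    show "eventually (\<lambda>n. \<forall>\<omega>\<in>fst (AY n). (intensity_dist T (max (m x) 0, frechet_mean T M L (Pf x))
        (expectation \<tau> * tau_tilde K (h n) x n (\<lambda>i. Xs i \<omega>) (\<lambda>i. N n i \<omega>),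
         f_tilde T M L K (h n) x n (\<lambda>i. Xs i \<omega>) (\<lambda>i. N n i \<omega>)))\<^sup>2 \<le> snd (AY n) \<omega>) sequentially"
      using n1
    proof eventually_elim
      case (elim n)
      show ?case using AY[OF elim] by blast
    qed
  qed
qed

end

lemma continuous_bounded_near:
  fixes p :: "real \<Rightarrow> real"
  assumes "\<And>u. isCont p u"
  shows "\<exists>B. \<forall>u. \<bar>u - x\<bar> \<le> c \<longrightarrow> \<bar>p u\<bar> \<le> B"
proof -
  have "bounded (p ` cball x c)"
    using assms by (intro compact_imp_bounded compact_continuous_image continuous_at_imp_continuous_on) auto
  then obtain B where B: "\<forall>v\<in>p ` cball x c. norm v \<le> B" unfolding bounded_iff by blast
  then show ?thesis by (intro exI[of _ B]) (auto simp: dist_real_def abs_minus_commute)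
qed

lemma at_top_of_over_ln:
  assumes "filterlim (\<lambda>n. \<alpha> n / ln (real n)) at_top sequentially"
  shows "filterlim \<alpha> at_top sequentially"
proof -
  have "filterlim (\<lambda>n. ln (real n)) at_top sequentially"
    using ln_at_top filterlim_real_sequentially by (rule filterlim_compose)
  then have "filterlim (\<lambda>n. \<alpha> n / ln (real n) * ln (real n)) at_top sequentially"
    by (rule filterlim_at_top_mult_at_top[OF assms])
  moreover have "eventually (\<lambda>n. \<alpha> n / ln (real n) * ln (real n) = \<alpha> n) sequentially"
    \<comment> \<open>The logarithm vanishes at 1, so cancelling it requires n \<ge> 2.\<close>
    using eventually_ge_at_top[of 2]
  proof eventually_elim
    case (elim n)
    then have "ln (real n) \<noteq> 0" by simp
    then show ?case by simp
  qed
  ultimately show ?thesis by (simp add: filterlim_cong)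
qed

theorem corollary1:
  fixes P :: "'a measure"
    and T M L :: real
    and X :: "'a \<Rightarrow> real" and \<Lambda> :: "'a \<Rightarrow> real \<Rightarrow> real"
    and Xs :: "nat \<Rightarrow> 'a \<Rightarrow> real" and \<Lambda>s :: "nat \<Rightarrow> 'a \<Rightarrow> real \<Rightarrow> real"
    and N :: "nat \<Rightarrow> nat \<Rightarrow> 'a \<Rightarrow> real multiset"
    and \<tau> e :: "'a \<Rightarrow> real" and f :: "'a \<Rightarrow> real \<Rightarrow> real"
    and \<alpha> h :: "nat \<Rightarrow> real" and K :: "real \<Rightarrow> real"
    and x \<kappa> M1 \<delta> \<sigma>bar c0 :: real
    and fX m \<sigma>sq \<psi> :: "real \<Rightarrow> real"
    and g :: "(real \<Rightarrow> real) \<Rightarrow> real \<Rightarrow> real"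
    and Pf :: "real \<Rightarrow> (real \<Rightarrow> real) measure"
  assumes P: "prob_space P"
    and TML: "0 < T" "0 < M" "M < L"
    and nonempty: "quantile_set T M L \<noteq> {}"
    \<comment> \<open>the random pair and its i.i.d. copies\<close>
    and X_meas: "X \<in> borel_measurable P"
    and \<Lambda>_meas: "\<Lambda> \<in> P \<rightarrow>\<^sub>M intensity_algebra T"
    and \<tau>_def: "\<tau> = (\<lambda>\<omega>. intensity_factor T (\<Lambda> \<omega>))"
    and f_def: "f = (\<lambda>\<omega>. shape T (\<Lambda> \<omega>))"
    and copies_indep: "prob_space.indep_vars P (\<lambda>_. borel \<Otimes>\<^sub>M intensity_algebra T)
          (\<lambda>i \<omega>. (Xs i \<omega>, \<Lambda>s i \<omega>)) {1..}"
    and copies_distr: "\<And>i. i \<ge> 1 \<Longrightarrow>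
          distr P (borel \<Otimes>\<^sub>M intensity_algebra T) (\<lambda>\<omega>. (Xs i \<omega>, \<Lambda>s i \<omega>)) =
          distr P (borel \<Otimes>\<^sub>M intensity_algebra T) (\<lambda>\<omega>. (X \<omega>, \<Lambda> \<omega>))"
    \<comment> \<open>the observed point processes\<close>
    and \<alpha>_pos: "\<And>n. n \<ge> 1 \<Longrightarrow> 0 < \<alpha> n"
    and N_poisson: "\<And>n. n \<ge> 1 \<Longrightarrow> cond_poisson_processes P
          (vimage_algebra (space P) (\<lambda>\<omega>. \<lambda>i\<in>{1..n}. (Xs i \<omega>, \<Lambda>s i \<omega>))
            (\<Pi>\<^sub>M i\<in>{1..n}. borel \<Otimes>\<^sub>M intensity_algebra T))
          T {1..n} (\<lambda>i \<omega> t. \<alpha> n * \<Lambda>s i \<omega> t) (N n)"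
    and K: "smoothing_kernel K"
    and f_shape: "\<And>\<omega>. \<omega> \<in> space P \<Longrightarrow> f \<omega> \<in> shape_space T M L"
    and \<tau>_bounds: "0 < \<kappa>" "\<kappa> \<le> M1" "AE \<omega> in P. \<kappa> \<le> \<tau> \<omega> \<and> \<tau> \<omega> \<le> M1"
    \<comment> \<open>marginal density of X, conditional densities of X given f = y, and the conditional law of f given X\<close>
    and fX: "distributed P lborel X (\<lambda>u. ennreal (fX u))" "twice_cont_diff fX"
    and g_cond: "regular_cond_distr P borel X (shape_borel T M L) f
          (\<lambda>y. density lborel (\<lambda>u. ennreal (g y u)))"
    and g_nonneg: "\<And>y u. y \<in> shape_space T M L \<Longrightarrow> 0 \<le> g y u"
    and g_smooth: "\<And>y. y \<in> shape_space T M L \<Longrightarrow> twice_cont_diff (g y)"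
    and g_bound: "bdd_above {\<bar>deriv (deriv (g y)) u\<bar> | y u. y \<in> shape_space T M L}"
    and Pf_cond: "regular_cond_distr P (shape_borel T M L) f borel X Pf"
    and Pf_cont: "\<And>U. shape_open T M L U \<Longrightarrow> continuous_on UNIV (\<lambda>u. measure (Pf u) U)"
    and fX_pos: "\<And>u. 0 < fX u"
    and m: "regression_function P X \<tau> m" "twice_cont_diff m"
    and e_def: "e = (\<lambda>\<omega>. \<tau> \<omega> - m (X \<omega>))"
    and \<sigma>sq: "regression_function P X (\<lambda>\<omega>. (e \<omega>)\<^sup>2) \<sigma>sq" "twice_cont_diff \<sigma>sq"
    and e_moment: "0 < \<delta>" "0 < \<sigma>bar"
          "AE \<omega> in P. real_cond_exp P (vimage_algebra (space P) X borel)
             (\<lambda>\<omega>. \<bar>e \<omega>\<bar> powr (2 + \<delta>)) \<omega> \<le> \<sigma>bar"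
    and h: "0 < c0" "\<And>n. n \<ge> 1 \<Longrightarrow> h n = c0 * real n powr (-1/5)"
    and \<alpha>_log: "filterlim (\<lambda>n. \<alpha> n / ln (real n)) at_top sequentially"
    and \<psi>: "(\<lambda>n. \<psi> (\<alpha> n)) \<asymp> (\<lambda>n. real n powr (2/5))"
  shows "big_O_p P
     (\<lambda>n \<omega>. intensity_dist T
        (max (m x) 0, frechet_mean T M L (Pf x))
        ((LINT \<omega>'|P. \<tau> \<omega>') * tau_tilde K (h n) x n (\<lambda>i. Xs i \<omega>) (\<lambda>i. N n i \<omega>),
         f_tilde T M L K (h n) x n (\<lambda>i. Xs i \<omega>) (\<lambda>i. N n i \<omega>)))
     (\<lambda>n. real n powr (-2/5) + \<alpha> n powr (-1/4))"
proof -
  obtain B where B: "\<And>v. K v \<le> B" using smoothing_kernel_bounded[OF K] by blast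
  obtain B1 where B1: "\<And>u. \<bar>u - x\<bar> \<le> c0 \<Longrightarrow> \<bar>fX u\<bar> \<le> B1"
    using continuous_bounded_near[OF twice_cont_diffD(3)[OF fX(2)]] by blast
  obtain B2 where B2: "\<And>u. \<bar>u - x\<bar> \<le> c0 \<Longrightarrow> \<bar>deriv (deriv fX) u\<bar> \<le> B2"
    using continuous_bounded_near[OF twice_cont_diffD(5)[OF fX(2)]] by blast
  obtain B3 where B3: "\<And>u. \<bar>u - x\<bar> \<le> c0 \<Longrightarrow> \<bar>deriv (deriv m) u\<bar> \<le> B3"
    using continuous_bounded_near[OF twice_cont_diffD(5)[OF m(2)]] by blast
  obtain B4 where B4: "\<And>y u. y \<in> shape_space T M L \<Longrightarrow> \<bar>deriv (deriv (g y)) u\<bar> \<le> B4"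
    using g_bound unfolding bdd_above_def by blast
  \<comment> \<open>Continuity bounds the density of X and the second derivatives near x, and
    hypothesis (iii) bounds those of all conditional densities; the maximum instantiates the single
    constant of the model.\<close>
  define D where "D = max B (max B1 (max B2 (max B3 B4)))"
  have D: "B \<le> D" "B1 \<le> D" "B2 \<le> D" "B3 \<le> D" "B4 \<le> D" by (auto simp: D_def)
  interpret prob_space P by (rule P)
  interpret model: intensity_model P T M L X \<Lambda> K x \<kappa> M1 c0 D fX m g Pf
  proof unfold_locales
    show "shape T (\<Lambda> \<omega>) \<in> shape_space T M L" if "\<omega> \<in> space P" for \<omega>
      using f_shape[OF that] by (simp add: f_def)
    show "AE \<omega> in P. \<kappa> \<le> intensity_factor T (\<Lambda> \<omega>) \<and> intensity_factor T (\<Lambda> \<omega>) \<le> M1"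
      using \<tau>_bounds(3) by (simp add: \<tau>_def)
    show "regular_cond_distr P borel X (shape_borel T M L) (\<lambda>\<omega>. shape T (\<Lambda> \<omega>)) (\<lambda>y. density lborel (\<lambda>u. ennreal (g y u)))"
      using g_cond by (simp only: f_def)
    show "regular_cond_distr P (shape_borel T M L) (\<lambda>\<omega>. shape T (\<Lambda> \<omega>)) borel X Pf"
      using Pf_cond by (simp only: f_def)
    show "regression_function P X (\<lambda>\<omega>. intensity_factor T (\<Lambda> \<omega>)) m"
      using m(1) by (simp only: \<tau>_def)
    show "K v \<le> D" for v using B[of v] D(1) by linarith
    show "fX u \<le> D" if "\<bar>u - x\<bar> \<le> c0" for u using B1[OF that] D(2) by linarith
    show "\<bar>deriv (deriv fX) u\<bar> \<le> D" if "\<bar>u - x\<bar> \<le> c0" for u using B2[OF that] D(3) by linarith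
    show "\<bar>deriv (deriv m) u\<bar> \<le> D" if "\<bar>u - x\<bar> \<le> c0" for u using B3[OF that] D(4) by linarith
    show "\<bar>deriv (deriv (g y)) u\<bar> \<le> D" if "y \<in> shape_space T M L" for y u using B4[OF that, of u] D(5) by linarith
  qed (fact TML X_meas \<Lambda>_meas K \<tau>_bounds(1,2) fX g_nonneg g_smooth Pf_cont fX_pos m(2) h(1))+
  have smp: "intensity_sample P T M L X \<Lambda> K x \<kappa> M1 c0 D fX m g Pf Xs \<Lambda>s (N n) (\<alpha> n) (h n) n" if n: "1 \<le> n" for n
  proof unfold_locales
    show "0 < h n" "h n \<le> c0" unfolding h(2)[OF n] using bandwidth_facts(1,2)[OF n h(1)] by auto
  qed (fact copies_indep copies_distr n \<alpha>_pos[OF n] N_poisson[OF n])+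
  show ?thesis
    using model.estimator_rate[OF smp h(2) at_top_of_over_ln[OF \<alpha>_log]] unfolding \<tau>_def .
qed

end
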